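(* Let $K$ be a number field with ring of integers $\mathfrak{o}_K$, let $U$ be a $K$-variety, and assume: (O) there are nonconstant regular functions $s_1,\dots,s_n\in\mathcal{O}_U(U)\setminus K$ and a constant $C>0$ such that for every $(x_v)_v\in\prod_{v\mid\infty}U(K_v)$ there is some $1\le i\le n$ with $|s_i(x_v)|_v<C$ simultaneously for all archimedean places $v$. Then $\mathfrak{U}(\mathfrak{o}_K)$ is not Zariski dense (in $U$) for any integral model $\mathfrak{U}$ of $U$.
   Context: An integral model of $U$ is a flat, separated $\mathfrak{o}_K$-scheme of finite type $\mathfrak{U}$ with an isomorphism $\mathfrak{U}\times_{\mathfrak{o}_K}K\cong U$; $\mathfrak{U}(\mathfrak{o}_K)$ is viewed as a subset of $U(K)$. For a place $v$, $K_v$ is the completion and $|\cdot|_v$ its absolute value. *)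

theory Defs
  imports
    "HOL-Analysis.Analysis"
    "HOL-Computational_Algebra.Computational_Algebra"
    "HOL-Algebra.Algebra"
    "HOL-Algebra.Algebraic_Closure_Type"
begin

section \<open>Commutative algebra\<close>

definition local_ring :: "'a ring \<Rightarrow> bool" where
  "local_ring R \<longleftrightarrow> cring R \<and> (\<exists>!M. maximalideal M R)"

definition the_maximal_ideal :: "'a ring \<Rightarrow> 'a set" where
  "the_maximal_ideal R = (THE M. maximalideal M R)"

definition local_ring_hom :: "'a ring \<Rightarrow> 'b ring \<Rightarrow> ('a \<Rightarrow> 'b) set" where
  "local_ring_hom R S =
     {h \<in> ring_hom R S. h ` the_maximal_ideal R \<subseteq> the_maximal_ideal S}"

subsection \<open>Localisation\<close>

definition fraction :: "'a ring \<Rightarrow> 'a set \<Rightarrow> 'a \<Rightarrow> 'a \<Rightarrow> ('a \<times> 'a) set" where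
  "fraction A S a s =
     {(b, t). b \<in> carrier A \<and> t \<in> S \<and>
        (\<exists>u\<in>S. u \<otimes>\<^bsub>A\<^esub> (a \<otimes>\<^bsub>A\<^esub> t) = u \<otimes>\<^bsub>A\<^esub> (b \<otimes>\<^bsub>A\<^esub> s))}"

text \<open>An operation on classes is the union of its values on all pairs of representatives; as
  these values coincide, the union is that class. The same device is used for stalks, for tensor
  products and for induced maps.\<close>

definition localisation :: "'a ring \<Rightarrow> 'a set \<Rightarrow> ('a \<times> 'a) set ring" where
  "localisation A S =
     \<lparr>carrier = {fraction A S a s |a s. a \<in> carrier A \<and> s \<in> S},
      monoid.mult = (\<lambda>x y. \<Union>(a, s)\<in>x. \<Union>(b, t)\<in>y. fraction A S (a \<otimes>\<^bsub>A\<^esub> b) (s \<otimes>\<^bsub>A\<^esub> t)),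
      monoid.one = fraction A S \<one>\<^bsub>A\<^esub> \<one>\<^bsub>A\<^esub>,
      ring.zero = fraction A S \<zero>\<^bsub>A\<^esub> \<one>\<^bsub>A\<^esub>,
      ring.add = (\<lambda>x y. \<Union>(a, s)\<in>x. \<Union>(b, t)\<in>y.
               fraction A S (a \<otimes>\<^bsub>A\<^esub> t \<oplus>\<^bsub>A\<^esub> b \<otimes>\<^bsub>A\<^esub> s) (s \<otimes>\<^bsub>A\<^esub> t))\<rparr>"

definition fraction_map ::
    "'b ring \<Rightarrow> 'b set \<Rightarrow> ('a \<Rightarrow> 'b) \<Rightarrow> ('a \<times> 'a) set \<Rightarrow> ('b \<times> 'b) set" where
  "fraction_map B T h x = (\<Union>(a, s)\<in>x. fraction B T (h a) (h s))"

abbreviation prime_fraction :: "'a ring \<Rightarrow> 'a set \<Rightarrow> 'a \<Rightarrow> 'a \<Rightarrow> ('a \<times> 'a) set" where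
  "prime_fraction A P \<equiv> fraction A (carrier A - P)"

abbreviation localisation_at :: "'a ring \<Rightarrow> 'a set \<Rightarrow> ('a \<times> 'a) set ring" where
  "localisation_at A P \<equiv> localisation A (carrier A - P)"

subsection \<open>Tensor products\<close>

text \<open>A list \<open>[(m\<^sub>1, n\<^sub>1), \<dots>, (m\<^sub>k, n\<^sub>k)]\<close> stands for the sum of the
  \<open>m\<^sub>i \<otimes> n\<^sub>i\<close>; two lists are related when these sums agree in the tensor product of
  \<open>M\<close> and \<open>N\<close> over \<open>R\<close>. The class of \<open>[(\<ominus> m, n)]\<close> is the additive inverse of that of
  \<open>[(m, n)]\<close>, so the quotient is a group.\<close>

inductive tensor_eq ::
    "'r ring \<Rightarrow> ('r, 'm) module \<Rightarrow> ('r, 'n) module \<Rightarrow>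
     ('m \<times> 'n) list \<Rightarrow> ('m \<times> 'n) list \<Rightarrow> bool"
  for R :: "'r ring" and M :: "('r, 'm) module" and N :: "('r, 'n) module" where
  refl: "set xs \<subseteq> carrier M \<times> carrier N \<Longrightarrow> tensor_eq R M N xs xs"
| sym: "tensor_eq R M N xs ys \<Longrightarrow> tensor_eq R M N ys xs"
| trans: "tensor_eq R M N xs ys \<Longrightarrow> tensor_eq R M N ys zs \<Longrightarrow> tensor_eq R M N xs zs"
| append: "tensor_eq R M N xs xs' \<Longrightarrow> tensor_eq R M N ys ys' \<Longrightarrow>
    tensor_eq R M N (xs @ ys) (xs' @ ys')"
| commute: "set xs \<subseteq> carrier M \<times> carrier N \<Longrightarrow> set ys \<subseteq> carrier M \<times> carrier N \<Longrightarrow>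
    tensor_eq R M N (xs @ ys) (ys @ xs)"
| zero: "n \<in> carrier N \<Longrightarrow> tensor_eq R M N [(\<zero>\<^bsub>M\<^esub>, n)] []"
| add_left: "m \<in> carrier M \<Longrightarrow> m' \<in> carrier M \<Longrightarrow> n \<in> carrier N \<Longrightarrow>
    tensor_eq R M N [(m \<oplus>\<^bsub>M\<^esub> m', n)] [(m, n), (m', n)]"
| add_right: "m \<in> carrier M \<Longrightarrow> n \<in> carrier N \<Longrightarrow> n' \<in> carrier N \<Longrightarrow>
    tensor_eq R M N [(m, n \<oplus>\<^bsub>N\<^esub> n')] [(m, n), (m, n')]"
| smult: "r \<in> carrier R \<Longrightarrow> m \<in> carrier M \<Longrightarrow> n \<in> carrier N \<Longrightarrow>
    tensor_eq R M N [(r \<odot>\<^bsub>M\<^esub> m, n)] [(m, r \<odot>\<^bsub>N\<^esub> n)]"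

definition tensor_class ::
    "'r ring \<Rightarrow> ('r, 'm) module \<Rightarrow> ('r, 'n) module \<Rightarrow> ('m \<times> 'n) list \<Rightarrow> ('m \<times> 'n) list set"
  where "tensor_class R M N xs = {ys. tensor_eq R M N xs ys}"

definition algebra_via :: "('r \<Rightarrow> 'a) \<Rightarrow> 'a ring \<Rightarrow> ('r, 'a) module" where
  "algebra_via h A =
     \<lparr>carrier = carrier A, monoid.mult = monoid.mult A, monoid.one = monoid.one A,
      ring.zero = ring.zero A, ring.add = ring.add A,
      smult = (\<lambda>r a. h r \<otimes>\<^bsub>A\<^esub> a)\<rparr>"

definition tensor_ring ::
    "'r ring \<Rightarrow> ('r, 'a) module \<Rightarrow> ('r, 'b) module \<Rightarrow> ('a \<times> 'b) list set ring" where
  "tensor_ring R A B =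
     \<lparr>carrier = tensor_class R A B ` lists (carrier A \<times> carrier B),
      monoid.mult = (\<lambda>x y. \<Union>xs\<in>x. \<Union>ys\<in>y. tensor_class R A B
                [(a \<otimes>\<^bsub>A\<^esub> a', b \<otimes>\<^bsub>B\<^esub> b'). (a, b) \<leftarrow> xs, (a', b') \<leftarrow> ys]),
      monoid.one = tensor_class R A B [(\<one>\<^bsub>A\<^esub>, \<one>\<^bsub>B\<^esub>)],
      ring.zero = tensor_class R A B [],
      ring.add = (\<lambda>x y. \<Union>xs\<in>x. \<Union>ys\<in>y. tensor_class R A B (xs @ ys))\<rparr>"

subsection \<open>Flatness\<close>

definition module_injection ::
    "'r ring \<Rightarrow> ('r, 'm) module \<Rightarrow> ('r, 'n) module \<Rightarrow> ('m \<Rightarrow> 'n) \<Rightarrow> bool" where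
  "module_injection R N N' h \<longleftrightarrow>
     h \<in> carrier N \<rightarrow> carrier N' \<and>
     (\<forall>x\<in>carrier N. \<forall>y\<in>carrier N. h (x \<oplus>\<^bsub>N\<^esub> y) = h x \<oplus>\<^bsub>N'\<^esub> h y) \<and>
     (\<forall>r\<in>carrier R. \<forall>x\<in>carrier N. h (r \<odot>\<^bsub>N\<^esub> x) = r \<odot>\<^bsub>N'\<^esub> h x) \<and>
     inj_on h (carrier N)"

text \<open>Tensoring with \<open>M\<close> preserves injections. Flatness only has to be tested on submodules
  of finitely generated modules; these are subquotients of some \<open>R\<^sup>n\<close>, so they are isomorphic to
  modules whose elements have type \<^typ>\<open>(nat \<Rightarrow> 'r) set\<close>, and no larger types are needed.\<close>

definition flat_module :: "'r ring \<Rightarrow> ('r, 'm) module \<Rightarrow> bool" where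
  "flat_module R M \<longleftrightarrow>
     (\<forall>(N :: ('r, (nat \<Rightarrow> 'r) set) module) (N' :: ('r, (nat \<Rightarrow> 'r) set) module) h.
        module R N \<and> module R N' \<and> module_injection R N N' h \<longrightarrow>
        (\<forall>xs\<in>lists (carrier N \<times> carrier M).
           tensor_eq R N' M (map (\<lambda>(n, m). (h n, m)) xs) [] \<longrightarrow> tensor_eq R N M xs []))"

section \<open>Locally ringed spaces\<close>

record ('p, 'a) ringed_space =
  topo :: "'p topology"
  sec :: "'p set \<Rightarrow> 'a ring"
  res :: "'p set \<Rightarrow> 'p set \<Rightarrow> 'a \<Rightarrow> 'a"

abbreviation points :: "('p, 'a) ringed_space \<Rightarrow> 'p set" where
  "points \<XX> \<equiv> topspace (topo \<XX>)"

definition sheaf_of_rings :: "('p, 'a) ringed_space \<Rightarrow> bool" where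
  "sheaf_of_rings \<XX> \<longleftrightarrow>
     (\<forall>V. openin (topo \<XX>) V \<longrightarrow> cring (sec \<XX> V)) \<and>
     (\<forall>V W. openin (topo \<XX>) V \<and> openin (topo \<XX>) W \<and> W \<subseteq> V \<longrightarrow>
        res \<XX> V W \<in> ring_hom (sec \<XX> V) (sec \<XX> W)) \<and>
     (\<forall>V. openin (topo \<XX>) V \<longrightarrow> (\<forall>s\<in>carrier (sec \<XX> V). res \<XX> V V s = s)) \<and>
     (\<forall>V W N. openin (topo \<XX>) V \<and> openin (topo \<XX>) W \<and> openin (topo \<XX>) N \<and> N \<subseteq> W \<and> W \<subseteq> V \<longrightarrow>
        (\<forall>s\<in>carrier (sec \<XX> V). res \<XX> W N (res \<XX> V W s) = res \<XX> V N s)) \<and>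
     (\<forall>\<C>. (\<forall>W\<in>\<C>. openin (topo \<XX>) W) \<longrightarrow>
        (\<forall>s\<in>carrier (sec \<XX> (\<Union>\<C>)). \<forall>t\<in>carrier (sec \<XX> (\<Union>\<C>)).
           (\<forall>W\<in>\<C>. res \<XX> (\<Union>\<C>) W s = res \<XX> (\<Union>\<C>) W t) \<longrightarrow> s = t) \<and>
        (\<forall>\<sigma>. (\<forall>W\<in>\<C>. \<sigma> W \<in> carrier (sec \<XX> W)) \<and>
             (\<forall>W\<in>\<C>. \<forall>W'\<in>\<C>. res \<XX> W (W \<inter> W') (\<sigma> W) = res \<XX> W' (W \<inter> W') (\<sigma> W')) \<longrightarrow>
           (\<exists>s\<in>carrier (sec \<XX> (\<Union>\<C>)). \<forall>W\<in>\<C>. res \<XX> (\<Union>\<C>) W s = \<sigma> W)))"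

definition germ :: "('p, 'a) ringed_space \<Rightarrow> 'p \<Rightarrow> 'p set \<Rightarrow> 'a \<Rightarrow> ('p set \<times> 'a) set" where
  "germ \<XX> x V s =
     {(W, t). openin (topo \<XX>) W \<and> x \<in> W \<and> t \<in> carrier (sec \<XX> W) \<and>
        (\<exists>N. openin (topo \<XX>) N \<and> x \<in> N \<and> N \<subseteq> V \<inter> W \<and> res \<XX> V N s = res \<XX> W N t)}"

definition stalk :: "('p, 'a) ringed_space \<Rightarrow> 'p \<Rightarrow> ('p set \<times> 'a) set ring" where
  "stalk \<XX> x =
     \<lparr>carrier = {germ \<XX> x V s |V s. openin (topo \<XX>) V \<and> x \<in> V \<and> s \<in> carrier (sec \<XX> V)},
      monoid.mult = (\<lambda>g h. \<Union>(V, s)\<in>g. \<Union>(W, t)\<in>h.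
                germ \<XX> x (V \<inter> W) (res \<XX> V (V \<inter> W) s \<otimes>\<^bsub>sec \<XX> (V \<inter> W)\<^esub> res \<XX> W (V \<inter> W) t)),
      monoid.one = germ \<XX> x (points \<XX>) \<one>\<^bsub>sec \<XX> (points \<XX>)\<^esub>,
      ring.zero = germ \<XX> x (points \<XX>) \<zero>\<^bsub>sec \<XX> (points \<XX>)\<^esub>,
      ring.add = (\<lambda>g h. \<Union>(V, s)\<in>g. \<Union>(W, t)\<in>h.
                germ \<XX> x (V \<inter> W) (res \<XX> V (V \<inter> W) s \<oplus>\<^bsub>sec \<XX> (V \<inter> W)\<^esub> res \<XX> W (V \<inter> W) t))\<rparr>"

definition locally_ringed_space :: "('p, 'a) ringed_space \<Rightarrow> bool" where
  "locally_ringed_space \<XX> \<longleftrightarrow> sheaf_of_rings \<XX> \<and> (\<forall>x\<in>points \<XX>. local_ring (stalk \<XX> x))"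

definition open_subspace :: "('p, 'a) ringed_space \<Rightarrow> 'p set \<Rightarrow> ('p, 'a) ringed_space" where
  "open_subspace \<XX> V = \<XX>\<lparr>topo := subtopology (topo \<XX>) V\<rparr>"

text \<open>The space whose sections over an open \<open>V\<close> are the families \<open>\<sigma> z \<in> L z\<close> (for \<open>z \<in> V\<close>)
  that have the form \<open>Q\<close> in a neighbourhood of every point of \<open>V\<close>.\<close>

definition space_of_local_families ::
    "'p topology \<Rightarrow> ('p \<Rightarrow> 'c ring) \<Rightarrow> ('p set \<Rightarrow> ('p \<Rightarrow> 'c) \<Rightarrow> bool) \<Rightarrow>
     ('p, 'p \<Rightarrow> 'c) ringed_space" where
  "space_of_local_families T L Q =
     \<lparr>topo = T,
      sec = (\<lambda>V.
        \<lparr>carrier = {\<sigma> \<in> (\<Pi>\<^sub>E z\<in>V. carrier (L z)).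
                     \<forall>z\<in>V. \<exists>N. openin T N \<and> z \<in> N \<and> N \<subseteq> V \<and> Q N \<sigma>},
         monoid.mult = (\<lambda>\<sigma> \<tau>. \<lambda>z\<in>V. \<sigma> z \<otimes>\<^bsub>L z\<^esub> \<tau> z),
         monoid.one = (\<lambda>z\<in>V. \<one>\<^bsub>L z\<^esub>),
         ring.zero = (\<lambda>z\<in>V. \<zero>\<^bsub>L z\<^esub>),
         ring.add = (\<lambda>\<sigma> \<tau>. \<lambda>z\<in>V. \<sigma> z \<oplus>\<^bsub>L z\<^esub> \<tau> z)\<rparr>),
      res = (\<lambda>V W \<sigma>. restrict \<sigma> W)\<rparr>"

subsection \<open>Morphisms\<close>

text \<open>A map of ringed spaces from \<open>\<XX>\<close> to \<open>\<YY>\<close> consists of a map of points and of maps from the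
  sections over each open \<open>V\<close> of \<open>\<YY>\<close> to the sections over the preimage of \<open>V\<close>. Values outside the
  relevant carriers are immaterial, so maps are compared by \<open>same_map\<close>.\<close>

record ('p, 'q, 'a, 'b) ringed_map =
  pt :: "'p \<Rightarrow> 'q"
  pull :: "'q set \<Rightarrow> 'b \<Rightarrow> 'a"

definition preim ::
    "('p, 'a) ringed_space \<Rightarrow> ('p, 'q, 'a, 'b) ringed_map \<Rightarrow> 'q set \<Rightarrow> 'p set" where
  "preim \<XX> f V = {x \<in> points \<XX>. pt f x \<in> V}"

definition stalk_map ::
    "('p, 'a) ringed_space \<Rightarrow> ('p, 'q, 'a, 'b) ringed_map \<Rightarrow> 'p \<Rightarrow>
     ('q set \<times> 'b) set \<Rightarrow> ('p set \<times> 'a) set" where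
  "stalk_map \<XX> f x g = (\<Union>(V, t)\<in>g. germ \<XX> x (preim \<XX> f V) (pull f V t))"

definition morphism ::
    "('p, 'a) ringed_space \<Rightarrow> ('q, 'b) ringed_space \<Rightarrow> ('p, 'q, 'a, 'b) ringed_map \<Rightarrow> bool" where
  "morphism \<XX> \<YY> f \<longleftrightarrow>
     continuous_map (topo \<XX>) (topo \<YY>) (pt f) \<and>
     (\<forall>V. openin (topo \<YY>) V \<longrightarrow> pull f V \<in> ring_hom (sec \<YY> V) (sec \<XX> (preim \<XX> f V))) \<and>
     (\<forall>V W. openin (topo \<YY>) V \<and> openin (topo \<YY>) W \<and> W \<subseteq> V \<longrightarrow>
        (\<forall>s\<in>carrier (sec \<YY> V).
           pull f W (res \<YY> V W s) = res \<XX> (preim \<XX> f V) (preim \<XX> f W) (pull f V s))) \<and>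
     (\<forall>x\<in>points \<XX>. stalk_map \<XX> f x \<in> local_ring_hom (stalk \<YY> (pt f x)) (stalk \<XX> x))"

definition same_map ::
    "('p, 'a) ringed_space \<Rightarrow> ('q, 'b) ringed_space \<Rightarrow>
     ('p, 'q, 'a, 'b) ringed_map \<Rightarrow> ('p, 'q, 'a, 'b) ringed_map \<Rightarrow> bool" where
  "same_map \<XX> \<YY> f g \<longleftrightarrow>
     (\<forall>x\<in>points \<XX>. pt f x = pt g x) \<and>
     (\<forall>V. openin (topo \<YY>) V \<longrightarrow> (\<forall>s\<in>carrier (sec \<YY> V). pull f V s = pull g V s))"

definition id_map :: "('p, 'p, 'a, 'a) ringed_map" where
  "id_map = \<lparr>pt = (\<lambda>x. x), pull = (\<lambda>V s. s)\<rparr>"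

text \<open>\<open>comp_map \<YY> g f\<close> is \<open>g\<close> after \<open>f\<close>, where \<open>f\<close> maps to \<open>\<YY>\<close> and \<open>g\<close> maps from \<open>\<YY>\<close>.\<close>

definition comp_map ::
    "('q, 'b) ringed_space \<Rightarrow> ('q, 'r, 'b, 'c) ringed_map \<Rightarrow> ('p, 'q, 'a, 'b) ringed_map \<Rightarrow>
     ('p, 'r, 'a, 'c) ringed_map" where
  "comp_map \<YY> g f =
     \<lparr>pt = (\<lambda>x. pt g (pt f x)), pull = (\<lambda>V s. pull f (preim \<YY> g V) (pull g V s))\<rparr>"

definition isomorphism ::
    "('p, 'a) ringed_space \<Rightarrow> ('q, 'b) ringed_space \<Rightarrow> ('p, 'q, 'a, 'b) ringed_map \<Rightarrow> bool" where
  "isomorphism \<XX> \<YY> f \<longleftrightarrow>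
     morphism \<XX> \<YY> f \<and>
     (\<exists>g. morphism \<YY> \<XX> g \<and>
        same_map \<XX> \<XX> (comp_map \<YY> g f) id_map \<and> same_map \<YY> \<YY> (comp_map \<XX> f g) id_map)"

definition closed_immersion ::
    "('p, 'a) ringed_space \<Rightarrow> ('q, 'b) ringed_space \<Rightarrow> ('p, 'q, 'a, 'b) ringed_map \<Rightarrow> bool" where
  "closed_immersion \<XX> \<YY> f \<longleftrightarrow>
     morphism \<XX> \<YY> f \<and>
     embedding_map (topo \<XX>) (topo \<YY>) (pt f) \<and>
     closedin (topo \<YY>) (pt f ` points \<XX>) \<and>
     (\<forall>x\<in>points \<XX>. stalk_map \<XX> f x ` carrier (stalk \<YY> (pt f x)) = carrier (stalk \<XX> x))"

section \<open>Schemes\<close>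

definition prime_spectrum :: "'a ring \<Rightarrow> 'a set set" where
  "prime_spectrum A = {P. primeideal P A}"

text \<open>The topology is generated by the basic open sets \<open>D(f)\<close>; a section is locally a quotient
  \<open>a / f\<close> with \<open>f\<close> outside all primes under consideration.\<close>

definition Spec :: "'a ring \<Rightarrow> ('a set, 'a set \<Rightarrow> ('a \<times> 'a) set) ringed_space" where
  "Spec A = space_of_local_families
     (topology_generated_by {{P \<in> prime_spectrum A. f \<notin> P} |f. f \<in> carrier A})
     (localisation_at A)
     (\<lambda>N \<sigma>. \<exists>a\<in>carrier A. \<exists>f\<in>carrier A. \<forall>P\<in>N. f \<notin> P \<and> \<sigma> P = prime_fraction A P a f)"

definition Spec_global_section :: "'a ring \<Rightarrow> 'a \<Rightarrow> 'a set \<Rightarrow> ('a \<times> 'a) set" where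
  "Spec_global_section A a = (\<lambda>P\<in>prime_spectrum A. prime_fraction A P a \<one>\<^bsub>A\<^esub>)"

text \<open>The morphism from \<open>Spec B\<close> to \<open>Spec A\<close> induced by a ring homomorphism \<open>h\<close> from \<open>A\<close> to \<open>B\<close>.\<close>

definition Spec_map ::
    "'a ring \<Rightarrow> 'b ring \<Rightarrow> ('a \<Rightarrow> 'b) \<Rightarrow>
     ('b set, 'a set, 'b set \<Rightarrow> ('b \<times> 'b) set, 'a set \<Rightarrow> ('a \<times> 'a) set) ringed_map" where
  "Spec_map A B h =
     \<lparr>pt = (\<lambda>Q. {a \<in> carrier A. h a \<in> Q}),
      pull = (\<lambda>V \<sigma>. \<lambda>Q\<in>{Q \<in> prime_spectrum B. {a \<in> carrier A. h a \<in> Q} \<in> V}.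
                fraction_map B (carrier B - Q) h (\<sigma> {a \<in> carrier A. h a \<in> Q}))\<rparr>"

text \<open>An affine open subset is the spectrum of its ring of sections, so rings with elements of
  the type of the sections suffice.\<close>

definition affine_open :: "('p, 'a) ringed_space \<Rightarrow> 'p set \<Rightarrow> bool" where
  "affine_open \<XX> V \<longleftrightarrow>
     openin (topo \<XX>) V \<and>
     (\<exists>(A :: 'a ring) f. cring A \<and> isomorphism (open_subspace \<XX> V) (Spec A) f)"

definition scheme :: "('p, 'a) ringed_space \<Rightarrow> bool" where
  "scheme \<XX> \<longleftrightarrow> locally_ringed_space \<XX> \<and> (\<forall>x\<in>points \<XX>. \<exists>V. affine_open \<XX> V \<and> x \<in> V)"

definition integral_scheme :: "('p, 'a) ringed_space \<Rightarrow> bool" where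
  "integral_scheme \<XX> \<longleftrightarrow>
     scheme \<XX> \<and> points \<XX> \<noteq> {} \<and> (\<forall>V. openin (topo \<XX>) V \<and> V \<noteq> {} \<longrightarrow> domain (sec \<XX> V))"

subsection \<open>Fibre products\<close>

text \<open>The fibre product of \<open>f : \<XX> \<rightarrow> S\<close> and \<open>g : \<YY> \<rightarrow> S\<close> in the category of locally ringed spaces,
  which for schemes is their fibre product as schemes. Its points over a pair \<open>(x, y)\<close> with
  \<open>f x = g y\<close> are the prime ideals of the tensor product of the local rings of \<open>x\<close> and \<open>y\<close> that
  contract to both maximal ideals; sections have values in the localisations at these primes and
  are locally quotients of elements \<open>\<Sum> a\<^sub>i \<otimes> b\<^sub>i\<close> with sections \<open>a\<^sub>i\<close> of \<open>\<XX>\<close> and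
  \<open>b\<^sub>i\<close> of \<open>\<YY>\<close>.\<close>

definition stalk_algebra ::
    "('p, 'a) ringed_space \<Rightarrow> ('p, 's, 'a, 'c) ringed_map \<Rightarrow> 'p \<Rightarrow>
     (('s set \<times> 'c) set, ('p set \<times> 'a) set) module" where
  "stalk_algebra \<XX> f x = algebra_via (stalk_map \<XX> f x) (stalk \<XX> x)"

context
  fixes \<XX> :: "('p, 'a) ringed_space" and \<YY> :: "('q, 'b) ringed_space"
    and S :: "('s, 'c) ringed_space"
    and f :: "('p, 's, 'a, 'c) ringed_map" and g :: "('q, 's, 'b, 'c) ringed_map"
begin

definition stalk_tensor ::
    "'p \<Rightarrow> 'q \<Rightarrow> (('p set \<times> 'a) set \<times> ('q set \<times> 'b) set) list set ring" where
  "stalk_tensor x y =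
     tensor_ring (stalk S (pt f x)) (stalk_algebra \<XX> f x) (stalk_algebra \<YY> g y)"

definition stalk_tensor_class ::
    "'p \<Rightarrow> 'q \<Rightarrow> (('p set \<times> 'a) set \<times> ('q set \<times> 'b) set) list \<Rightarrow>
     (('p set \<times> 'a) set \<times> ('q set \<times> 'b) set) list set" where
  "stalk_tensor_class x y =
     tensor_class (stalk S (pt f x)) (stalk_algebra \<XX> f x) (stalk_algebra \<YY> g y)"

definition fibre_points ::
    "('p \<times> 'q \<times> (('p set \<times> 'a) set \<times> ('q set \<times> 'b) set) list set set) set" where
  "fibre_points = {(x, y, P). x \<in> points \<XX> \<and> y \<in> points \<YY> \<and> pt f x = pt g y \<and>
     primeideal P (stalk_tensor x y) \<and>
     {a \<in> carrier (stalk \<XX> x). stalk_tensor_class x y [(a, \<one>\<^bsub>stalk \<YY> y\<^esub>)] \<in> P} =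
       the_maximal_ideal (stalk \<XX> x) \<and>
     {b \<in> carrier (stalk \<YY> y). stalk_tensor_class x y [(\<one>\<^bsub>stalk \<XX> x\<^esub>, b)] \<in> P} =
       the_maximal_ideal (stalk \<YY> y)}"

definition tensor_germ ::
    "'p set \<Rightarrow> 'q set \<Rightarrow> ('a \<times> 'b) list \<Rightarrow> 'p \<Rightarrow> 'q \<Rightarrow>
     (('p set \<times> 'a) set \<times> ('q set \<times> 'b) set) list set" where
  "tensor_germ V W t x y =
     stalk_tensor_class x y (map (\<lambda>(a, b). (germ \<XX> x V a, germ \<YY> y W b)) t)"

definition fibre_basic_open ::
    "'p set \<Rightarrow> 'q set \<Rightarrow> ('a \<times> 'b) list \<Rightarrow>
     ('p \<times> 'q \<times> (('p set \<times> 'a) set \<times> ('q set \<times> 'b) set) list set set) set" where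
  "fibre_basic_open V W t =
     {(x, y, P) \<in> fibre_points. x \<in> V \<and> y \<in> W \<and> tensor_germ V W t x y \<notin> P}"

definition fibre_product ::
    "('p \<times> 'q \<times> (('p set \<times> 'a) set \<times> ('q set \<times> 'b) set) list set set,
      'p \<times> 'q \<times> (('p set \<times> 'a) set \<times> ('q set \<times> 'b) set) list set set \<Rightarrow>
        ((('p set \<times> 'a) set \<times> ('q set \<times> 'b) set) list set \<times>
         (('p set \<times> 'a) set \<times> ('q set \<times> 'b) set) list set) set) ringed_space" where
  "fibre_product = space_of_local_families
     (topology_generated_by
        {fibre_basic_open V W t |V W t. openin (topo \<XX>) V \<and> openin (topo \<YY>) W \<and>
           t \<in> lists (carrier (sec \<XX> V) \<times> carrier (sec \<YY> W))})
     (\<lambda>(x, y, P). localisation_at (stalk_tensor x y) P)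
     (\<lambda>N \<sigma>. \<exists>V W. openin (topo \<XX>) V \<and> openin (topo \<YY>) W \<and>
        (\<exists>n\<in>lists (carrier (sec \<XX> V) \<times> carrier (sec \<YY> W)).
         \<exists>t\<in>lists (carrier (sec \<XX> V) \<times> carrier (sec \<YY> W)).
           N \<subseteq> fibre_basic_open V W t \<and>
           (\<forall>(x, y, P)\<in>N. \<sigma> (x, y, P) =
              prime_fraction (stalk_tensor x y) P (tensor_germ V W n x y) (tensor_germ V W t x y))))"

definition fibre_fst ::
    "('p \<times> 'q \<times> (('p set \<times> 'a) set \<times> ('q set \<times> 'b) set) list set set, 'p,
      'p \<times> 'q \<times> (('p set \<times> 'a) set \<times> ('q set \<times> 'b) set) list set set \<Rightarrow>
        ((('p set \<times> 'a) set \<times> ('q set \<times> 'b) set) list set \<times>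
         (('p set \<times> 'a) set \<times> ('q set \<times> 'b) set) list set) set, 'a) ringed_map" where
  "fibre_fst =
     \<lparr>pt = fst,
      pull = (\<lambda>V s. \<lambda>(x, y, P)\<in>{(x, y, P) \<in> fibre_points. x \<in> V}.
                prime_fraction (stalk_tensor x y) P
                  (stalk_tensor_class x y [(germ \<XX> x V s, \<one>\<^bsub>stalk \<YY> y\<^esub>)])
                  \<one>\<^bsub>stalk_tensor x y\<^esub>)\<rparr>"

definition fibre_snd ::
    "('p \<times> 'q \<times> (('p set \<times> 'a) set \<times> ('q set \<times> 'b) set) list set set, 'q,
      'p \<times> 'q \<times> (('p set \<times> 'a) set \<times> ('q set \<times> 'b) set) list set set \<Rightarrow>
        ((('p set \<times> 'a) set \<times> ('q set \<times> 'b) set) list set \<times>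
         (('p set \<times> 'a) set \<times> ('q set \<times> 'b) set) list set) set, 'b) ringed_map" where
  "fibre_snd =
     \<lparr>pt = (\<lambda>(x, y, P). y),
      pull = (\<lambda>W s. \<lambda>(x, y, P)\<in>{(x, y, P) \<in> fibre_points. y \<in> W}.
                prime_fraction (stalk_tensor x y) P
                  (stalk_tensor_class x y [(\<one>\<^bsub>stalk \<XX> x\<^esub>, germ \<YY> y W s)])
                  \<one>\<^bsub>stalk_tensor x y\<^esub>)\<rparr>"

end

subsection \<open>Properties of morphisms\<close>

definition separated ::
    "('p, 'a) ringed_space \<Rightarrow> ('q, 'b) ringed_space \<Rightarrow> ('p, 'q, 'a, 'b) ringed_map \<Rightarrow> bool" where
  "separated \<XX> S f \<longleftrightarrow>
     (\<exists>\<delta>. closed_immersion \<XX> (fibre_product \<XX> \<XX> S f f) \<delta> \<and>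
        same_map \<XX> \<XX> (comp_map (fibre_product \<XX> \<XX> S f f) (fibre_fst \<XX> \<XX> S f f) \<delta>) id_map \<and>
        same_map \<XX> \<XX> (comp_map (fibre_product \<XX> \<XX> S f f) (fibre_snd \<XX> \<XX> S f f) \<delta>) id_map)"

definition finite_type ::
    "('p, 'a) ringed_space \<Rightarrow> ('q, 'b) ringed_space \<Rightarrow> ('p, 'q, 'a, 'b) ringed_map \<Rightarrow> bool" where
  "finite_type \<XX> S f \<longleftrightarrow>
     (\<forall>y\<in>points S. \<exists>V. affine_open S V \<and> y \<in> V \<and>
        (\<exists>\<W>. finite \<W> \<and> \<Union>\<W> = preim \<XX> f V \<and>
           (\<forall>W\<in>\<W>. affine_open \<XX> W \<and>
              (\<exists>T. finite T \<and> T \<subseteq> carrier (sec \<XX> W) \<and>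
                 generate_ring (sec \<XX> W)
                   ((\<lambda>b. res \<XX> (preim \<XX> f V) W (pull f V b)) ` carrier (sec S V) \<union> T) =
                 carrier (sec \<XX> W)))))"

definition flat ::
    "('p, 'a) ringed_space \<Rightarrow> ('q, 'b) ringed_space \<Rightarrow> ('p, 'q, 'a, 'b) ringed_map \<Rightarrow> bool" where
  "flat \<XX> S f \<longleftrightarrow> (\<forall>x\<in>points \<XX>. flat_module (stalk S (pt f x)) (stalk_algebra \<XX> f x))"

text \<open>\<open>points_over T \<XX> S f \<tau>\<close>: the morphisms of \<open>S\<close>-schemes from \<open>\<tau> : T \<rightarrow> S\<close> to \<open>f : \<XX> \<rightarrow> S\<close>.\<close>

definition points_over ::
    "('t, 'd) ringed_space \<Rightarrow> ('p, 'a) ringed_space \<Rightarrow> ('q, 'b) ringed_space \<Rightarrow>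
     ('p, 'q, 'a, 'b) ringed_map \<Rightarrow> ('t, 'q, 'd, 'b) ringed_map \<Rightarrow>
     ('t, 'p, 'd, 'a) ringed_map set" where
  "points_over T \<XX> S f \<tau> = {x. morphism T \<XX> x \<and> same_map T S (comp_map \<XX> f x) \<tau>}"

text \<open>The value in \<open>A\<close> of a global section \<open>s\<close> of \<open>\<XX>\<close> at an \<open>A\<close>-valued point \<open>x\<close>.\<close>

definition value_at ::
    "'r ring \<Rightarrow> ('p, 'a) ringed_space \<Rightarrow> 'a \<Rightarrow>
     ('r set, 'p, 'r set \<Rightarrow> ('r \<times> 'r) set, 'a) ringed_map \<Rightarrow> 'r" where
  "value_at A \<XX> s x =
     (THE a. a \<in> carrier A \<and> pull x (points \<XX>) s = Spec_global_section A a)"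

section \<open>Number fields and their archimedean completions\<close>

definition number_field :: "'k::field_char_0 itself \<Rightarrow> bool" where
  "number_field _ \<longleftrightarrow>
     (\<exists>B::'k set. finite B \<and> (\<forall>x. \<exists>c::'k \<Rightarrow> rat. x = (\<Sum>b\<in>B. of_rat (c b) * b)))"

abbreviation field_ring :: "'k::field_char_0 ring" where
  "field_ring \<equiv> ring_of_type_algebra"

definition integer_ring :: "'k::field_char_0 ring" where
  "integer_ring = field_ring\<lparr>carrier := {x. algebraic_int x}\<rparr>"

text \<open>An archimedean place is represented by the unique absolute value in its class that extends
  the usual absolute value of the rational numbers.\<close>

definition archimedean_place :: "('k::field_char_0 \<Rightarrow> real) \<Rightarrow> bool" where
  "archimedean_place v \<longleftrightarrow>
     (\<forall>x. 0 \<le> v x) \<and> (\<forall>x. v x = 0 \<longleftrightarrow> x = 0) \<and>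
     (\<forall>x y. v (x * y) = v x * v y) \<and> (\<forall>x y. v (x + y) \<le> v x + v y) \<and>
     (\<forall>q::rat. v (of_rat q) = real_of_rat \<bar>q\<bar>)"

definition cauchy_sequences :: "('k::field_char_0 \<Rightarrow> real) \<Rightarrow> (nat \<Rightarrow> 'k) ring" where
  "cauchy_sequences v =
     \<lparr>carrier = {u. \<forall>e>0. \<exists>N. \<forall>m\<ge>N. \<forall>n\<ge>N. v (u m - u n) < e},
      monoid.mult = (\<lambda>u w n. u n * w n), monoid.one = (\<lambda>_. 1),
      ring.zero = (\<lambda>_. 0), ring.add = (\<lambda>u w n. u n + w n)\<rparr>"

definition null_sequences :: "('k::field_char_0 \<Rightarrow> real) \<Rightarrow> (nat \<Rightarrow> 'k) set" where
  "null_sequences v = {u. (\<lambda>n. v (u n)) \<longlonglongrightarrow> 0}"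

definition place_completion :: "('k::field_char_0 \<Rightarrow> real) \<Rightarrow> (nat \<Rightarrow> 'k) set ring" where
  "place_completion v = cauchy_sequences v Quot null_sequences v"

definition to_completion :: "('k::field_char_0 \<Rightarrow> real) \<Rightarrow> 'k \<Rightarrow> (nat \<Rightarrow> 'k) set" where
  "to_completion v a = null_sequences v +>\<^bsub>cauchy_sequences v\<^esub> (\<lambda>_. a)"

definition completion_abs :: "('k::field_char_0 \<Rightarrow> real) \<Rightarrow> (nat \<Rightarrow> 'k) set \<Rightarrow> real" where
  "completion_abs v \<xi> = (THE r. \<exists>u\<in>\<xi>. (\<lambda>n. v (u n)) \<longlonglongrightarrow> r)"

section \<open>Varieties and integral models\<close>

definition variety ::
    "('p, 'a) ringed_space \<Rightarrow>
     ('p, 'k::field_char_0 set, 'a, 'k set \<Rightarrow> ('k \<times> 'k) set) ringed_map \<Rightarrow> bool" where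
  "variety U \<pi> \<longleftrightarrow>
     integral_scheme U \<and> morphism U (Spec field_ring) \<pi> \<and>
     separated U (Spec field_ring) \<pi> \<and> finite_type U (Spec field_ring) \<pi>"

definition constant_functions ::
    "('p, 'k::field_char_0 set, 'a, 'k set \<Rightarrow> ('k \<times> 'k) set) ringed_map \<Rightarrow> 'a set" where
  "constant_functions \<pi> =
     pull \<pi> (prime_spectrum field_ring) ` Spec_global_section field_ring ` (UNIV :: 'k set)"

text \<open>The sets \<open>U(K)\<close> and \<open>U(K\<^sub>v)\<close>.\<close>

definition rational_points ::
    "('p, 'a) ringed_space \<Rightarrow>
     ('p, 'k::field_char_0 set, 'a, 'k set \<Rightarrow> ('k \<times> 'k) set) ringed_map \<Rightarrow>
     ('k set, 'p, 'k set \<Rightarrow> ('k \<times> 'k) set, 'a) ringed_map set" where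
  "rational_points U \<pi> = points_over (Spec field_ring) U (Spec field_ring) \<pi> id_map"

definition local_points ::
    "('k::field_char_0 \<Rightarrow> real) \<Rightarrow> ('p, 'a) ringed_space \<Rightarrow>
     ('p, 'k set, 'a, 'k set \<Rightarrow> ('k \<times> 'k) set) ringed_map \<Rightarrow>
     ((nat \<Rightarrow> 'k) set set, 'p,
      (nat \<Rightarrow> 'k) set set \<Rightarrow> ((nat \<Rightarrow> 'k) set \<times> (nat \<Rightarrow> 'k) set) set, 'a) ringed_map set" where
  "local_points v U \<pi> =
     points_over (Spec (place_completion v)) U (Spec field_ring) \<pi>
       (Spec_map field_ring (place_completion v) (to_completion v))"

definition Spec_inclusion ::
    "('k::field_char_0 set, 'k set, 'k set \<Rightarrow> ('k \<times> 'k) set, 'k set \<Rightarrow> ('k \<times> 'k) set) ringed_map"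
  where "Spec_inclusion = Spec_map integer_ring field_ring (\<lambda>x. x)"

abbreviation generic_fibre where
  "generic_fibre \<UU> f \<equiv>
     fibre_product \<UU> (Spec field_ring) (Spec integer_ring) f Spec_inclusion"

abbreviation generic_fibre_to_model where
  "generic_fibre_to_model \<UU> f \<equiv>
     fibre_fst \<UU> (Spec field_ring) (Spec integer_ring) f Spec_inclusion"

abbreviation generic_fibre_to_base where
  "generic_fibre_to_base \<UU> f \<equiv>
     fibre_snd \<UU> (Spec field_ring) (Spec integer_ring) f Spec_inclusion"

text \<open>The identification of \<open>U\<close> with the generic fibre is the isomorphism \<open>\<theta>\<close> over \<open>K\<close>.\<close>

definition integral_model where
  "integral_model U \<pi> \<UU> f \<theta> \<longleftrightarrow>
     scheme \<UU> \<and> morphism \<UU> (Spec integer_ring) f \<and>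
     flat \<UU> (Spec integer_ring) f \<and> separated \<UU> (Spec integer_ring) f \<and>
     finite_type \<UU> (Spec integer_ring) f \<and>
     isomorphism U (generic_fibre \<UU> f) \<theta> \<and>
     same_map U (Spec field_ring)
       (comp_map (generic_fibre \<UU> f) (generic_fibre_to_base \<UU> f) \<theta>) \<pi>"

text \<open>The \<open>K\<close>-points of \<open>U\<close> which, viewed as \<open>K\<close>-points of the model, extend to sections of the
  model over the ring of integers.\<close>

definition integral_points where
  "integral_points U \<pi> \<UU> f \<theta> =
     {Q \<in> rational_points U \<pi>.
        \<exists>P\<in>points_over (Spec integer_ring) \<UU> (Spec integer_ring) f id_map.
          same_map (Spec field_ring) \<UU>
            (comp_map (generic_fibre \<UU> f) (generic_fibre_to_model \<UU> f)
               (comp_map U \<theta> Q))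
            (comp_map (Spec integer_ring) P Spec_inclusion)}"

definition zariski_dense where
  "zariski_dense U Z \<longleftrightarrow>
     topo U closure_of (\<Union>Q\<in>Z. pt Q ` points (Spec field_ring)) = points U"

end

theory Submission
  imports "Jordan_Normal_Form.Char_Poly" Defs
begin

text \<open>Let \<open>Q\<close> be an integral point and \<open>P\<close> the section of the model that extends it. For a regular function
  \<open>s\<close> on \<open>U\<close> there is one \<open>m > 0\<close> such that \<open>m s(Q)\<close> is integral for all \<open>Q\<close>: on each of finitely many
  affine pieces of the model, the functions \<open>b\<close> for which \<open>b s\<close> is given by a function of the piece at all
  integral points form an ideal, and a prime ideal that contains it and no positive integer would be a
  point of the generic fibre, near which \<open>s\<close> comes from the model up to an integer denominator.
  As \<open>Q\<close> is a point over every completion, (O) bounds some \<open>s\<^sub>i(Q)\<close> at all archimedean places, so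
  \<open>m s\<^sub>i(Q)\<close> is one of finitely many algebraic integers. Hence the integral points are zeros of a finite
  product of functions \<open>s\<^sub>i - c\<close>, which is not zero because \<open>U\<close> is integral and no \<open>s\<^sub>i\<close> is constant.\<close>

section \<open>Commutative algebra\<close>

lemma (in cring) ideal_insertI:
  assumes "ideal I R" "a \<in> carrier R"
  shows "ideal {x \<oplus> r \<otimes> a |x r. x \<in> I \<and> r \<in> carrier R} R"
    (is "ideal ?J R")
proof -
  have "?J = I <+>\<^bsub>R\<^esub> PIdl a"
    unfolding set_add_def' cgenideal_def by blast
  then show ?thesis
    using add_ideals[OF assms(1) cgenideal_ideal[OF assms(2)]] by simp
qed

text \<open>Zorn's lemma on the ideals that contain \<open>I\<close> and avoid \<open>S\<close>.
  With \<open>S\<close> multiplicative the result is prime, with \<open>S = {\<one>}\<close> it is a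
  maximal ideal; both cases occur below.\<close>

lemma (in ring) maximal_ideal_avoiding:
  assumes I: "ideal I R" and disj: "I \<inter> S = {}"
  obtains P where "ideal P R" "I \<subseteq> P" "P \<inter> S = {}"
    "\<And>J. ideal J R \<Longrightarrow> P \<subseteq> J \<Longrightarrow> J \<inter> S = {} \<Longrightarrow> J = P"
proof -
  define \<A> where "\<A> = {J. ideal J R \<and> I \<subseteq> J \<and> J \<inter> S = {}}"
  have "\<exists>P\<in>\<A>. \<forall>J\<in>\<A>. P \<subseteq> J \<longrightarrow> J = P"
  proof (rule subset_Zorn_nonempty)
    show "\<A> \<noteq> {}" using I disj by (auto simp: \<A>_def)
  next
    fix \<C> assume C: "\<C> \<noteq> {}" "subset.chain \<A> \<C>"
    have sub: "J \<in> \<A>" if "J \<in> \<C>" for J using C that by (auto simp: subset.chain_def)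
    have tot: "J \<subseteq> J' \<or> J' \<subseteq> J" if "J \<in> \<C>" "J' \<in> \<C>" for J J'
      using C that by (auto simp: subset.chain_def)
    have id: "ideal J R" if "J \<in> \<C>" for J using sub[OF that] by (simp add: \<A>_def)
    have "ideal (\<Union>\<C>) R"
    proof (rule idealI)
      show "ring R" by (rule ring_axioms)
      show "subgroup (\<Union>\<C>) (add_monoid R)"
      proof (rule add.subgroupI)
        show "\<Union>\<C> \<subseteq> carrier R"
          using id ideal.Icarr by fastforce
        obtain J where "J \<in> \<C>" using C by blast
        then have "\<zero> \<in> \<Union>\<C>" using additive_subgroup.zero_closed[OF ideal.axioms(1)[OF id]] by blast
        then show "\<Union>\<C> \<noteq> {}" by blast
      next
        fix a assume "a \<in> \<Union>\<C>"
        then obtain J where "J \<in> \<C>" "a \<in> J" by blast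
        then have "\<ominus> a \<in> J" using additive_subgroup.a_inv_closed[OF ideal.axioms(1)[OF id]] by blast
        then show "\<ominus> a \<in> \<Union>\<C>" using \<open>J \<in> \<C>\<close> by blast
      next
        fix a b assume "a \<in> \<Union>\<C>" "b \<in> \<Union>\<C>"
        then obtain J J' where "J \<in> \<C>" "a \<in> J" "J' \<in> \<C>" "b \<in> J'" by blast
        then obtain J'' where "J'' \<in> \<C>" "a \<in> J''" "b \<in> J''" using tot by blast
        then have "a \<oplus> b \<in> J''" using additive_subgroup.a_closed[OF ideal.axioms(1)[OF id]] by blast
        then show "a \<oplus> b \<in> \<Union>\<C>" using \<open>J'' \<in> \<C>\<close> by blast
      qed
    next
      fix a x assume "a \<in> \<Union>\<C>" "x \<in> carrier R"
      then obtain J where J: "J \<in> \<C>" "a \<in> J" by blast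
      show "x \<otimes> a \<in> \<Union>\<C>" "a \<otimes> x \<in> \<Union>\<C>"
        using ideal.I_l_closed[OF id J(2)] ideal.I_r_closed[OF id J(2)] J \<open>x \<in> carrier R\<close> by blast+
    qed
    moreover have "I \<subseteq> \<Union>\<C>" "\<Union>\<C> \<inter> S = {}" using sub C by (auto simp: \<A>_def)
    ultimately show "\<Union>\<C> \<in> \<A>" by (simp add: \<A>_def)
  qed
  then obtain P where P: "P \<in> \<A>" and max: "\<And>J. J \<in> \<A> \<Longrightarrow> P \<subseteq> J \<Longrightarrow> J = P" by blast
  then show thesis using that[of P] by (auto simp: \<A>_def)
qed

text \<open>An ideal \<open>P\<close> maximal among those avoiding \<open>S\<close> is prime: if
  \<open>a\<close> and \<open>b\<close> lie outside \<open>P\<close>, both enlarged ideals meet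
  \<open>S\<close>, and the product of the two meeting elements lies in \<open>S\<close>, but also
  in \<open>P\<close> as soon as \<open>a \<otimes> b\<close> does.\<close>

lemma (in cring) primeideal_avoiding:
  assumes I: "ideal I R" and S: "S \<subseteq> carrier R" "\<one> \<in> S"
    "\<And>s t. s \<in> S \<Longrightarrow> t \<in> S \<Longrightarrow> s \<otimes> t \<in> S"
    and disj: "I \<inter> S = {}"
  shows "\<exists>P. primeideal P R \<and> I \<subseteq> P \<and> P \<inter> S = {}"
proof -
  obtain P where P: "ideal P R" "I \<subseteq> P" "P \<inter> S = {}"
    and max: "\<And>J. ideal J R \<Longrightarrow> P \<subseteq> J \<Longrightarrow> J \<inter> S = {} \<Longrightarrow> J = P"
    using maximal_ideal_avoiding[OF I disj] by blast
  interpret P: ideal P R by (rule P(1))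
  have hit: "\<exists>x\<in>P. \<exists>r\<in>carrier R. x \<oplus> r \<otimes> a \<in> S" if a: "a \<in> carrier R" "a \<notin> P" for a
  proof (rule ccontr)
    assume no: "\<not> ?thesis"
    let ?J = "{x \<oplus> r \<otimes> a |x r. x \<in> P \<and> r \<in> carrier R}"
    have sub: "P \<subseteq> ?J"
    proof
      fix x assume x: "x \<in> P"
      then have "x = x \<oplus> \<zero> \<otimes> a" using a P.Icarr[OF x] by simp
      then show "x \<in> ?J" using x by blast
    qed
    have "?J = P"
      using no by (intro max ideal_insertI[OF P.is_ideal a(1)] sub) blast
    moreover have "a = \<zero> \<oplus> \<one> \<otimes> a" using a by simp
    then have "a \<in> ?J" using additive_subgroup.zero_closed[OF P.additive_subgroup_axioms] by blast
    ultimately show False using a by blast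
  qed
  have "primeideal P R"
  proof (rule primeidealI[OF P.is_ideal cring_axioms])
    show "carrier R \<noteq> P" using P S by auto
    fix a b assume ab: "a \<in> carrier R" "b \<in> carrier R" "a \<otimes> b \<in> P"
    show "a \<in> P \<or> b \<in> P"
    proof (rule ccontr)
      assume "\<not> ?thesis"
      then obtain x r y t where xr: "x \<in> P" "r \<in> carrier R" "x \<oplus> r \<otimes> a \<in> S"
        and yt: "y \<in> P" "t \<in> carrier R" "y \<oplus> t \<otimes> b \<in> S"
        using hit ab by meson
      have xy: "x \<in> carrier R" "y \<in> carrier R" using xr yt P.Icarr by auto
      have "(x \<oplus> r \<otimes> a) \<otimes> (y \<oplus> t \<otimes> b) = (x \<otimes> (y \<oplus> t \<otimes> b) \<oplus> (r \<otimes> a) \<otimes> y) \<oplus> (r \<otimes> t) \<otimes> (a \<otimes> b)"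
        using xy ab xr yt by algebra
      also have "\<dots> \<in> P"
        using xy ab xr yt
        by (metis P.a_closed P.I_l_closed P.I_r_closed a_closed m_closed)
      finally show False using S(3)[OF xr(3) yt(3)] P by auto
    qed
  qed
  then show ?thesis using P by blast
qed

text \<open>The local-to-global principle of the development: multipliers that make something good
  form an ideal, and each prime offers a multiplier outside it, so one itself is a
  multiplier.\<close>

lemma (in cring) one_mem_ideal:
  assumes I: "ideal I R" and no: "\<And>P. primeideal P R \<Longrightarrow> \<exists>a\<in>I. a \<notin> P"
  shows "\<one> \<in> I"
proof (rule ccontr)
  assume "\<one> \<notin> I"
  then obtain P where "primeideal P R" "I \<subseteq> P"
    using primeideal_avoiding[OF I, of "{\<one>}"] by auto
  then show False using no by blast
qed

lemma primeideal_one_notin: "primeideal P R \<Longrightarrow> \<one>\<^bsub>R\<^esub> \<notin> P"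
  by (metis ideal.one_imp_carrier primeideal.axioms(1) primeideal.I_notcarr)

lemma (in cring) prime_mem_mult_iff:
  assumes "primeideal P R" "a \<in> carrier R" "b \<in> carrier R"
  shows "a \<otimes> b \<in> P \<longleftrightarrow> a \<in> P \<or> b \<in> P"
proof -
  interpret P: primeideal P R by fact
  show ?thesis using assms P.I_prime P.I_l_closed P.I_r_closed by blast
qed

text \<open>Otherwise zero is not a power of \<open>a\<close>, and a prime avoiding all powers of
  \<open>a\<close> would miss \<open>a\<close>.\<close>

lemma (in cring) nilpotent_if_in_all_primes:
  assumes a: "a \<in> carrier R" and all: "\<And>P. primeideal P R \<Longrightarrow> a \<in> P"
  shows "\<exists>k::nat. a [^] k = \<zero>"
proof (rule ccontr)
  assume no: "\<not> ?thesis"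
  let ?S = "range (\<lambda>k::nat. a [^] k)"
  have "\<exists>P. primeideal P R \<and> {\<zero>} \<subseteq> P \<and> P \<inter> ?S = {}"
  proof (rule primeideal_avoiding[OF zeroideal])
    show "?S \<subseteq> carrier R" using a by auto
    show "\<one> \<in> ?S" by (rule image_eqI[of _ _ 0]) auto
    show "{\<zero>} \<inter> ?S = {}" using no by auto
    fix s t assume "s \<in> ?S" "t \<in> ?S"
    then obtain k l :: nat where "s = a [^] k" "t = a [^] l" by blast
    then have "s \<otimes> t = a [^] (k + l)" using a by (simp add: nat_pow_mult)
    then show "s \<otimes> t \<in> ?S" by blast
  qed
  then obtain P where P: "primeideal P R" "P \<inter> ?S = {}" by blast
  have "a = a [^] (1::nat)" using a by simp
  then have "a \<in> ?S" by blast
  then show False using P all by blast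
qed

subsection \<open>Local rings\<close>

text \<open>A nonunit generates a proper ideal, which lies in a maximal ideal and hence in the only
  one. Membership thus becomes invertibility, which can be tested on sections.\<close>

lemma mem_the_maximal_ideal_iff:
  fixes R (structure)
  assumes loc: "local_ring R" and a: "a \<in> carrier R"
  shows "a \<in> the_maximal_ideal R \<longleftrightarrow> a \<notin> Units R"
proof -
  interpret cring R using loc unfolding local_ring_def by blast
  have max: "maximalideal (the_maximal_ideal R) R"
    unfolding the_maximal_ideal_def using loc unfolding local_ring_def by (elim conjE) (rule theI')
  have uni: "M = the_maximal_ideal R" if "maximalideal M R" for M
    using loc max that unfolding local_ring_def by blast
  interpret M: maximalideal "the_maximal_ideal R" R by fact
  show ?thesis
  proof
    assume aM: "a \<in> the_maximal_ideal R"
    show "a \<notin> Units R"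
    proof
      assume "a \<in> Units R"
      then have "\<one> \<in> the_maximal_ideal R" using M.I_r_closed[OF aM, of "inv a"] by simp
      then show False using M.one_imp_carrier M.I_notcarr by blast
    qed
  next
    assume nu: "a \<notin> Units R"
    have "\<one> \<notin> PIdl a"
    proof
      assume "\<one> \<in> PIdl a"
      then obtain x where "x \<in> carrier R" "x \<otimes> a = \<one>" by (auto simp: cgenideal_def)
      then show False using nu a m_comm by (auto simp: Units_def)
    qed
    then have "PIdl a \<inter> {\<one>} = {}" by simp
    then obtain M where M: "ideal M R" "PIdl a \<subseteq> M" "M \<inter> {\<one>} = {}"
      and mx: "\<And>J. ideal J R \<Longrightarrow> M \<subseteq> J \<Longrightarrow> J \<inter> {\<one>} = {} \<Longrightarrow> J = M"
      using maximal_ideal_avoiding[OF cgenideal_ideal[OF a]] by blast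
    have "maximalideal M R"
    proof (rule maximalidealI[OF M(1)])
      show "carrier R \<noteq> M" using M(3) by auto
      fix J assume J: "ideal J R" "M \<subseteq> J" "J \<subseteq> carrier R"
      show "J = M \<or> J = carrier R"
        using mx[OF J(1,2)] ideal.one_imp_carrier[OF J(1)] by blast
    qed
    moreover have "a \<in> M" using M(2) cgenideal_self[OF a] by blast
    ultimately show "a \<in> the_maximal_ideal R" using uni by blast
  qed
qed

text \<open>Nonunits are always stable under multiplication by ring elements; with
  \<open>add\<close> they form an ideal, and every proper ideal consists of nonunits.\<close>

lemma local_ringI:
  fixes R (structure)
  assumes "cring R" and one: "\<one> \<noteq> \<zero>"
    and add: "\<And>a b. a \<in> carrier R \<Longrightarrow> b \<in> carrier R \<Longrightarrow> a \<notin> Units R \<Longrightarrow> b \<notin> Units R \<Longrightarrow>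
      a \<oplus> b \<notin> Units R"
  shows "local_ring R"
proof -
  interpret cring R by fact
  let ?M = "carrier R - Units R"
  have mult: "x \<otimes> a \<notin> Units R" if "a \<in> ?M" "x \<in> carrier R" for a x
  proof
    assume u: "x \<otimes> a \<in> Units R"
    have "(x \<otimes> inv (x \<otimes> a)) \<otimes> a = (x \<otimes> a) \<otimes> inv (x \<otimes> a)"
      using that u m_assoc[of x "inv (x \<otimes> a)" a] m_assoc[of x a "inv (x \<otimes> a)"]
        m_comm[of a "inv (x \<otimes> a)"] by force
    also have "\<dots> = \<one>" using u by simp
    finally have 1: "(x \<otimes> inv (x \<otimes> a)) \<otimes> a = \<one>" .
    have 2: "x \<otimes> inv (x \<otimes> a) \<in> carrier R" using that u by simp
    then have "a \<otimes> (x \<otimes> inv (x \<otimes> a)) = \<one>" using 1 that m_comm[OF _ 2, of a] by simp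
    then have "a \<in> Units R"
      unfolding Units_def using that 1 2 by blast
    then show False using that by blast
  qed
  have idl: "ideal ?M R"
  proof (rule idealI)
    show "ring R" by (rule ring_axioms)
    show "subgroup ?M (add_monoid R)"
    proof (rule add.subgroupI)
      have "\<zero> \<in> ?M" using one by (auto simp: Units_def)
      then show "?M \<noteq> {}" by blast
      fix a assume a: "a \<in> ?M"
      have "\<ominus> a = (\<ominus> \<one>) \<otimes> a" using a by (simp add: l_minus)
      then show "\<ominus> a \<in> ?M" using mult[OF a, of "\<ominus> \<one>"] a by auto
      fix b assume "b \<in> ?M"
      then show "a \<oplus> b \<in> ?M" using add a by auto
    qed auto
    fix a x assume "a \<in> ?M" "x \<in> carrier R"
    then show "x \<otimes> a \<in> ?M" "a \<otimes> x \<in> ?M" using mult[of a x] m_comm by auto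
  qed
  have sub: "J \<subseteq> ?M" if J: "ideal J R" "J \<noteq> carrier R" for J
  proof
    fix a assume "a \<in> J"
    then show "a \<in> ?M"
      using J ideal.Icarr[OF J(1)] ideal.I_l_closed[OF J(1), of a "inv a"] ideal.one_imp_carrier[OF J(1)]
      by auto
  qed
  have "maximalideal ?M R"
  proof (rule maximalidealI[OF idl])
    show "carrier R \<noteq> ?M" using Units_one_closed by blast
    fix J assume "ideal J R" "?M \<subseteq> J" "J \<subseteq> carrier R"
    then show "J = ?M \<or> J = carrier R" using sub by blast
  qed
  moreover have "N = ?M" if N: "maximalideal N R" for N
  proof -
    interpret N: maximalideal N R by fact
    have "N \<subseteq> ?M" using sub N.is_ideal N.I_notcarr by metis
    then show ?thesis using N.I_maximal[OF idl] Units_one_closed by blast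
  qed
  ultimately show ?thesis unfolding local_ring_def using cring_axioms by blast
qed

text \<open>Evaluates the operations on classes that are defined as unions over all
  representatives.\<close>

lemma UN_eq_const: "x \<in> B \<Longrightarrow> (\<And>x. x \<in> B \<Longrightarrow> g x = C) \<Longrightarrow> \<Union>(g ` B) = C"
  by auto

subsection \<open>Localisation\<close>

locale mult_set = cring A for A :: "'a ring" (structure) +
  fixes S :: "'a set"
  assumes sub: "S \<subseteq> carrier A" and one_mem: "\<one> \<in> S"
    and mult_mem: "\<And>s t. s \<in> S \<Longrightarrow> t \<in> S \<Longrightarrow> s \<otimes> t \<in> S"
begin

lemma S_carr: "s \<in> S \<Longrightarrow> s \<in> carrier A"
  using sub by blast

lemma fraction_mem:
  "(b, t) \<in> fraction A S a s \<longleftrightarrow> b \<in> carrier A \<and> t \<in> S \<and> (\<exists>u\<in>S. u \<otimes> (a \<otimes> t) = u \<otimes> (b \<otimes> s))"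
  by (simp add: fraction_def)

lemma fraction_self: "a \<in> carrier A \<Longrightarrow> s \<in> S \<Longrightarrow> (a, s) \<in> fraction A S a s"
  using one_mem by (auto simp: fraction_mem)

text \<open>Transitivity of equality of fractions: if \<open>u\<close> and \<open>v\<close> witness
  the two given equalities, then \<open>u \<otimes> v \<otimes> t\<close> witnesses the third, the
  factor \<open>t\<close> standing in for cancellation.\<close>

lemma fraction_sub:
  assumes "a \<in> carrier A" "s \<in> S" "(b, t) \<in> fraction A S a s"
  shows "fraction A S b t \<subseteq> fraction A S a s"
proof
  fix z assume z: "z \<in> fraction A S b t"
  obtain c r where [simp]: "z = (c, r)" by (cases z)
  obtain u where u: "u \<in> S" "u \<otimes> (a \<otimes> t) = u \<otimes> (b \<otimes> s)" and b: "b \<in> carrier A" "t \<in> S"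
    using assms by (auto simp: fraction_mem)
  obtain v where v: "v \<in> S" "v \<otimes> (b \<otimes> r) = v \<otimes> (c \<otimes> t)" and c: "c \<in> carrier A" "r \<in> S"
    using z by (auto simp: fraction_mem)
  note carr = assms(1) b(1) c(1) S_carr[OF assms(2)] S_carr[OF b(2)] S_carr[OF c(2)]
    S_carr[OF u(1)] S_carr[OF v(1)]
  have "(u \<otimes> v \<otimes> t) \<otimes> (a \<otimes> r) = (v \<otimes> r) \<otimes> (u \<otimes> (a \<otimes> t))" using carr by (simp add: m_ac)
  also have "\<dots> = (u \<otimes> s) \<otimes> (v \<otimes> (b \<otimes> r))" unfolding u(2) using carr by (simp add: m_ac)
  also have "\<dots> = (u \<otimes> v \<otimes> t) \<otimes> (c \<otimes> s)" unfolding v(2) using carr by (simp add: m_ac)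
  finally show "z \<in> fraction A S a s"
    using c mult_mem[OF mult_mem[OF u(1) v(1)] b(2)] by (auto simp: fraction_mem)
qed

lemma fraction_sym: "a \<in> carrier A \<Longrightarrow> s \<in> S \<Longrightarrow> (b, t) \<in> fraction A S a s \<Longrightarrow> (a, s) \<in> fraction A S b t"
  by (auto simp: fraction_mem) (metis)

lemma fraction_eq_of_mem:
  "a \<in> carrier A \<Longrightarrow> s \<in> S \<Longrightarrow> (b, t) \<in> fraction A S a s \<Longrightarrow> fraction A S b t = fraction A S a s"
  using fraction_sub fraction_sym by (metis fraction_mem subset_antisym)

lemma fraction_eqD:
  assumes "a \<in> carrier A" "s \<in> S" "b \<in> carrier A" "t \<in> S" "fraction A S a s = fraction A S b t"
  shows "\<exists>u\<in>S. u \<otimes> (a \<otimes> t) = u \<otimes> (b \<otimes> s)"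
proof -
  have "(b, t) \<in> fraction A S a s" using fraction_self[of b t] assms by blast
  then show ?thesis by (simp add: fraction_mem)
qed

lemma fraction_eqI':
  assumes "a \<in> carrier A" "s \<in> S" "b \<in> carrier A" "t \<in> S" "u \<in> S"
    "u \<otimes> (a \<otimes> t) = u \<otimes> (b \<otimes> s)"
  shows "fraction A S a s = fraction A S b t"
proof -
  have "(b, t) \<in> fraction A S a s" unfolding fraction_mem using assms by blast
  then show ?thesis using fraction_eq_of_mem assms by blast
qed

lemma fraction_eqI:
  assumes "a \<in> carrier A" "s \<in> S" "b \<in> carrier A" "t \<in> S" "a \<otimes> t = b \<otimes> s"
  shows "fraction A S a s = fraction A S b t"
  using assms by (intro fraction_eqI'[OF _ _ _ _ one_mem]) auto

lemma fraction_in_carrier: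
  "a \<in> carrier A \<Longrightarrow> s \<in> S \<Longrightarrow> fraction A S a s \<in> carrier (localisation A S)"
  by (auto simp: localisation_def)

lemma localisation_carrierE:
  assumes "x \<in> carrier (localisation A S)"
  obtains a s where "a \<in> carrier A" "s \<in> S" "x = fraction A S a s"
  using assms by (auto simp: localisation_def)

text \<open>Other representatives give the same class, since the witnesses \<open>u\<close> and
  \<open>v\<close> multiply to a witness for the products; so the union in the definition is a
  single class.\<close>

lemma fraction_mult:
  assumes "a \<in> carrier A" "s \<in> S" "b \<in> carrier A" "t \<in> S"
  shows "fraction A S a s \<otimes>\<^bsub>localisation A S\<^esub> fraction A S b t = fraction A S (a \<otimes> b) (s \<otimes> t)"
proof -
  have "fraction A S (a' \<otimes> b') (s' \<otimes> t') = fraction A S (a \<otimes> b) (s \<otimes> t)"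
    if as: "(a', s') \<in> fraction A S a s" and bt: "(b', t') \<in> fraction A S b t" for a' s' b' t'
  proof -
    obtain u where u: "u \<in> S" "u \<otimes> (a \<otimes> s') = u \<otimes> (a' \<otimes> s)" and a': "a' \<in> carrier A" "s' \<in> S"
      using as by (auto simp: fraction_mem)
    obtain v where v: "v \<in> S" "v \<otimes> (b \<otimes> t') = v \<otimes> (b' \<otimes> t)" and b': "b' \<in> carrier A" "t' \<in> S"
      using bt by (auto simp: fraction_mem)
    note carr = assms(1,3) a'(1) b'(1) assms(2,4)[THEN S_carr] a'(2)[THEN S_carr] b'(2)[THEN S_carr]
      u(1)[THEN S_carr] v(1)[THEN S_carr]
    have "(u \<otimes> v) \<otimes> ((a \<otimes> b) \<otimes> (s' \<otimes> t')) = (u \<otimes> (a \<otimes> s')) \<otimes> (v \<otimes> (b \<otimes> t'))"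
      using carr by (simp add: m_ac)
    also have "\<dots> = (u \<otimes> v) \<otimes> ((a' \<otimes> b') \<otimes> (s \<otimes> t))"
      unfolding u(2) v(2) using carr by (simp add: m_ac)
    finally show ?thesis
      using assms a' b' mult_mem[OF u(1) v(1)] by (intro fraction_eqI'[symmetric]) (auto simp: mult_mem)
  qed
  then show ?thesis
    unfolding localisation_def monoid.simps
    by (intro UN_eq_const[OF fraction_self[OF assms(1,2)]], clarsimp)
       (intro UN_eq_const[OF fraction_self[OF assms(3,4)]], clarsimp)
qed

lemma fraction_add:
  assumes "a \<in> carrier A" "s \<in> S" "b \<in> carrier A" "t \<in> S"
  shows "fraction A S a s \<oplus>\<^bsub>localisation A S\<^esub> fraction A S b t =
    fraction A S (a \<otimes> t \<oplus> b \<otimes> s) (s \<otimes> t)"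
proof -
  have "fraction A S (a' \<otimes> t' \<oplus> b' \<otimes> s') (s' \<otimes> t') = fraction A S (a \<otimes> t \<oplus> b \<otimes> s) (s \<otimes> t)"
    if as: "(a', s') \<in> fraction A S a s" and bt: "(b', t') \<in> fraction A S b t" for a' s' b' t'
  proof -
    obtain u where u: "u \<in> S" "u \<otimes> (a \<otimes> s') = u \<otimes> (a' \<otimes> s)" and a': "a' \<in> carrier A" "s' \<in> S"
      using as by (auto simp: fraction_mem)
    obtain v where v: "v \<in> S" "v \<otimes> (b \<otimes> t') = v \<otimes> (b' \<otimes> t)" and b': "b' \<in> carrier A" "t' \<in> S"
      using bt by (auto simp: fraction_mem)
    note carr = assms(1,3) a'(1) b'(1) assms(2,4)[THEN S_carr] a'(2)[THEN S_carr] b'(2)[THEN S_carr]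
      u(1)[THEN S_carr] v(1)[THEN S_carr]
    have "(u \<otimes> v) \<otimes> ((a \<otimes> t \<oplus> b \<otimes> s) \<otimes> (s' \<otimes> t')) =
        (u \<otimes> (a \<otimes> s')) \<otimes> (v \<otimes> t \<otimes> t') \<oplus> (v \<otimes> (b \<otimes> t')) \<otimes> (u \<otimes> s \<otimes> s')"
      using carr by (simp add: m_ac l_distr r_distr)
    also have "\<dots> = (u \<otimes> v) \<otimes> ((a' \<otimes> t' \<oplus> b' \<otimes> s') \<otimes> (s \<otimes> t))"
      unfolding u(2) v(2) using carr by (simp add: m_ac l_distr r_distr)
    finally show ?thesis
      using assms a' b' mult_mem[OF u(1) v(1)] carr
      by (intro fraction_eqI'[symmetric]) (auto simp: mult_mem)
  qed
  then show ?thesis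
    unfolding localisation_def ring.simps
    by (intro UN_eq_const[OF fraction_self[OF assms(1,2)]], clarsimp)
       (intro UN_eq_const[OF fraction_self[OF assms(3,4)]], clarsimp)
qed

lemma localisation_one: "\<one>\<^bsub>localisation A S\<^esub> = fraction A S \<one> \<one>"
  and localisation_zero: "\<zero>\<^bsub>localisation A S\<^esub> = fraction A S \<zero> \<one>"
  by (simp_all add: localisation_def)

lemma fraction_cancel:
  assumes "a \<in> carrier A" "s \<in> S" "t \<in> S"
  shows "fraction A S (a \<otimes> t) (s \<otimes> t) = fraction A S a s"
  using assms S_carr by (intro fraction_eqI) (auto simp: mult_mem m_ac)

lemma fraction_add_same:
  assumes "a \<in> carrier A" "b \<in> carrier A" "s \<in> S"
  shows "fraction A S a s \<oplus>\<^bsub>localisation A S\<^esub> fraction A S b s = fraction A S (a \<oplus> b) s"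
  using assms S_carr fraction_cancel[of "a \<oplus> b" s s]
  by (simp add: fraction_add l_distr[symmetric])

lemma fraction_zero: "s \<in> S \<Longrightarrow> fraction A S \<zero> s = \<zero>\<^bsub>localisation A S\<^esub>"
  unfolding localisation_zero using one_mem S_carr by (intro fraction_eqI) auto

lemma fraction_self_one: "s \<in> S \<Longrightarrow> fraction A S s s = \<one>\<^bsub>localisation A S\<^esub>"
  unfolding localisation_one using one_mem S_carr by (intro fraction_eqI) auto

lemma localisation_cring: "cring (localisation A S)"
proof (rule cringI)
  let ?L = "localisation A S"
  show "abelian_group ?L"
  proof (rule abelian_groupI)
    fix x y z assume "x \<in> carrier ?L" "y \<in> carrier ?L" "z \<in> carrier ?L"
    then obtain a s b t c r where [simp]: "x = fraction A S a s" "y = fraction A S b t"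
      "z = fraction A S c r" and m: "a \<in> carrier A" "b \<in> carrier A" "c \<in> carrier A" "s \<in> S" "t \<in> S" "r \<in> S"
      by (metis localisation_carrierE)
    have c: "s \<in> carrier A" "t \<in> carrier A" "r \<in> carrier A" using m S_carr by auto
    show "x \<oplus>\<^bsub>?L\<^esub> y \<oplus>\<^bsub>?L\<^esub> z = x \<oplus>\<^bsub>?L\<^esub> (y \<oplus>\<^bsub>?L\<^esub> z)"
      using m c by (simp add: fraction_add mult_mem m_assoc)
        (rule arg_cong[of _ _ "\<lambda>x. fraction A S x _"], simp add: m_ac l_distr r_distr a_ac)
  next
    fix x y assume "x \<in> carrier ?L" "y \<in> carrier ?L"
    then obtain a s b t where [simp]: "x = fraction A S a s" "y = fraction A S b t"
      and m: "a \<in> carrier A" "b \<in> carrier A" "s \<in> S" "t \<in> S"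
      by (metis localisation_carrierE)
    have c: "s \<in> carrier A" "t \<in> carrier A" using m S_carr by auto
    show "x \<oplus>\<^bsub>?L\<^esub> y \<in> carrier ?L" using m c by (simp add: fraction_add fraction_in_carrier mult_mem)
    show "x \<oplus>\<^bsub>?L\<^esub> y = y \<oplus>\<^bsub>?L\<^esub> x" using m c by (simp add: fraction_add m_ac a_ac)
  next
    fix x assume "x \<in> carrier ?L"
    then obtain a s where [simp]: "x = fraction A S a s" and m: "a \<in> carrier A" "s \<in> S"
      by (metis localisation_carrierE)
    have c: "s \<in> carrier A" using m S_carr by auto
    show "\<zero>\<^bsub>?L\<^esub> \<oplus>\<^bsub>?L\<^esub> x = x" using m c one_mem by (simp add: localisation_zero fraction_add)
    have "fraction A S (\<ominus> a) s \<oplus>\<^bsub>?L\<^esub> x = \<zero>\<^bsub>?L\<^esub>"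
      using m c by (simp add: fraction_add_same fraction_zero l_neg)
    then show "\<exists>y\<in>carrier ?L. y \<oplus>\<^bsub>?L\<^esub> x = \<zero>\<^bsub>?L\<^esub>" using m fraction_in_carrier by blast
  qed (simp add: localisation_zero fraction_in_carrier one_mem)
  show "comm_monoid ?L"
  proof (rule comm_monoidI)
    fix x y z assume "x \<in> carrier ?L" "y \<in> carrier ?L" "z \<in> carrier ?L"
    then obtain a s b t c r where [simp]: "x = fraction A S a s" "y = fraction A S b t"
      "z = fraction A S c r" and m: "a \<in> carrier A" "b \<in> carrier A" "c \<in> carrier A" "s \<in> S" "t \<in> S" "r \<in> S"
      by (metis localisation_carrierE)
    have c: "s \<in> carrier A" "t \<in> carrier A" "r \<in> carrier A" using m S_carr by auto
    show "x \<otimes>\<^bsub>?L\<^esub> y \<otimes>\<^bsub>?L\<^esub> z = x \<otimes>\<^bsub>?L\<^esub> (y \<otimes>\<^bsub>?L\<^esub> z)"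
      using m c by (simp add: fraction_mult mult_mem m_assoc)
  next
    fix x y assume "x \<in> carrier ?L" "y \<in> carrier ?L"
    then obtain a s b t where [simp]: "x = fraction A S a s" "y = fraction A S b t"
      and m: "a \<in> carrier A" "b \<in> carrier A" "s \<in> S" "t \<in> S"
      by (metis localisation_carrierE)
    have c: "s \<in> carrier A" "t \<in> carrier A" using m S_carr by auto
    show "x \<otimes>\<^bsub>?L\<^esub> y \<in> carrier ?L" using m c by (simp add: fraction_mult fraction_in_carrier mult_mem)
    show "x \<otimes>\<^bsub>?L\<^esub> y = y \<otimes>\<^bsub>?L\<^esub> x" using m c by (simp add: fraction_mult m_ac)
  next
    fix x assume "x \<in> carrier ?L"
    then obtain a s where [simp]: "x = fraction A S a s" and m: "a \<in> carrier A" "s \<in> S"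
      by (metis localisation_carrierE)
    have c: "s \<in> carrier A" using m S_carr by auto
    show "\<one>\<^bsub>?L\<^esub> \<otimes>\<^bsub>?L\<^esub> x = x" using m c one_mem by (simp add: localisation_one fraction_mult)
  qed (simp add: localisation_one fraction_in_carrier one_mem)
  fix x y z assume "x \<in> carrier ?L" "y \<in> carrier ?L" "z \<in> carrier ?L"
  then obtain a s b t c r where [simp]: "x = fraction A S a s" "y = fraction A S b t"
    "z = fraction A S c r" and m: "a \<in> carrier A" "b \<in> carrier A" "c \<in> carrier A" "s \<in> S" "t \<in> S" "r \<in> S"
    by (metis localisation_carrierE)
  have c: "s \<in> carrier A" "t \<in> carrier A" "r \<in> carrier A" using m S_carr by auto
  show "(x \<oplus>\<^bsub>?L\<^esub> y) \<otimes>\<^bsub>?L\<^esub> z = x \<otimes>\<^bsub>?L\<^esub> z \<oplus>\<^bsub>?L\<^esub> y \<otimes>\<^bsub>?L\<^esub> z"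
    using m c by (simp add: fraction_mult fraction_add mult_mem)
      (rule fraction_eqI, simp_all add: mult_mem, simp add: m_ac l_distr r_distr)
qed

end


lemma mult_set_primeideal:
  fixes A :: "'a ring"
  assumes "primeideal P A"
  shows "mult_set A (carrier A - P)"
proof -
  interpret P: primeideal P A by fact
  show ?thesis
  proof
    show "\<one>\<^bsub>A\<^esub> \<in> carrier A - P" using P.one_imp_carrier P.I_notcarr by auto
    fix s t assume "s \<in> carrier A - P" "t \<in> carrier A - P"
    then show "s \<otimes>\<^bsub>A\<^esub> t \<in> carrier A - P" using P.I_prime by auto
  qed auto
qed

text \<open>\<open>h\<close> carries an equality of fractions with witness \<open>u\<close> to one
  with witness \<open>h u\<close>, so all representatives contribute the same class.\<close>

lemma fraction_map_fraction:
  assumes A: "mult_set A S" and B: "mult_set B T" and h: "h \<in> ring_hom A B" "h ` S \<subseteq> T"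
    and a: "a \<in> carrier A" "s \<in> S"
  shows "fraction_map B T h (fraction A S a s) = fraction B T (h a) (h s)"
proof -
  interpret A: mult_set A S by fact
  interpret B: mult_set B T by fact
  note hom = ring_hom_memE[OF h(1)]
  have "fraction B T (h b) (h t) = fraction B T (h a) (h s)" if bt: "(b, t) \<in> fraction A S a s" for b t
  proof -
    obtain u where u: "u \<in> S" "u \<otimes>\<^bsub>A\<^esub> (a \<otimes>\<^bsub>A\<^esub> t) = u \<otimes>\<^bsub>A\<^esub> (b \<otimes>\<^bsub>A\<^esub> s)" and b: "b \<in> carrier A" "t \<in> S"
      using bt by (auto simp: A.fraction_mem)
    note c = u(1)[THEN A.S_carr] a(2)[THEN A.S_carr] b(2)[THEN A.S_carr]
    have "h u \<otimes>\<^bsub>B\<^esub> (h a \<otimes>\<^bsub>B\<^esub> h t) = h u \<otimes>\<^bsub>B\<^esub> (h b \<otimes>\<^bsub>B\<^esub> h s)"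
      using arg_cong[OF u(2), of h] a b c by (simp add: hom(2))
    then show ?thesis
      using u(1) a b h(2) hom(1) by (intro B.fraction_eqI'[symmetric, of _ _ _ _ "h u"]) auto
  qed
  then show ?thesis
    unfolding fraction_map_def by (intro UN_eq_const[OF A.fraction_self[OF a]]) auto
qed

section \<open>Ringed spaces\<close>

text \<open>The axioms on restriction alone. They are the common ground on which germs and morphisms
  are treated for sheaves, for \<open>Spec A\<close> and for open subspaces.\<close>

locale presheaf_space =
  fixes \<XX> :: "('p, 'a) ringed_space"
  assumes cring_sec: "\<And>V. openin (topo \<XX>) V \<Longrightarrow> cring (sec \<XX> V)"
    and res_hom: "\<And>V W. openin (topo \<XX>) V \<Longrightarrow> openin (topo \<XX>) W \<Longrightarrow> W \<subseteq> V \<Longrightarrow>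
      res \<XX> V W \<in> ring_hom (sec \<XX> V) (sec \<XX> W)"
    and res_id: "\<And>V s. openin (topo \<XX>) V \<Longrightarrow> s \<in> carrier (sec \<XX> V) \<Longrightarrow> res \<XX> V V s = s"
    and res_res: "\<And>V W N s. openin (topo \<XX>) V \<Longrightarrow> openin (topo \<XX>) W \<Longrightarrow> openin (topo \<XX>) N \<Longrightarrow>
      N \<subseteq> W \<Longrightarrow> W \<subseteq> V \<Longrightarrow> s \<in> carrier (sec \<XX> V) \<Longrightarrow> res \<XX> W N (res \<XX> V W s) = res \<XX> V N s"
begin

abbreviation opn :: "'p set \<Rightarrow> bool" where "opn \<equiv> openin (topo \<XX>)"

lemma res_closed: "opn V \<Longrightarrow> opn W \<Longrightarrow> W \<subseteq> V \<Longrightarrow> s \<in> carrier (sec \<XX> V) \<Longrightarrow> res \<XX> V W s \<in> carrier (sec \<XX> W)"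
  using ring_hom_memE(1)[OF res_hom] .

lemma germ_mem:
  "(W, t) \<in> germ \<XX> x V s \<longleftrightarrow> opn W \<and> x \<in> W \<and> t \<in> carrier (sec \<XX> W) \<and>
    (\<exists>N. opn N \<and> x \<in> N \<and> N \<subseteq> V \<inter> W \<and> res \<XX> V N s = res \<XX> W N t)"
  by (simp add: germ_def)

lemma germ_self: "opn V \<Longrightarrow> x \<in> V \<Longrightarrow> s \<in> carrier (sec \<XX> V) \<Longrightarrow> (V, s) \<in> germ \<XX> x V s"
  by (auto simp: germ_mem)

lemma germ_subset:
  assumes V: "opn V" "x \<in> V" "s \<in> carrier (sec \<XX> V)" and W: "(W, t) \<in> germ \<XX> x V s"
  shows "germ \<XX> x W t \<subseteq> germ \<XX> x V s"
proof
  fix z assume z: "z \<in> germ \<XX> x W t"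
  obtain Z r where [simp]: "z = (Z, r)" by (cases z)
  obtain N where N: "opn N" "x \<in> N" "N \<subseteq> V \<inter> W" "res \<XX> V N s = res \<XX> W N t"
    and W': "opn W" "x \<in> W" "t \<in> carrier (sec \<XX> W)"
    using W by (auto simp: germ_mem)
  obtain M where M: "opn M" "x \<in> M" "M \<subseteq> W \<inter> Z" "res \<XX> W M t = res \<XX> Z M r"
    and Z: "opn Z" "x \<in> Z" "r \<in> carrier (sec \<XX> Z)"
    using z by (auto simp: germ_mem)
  have NM: "opn (N \<inter> M)" using N M by blast
  have "res \<XX> V (N \<inter> M) s = res \<XX> N (N \<inter> M) (res \<XX> V N s)"
    using N M V NM by (subst res_res) auto
  also have "\<dots> = res \<XX> W (N \<inter> M) t"
    unfolding N(4) using N M W' NM by (subst res_res) auto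
  also have "\<dots> = res \<XX> M (N \<inter> M) (res \<XX> W M t)"
    using N M W' NM by (subst res_res) auto
  also have "\<dots> = res \<XX> Z (N \<inter> M) r"
    unfolding M(4) using N M Z NM by (subst res_res) auto
  finally show "z \<in> germ \<XX> x V s"
    using N M Z NM by (auto simp: germ_mem intro!: exI[of _ "N \<inter> M"])
qed

lemma germ_eq_of_mem:
  assumes V: "opn V" "x \<in> V" "s \<in> carrier (sec \<XX> V)" and W: "(W, t) \<in> germ \<XX> x V s"
  shows "germ \<XX> x W t = germ \<XX> x V s"
proof
  show "germ \<XX> x W t \<subseteq> germ \<XX> x V s" using germ_subset[OF assms] .
  obtain N where N: "opn N" "x \<in> N" "N \<subseteq> V \<inter> W" "res \<XX> V N s = res \<XX> W N t"
    and W': "opn W" "x \<in> W" "t \<in> carrier (sec \<XX> W)"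
    using W by (auto simp: germ_mem)
  have "(V, s) \<in> germ \<XX> x W t" using N V unfolding germ_mem by (intro conjI exI[of _ N]) auto
  then show "germ \<XX> x V s \<subseteq> germ \<XX> x W t" using germ_subset[OF W'] by blast
qed

lemma germ_eqI:
  assumes "opn V" "x \<in> V" "s \<in> carrier (sec \<XX> V)" "opn W" "x \<in> W" "t \<in> carrier (sec \<XX> W)"
    "opn N" "x \<in> N" "N \<subseteq> V" "N \<subseteq> W" "res \<XX> V N s = res \<XX> W N t"
  shows "germ \<XX> x V s = germ \<XX> x W t"
proof -
  have "(W, t) \<in> germ \<XX> x V s" unfolding germ_mem using assms by blast
  then show ?thesis using germ_eq_of_mem assms by blast
qed

lemma germ_eqD:
  assumes "germ \<XX> x V s = germ \<XX> x W t" "opn W" "x \<in> W" "t \<in> carrier (sec \<XX> W)"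
  obtains N where "opn N" "x \<in> N" "N \<subseteq> V" "N \<subseteq> W" "res \<XX> V N s = res \<XX> W N t"
  using germ_self[OF assms(2-4)] unfolding assms(1)[symmetric] germ_mem by blast

lemma germ_res:
  assumes "opn V" "opn W" "W \<subseteq> V" "x \<in> W" "s \<in> carrier (sec \<XX> V)"
  shows "germ \<XX> x W (res \<XX> V W s) = germ \<XX> x V s"
  using assms by (intro germ_eqI[where N = W]) (auto simp: res_closed res_id)

lemma germ_in_stalk:
  "opn V \<Longrightarrow> x \<in> V \<Longrightarrow> s \<in> carrier (sec \<XX> V) \<Longrightarrow> germ \<XX> x V s \<in> carrier (stalk \<XX> x)"
  by (auto simp: stalk_def)

lemma stalkE:
  assumes "g \<in> carrier (stalk \<XX> x)"
  obtains V s where "opn V" "x \<in> V" "s \<in> carrier (sec \<XX> V)" "g = germ \<XX> x V s"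
  using assms by (auto simp: stalk_def)

text \<open>Two germs are represented by sections over the intersection of their domains, so the
  ring laws of a stalk become those of one ring of sections.\<close>

lemma stalkE2:
  assumes "g \<in> carrier (stalk \<XX> x)" "h \<in> carrier (stalk \<XX> x)"
  obtains V s t where "opn V" "x \<in> V" "s \<in> carrier (sec \<XX> V)" "t \<in> carrier (sec \<XX> V)"
    "g = germ \<XX> x V s" "h = germ \<XX> x V t"
proof -
  obtain V s where V: "opn V" "x \<in> V" "s \<in> carrier (sec \<XX> V)" "g = germ \<XX> x V s"
    using stalkE assms by metis
  obtain W t where W: "opn W" "x \<in> W" "t \<in> carrier (sec \<XX> W)" "h = germ \<XX> x W t"
    using stalkE assms by metis
  have "opn (V \<inter> W)" using V W by blast
  then show thesis
    by (intro that[of "V \<inter> W" "res \<XX> V (V \<inter> W) s" "res \<XX> W (V \<inter> W) t"])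
      (use V W in \<open>auto simp: res_closed germ_res\<close>)
qed

lemma stalkE3:
  assumes "g \<in> carrier (stalk \<XX> x)" "h \<in> carrier (stalk \<XX> x)" "k \<in> carrier (stalk \<XX> x)"
  obtains V s t r where "opn V" "x \<in> V" "s \<in> carrier (sec \<XX> V)" "t \<in> carrier (sec \<XX> V)"
    "r \<in> carrier (sec \<XX> V)" "g = germ \<XX> x V s" "h = germ \<XX> x V t" "k = germ \<XX> x V r"
proof -
  obtain V s t where V: "opn V" "x \<in> V" "s \<in> carrier (sec \<XX> V)" "t \<in> carrier (sec \<XX> V)"
    "g = germ \<XX> x V s" "h = germ \<XX> x V t"
    using stalkE2 assms by metis
  obtain W r where W: "opn W" "x \<in> W" "r \<in> carrier (sec \<XX> W)" "k = germ \<XX> x W r"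
    using stalkE assms by metis
  have "opn (V \<inter> W)" using V W by blast
  then show thesis
    by (intro that[of "V \<inter> W" "res \<XX> V (V \<inter> W) s" "res \<XX> V (V \<inter> W) t" "res \<XX> W (V \<inter> W) r"])
      (use V W in \<open>auto simp: res_closed germ_res\<close>)
qed

text \<open>Addition and multiplication of germs are both instances of \<open>op\<close>. For other
  representatives the results agree on \<open>N \<inter> M\<close>, where the sections agree
  pairwise and \<open>op\<close> commutes with restriction.\<close>

lemma germ_op:
  assumes V: "opn V" "x \<in> V" "s \<in> carrier (sec \<XX> V)" and W: "opn W" "x \<in> W" "t \<in> carrier (sec \<XX> W)"
    and closed: "\<And>V s t. opn V \<Longrightarrow> s \<in> carrier (sec \<XX> V) \<Longrightarrow> t \<in> carrier (sec \<XX> V) \<Longrightarrow>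
      op V s t \<in> carrier (sec \<XX> V)"
    and hom: "\<And>V W s t. opn V \<Longrightarrow> opn W \<Longrightarrow> W \<subseteq> V \<Longrightarrow> s \<in> carrier (sec \<XX> V) \<Longrightarrow>
      t \<in> carrier (sec \<XX> V) \<Longrightarrow> res \<XX> V W (op V s t) = op W (res \<XX> V W s) (res \<XX> V W t)"
  shows "(\<Union>(V, s)\<in>germ \<XX> x V s. \<Union>(W, t)\<in>germ \<XX> x W t.
      germ \<XX> x (V \<inter> W) (op (V \<inter> W) (res \<XX> V (V \<inter> W) s) (res \<XX> W (V \<inter> W) t))) =
    germ \<XX> x (V \<inter> W) (op (V \<inter> W) (res \<XX> V (V \<inter> W) s) (res \<XX> W (V \<inter> W) t))"
proof -
  have "germ \<XX> x (V' \<inter> W') (op (V' \<inter> W') (res \<XX> V' (V' \<inter> W') s') (res \<XX> W' (V' \<inter> W') t')) =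
      germ \<XX> x (V \<inter> W) (op (V \<inter> W) (res \<XX> V (V \<inter> W) s) (res \<XX> W (V \<inter> W) t))"
    if Vs: "(V', s') \<in> germ \<XX> x V s" and Wt: "(W', t') \<in> germ \<XX> x W t" for V' s' W' t'
  proof -
    obtain N where N: "opn N" "x \<in> N" "N \<subseteq> V \<inter> V'" "res \<XX> V N s = res \<XX> V' N s'"
      and V': "opn V'" "x \<in> V'" "s' \<in> carrier (sec \<XX> V')"
      using Vs by (auto simp: germ_mem)
    obtain M where M: "opn M" "x \<in> M" "M \<subseteq> W \<inter> W'" "res \<XX> W M t = res \<XX> W' M t'"
      and W': "opn W'" "x \<in> W'" "t' \<in> carrier (sec \<XX> W')"
      using Wt by (auto simp: germ_mem)
    have NM: "opn (N \<inter> M)" using N M by blast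
    have o: "opn (V \<inter> W)" "opn (V' \<inter> W')" using V W V' W' by auto
    have s: "res \<XX> V (N \<inter> M) s = res \<XX> V' (N \<inter> M) s'"
      using res_res[OF V(1) N(1) NM _ _ V(3)] res_res[OF V'(1) N(1) NM _ _ V'(3)] N by auto
    have t: "res \<XX> W (N \<inter> M) t = res \<XX> W' (N \<inter> M) t'"
      using res_res[OF W(1) M(1) NM _ _ W(3)] res_res[OF W'(1) M(1) NM _ _ W'(3)] M by auto
    have r: "res \<XX> V (V \<inter> W) s \<in> carrier (sec \<XX> (V \<inter> W))"
      "res \<XX> W (V \<inter> W) t \<in> carrier (sec \<XX> (V \<inter> W))"
      "res \<XX> V' (V' \<inter> W') s' \<in> carrier (sec \<XX> (V' \<inter> W'))"
      "res \<XX> W' (V' \<inter> W') t' \<in> carrier (sec \<XX> (V' \<inter> W'))"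
      using V W V' W' o by (auto intro!: res_closed)
    have sub: "N \<inter> M \<subseteq> V \<inter> W" "N \<inter> M \<subseteq> V' \<inter> W'" using N M by auto
    have 1: "res \<XX> (V \<inter> W) (N \<inter> M) (op (V \<inter> W) (res \<XX> V (V \<inter> W) s) (res \<XX> W (V \<inter> W) t)) =
        op (N \<inter> M) (res \<XX> V (N \<inter> M) s) (res \<XX> W (N \<inter> M) t)"
      unfolding hom[OF o(1) NM sub(1) r(1,2)]
      using res_res[OF V(1) o(1) NM sub(1) _ V(3)] res_res[OF W(1) o(1) NM sub(1) _ W(3)] by simp
    have 2: "res \<XX> (V' \<inter> W') (N \<inter> M) (op (V' \<inter> W') (res \<XX> V' (V' \<inter> W') s') (res \<XX> W' (V' \<inter> W') t')) =
        op (N \<inter> M) (res \<XX> V' (N \<inter> M) s') (res \<XX> W' (N \<inter> M) t')"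
      unfolding hom[OF o(2) NM sub(2) r(3,4)]
      using res_res[OF V'(1) o(2) NM sub(2) _ V'(3)] res_res[OF W'(1) o(2) NM sub(2) _ W'(3)] by simp
    show ?thesis
    proof (rule germ_eqI[OF o(2) _ closed[OF o(2) r(3,4)] o(1) _ closed[OF o(1) r(1,2)] NM _ sub(2,1)])
      show "x \<in> V' \<inter> W'" "x \<in> V \<inter> W" "x \<in> N \<inter> M" using V W V' W' N M by auto
    qed (simp only: 1 2 s t)
  qed
  then show ?thesis
    by (intro UN_eq_const[OF germ_self[OF V]], clarsimp)
       (intro UN_eq_const[OF germ_self[OF W]], clarsimp)
qed

lemma germ_mult:
  assumes "opn V" "x \<in> V" "s \<in> carrier (sec \<XX> V)" "t \<in> carrier (sec \<XX> V)"
  shows "germ \<XX> x V s \<otimes>\<^bsub>stalk \<XX> x\<^esub> germ \<XX> x V t = germ \<XX> x V (s \<otimes>\<^bsub>sec \<XX> V\<^esub> t)"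
proof -
  have "germ \<XX> x V s \<otimes>\<^bsub>stalk \<XX> x\<^esub> germ \<XX> x V t = germ \<XX> x (V \<inter> V)
      (res \<XX> V (V \<inter> V) s \<otimes>\<^bsub>sec \<XX> (V \<inter> V)\<^esub> res \<XX> V (V \<inter> V) t)"
    unfolding stalk_def monoid.simps
    using assms by (intro germ_op)
      (auto intro: monoid.m_closed[OF ring.is_monoid[OF cring.axioms(1)[OF cring_sec]]]
        ring_hom_memE(2)[OF res_hom])
  then show ?thesis using assms by (simp add: res_id)
qed

lemma germ_add:
  assumes "opn V" "x \<in> V" "s \<in> carrier (sec \<XX> V)" "t \<in> carrier (sec \<XX> V)"
  shows "germ \<XX> x V s \<oplus>\<^bsub>stalk \<XX> x\<^esub> germ \<XX> x V t = germ \<XX> x V (s \<oplus>\<^bsub>sec \<XX> V\<^esub> t)"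
proof -
  have "germ \<XX> x V s \<oplus>\<^bsub>stalk \<XX> x\<^esub> germ \<XX> x V t = germ \<XX> x (V \<inter> V)
      (res \<XX> V (V \<inter> V) s \<oplus>\<^bsub>sec \<XX> (V \<inter> V)\<^esub> res \<XX> V (V \<inter> V) t)"
    unfolding stalk_def ring.simps
    using assms by (intro germ_op)
      (auto intro: ring.ring_simprules(1)[OF cring.axioms(1)[OF cring_sec]]
        ring_hom_memE(3)[OF res_hom])
  then show ?thesis using assms by (simp add: res_id)
qed

lemma sec_one_closed: "opn V \<Longrightarrow> \<one>\<^bsub>sec \<XX> V\<^esub> \<in> carrier (sec \<XX> V)"
  and sec_zero_closed: "opn V \<Longrightarrow> \<zero>\<^bsub>sec \<XX> V\<^esub> \<in> carrier (sec \<XX> V)"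
  using ring.ring_simprules(2,6)[OF cring.axioms(1)[OF cring_sec]] by auto

lemma res_one: "opn V \<Longrightarrow> opn W \<Longrightarrow> W \<subseteq> V \<Longrightarrow> res \<XX> V W \<one>\<^bsub>sec \<XX> V\<^esub> = \<one>\<^bsub>sec \<XX> W\<^esub>"
  using ring_hom_memE(4)[OF res_hom] .

lemma res_zero: "opn V \<Longrightarrow> opn W \<Longrightarrow> W \<subseteq> V \<Longrightarrow> res \<XX> V W \<zero>\<^bsub>sec \<XX> V\<^esub> = \<zero>\<^bsub>sec \<XX> W\<^esub>"
  using ring_hom_zero[OF res_hom cring.axioms(1)[OF cring_sec] cring.axioms(1)[OF cring_sec]] .

lemma germ_one:
  assumes "opn V" "x \<in> V" shows "germ \<XX> x V \<one>\<^bsub>sec \<XX> V\<^esub> = \<one>\<^bsub>stalk \<XX> x\<^esub>"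
proof -
  have "V \<subseteq> points \<XX>" using assms(1) by (rule openin_subset)
  then show ?thesis
    using assms germ_res[of "points \<XX>" V x "\<one>\<^bsub>sec \<XX> (points \<XX>)\<^esub>"]
    by (simp add: stalk_def res_one sec_one_closed)
qed

lemma germ_zero:
  assumes "opn V" "x \<in> V" shows "germ \<XX> x V \<zero>\<^bsub>sec \<XX> V\<^esub> = \<zero>\<^bsub>stalk \<XX> x\<^esub>"
proof -
  have "V \<subseteq> points \<XX>" using assms(1) by (rule openin_subset)
  then show ?thesis
    using assms germ_res[of "points \<XX>" V x "\<zero>\<^bsub>sec \<XX> (points \<XX>)\<^esub>"]
    by (simp add: stalk_def res_zero sec_zero_closed)
qed

lemma germ_hom: "opn V \<Longrightarrow> x \<in> V \<Longrightarrow> germ \<XX> x V \<in> ring_hom (sec \<XX> V) (stalk \<XX> x)"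
  by (intro ring_hom_memI) (auto simp: germ_mult germ_add germ_one germ_in_stalk)

lemma stalk_cring:
  assumes x: "x \<in> points \<XX>"
  shows "cring (stalk \<XX> x)"
proof (rule cringI)
  let ?L = "stalk \<XX> x"
  have one: "\<one>\<^bsub>?L\<^esub> \<in> carrier ?L" and zero: "\<zero>\<^bsub>?L\<^esub> \<in> carrier ?L"
    using x by (auto simp: stalk_def sec_one_closed sec_zero_closed intro!: exI[of _ "points \<XX>"])
  show "abelian_group ?L"
  proof (rule abelian_groupI)
    fix a b c assume "a \<in> carrier ?L" "b \<in> carrier ?L" "c \<in> carrier ?L"
    then obtain V s t r where V: "opn V" "x \<in> V" and m: "s \<in> carrier (sec \<XX> V)" "t \<in> carrier (sec \<XX> V)"
      "r \<in> carrier (sec \<XX> V)" and [simp]: "a = germ \<XX> x V s" "b = germ \<XX> x V t" "c = germ \<XX> x V r"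
      by (rule stalkE3)
    interpret V: cring "sec \<XX> V" using cring_sec V by blast
    show "a \<oplus>\<^bsub>?L\<^esub> b \<oplus>\<^bsub>?L\<^esub> c = a \<oplus>\<^bsub>?L\<^esub> (b \<oplus>\<^bsub>?L\<^esub> c)"
      using V m by (simp add: germ_add V.a_assoc)
  next
    fix a b assume "a \<in> carrier ?L" "b \<in> carrier ?L"
    then obtain V s t where V: "opn V" "x \<in> V" and m: "s \<in> carrier (sec \<XX> V)" "t \<in> carrier (sec \<XX> V)"
      and [simp]: "a = germ \<XX> x V s" "b = germ \<XX> x V t"
      by (rule stalkE2)
    interpret V: cring "sec \<XX> V" using cring_sec V by blast
    show "a \<oplus>\<^bsub>?L\<^esub> b \<in> carrier ?L" using V m by (simp add: germ_add germ_in_stalk)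
    show "a \<oplus>\<^bsub>?L\<^esub> b = b \<oplus>\<^bsub>?L\<^esub> a" using V m by (simp add: germ_add V.a_comm)
  next
    fix a assume "a \<in> carrier ?L"
    then obtain V s where V: "opn V" "x \<in> V" and m: "s \<in> carrier (sec \<XX> V)"
      and [simp]: "a = germ \<XX> x V s"
      by (rule stalkE)
    interpret V: cring "sec \<XX> V" using cring_sec V by blast
    show "\<zero>\<^bsub>?L\<^esub> \<oplus>\<^bsub>?L\<^esub> a = a" using V m by (simp add: germ_zero[OF V, symmetric] germ_add)
    show "\<exists>b\<in>carrier ?L. b \<oplus>\<^bsub>?L\<^esub> a = \<zero>\<^bsub>?L\<^esub>"
      using V m by (intro bexI[of _ "germ \<XX> x V (\<ominus>\<^bsub>sec \<XX> V\<^esub> s)"])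
        (simp_all add: germ_zero[OF V, symmetric] germ_add V.l_neg germ_in_stalk)
  qed (rule zero)
  show "comm_monoid ?L"
  proof (rule comm_monoidI)
    fix a b c assume "a \<in> carrier ?L" "b \<in> carrier ?L" "c \<in> carrier ?L"
    then obtain V s t r where V: "opn V" "x \<in> V" and m: "s \<in> carrier (sec \<XX> V)" "t \<in> carrier (sec \<XX> V)"
      "r \<in> carrier (sec \<XX> V)" and [simp]: "a = germ \<XX> x V s" "b = germ \<XX> x V t" "c = germ \<XX> x V r"
      by (rule stalkE3)
    interpret V: cring "sec \<XX> V" using cring_sec V by blast
    show "a \<otimes>\<^bsub>?L\<^esub> b \<otimes>\<^bsub>?L\<^esub> c = a \<otimes>\<^bsub>?L\<^esub> (b \<otimes>\<^bsub>?L\<^esub> c)"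
      using V m by (simp add: germ_mult V.m_assoc)
  next
    fix a b assume "a \<in> carrier ?L" "b \<in> carrier ?L"
    then obtain V s t where V: "opn V" "x \<in> V" and m: "s \<in> carrier (sec \<XX> V)" "t \<in> carrier (sec \<XX> V)"
      and [simp]: "a = germ \<XX> x V s" "b = germ \<XX> x V t"
      by (rule stalkE2)
    interpret V: cring "sec \<XX> V" using cring_sec V by blast
    show "a \<otimes>\<^bsub>?L\<^esub> b \<in> carrier ?L" using V m by (simp add: germ_mult germ_in_stalk)
    show "a \<otimes>\<^bsub>?L\<^esub> b = b \<otimes>\<^bsub>?L\<^esub> a" using V m by (simp add: germ_mult V.m_comm)
  next
    fix a assume "a \<in> carrier ?L"
    then obtain V s where V: "opn V" "x \<in> V" and m: "s \<in> carrier (sec \<XX> V)"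
      and [simp]: "a = germ \<XX> x V s"
      by (rule stalkE)
    interpret V: cring "sec \<XX> V" using cring_sec V by blast
    show "\<one>\<^bsub>?L\<^esub> \<otimes>\<^bsub>?L\<^esub> a = a" using V m by (simp add: germ_one[OF V, symmetric] germ_mult)
  qed (rule one)
  fix a b c assume "a \<in> carrier ?L" "b \<in> carrier ?L" "c \<in> carrier ?L"
  then obtain V s t r where V: "opn V" "x \<in> V" and m: "s \<in> carrier (sec \<XX> V)" "t \<in> carrier (sec \<XX> V)"
    "r \<in> carrier (sec \<XX> V)" and [simp]: "a = germ \<XX> x V s" "b = germ \<XX> x V t" "c = germ \<XX> x V r"
    by (rule stalkE3)
  interpret V: cring "sec \<XX> V" using cring_sec V by blast
  show "(a \<oplus>\<^bsub>?L\<^esub> b) \<otimes>\<^bsub>?L\<^esub> c = a \<otimes>\<^bsub>?L\<^esub> c \<oplus>\<^bsub>?L\<^esub> b \<otimes>\<^bsub>?L\<^esub> c"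
    using V m by (simp add: germ_mult germ_add V.l_distr)
qed

text \<open>Invertibility of the germ of \<open>s\<close> at \<open>x\<close>, said in terms of
  sections; in this form it passes through \<open>pull\<close> and \<open>res\<close> without
  mention of stalks.\<close>

definition unit_at :: "'p \<Rightarrow> 'p set \<Rightarrow> 'a \<Rightarrow> bool" where
  "unit_at x V s \<longleftrightarrow> (\<exists>N. opn N \<and> x \<in> N \<and> N \<subseteq> V \<and>
     (\<exists>t\<in>carrier (sec \<XX> N). res \<XX> V N s \<otimes>\<^bsub>sec \<XX> N\<^esub> t = \<one>\<^bsub>sec \<XX> N\<^esub>))"

lemma germ_Units_iff:
  assumes V: "opn V" "x \<in> V" "s \<in> carrier (sec \<XX> V)"
  shows "germ \<XX> x V s \<in> Units (stalk \<XX> x) \<longleftrightarrow> unit_at x V s"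
proof
  assume "germ \<XX> x V s \<in> Units (stalk \<XX> x)"
  then obtain h where h: "h \<in> carrier (stalk \<XX> x)" "germ \<XX> x V s \<otimes>\<^bsub>stalk \<XX> x\<^esub> h = \<one>\<^bsub>stalk \<XX> x\<^esub>"
    by (auto simp: Units_def)
  obtain W t where W: "opn W" "x \<in> W" "t \<in> carrier (sec \<XX> W)" "h = germ \<XX> x W t"
    using h stalkE by metis
  let ?N = "V \<inter> W"
  have N: "opn ?N" "x \<in> ?N" using V W by auto
  interpret N: cring "sec \<XX> ?N" using cring_sec N by blast
  have s: "res \<XX> V ?N s \<in> carrier (sec \<XX> ?N)" "res \<XX> W ?N t \<in> carrier (sec \<XX> ?N)"
    using V W N by (auto intro: res_closed)
  have "germ \<XX> x ?N (res \<XX> V ?N s \<otimes>\<^bsub>sec \<XX> ?N\<^esub> res \<XX> W ?N t) = germ \<XX> x V s \<otimes>\<^bsub>stalk \<XX> x\<^esub> h"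
    using s N V W by (subst germ_mult[symmetric]) (auto simp: germ_res)
  also have "\<dots> = germ \<XX> x ?N \<one>\<^bsub>sec \<XX> ?N\<^esub>" using h N by (simp add: germ_one)
  finally obtain M where M: "opn M" "x \<in> M" "M \<subseteq> ?N"
    "res \<XX> ?N M (res \<XX> V ?N s \<otimes>\<^bsub>sec \<XX> ?N\<^esub> res \<XX> W ?N t) = res \<XX> ?N M \<one>\<^bsub>sec \<XX> ?N\<^esub>"
    using germ_eqD[OF _ N N.one_closed] by metis
  have "res \<XX> V M s \<otimes>\<^bsub>sec \<XX> M\<^esub> res \<XX> W M t = \<one>\<^bsub>sec \<XX> M\<^esub>"
    using M(4) ring_hom_memE(2)[OF res_hom[OF N(1) M(1,3)] s] V W N M
    by (simp add: res_res res_one)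
  then show "unit_at x V s"
    unfolding unit_at_def using M V W by (intro exI[of _ M]) (auto intro!: bexI[of _ "res \<XX> W M t"] res_closed)
next
  assume "unit_at x V s"
  then obtain N t where N: "opn N" "x \<in> N" "N \<subseteq> V" "t \<in> carrier (sec \<XX> N)"
    "res \<XX> V N s \<otimes>\<^bsub>sec \<XX> N\<^esub> t = \<one>\<^bsub>sec \<XX> N\<^esub>" by (auto simp: unit_at_def)
  have x: "x \<in> points \<XX>" using V openin_subset by blast
  interpret S: cring "stalk \<XX> x" using stalk_cring[OF x] .
  have r: "res \<XX> V N s \<in> carrier (sec \<XX> N)" using V N by (auto intro: res_closed)
  have "germ \<XX> x V s \<otimes>\<^bsub>stalk \<XX> x\<^esub> germ \<XX> x N t =
      germ \<XX> x N (res \<XX> V N s \<otimes>\<^bsub>sec \<XX> N\<^esub> t)"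
    unfolding germ_mult[OF N(1,2) r N(4), symmetric] germ_res[OF V(1) N(1,3,2) V(3)] ..
  also have "\<dots> = \<one>\<^bsub>stalk \<XX> x\<^esub>"
    unfolding N(5) by (rule germ_one[OF N(1,2)])
  finally have 1: "germ \<XX> x V s \<otimes>\<^bsub>stalk \<XX> x\<^esub> germ \<XX> x N t = \<one>\<^bsub>stalk \<XX> x\<^esub>" .
  have c: "germ \<XX> x V s \<in> carrier (stalk \<XX> x)" "germ \<XX> x N t \<in> carrier (stalk \<XX> x)"
    using germ_in_stalk V N by auto
  show "germ \<XX> x V s \<in> Units (stalk \<XX> x)"
    unfolding Units_def using 1 c S.m_comm[OF c] by auto
qed

end

lemma presheaf_space_of_sheaf:
  assumes "sheaf_of_rings \<XX>"
  shows "presheaf_space \<XX>"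
proof (rule presheaf_space.intro)
  note h = assms[unfolded sheaf_of_rings_def]
  show "cring (sec \<XX> V)" if "openin (topo \<XX>) V" for V
    using h[THEN conjunct1] that by blast
  show "res \<XX> V W \<in> ring_hom (sec \<XX> V) (sec \<XX> W)"
    if "openin (topo \<XX>) V" "openin (topo \<XX>) W" "W \<subseteq> V" for V W
    using h[THEN conjunct2, THEN conjunct1] that by blast
  show "res \<XX> V V s = s" if "openin (topo \<XX>) V" "s \<in> carrier (sec \<XX> V)" for V s
    using h[THEN conjunct2, THEN conjunct2, THEN conjunct1] that by blast
  show "res \<XX> W N (res \<XX> V W s) = res \<XX> V N s"
    if "openin (topo \<XX>) V" "openin (topo \<XX>) W" "openin (topo \<XX>) N" "N \<subseteq> W" "W \<subseteq> V"
      "s \<in> carrier (sec \<XX> V)" for V W N s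
    using h[THEN conjunct2, THEN conjunct2, THEN conjunct2, THEN conjunct1] that by blast
qed

subsection \<open>Morphisms\<close>

text \<open>The condition on stalks is kept apart; \<open>morphism_iff\<close> restates it as
  reflection of invertible sections.\<close>

locale ringed_map_hom = X: presheaf_space \<XX> + Y: presheaf_space \<YY>
  for \<XX> :: "('p, 'a) ringed_space" and \<YY> :: "('q, 'b) ringed_space" +
  fixes f :: "('p, 'q, 'a, 'b) ringed_map"
  assumes cont: "continuous_map (topo \<XX>) (topo \<YY>) (pt f)"
    and pull_hom: "\<And>V. openin (topo \<YY>) V \<Longrightarrow> pull f V \<in> ring_hom (sec \<YY> V) (sec \<XX> (preim \<XX> f V))"
    and pull_res: "\<And>V W s. openin (topo \<YY>) V \<Longrightarrow> openin (topo \<YY>) W \<Longrightarrow> W \<subseteq> V \<Longrightarrow>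
      s \<in> carrier (sec \<YY> V) \<Longrightarrow>
      pull f W (res \<YY> V W s) = res \<XX> (preim \<XX> f V) (preim \<XX> f W) (pull f V s)"
begin

lemma opn_preim: "Y.opn V \<Longrightarrow> X.opn (preim \<XX> f V)"
  using openin_continuous_map_preimage[OF cont, of V] by (simp add: preim_def)

lemma pt_closed: "x \<in> points \<XX> \<Longrightarrow> pt f x \<in> points \<YY>"
  using cont by (auto simp: continuous_map_def)

lemma preim_points: "preim \<XX> f (points \<YY>) = points \<XX>"
  using pt_closed by (auto simp: preim_def)

lemma mem_preim: "x \<in> preim \<XX> f V \<longleftrightarrow> x \<in> points \<XX> \<and> pt f x \<in> V"
  by (auto simp: preim_def)

lemma preim_mono: "W \<subseteq> V \<Longrightarrow> preim \<XX> f W \<subseteq> preim \<XX> f V"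
  by (auto simp: preim_def)

lemma pull_closed: "Y.opn V \<Longrightarrow> s \<in> carrier (sec \<YY> V) \<Longrightarrow> pull f V s \<in> carrier (sec \<XX> (preim \<XX> f V))"
  using ring_hom_memE(1)[OF pull_hom] .

text \<open>Sections that agree on a neighbourhood \<open>N\<close> have pullbacks that agree on its
  preimage, so the union defining the stalk map is a single germ.\<close>

lemma stalk_map_germ:
  assumes x: "x \<in> points \<XX>" and V: "Y.opn V" "pt f x \<in> V" "s \<in> carrier (sec \<YY> V)"
  shows "stalk_map \<XX> f x (germ \<YY> (pt f x) V s) = germ \<XX> x (preim \<XX> f V) (pull f V s)"
proof -
  have "germ \<XX> x (preim \<XX> f W) (pull f W t) = germ \<XX> x (preim \<XX> f V) (pull f V s)"
    if Wt: "(W, t) \<in> germ \<YY> (pt f x) V s" for W t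
  proof -
    obtain N where N: "Y.opn N" "pt f x \<in> N" "N \<subseteq> V \<inter> W" "res \<YY> V N s = res \<YY> W N t"
      and W: "Y.opn W" "pt f x \<in> W" "t \<in> carrier (sec \<YY> W)"
      using Wt unfolding Y.germ_mem by blast
    have sub: "N \<subseteq> V" "N \<subseteq> W" using N by auto
    show ?thesis
    proof (rule X.germ_eqI)
      show "X.opn (preim \<XX> f N)" "x \<in> preim \<XX> f N" using N x by (auto simp: opn_preim mem_preim)
      show "preim \<XX> f N \<subseteq> preim \<XX> f V" "preim \<XX> f N \<subseteq> preim \<XX> f W" using sub preim_mono by auto
      show "res \<XX> (preim \<XX> f W) (preim \<XX> f N) (pull f W t) = res \<XX> (preim \<XX> f V) (preim \<XX> f N) (pull f V s)"
        using pull_res[OF W(1) N(1) sub(2) W(3)] pull_res[OF V(1) N(1) sub(1) V(3)] N(4) by simp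
    qed (use V W x in \<open>auto simp: opn_preim mem_preim pull_closed\<close>)
  qed
  then show ?thesis
    unfolding stalk_map_def by (intro UN_eq_const[OF Y.germ_self[OF V]]) auto
qed

lemma stalk_map_hom:
  assumes x: "x \<in> points \<XX>"
  shows "stalk_map \<XX> f x \<in> ring_hom (stalk \<YY> (pt f x)) (stalk \<XX> x)"
proof (rule ring_hom_memI)
  fix g assume "g \<in> carrier (stalk \<YY> (pt f x))"
  then obtain V s where V: "Y.opn V" "pt f x \<in> V" "s \<in> carrier (sec \<YY> V)" "g = germ \<YY> (pt f x) V s"
    by (rule Y.stalkE)
  show "stalk_map \<XX> f x g \<in> carrier (stalk \<XX> x)"
    unfolding V(4) using V x by (simp add: stalk_map_germ X.germ_in_stalk opn_preim mem_preim pull_closed)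
next
  fix g h assume "g \<in> carrier (stalk \<YY> (pt f x))" "h \<in> carrier (stalk \<YY> (pt f x))"
  then obtain V s t where V: "Y.opn V" "pt f x \<in> V" "s \<in> carrier (sec \<YY> V)" "t \<in> carrier (sec \<YY> V)"
    and g: "g = germ \<YY> (pt f x) V s" "h = germ \<YY> (pt f x) V t"
    by (rule Y.stalkE2)
  interpret V: cring "sec \<YY> V" using Y.cring_sec V by blast
  show "stalk_map \<XX> f x (g \<otimes>\<^bsub>stalk \<YY> (pt f x)\<^esub> h) =
      stalk_map \<XX> f x g \<otimes>\<^bsub>stalk \<XX> x\<^esub> stalk_map \<XX> f x h"
    unfolding g using V x ring_hom_memE(2)[OF pull_hom[OF V(1)]]
    by (simp add: Y.germ_mult X.germ_mult stalk_map_germ opn_preim mem_preim pull_closed)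
  show "stalk_map \<XX> f x (g \<oplus>\<^bsub>stalk \<YY> (pt f x)\<^esub> h) =
      stalk_map \<XX> f x g \<oplus>\<^bsub>stalk \<XX> x\<^esub> stalk_map \<XX> f x h"
    unfolding g using V x ring_hom_memE(3)[OF pull_hom[OF V(1)]]
    by (simp add: Y.germ_add X.germ_add stalk_map_germ opn_preim mem_preim pull_closed)
next
  have V: "Y.opn (points \<YY>)" "pt f x \<in> points \<YY>" using pt_closed x by auto
  have "stalk_map \<XX> f x (germ \<YY> (pt f x) (points \<YY>) \<one>\<^bsub>sec \<YY> (points \<YY>)\<^esub>) =
      germ \<XX> x (preim \<XX> f (points \<YY>)) \<one>\<^bsub>sec \<XX> (preim \<XX> f (points \<YY>))\<^esub>"
    using V x ring_hom_memE(4)[OF pull_hom[OF V(1)]] by (simp add: stalk_map_germ Y.sec_one_closed)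
  then show "stalk_map \<XX> f x \<one>\<^bsub>stalk \<YY> (pt f x)\<^esub> = \<one>\<^bsub>stalk \<XX> x\<^esub>"
    using V x by (simp add: Y.germ_one X.germ_one preim_points)
qed

lemma unit_at_pull:
  assumes "x \<in> points \<XX>" "Y.opn V" "pt f x \<in> V" "s \<in> carrier (sec \<YY> V)" "Y.unit_at (pt f x) V s"
  shows "X.unit_at x (preim \<XX> f V) (pull f V s)"
proof -
  obtain N t where N: "Y.opn N" "pt f x \<in> N" "N \<subseteq> V" "t \<in> carrier (sec \<YY> N)"
    "res \<YY> V N s \<otimes>\<^bsub>sec \<YY> N\<^esub> t = \<one>\<^bsub>sec \<YY> N\<^esub>"
    using assms(5) by (auto simp: Y.unit_at_def)
  note hom = ring_hom_memE[OF pull_hom[OF N(1)]]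
  have "res \<XX> (preim \<XX> f V) (preim \<XX> f N) (pull f V s) \<otimes>\<^bsub>sec \<XX> (preim \<XX> f N)\<^esub> pull f N t =
      pull f N (res \<YY> V N s \<otimes>\<^bsub>sec \<YY> N\<^esub> t)"
    unfolding pull_res[OF assms(2) N(1,3) assms(4), symmetric]
    using hom(2)[OF Y.res_closed[OF assms(2) N(1,3) assms(4)] N(4)] by simp
  then have "res \<XX> (preim \<XX> f V) (preim \<XX> f N) (pull f V s) \<otimes>\<^bsub>sec \<XX> (preim \<XX> f N)\<^esub> pull f N t =
      \<one>\<^bsub>sec \<XX> (preim \<XX> f N)\<^esub>" using N hom(4) by simp
  moreover have "X.opn (preim \<XX> f N)" "x \<in> preim \<XX> f N" "preim \<XX> f N \<subseteq> preim \<XX> f V"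
    "pull f N t \<in> carrier (sec \<XX> (preim \<XX> f N))"
    using assms(1) N opn_preim mem_preim pull_closed preim_mono by auto
  ultimately show ?thesis unfolding X.unit_at_def by blast
qed

text \<open>In a local ring the maximal ideal consists of the nonunits, so a homomorphism of local
  rings is local exactly when it reflects units; and every germ comes from a section.\<close>

lemma stalk_map_local_iff:
  assumes x: "x \<in> points \<XX>" and loc: "local_ring (stalk \<YY> (pt f x))" "local_ring (stalk \<XX> x)"
  shows "stalk_map \<XX> f x \<in> local_ring_hom (stalk \<YY> (pt f x)) (stalk \<XX> x) \<longleftrightarrow>
    (\<forall>V s. Y.opn V \<longrightarrow> pt f x \<in> V \<longrightarrow> s \<in> carrier (sec \<YY> V) \<longrightarrow>
       X.unit_at x (preim \<XX> f V) (pull f V s) \<longrightarrow> Y.unit_at (pt f x) V s)" (is "_ \<longleftrightarrow> ?R")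
proof -
  have max_Y: "germ \<YY> (pt f x) V s \<in> the_maximal_ideal (stalk \<YY> (pt f x)) \<longleftrightarrow> \<not> Y.unit_at (pt f x) V s"
    if "Y.opn V" "pt f x \<in> V" "s \<in> carrier (sec \<YY> V)" for V s
    using mem_the_maximal_ideal_iff[OF loc(1) Y.germ_in_stalk[OF that]] Y.germ_Units_iff[OF that] by simp
  have max_X: "stalk_map \<XX> f x (germ \<YY> (pt f x) V s) \<in> the_maximal_ideal (stalk \<XX> x) \<longleftrightarrow>
      \<not> X.unit_at x (preim \<XX> f V) (pull f V s)"
    if V: "Y.opn V" "pt f x \<in> V" "s \<in> carrier (sec \<YY> V)" for V s
  proof -
    have c: "X.opn (preim \<XX> f V)" "x \<in> preim \<XX> f V" "pull f V s \<in> carrier (sec \<XX> (preim \<XX> f V))"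
      using V x by (auto simp: opn_preim mem_preim pull_closed)
    show ?thesis
      using mem_the_maximal_ideal_iff[OF loc(2) X.germ_in_stalk[OF c]] X.germ_Units_iff[OF c]
        stalk_map_germ[OF x V] by simp
  qed
  have sub: "the_maximal_ideal (stalk \<YY> (pt f x)) \<subseteq> carrier (stalk \<YY> (pt f x))"
  proof -
    have "maximalideal (the_maximal_ideal (stalk \<YY> (pt f x))) (stalk \<YY> (pt f x))"
      unfolding the_maximal_ideal_def using loc(1) unfolding local_ring_def by (elim conjE) (rule theI')
    then show ?thesis
      by (meson additive_subgroup.a_subset ideal.axioms(1) maximalideal.axioms(1))
  qed
  have "stalk_map \<XX> f x ` the_maximal_ideal (stalk \<YY> (pt f x)) \<subseteq> the_maximal_ideal (stalk \<XX> x) \<longleftrightarrow> ?R"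
  proof
    assume l: "stalk_map \<XX> f x ` the_maximal_ideal (stalk \<YY> (pt f x)) \<subseteq> the_maximal_ideal (stalk \<XX> x)"
    show ?R
    proof (intro allI impI)
      fix V s assume V: "Y.opn V" "pt f x \<in> V" "s \<in> carrier (sec \<YY> V)"
        and u: "X.unit_at x (preim \<XX> f V) (pull f V s)"
      show "Y.unit_at (pt f x) V s" using max_X[OF V] max_Y[OF V] u l by blast
    qed
  next
    assume r: ?R
    show "stalk_map \<XX> f x ` the_maximal_ideal (stalk \<YY> (pt f x)) \<subseteq> the_maximal_ideal (stalk \<XX> x)"
    proof
      fix h assume "h \<in> stalk_map \<XX> f x ` the_maximal_ideal (stalk \<YY> (pt f x))"
      then obtain g where g: "g \<in> the_maximal_ideal (stalk \<YY> (pt f x))" "h = stalk_map \<XX> f x g" by blast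
      obtain V s where V: "Y.opn V" "pt f x \<in> V" "s \<in> carrier (sec \<YY> V)" "g = germ \<YY> (pt f x) V s"
        using Y.stalkE g sub by blast
      show "h \<in> the_maximal_ideal (stalk \<XX> x)"
        using max_X[OF V(1-3)] max_Y[OF V(1-3)] V(4) g r V(1-3) by blast
    qed
  qed
  then show ?thesis unfolding local_ring_hom_def using stalk_map_hom[OF x] by simp
qed

end

lemma ringed_map_hom_of_morphism:
  assumes "presheaf_space \<XX>" "presheaf_space \<YY>" "morphism \<XX> \<YY> f"
  shows "ringed_map_hom \<XX> \<YY> f"
  using assms unfolding morphism_def ringed_map_hom_def ringed_map_hom_axioms_def by blast

definition local_space :: "('p, 'a) ringed_space \<Rightarrow> bool" where
  "local_space \<XX> \<longleftrightarrow> presheaf_space \<XX> \<and> (\<forall>x\<in>points \<XX>. local_ring (stalk \<XX> x))"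

lemma morphism_iff:
  assumes X: "local_space \<XX>" and Y: "local_space \<YY>"
  shows "morphism \<XX> \<YY> f \<longleftrightarrow> ringed_map_hom \<XX> \<YY> f \<and>
    (\<forall>x V s. x \<in> points \<XX> \<longrightarrow> openin (topo \<YY>) V \<longrightarrow> pt f x \<in> V \<longrightarrow> s \<in> carrier (sec \<YY> V) \<longrightarrow>
       presheaf_space.unit_at \<XX> x (preim \<XX> f V) (pull f V s) \<longrightarrow>
       presheaf_space.unit_at \<YY> (pt f x) V s)" (is "?L \<longleftrightarrow> ?H \<and> ?R")
proof -
  have ps: "presheaf_space \<XX>" "presheaf_space \<YY>" using X Y by (auto simp: local_space_def)
  have "?L \<longleftrightarrow> ?R" if H: ?H
  proof -
    interpret ringed_map_hom \<XX> \<YY> f by (rule H)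
    have "?L \<longleftrightarrow> (\<forall>x\<in>points \<XX>. stalk_map \<XX> f x \<in> local_ring_hom (stalk \<YY> (pt f x)) (stalk \<XX> x))"
      unfolding morphism_def using cont pull_hom pull_res by blast
    moreover have "(stalk_map \<XX> f x \<in> local_ring_hom (stalk \<YY> (pt f x)) (stalk \<XX> x)) \<longleftrightarrow>
       (\<forall>V s. Y.opn V \<longrightarrow> pt f x \<in> V \<longrightarrow> s \<in> carrier (sec \<YY> V) \<longrightarrow>
       X.unit_at x (preim \<XX> f V) (pull f V s) \<longrightarrow> Y.unit_at (pt f x) V s)" if x: "x \<in> points \<XX>" for x
      using X Y pt_closed[OF x] x unfolding local_space_def by (intro stalk_map_local_iff) auto
    ultimately show ?thesis by (simp add: Ball_def)
  qed
  with ringed_map_hom_of_morphism[OF ps, of f] show ?thesis by argo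
qed

lemma preim_comp:
  assumes "ringed_map_hom \<XX> \<YY> f"
  shows "preim \<XX> (comp_map \<YY> g f) V = preim \<XX> f (preim \<YY> g V)"
proof -
  interpret ringed_map_hom \<XX> \<YY> f by fact
  show ?thesis using pt_closed by (auto simp: preim_def comp_map_def)
qed

lemma ringed_map_hom_comp:
  assumes f: "ringed_map_hom \<XX> \<YY> f" and g: "ringed_map_hom \<YY> \<ZZ> g"
  shows "ringed_map_hom \<XX> \<ZZ> (comp_map \<YY> g f)"
proof -
  interpret f: ringed_map_hom \<XX> \<YY> f by fact
  interpret g: ringed_map_hom \<YY> \<ZZ> g by fact
  note pre = preim_comp[OF f, of g]
  have pt: "pt (comp_map \<YY> g f) = pt g \<circ> pt f" by (auto simp: comp_map_def)
  have pull: "pull (comp_map \<YY> g f) V = pull f (preim \<YY> g V) \<circ> pull g V" for V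
    by (auto simp: comp_map_def)
  show ?thesis
  proof
    show "continuous_map (topo \<XX>) (topo \<ZZ>) (pt (comp_map \<YY> g f))"
      unfolding pt using f.cont g.cont by (rule continuous_map_compose)
    fix V assume V: "openin (topo \<ZZ>) V"
    show "pull (comp_map \<YY> g f) V \<in> ring_hom (sec \<ZZ> V) (sec \<XX> (preim \<XX> (comp_map \<YY> g f) V))"
      unfolding pull pre using g.pull_hom[OF V] f.pull_hom[OF g.opn_preim[OF V]] by (rule ring_hom_trans)
    fix W s assume W: "openin (topo \<ZZ>) W" "W \<subseteq> V" "s \<in> carrier (sec \<ZZ> V)"
    show "pull (comp_map \<YY> g f) W (res \<ZZ> V W s) =
        res \<XX> (preim \<XX> (comp_map \<YY> g f) V) (preim \<XX> (comp_map \<YY> g f) W) (pull (comp_map \<YY> g f) V s)"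
      unfolding pull pre using V W
      by (simp add: g.pull_res f.pull_res g.opn_preim g.preim_mono g.pull_closed)
  qed
qed

text \<open>Reflection of invertible sections passes to composites at once, so no stalk maps have to
  be composed.\<close>

lemma morphism_comp:
  assumes X: "local_space \<XX>" and Y: "local_space \<YY>" and Z: "local_space \<ZZ>"
    and f: "morphism \<XX> \<YY> f" and g: "morphism \<YY> \<ZZ> g"
  shows "morphism \<XX> \<ZZ> (comp_map \<YY> g f)"
proof -
  have F: "ringed_map_hom \<XX> \<YY> f" and G: "ringed_map_hom \<YY> \<ZZ> g"
    using f g morphism_iff X Y Z by blast+
  interpret F: ringed_map_hom \<XX> \<YY> f by (rule F)
  interpret G: ringed_map_hom \<YY> \<ZZ> g by (rule G)
  show ?thesis
    unfolding morphism_iff[OF X Z]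
  proof (intro conjI ringed_map_hom_comp[OF F G] allI impI)
    fix x V s assume x: "x \<in> points \<XX>" and V: "openin (topo \<ZZ>) V" "pt (comp_map \<YY> g f) x \<in> V"
      "s \<in> carrier (sec \<ZZ> V)"
      and u: "F.X.unit_at x (preim \<XX> (comp_map \<YY> g f) V) (pull (comp_map \<YY> g f) V s)"
    have V': "pt g (pt f x) \<in> V" using V by (simp add: comp_map_def)
    have u': "F.X.unit_at x (preim \<XX> f (preim \<YY> g V)) (pull f (preim \<YY> g V) (pull g V s))"
      using u preim_comp[OF F, of g V] by (simp add: comp_map_def)
    have "F.Y.unit_at (pt f x) (preim \<YY> g V) (pull g V s)"
      using f[unfolded morphism_iff[OF X Y], THEN conjunct2, rule_format, OF x G.opn_preim[OF V(1)] _
          G.pull_closed[OF V(1,3)] u'] F.pt_closed[OF x] V' by (simp add: G.mem_preim)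
    then have "G.Y.unit_at (pt g (pt f x)) V s"
      by (rule g[unfolded morphism_iff[OF Y Z], THEN conjunct2, rule_format, OF F.pt_closed[OF x] V(1) V' V(3)])
    then show "G.Y.unit_at (pt (comp_map \<YY> g f) x) V s" by (simp add: comp_map_def)
  qed
qed

lemma local_space_of_lrs: "locally_ringed_space \<XX> \<Longrightarrow> local_space \<XX>"
  by (simp add: locally_ringed_space_def local_space_def presheaf_space_of_sheaf)

section \<open>Affine schemes\<close>

context mult_set begin

lemma fraction_uminus:
  assumes "a \<in> carrier A" "s \<in> S"
  shows "\<ominus>\<^bsub>localisation A S\<^esub> fraction A S a s = fraction A S (\<ominus> a) s"
proof -
  interpret L: cring "localisation A S" by (rule localisation_cring)
  have "fraction A S (\<ominus> a) s \<oplus>\<^bsub>localisation A S\<^esub> fraction A S a s = \<zero>\<^bsub>localisation A S\<^esub>"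
    using assms by (simp add: fraction_add_same fraction_zero l_neg)
  then show ?thesis
    using assms by (intro L.minus_equality) (auto intro: fraction_in_carrier)
qed

end

locale affine = cring A for A :: "'a ring" (structure)
begin

definition basic :: "'a \<Rightarrow> 'a set set" where
  "basic f = {P \<in> prime_spectrum A. f \<notin> P}"

lemma mem_basic: "P \<in> basic f \<longleftrightarrow> primeideal P A \<and> f \<notin> P"
  by (auto simp: basic_def prime_spectrum_def)

lemma basic_mult: "f \<in> carrier A \<Longrightarrow> g \<in> carrier A \<Longrightarrow> basic (f \<otimes> g) = basic f \<inter> basic g"
  using prime_mem_mult_iff by (auto simp: mem_basic)

lemma basic_one: "basic \<one> = prime_spectrum A"
  using primeideal_one_notin by (auto simp: basic_def prime_spectrum_def)

abbreviation opn :: "'a set set \<Rightarrow> bool" where "opn \<equiv> openin (topo (Spec A))"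

lemma topo_Spec: "topo (Spec A) = topology_generated_by {basic f |f. f \<in> carrier A}"
  by (simp add: Spec_def space_of_local_families_def basic_def)

lemma opn_basic: "f \<in> carrier A \<Longrightarrow> opn (basic f)"
  unfolding topo_Spec by (rule topology_generated_by_Basis) blast

lemma points_Spec: "points (Spec A) = prime_spectrum A"
proof -
  have "\<Union>{basic f |f. f \<in> carrier A} = prime_spectrum A"
    using basic_one by (auto simp: mem_basic prime_spectrum_def)
  then show ?thesis by (simp add: topo_Spec)
qed

lemma opn_prime: "opn V \<Longrightarrow> P \<in> V \<Longrightarrow> primeideal P A"
  using openin_subset points_Spec by (force simp: prime_spectrum_def)

text \<open>The sets \<open>basic f\<close> generate the topology, and they are a basis because
  \<open>basic f \<inter> basic g\<close> is \<open>basic (f \<otimes> g)\<close>.\<close>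

lemma basic_nbhd:
  assumes "opn V" "P \<in> V"
  obtains f where "f \<in> carrier A" "P \<in> basic f" "basic f \<subseteq> V"
proof -
  have "generate_topology_on {basic f |f. f \<in> carrier A} V"
    using assms(1) unfolding topo_Spec by (rule openin_topology_generated_by)
  then have "\<forall>P\<in>V. \<exists>f\<in>carrier A. P \<in> basic f \<and> basic f \<subseteq> V"
  proof (induction rule: generate_topology_on.induct)
    case (Int a b)
    show ?case
    proof
      fix P assume "P \<in> a \<inter> b"
      then obtain f g where "f \<in> carrier A" "P \<in> basic f" "basic f \<subseteq> a"
        "g \<in> carrier A" "P \<in> basic g" "basic g \<subseteq> b" using Int by blast
      then show "\<exists>f\<in>carrier A. P \<in> basic f \<and> basic f \<subseteq> a \<inter> b"
        by (intro bexI[of _ "f \<otimes> g"]) (auto simp: basic_mult)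
    qed
  next
    case (UN K)
    then show ?case by (meson UnionE UnionI Sup_upper subset_trans)
  qed auto
  then show thesis using assms(2) that by blast
qed

lemma ms: "P \<in> basic f \<Longrightarrow> mult_set A (carrier A - P)"
  by (auto simp: mem_basic intro: mult_set_primeideal)

lemma sec_carrier:
  "\<alpha> \<in> carrier (sec (Spec A) V) \<longleftrightarrow> \<alpha> \<in> (\<Pi>\<^sub>E P\<in>V. carrier (localisation_at A P)) \<and>
    (\<forall>P\<in>V. \<exists>N. opn N \<and> P \<in> N \<and> N \<subseteq> V \<and>
      (\<exists>a\<in>carrier A. \<exists>f\<in>carrier A. \<forall>P\<in>N. f \<notin> P \<and> \<alpha> P = prime_fraction A P a f))"
  by (simp add: Spec_def space_of_local_families_def)

lemma section_ext: "\<alpha> \<in> carrier (sec (Spec A) V) \<Longrightarrow> \<alpha> \<in> extensional V"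
  by (auto simp: sec_carrier PiE_def)

lemma sectionI:
  assumes "\<alpha> \<in> extensional V"
    and "\<And>P. P \<in> V \<Longrightarrow> \<exists>a\<in>carrier A. \<exists>g\<in>carrier A. P \<in> basic g \<and> basic g \<subseteq> V \<and>
      (\<forall>P'\<in>basic g. \<alpha> P' = prime_fraction A P' a g)"
  shows "\<alpha> \<in> carrier (sec (Spec A) V)"
  unfolding sec_carrier
proof (intro conjI ballI PiE_I)
  fix P assume "P \<in> V"
  then obtain a g where ag: "a \<in> carrier A" "g \<in> carrier A" "P \<in> basic g" "basic g \<subseteq> V"
    "\<forall>P'\<in>basic g. \<alpha> P' = prime_fraction A P' a g" using assms(2) by blast
  interpret mult_set A "carrier A - P" using ms ag by blast
  show "\<alpha> P \<in> carrier (localisation_at A P)"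
    using ag fraction_in_carrier by (auto simp: mem_basic)
  show "\<exists>N. opn N \<and> P \<in> N \<and> N \<subseteq> V \<and>
      (\<exists>a\<in>carrier A. \<exists>f\<in>carrier A. \<forall>P\<in>N. f \<notin> P \<and> \<alpha> P = prime_fraction A P a f)"
  proof (rule exI[of _ "basic g"], intro conjI, rule opn_basic[OF ag(2)], rule ag(3), rule ag(4),
      rule bexI[of _ a], rule bexI[of _ g], rule ballI)
    fix P' assume P': "P' \<in> basic g"
    then show "g \<notin> P' \<and> \<alpha> P' = prime_fraction A P' a g" using ag(5) by (simp add: mem_basic)
  qed (use ag in auto)
next
  fix P assume "P \<notin> V" then show "\<alpha> P = undefined" using assms(1) by (auto simp: extensional_def)
qed

lemma sectionE:
  assumes V: "opn V" and \<alpha>: "\<alpha> \<in> carrier (sec (Spec A) V)" and P: "P \<in> V"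
  obtains a g where "a \<in> carrier A" "g \<in> carrier A" "P \<in> basic g" "basic g \<subseteq> V"
    "\<And>P'. P' \<in> basic g \<Longrightarrow> \<alpha> P' = prime_fraction A P' a g"
proof -
  obtain N a f where N: "opn N" "P \<in> N" "N \<subseteq> V" and af: "a \<in> carrier A" "f \<in> carrier A"
    "\<And>P'. P' \<in> N \<Longrightarrow> f \<notin> P' \<and> \<alpha> P' = prime_fraction A P' a f"
    using \<alpha> P unfolding sec_carrier by meson
  obtain g where g: "g \<in> carrier A" "P \<in> basic g" "basic g \<subseteq> N"
    using basic_nbhd N by metis
  \<comment> \<open>Multiplying numerator and denominator by \<open>g\<close> lets the denominator
    itself define the neighbourhood.\<close>
  show thesis
  proof (rule that[of "a \<otimes> g" "f \<otimes> g"])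
    show "P \<in> basic (f \<otimes> g)" using g af N by (auto simp: basic_mult mem_basic)
    show "basic (f \<otimes> g) \<subseteq> V" using g af N by (auto simp: basic_mult)
    fix P' assume P': "P' \<in> basic (f \<otimes> g)"
    interpret mult_set A "carrier A - P'" using ms P' by blast
    show "\<alpha> P' = prime_fraction A P' (a \<otimes> g) (f \<otimes> g)"
      using P' g af by (subst fraction_cancel) (auto simp: basic_mult, auto simp: mem_basic)
  qed (use af g in auto)
qed

lemma section_value:
  assumes "opn V" "\<alpha> \<in> carrier (sec (Spec A) V)" "P \<in> V"
  shows "\<alpha> P \<in> carrier (localisation_at A P)"
  using assms by (auto simp: sec_carrier)

lemma sec_mult: "\<alpha> \<otimes>\<^bsub>sec (Spec A) V\<^esub> \<beta> = (\<lambda>P\<in>V. \<alpha> P \<otimes>\<^bsub>localisation_at A P\<^esub> \<beta> P)"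
  and sec_add: "\<alpha> \<oplus>\<^bsub>sec (Spec A) V\<^esub> \<beta> = (\<lambda>P\<in>V. \<alpha> P \<oplus>\<^bsub>localisation_at A P\<^esub> \<beta> P)"
  and sec_one: "\<one>\<^bsub>sec (Spec A) V\<^esub> = (\<lambda>P\<in>V. \<one>\<^bsub>localisation_at A P\<^esub>)"
  and sec_zero: "\<zero>\<^bsub>sec (Spec A) V\<^esub> = (\<lambda>P\<in>V. \<zero>\<^bsub>localisation_at A P\<^esub>)"
  and res_Spec: "res (Spec A) V W \<alpha> = restrict \<alpha> W"
  by (simp_all add: Spec_def space_of_local_families_def)

lemma section_constI:
  assumes "opn V" "a \<in> carrier A" "g \<in> carrier A" "V \<subseteq> basic g"
  shows "(\<lambda>P\<in>V. prime_fraction A P a g) \<in> carrier (sec (Spec A) V)"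
  unfolding sec_carrier
proof (intro conjI ballI PiE_I)
  fix P assume P: "P \<in> V"
  interpret mult_set A "carrier A - P" using ms P assms by blast
  show "(\<lambda>P\<in>V. prime_fraction A P a g) P \<in> carrier (localisation_at A P)"
    using assms P fraction_in_carrier by (auto simp: mem_basic)
  show "\<exists>N. opn N \<and> P \<in> N \<and> N \<subseteq> V \<and> (\<exists>a'\<in>carrier A. \<exists>f\<in>carrier A. \<forall>P\<in>N. f \<notin> P \<and>
      (\<lambda>P\<in>V. prime_fraction A P a g) P = prime_fraction A P a' f)"
  proof (rule exI[of _ V], intro conjI, rule assms(1), rule P, rule subset_refl,
      rule bexI[of _ a], rule bexI[of _ g], rule ballI)
    fix P' assume P': "P' \<in> V"
    then show "g \<notin> P' \<and> (\<lambda>P\<in>V. prime_fraction A P a g) P' = prime_fraction A P' a g"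
      using assms(4) by (auto simp: mem_basic)
  qed (use assms in auto)
qed auto

text \<open>Covers addition and multiplication: the result is again locally a fraction, with
  denominator \<open>g \<otimes> h\<close> and a numerator \<open>num a g b h\<close> that does not
  depend on the prime.\<close>

lemma sec_closed_binary:
  assumes V: "opn V" and \<alpha>: "\<alpha> \<in> carrier (sec (Spec A) V)" and \<beta>: "\<beta> \<in> carrier (sec (Spec A) V)"
    and op: "\<And>a b g h. a \<in> carrier A \<Longrightarrow> b \<in> carrier A \<Longrightarrow> g \<in> carrier A \<Longrightarrow> h \<in> carrier A \<Longrightarrow> num a g b h \<in> carrier A \<and>
      (\<forall>P. primeideal P A \<longrightarrow> g \<notin> P \<longrightarrow> h \<notin> P \<longrightarrow>
        op P (prime_fraction A P a g) (prime_fraction A P b h) = prime_fraction A P (num a g b h) (g \<otimes> h))"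
  shows "(\<lambda>P\<in>V. op P (\<alpha> P) (\<beta> P)) \<in> carrier (sec (Spec A) V)"
proof (rule sectionI)
  fix P assume P: "P \<in> V"
  obtain a g where g: "a \<in> carrier A" "g \<in> carrier A" "P \<in> basic g" "basic g \<subseteq> V"
    "\<And>P'. P' \<in> basic g \<Longrightarrow> \<alpha> P' = prime_fraction A P' a g" using sectionE[OF V \<alpha> P] by metis
  obtain b h where h: "b \<in> carrier A" "h \<in> carrier A" "P \<in> basic h" "basic h \<subseteq> V"
    "\<And>P'. P' \<in> basic h \<Longrightarrow> \<beta> P' = prime_fraction A P' b h" using sectionE[OF V \<beta> P] by metis
  have o: "num a g b h \<in> carrier A" "\<And>P. primeideal P A \<Longrightarrow> g \<notin> P \<Longrightarrow> h \<notin> P \<Longrightarrow>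
        op P (prime_fraction A P a g) (prime_fraction A P b h) = prime_fraction A P (num a g b h) (g \<otimes> h)"
    using op g(1,2) h(1,2) by blast+
  show "\<exists>a\<in>carrier A. \<exists>g\<in>carrier A. P \<in> basic g \<and> basic g \<subseteq> V \<and>
      (\<forall>P'\<in>basic g. (\<lambda>P\<in>V. op P (\<alpha> P) (\<beta> P)) P' = prime_fraction A P' a g)"
  proof (rule bexI[of _ "num a g b h"], rule bexI[of _ "g \<otimes> h"], intro conjI ballI)
    fix P' assume "P' \<in> basic (g \<otimes> h)"
    then have P': "P' \<in> basic g" "P' \<in> basic h" using g h by (auto simp: basic_mult)
    then have "P' \<in> V" using g by blast
    then show "(\<lambda>P\<in>V. op P (\<alpha> P) (\<beta> P)) P' = prime_fraction A P' (num a g b h) (g \<otimes> h)"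
      using g(5)[OF P'(1)] h(5)[OF P'(2)] o(2)[of P'] P' by (simp add: mem_basic)
  qed (use g h o in \<open>auto simp: basic_mult\<close>)
qed auto

lemma sec_mult_closed:
  assumes "opn V" "\<alpha> \<in> carrier (sec (Spec A) V)" "\<beta> \<in> carrier (sec (Spec A) V)"
  shows "\<alpha> \<otimes>\<^bsub>sec (Spec A) V\<^esub> \<beta> \<in> carrier (sec (Spec A) V)"
  unfolding sec_mult
proof (rule sec_closed_binary[OF assms, of "\<lambda>a g b h. a \<otimes> b"], intro conjI allI impI)
  fix a b g h P assume "a \<in> carrier A" "b \<in> carrier A" "g \<in> carrier A" "h \<in> carrier A"
    "primeideal P A" "g \<notin> P" "h \<notin> P"
  then show "prime_fraction A P a g \<otimes>\<^bsub>localisation_at A P\<^esub> prime_fraction A P b h =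
      prime_fraction A P (a \<otimes> b) (g \<otimes> h)"
    by (intro mult_set.fraction_mult mult_set_primeideal) auto
qed auto

lemma sec_add_closed:
  assumes "opn V" "\<alpha> \<in> carrier (sec (Spec A) V)" "\<beta> \<in> carrier (sec (Spec A) V)"
  shows "\<alpha> \<oplus>\<^bsub>sec (Spec A) V\<^esub> \<beta> \<in> carrier (sec (Spec A) V)"
  unfolding sec_add
proof (rule sec_closed_binary[OF assms, of "\<lambda>a g b h. a \<otimes> h \<oplus> b \<otimes> g"], intro conjI allI impI)
  fix a b g h P assume "a \<in> carrier A" "b \<in> carrier A" "g \<in> carrier A" "h \<in> carrier A"
    "primeideal P A" "g \<notin> P" "h \<notin> P"
  then show "prime_fraction A P a g \<oplus>\<^bsub>localisation_at A P\<^esub> prime_fraction A P b h =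
      prime_fraction A P (a \<otimes> h \<oplus> b \<otimes> g) (g \<otimes> h)"
    by (intro mult_set.fraction_add mult_set_primeideal) auto
qed auto

lemma loc_cring: "opn V \<Longrightarrow> P \<in> V \<Longrightarrow> cring (localisation_at A P)"
  using opn_prime mult_set_primeideal mult_set.localisation_cring by blast

lemma sec_uminus:
  assumes V: "opn V" and \<alpha>: "\<alpha> \<in> carrier (sec (Spec A) V)"
  shows "(\<lambda>P\<in>V. \<ominus>\<^bsub>localisation_at A P\<^esub> \<alpha> P) \<in> carrier (sec (Spec A) V)"
proof (rule sectionI)
  fix P assume P: "P \<in> V"
  obtain a g where g: "a \<in> carrier A" "g \<in> carrier A" "P \<in> basic g" "basic g \<subseteq> V"
    "\<And>P'. P' \<in> basic g \<Longrightarrow> \<alpha> P' = prime_fraction A P' a g" using sectionE[OF V \<alpha> P] by metis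
  show "\<exists>a\<in>carrier A. \<exists>g\<in>carrier A. P \<in> basic g \<and> basic g \<subseteq> V \<and>
      (\<forall>P'\<in>basic g. (\<lambda>P\<in>V. \<ominus>\<^bsub>localisation_at A P\<^esub> \<alpha> P) P' = prime_fraction A P' a g)"
  proof (rule bexI[of _ "\<ominus> a"], rule bexI[of _ g], intro conjI ballI)
    fix P' assume P': "P' \<in> basic g"
    interpret mult_set A "carrier A - P'" using ms P' by blast
    show "(\<lambda>P\<in>V. \<ominus>\<^bsub>localisation_at A P\<^esub> \<alpha> P) P' = prime_fraction A P' (\<ominus> a) g"
      using P' g fraction_uminus[of a g] by (auto simp: mem_basic)
  qed (use g in auto)
qed auto

lemma sec_one_closed: "opn V \<Longrightarrow> \<one>\<^bsub>sec (Spec A) V\<^esub> \<in> carrier (sec (Spec A) V)"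
  and sec_zero_closed: "opn V \<Longrightarrow> \<zero>\<^bsub>sec (Spec A) V\<^esub> \<in> carrier (sec (Spec A) V)"
proof -
  assume V: "opn V"
  then have b: "V \<subseteq> basic \<one>" using openin_subset[OF V] basic_one points_Spec by auto
  have "\<one>\<^bsub>sec (Spec A) V\<^esub> = (\<lambda>P\<in>V. prime_fraction A P \<one> \<one>)"
    "\<zero>\<^bsub>sec (Spec A) V\<^esub> = (\<lambda>P\<in>V. prime_fraction A P \<zero> \<one>)"
    by (simp_all add: sec_one sec_zero localisation_def)
  then show "\<one>\<^bsub>sec (Spec A) V\<^esub> \<in> carrier (sec (Spec A) V)" "\<zero>\<^bsub>sec (Spec A) V\<^esub> \<in> carrier (sec (Spec A) V)"
    using section_constI[OF V _ _ b] by auto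
qed

lemma sec_cring:
  assumes V: "opn V"
  shows "cring (sec (Spec A) V)"
proof (rule cringI)
  let ?S = "sec (Spec A) V"
  note ext = section_ext and val = section_value[OF V] and L = loc_cring[OF V]
  note ring = L[THEN cring.axioms(1)]
  show "abelian_group ?S"
  proof (rule abelian_groupI)
    fix x y z assume c: "x \<in> carrier ?S" "y \<in> carrier ?S" "z \<in> carrier ?S"
    show "x \<oplus>\<^bsub>?S\<^esub> y \<oplus>\<^bsub>?S\<^esub> z = x \<oplus>\<^bsub>?S\<^esub> (y \<oplus>\<^bsub>?S\<^esub> z)"
      unfolding sec_add using c val
      by (intro restrict_ext) (simp add: ring.ring_simprules(7)[OF ring])
  next
    fix x y assume c: "x \<in> carrier ?S" "y \<in> carrier ?S"
    show "x \<oplus>\<^bsub>?S\<^esub> y = y \<oplus>\<^bsub>?S\<^esub> x"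
      unfolding sec_add using c val
      by (intro restrict_ext) (simp add: ring.ring_simprules(10)[OF ring])
  next
    fix x assume c: "x \<in> carrier ?S"
    show "\<zero>\<^bsub>?S\<^esub> \<oplus>\<^bsub>?S\<^esub> x = x"
    proof (rule extensionalityI)
      show "x \<in> extensional V" using c ext by blast
    next
      fix P assume "P \<in> V"
      then show "(\<zero>\<^bsub>?S\<^esub> \<oplus>\<^bsub>?S\<^esub> x) P = x P"
        using c val by (simp add: sec_add sec_zero ring.ring_simprules(8)[OF ring])
    qed (simp add: sec_add)
    have "(\<lambda>P\<in>V. \<ominus>\<^bsub>localisation_at A P\<^esub> x P) \<oplus>\<^bsub>?S\<^esub> x = \<zero>\<^bsub>?S\<^esub>"
      unfolding sec_add sec_zero using c val
      by (intro restrict_ext) (simp add: ring.ring_simprules(9)[OF ring])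
    then show "\<exists>y\<in>carrier ?S. y \<oplus>\<^bsub>?S\<^esub> x = \<zero>\<^bsub>?S\<^esub>" using sec_uminus[OF V c] by blast
  qed (use V in \<open>auto intro: sec_add_closed sec_zero_closed\<close>)
  show "comm_monoid ?S"
  proof (rule comm_monoidI)
    fix x y z assume c: "x \<in> carrier ?S" "y \<in> carrier ?S" "z \<in> carrier ?S"
    show "x \<otimes>\<^bsub>?S\<^esub> y \<otimes>\<^bsub>?S\<^esub> z = x \<otimes>\<^bsub>?S\<^esub> (y \<otimes>\<^bsub>?S\<^esub> z)"
      unfolding sec_mult using c val
      by (intro restrict_ext) (simp add: ring.ring_simprules(11)[OF ring])
  next
    fix x y assume c: "x \<in> carrier ?S" "y \<in> carrier ?S"
    show "x \<otimes>\<^bsub>?S\<^esub> y = y \<otimes>\<^bsub>?S\<^esub> x"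
      unfolding sec_mult using c val
      by (intro restrict_ext) (simp add: cring.cring_simprules(14)[OF L])
  next
    fix x assume c: "x \<in> carrier ?S"
    show "\<one>\<^bsub>?S\<^esub> \<otimes>\<^bsub>?S\<^esub> x = x"
    proof (rule extensionalityI)
      show "x \<in> extensional V" using c ext by blast
    next
      fix P assume "P \<in> V"
      then show "(\<one>\<^bsub>?S\<^esub> \<otimes>\<^bsub>?S\<^esub> x) P = x P"
        using c val by (simp add: sec_mult sec_one ring.ring_simprules(12)[OF ring])
    qed (simp add: sec_mult)
  qed (use V in \<open>auto intro: sec_mult_closed sec_one_closed\<close>)
  fix x y z assume c: "x \<in> carrier ?S" "y \<in> carrier ?S" "z \<in> carrier ?S"
  show "(x \<oplus>\<^bsub>?S\<^esub> y) \<otimes>\<^bsub>?S\<^esub> z = x \<otimes>\<^bsub>?S\<^esub> z \<oplus>\<^bsub>?S\<^esub> y \<otimes>\<^bsub>?S\<^esub> z"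
    unfolding sec_mult sec_add using c val
    by (intro restrict_ext) (simp add: ring.ring_simprules(13)[OF ring])
qed

lemma section_restrict:
  assumes V: "opn V" and W: "opn W" "W \<subseteq> V" and \<alpha>: "\<alpha> \<in> carrier (sec (Spec A) V)"
  shows "restrict \<alpha> W \<in> carrier (sec (Spec A) W)"
proof (rule sectionI)
  fix P assume P: "P \<in> W"
  then have "P \<in> V" using W by blast
  then obtain a g where g: "a \<in> carrier A" "g \<in> carrier A" "P \<in> basic g" "basic g \<subseteq> V"
    "\<And>P'. P' \<in> basic g \<Longrightarrow> \<alpha> P' = prime_fraction A P' a g" using sectionE[OF V \<alpha>] by metis
  obtain h where h: "h \<in> carrier A" "P \<in> basic h" "basic h \<subseteq> W" using basic_nbhd[OF W(1) P] by metis
  show "\<exists>a\<in>carrier A. \<exists>g\<in>carrier A. P \<in> basic g \<and> basic g \<subseteq> W \<and>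
      (\<forall>P'\<in>basic g. restrict \<alpha> W P' = prime_fraction A P' a g)"
  proof (rule bexI[of _ "a \<otimes> h"], rule bexI[of _ "g \<otimes> h"], intro conjI ballI)
    fix P' assume "P' \<in> basic (g \<otimes> h)"
    then have P': "P' \<in> basic g" "P' \<in> basic h" using g h by (auto simp: basic_mult)
    interpret mult_set A "carrier A - P'" using ms P' by blast
    have "prime_fraction A P' (a \<otimes> h) (g \<otimes> h) = prime_fraction A P' a g"
      using g h P' by (intro fraction_cancel) (auto simp: mem_basic)
    then show "restrict \<alpha> W P' = prime_fraction A P' (a \<otimes> h) (g \<otimes> h)"
      using g(5)[OF P'(1)] P' h by auto
  qed (use g h in \<open>auto simp: basic_mult\<close>)
qed auto

sublocale Sp: presheaf_space "Spec A"
proof (rule presheaf_space.intro)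
  fix V assume V: "opn V"
  show "cring (sec (Spec A) V)" by (rule sec_cring[OF V])
  show "res (Spec A) V V s = s" if "s \<in> carrier (sec (Spec A) V)" for s
    using section_ext[OF that] by (simp add: res_Spec extensional_restrict)
  fix W assume W: "opn W" "W \<subseteq> V"
  show "res (Spec A) V W \<in> ring_hom (sec (Spec A) V) (sec (Spec A) W)"
  proof (rule ring_hom_memI)
    fix x y assume "x \<in> carrier (sec (Spec A) V)" "y \<in> carrier (sec (Spec A) V)"
    show "res (Spec A) V W (x \<otimes>\<^bsub>sec (Spec A) V\<^esub> y) =
        res (Spec A) V W x \<otimes>\<^bsub>sec (Spec A) W\<^esub> res (Spec A) V W y"
      "res (Spec A) V W (x \<oplus>\<^bsub>sec (Spec A) V\<^esub> y) =
        res (Spec A) V W x \<oplus>\<^bsub>sec (Spec A) W\<^esub> res (Spec A) V W y"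
      using W(2) by (auto simp: sec_mult sec_add res_Spec restrict_def fun_eq_iff)
  qed (use V W section_restrict in \<open>auto simp: sec_one res_Spec restrict_def fun_eq_iff\<close>)
  fix N s assume "opn N" "N \<subseteq> W" "s \<in> carrier (sec (Spec A) V)"
  then show "res (Spec A) W N (res (Spec A) V W s) = res (Spec A) V N s"
    using W by (auto simp: res_Spec restrict_def fun_eq_iff)
qed

lemma unit_at_iff:
  assumes V: "opn V" "P \<in> V" and \<alpha>: "\<alpha> \<in> carrier (sec (Spec A) V)"
    and a: "a \<in> carrier A" "g \<in> carrier A" "g \<notin> P" "\<alpha> P = prime_fraction A P a g"
  shows "Sp.unit_at P V \<alpha> \<longleftrightarrow> a \<notin> P"
proof -
  have P: "primeideal P A" using opn_prime V by blast
  interpret mult_set A "carrier A - P" using mult_set_primeideal[OF P] .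
  note pm = prime_mem_mult_iff[OF P]
  show ?thesis
  proof
    assume "Sp.unit_at P V \<alpha>"
    then obtain N \<beta> where N: "opn N" "P \<in> N" "N \<subseteq> V" "\<beta> \<in> carrier (sec (Spec A) N)"
      "restrict \<alpha> N \<otimes>\<^bsub>sec (Spec A) N\<^esub> \<beta> = \<one>\<^bsub>sec (Spec A) N\<^esub>"
      by (auto simp: Sp.unit_at_def res_Spec)
    have "(restrict \<alpha> N \<otimes>\<^bsub>sec (Spec A) N\<^esub> \<beta>) P = \<one>\<^bsub>sec (Spec A) N\<^esub> P" using N by simp
    then have e: "\<alpha> P \<otimes>\<^bsub>localisation_at A P\<^esub> \<beta> P = prime_fraction A P \<one> \<one>"
      using N by (simp add: sec_mult sec_one localisation_one)
    obtain b h where b: "b \<in> carrier A" "h \<in> carrier A - P" "\<beta> P = prime_fraction A P b h"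
      using section_value[OF N(1,4,2)] localisation_carrierE by metis
    have "prime_fraction A P (a \<otimes> b) (g \<otimes> h) = prime_fraction A P \<one> \<one>"
      using e b a by (simp add: fraction_mult)
    then obtain u where u: "u \<in> carrier A - P" "u \<otimes> ((a \<otimes> b) \<otimes> \<one>) = u \<otimes> (\<one> \<otimes> (g \<otimes> h))"
      using fraction_eqD[of "a \<otimes> b" "g \<otimes> h" \<one> \<one>] a b one_mem pm by auto
    have e2: "u \<otimes> (a \<otimes> b) = u \<otimes> (g \<otimes> h)" using u a b by simp
    have "u \<otimes> (g \<otimes> h) \<notin> P" using u(1) a b pm by simp
    then have "u \<otimes> (a \<otimes> b) \<notin> P" by (simp only: e2 not_False_eq_True)
    then show "a \<notin> P" using u(1) a b pm[of u "a \<otimes> b"] pm[of a b] by blast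
  next
    \<comment> \<open>The fraction \<open>a / g\<close> describes \<open>\<alpha>\<close> at
      \<open>P\<close> only. An inverse needs a fraction \<open>a' / g'\<close> valid on a
      neighbourhood; its numerator lies outside \<open>P\<close> as well, and \<open>g' / a'\<close>
      is the inverse on \<open>basic (a' \<otimes> g')\<close>.\<close>
    assume aP: "a \<notin> P"
    obtain a' g' where g': "a' \<in> carrier A" "g' \<in> carrier A" "P \<in> basic g'" "basic g' \<subseteq> V"
      "\<And>P'. P' \<in> basic g' \<Longrightarrow> \<alpha> P' = prime_fraction A P' a' g'"
      using sectionE[OF V(1) \<alpha> V(2)] by metis
    have gP: "g' \<notin> P" using g' by (simp add: mem_basic)
    have "prime_fraction A P a g = prime_fraction A P a' g'" using g' a by simp
    then obtain u where u: "u \<in> carrier A - P" "u \<otimes> (a \<otimes> g') = u \<otimes> (a' \<otimes> g)"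
      using fraction_eqD[of a g a' g'] a g' gP by auto
    have "u \<otimes> (a \<otimes> g') \<notin> P" using u(1) a g' gP aP pm by simp
    then have "u \<otimes> (a' \<otimes> g) \<notin> P" by (simp only: u(2) not_False_eq_True)
    then have a'P: "a' \<notin> P" using u(1) a g' pm[of u "a' \<otimes> g"] pm[of a' g] by blast
    let ?N = "basic (a' \<otimes> g')"
    have bN: "?N = basic a' \<inter> basic g'" using g' by (simp add: basic_mult)
    have N: "opn ?N" "P \<in> ?N" "?N \<subseteq> V" using g' opn_basic a'P P bN by (auto simp: mem_basic)
    have t: "(\<lambda>P\<in>?N. prime_fraction A P g' a') \<in> carrier (sec (Spec A) ?N)"
      using N(1) g' bN by (intro section_constI) auto
    have "restrict \<alpha> ?N \<otimes>\<^bsub>sec (Spec A) ?N\<^esub> (\<lambda>P\<in>?N. prime_fraction A P g' a') = \<one>\<^bsub>sec (Spec A) ?N\<^esub>"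
      unfolding sec_mult sec_one
    proof (rule restrict_ext)
      fix P' assume P': "P' \<in> ?N"
      interpret P': mult_set A "carrier A - P'" using ms P' by blast
      have m: "a' \<in> carrier A - P'" "g' \<in> carrier A - P'" using P' g' bN by (auto simp: mem_basic)
      show "restrict \<alpha> ?N P' \<otimes>\<^bsub>localisation_at A P'\<^esub> (\<lambda>P\<in>?N. prime_fraction A P g' a') P' =
          \<one>\<^bsub>localisation_at A P'\<^esub>"
        using P' g'(5)[of P'] g' bN m P'.fraction_self_one[OF P'.mult_mem[OF m]]
        by (simp add: P'.fraction_mult m_comm)
    qed
    then show "Sp.unit_at P V \<alpha>"
      unfolding Sp.unit_at_def res_Spec using N t by blast
  qed
qed

text \<open>A germ with value \<open>a / g\<close> at \<open>P\<close> is a nonunit exactly if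
  \<open>a\<close> lies in \<open>P\<close>, and the numerator of a sum of two such fractions lies
  in \<open>P\<close> again.\<close>

lemma stalk_local_ring:
  assumes P: "P \<in> points (Spec A)"
  shows "local_ring (stalk (Spec A) P)"
proof (rule local_ringI)
  have pP: "primeideal P A" using P points_Spec by (auto simp: prime_spectrum_def)
  interpret mult_set A "carrier A - P" using mult_set_primeideal[OF pP] .
  have top: "opn (points (Spec A))" by simp
  have uz: "Sp.unit_at P V \<alpha> \<longleftrightarrow> a \<notin> P" if "opn V" "P \<in> V" "\<alpha> \<in> carrier (sec (Spec A) V)"
    "a \<in> carrier A" "g \<in> carrier A - P" "\<alpha> P = prime_fraction A P a g" for V \<alpha> a g
    using unit_at_iff that by auto
  show "cring (stalk (Spec A) P)" by (rule Sp.stalk_cring[OF P])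
  show "\<one>\<^bsub>stalk (Spec A) P\<^esub> \<noteq> \<zero>\<^bsub>stalk (Spec A) P\<^esub>"
  proof
    interpret S: cring "stalk (Spec A) P" by (rule Sp.stalk_cring[OF P])
    assume "\<one>\<^bsub>stalk (Spec A) P\<^esub> = \<zero>\<^bsub>stalk (Spec A) P\<^esub>"
    then have "germ (Spec A) P (points (Spec A)) \<zero>\<^bsub>sec (Spec A) (points (Spec A))\<^esub> \<in> Units (stalk (Spec A) P)"
      using Sp.germ_zero[OF top P] S.Units_one_closed by simp
    then have "Sp.unit_at P (points (Spec A)) \<zero>\<^bsub>sec (Spec A) (points (Spec A))\<^esub>"
      using Sp.germ_Units_iff[OF top P sec_zero_closed[OF top]] by simp
    moreover have "\<zero>\<^bsub>sec (Spec A) (points (Spec A))\<^esub> P = prime_fraction A P \<zero> \<one>"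
      using P by (simp add: sec_zero localisation_zero)
    ultimately have "\<zero> \<notin> P" using uz[OF top P sec_zero_closed[OF top] _ one_mem] by auto
    then show False
      using additive_subgroup.zero_closed[OF ideal.axioms(1)[OF primeideal.axioms(1)[OF pP]]] by blast
  qed
  fix x y assume xy: "x \<in> carrier (stalk (Spec A) P)" "y \<in> carrier (stalk (Spec A) P)"
    "x \<notin> Units (stalk (Spec A) P)" "y \<notin> Units (stalk (Spec A) P)"
  obtain V s t where V: "opn V" "P \<in> V" "s \<in> carrier (sec (Spec A) V)" "t \<in> carrier (sec (Spec A) V)"
    and x: "x = germ (Spec A) P V s" "y = germ (Spec A) P V t"
    using xy(1,2) by (rule Sp.stalkE2)
  obtain a g where a: "a \<in> carrier A" "g \<in> carrier A - P" "s P = prime_fraction A P a g"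
    using section_value[OF V(1,3,2)] localisation_carrierE by metis
  obtain b h where b: "b \<in> carrier A" "h \<in> carrier A - P" "t P = prime_fraction A P b h"
    using section_value[OF V(1,4,2)] localisation_carrierE by metis
  have st: "s \<oplus>\<^bsub>sec (Spec A) V\<^esub> t \<in> carrier (sec (Spec A) V)" using V sec_add_closed by blast
  have "a \<in> P" "b \<in> P"
    using xy(3,4) uz[OF V(1,2,3) a] uz[OF V(1,2,4) b] Sp.germ_Units_iff V x by auto
  then have "a \<otimes> h \<oplus> b \<otimes> g \<in> P"
    using a b primeideal.axioms(1)[OF pP]
    by (intro additive_subgroup.a_closed[OF ideal.axioms(1)] ideal.I_r_closed) auto
  moreover have "(s \<oplus>\<^bsub>sec (Spec A) V\<^esub> t) P = prime_fraction A P (a \<otimes> h \<oplus> b \<otimes> g) (g \<otimes> h)"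
    using V a b by (simp add: sec_add fraction_add)
  ultimately have "\<not> Sp.unit_at P V (s \<oplus>\<^bsub>sec (Spec A) V\<^esub> t)"
    using uz[OF V(1,2) st _ mult_mem[OF a(2) b(2)]] a b by auto
  then show "x \<oplus>\<^bsub>stalk (Spec A) P\<^esub> y \<notin> Units (stalk (Spec A) P)"
    using V st x by (simp add: Sp.germ_add Sp.germ_Units_iff)
qed

lemma local_space_Spec: "local_space (Spec A)"
  unfolding local_space_def using stalk_local_ring Sp.presheaf_space_axioms by blast

end

lemma affineI: "cring A \<Longrightarrow> affine A"
  by (simp add: affine_def)

lemma (in affine) section_local:
  assumes "opn V" "\<alpha> \<in> carrier (sec (Spec A) V)" "P \<in> V"
  shows "\<exists>a\<in>carrier A. \<exists>g\<in>carrier A. P \<in> basic g \<and> basic g \<subseteq> V \<and>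
    (\<forall>P'\<in>basic g. \<alpha> P' = prime_fraction A P' a g)"
  using sectionE[OF assms] by metis

subsection \<open>Morphisms induced by ring homomorphisms\<close>

locale affine_hom = A: affine A + B: affine B for A :: "'a ring" and B :: "'b ring" +
  fixes h :: "'a \<Rightarrow> 'b"
  assumes h: "h \<in> ring_hom A B"
begin

abbreviation contraction :: "'b set \<Rightarrow> 'a set" where
  "contraction Q \<equiv> {a \<in> carrier A. h a \<in> Q}"

lemma primeideal_contraction: "primeideal Q B \<Longrightarrow> primeideal (contraction Q) A"
proof -
  assume Q: "primeideal Q B"
  interpret ring_hom_ring A B h
    using ring_hom_ringI2[OF A.ring_axioms B.ring_axioms h] .
  show ?thesis by (rule primeideal_vimage[OF A.is_cring Q])
qed

lemma h_closed: "a \<in> carrier A \<Longrightarrow> h a \<in> carrier B"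
  using ring_hom_memE(1)[OF h] .

lemma pt_Spec_map: "pt (Spec_map A B h) Q = contraction Q"
  by (simp add: Spec_map_def)

lemma preim_Spec_map:
  "preim (Spec B) (Spec_map A B h) V = {Q \<in> prime_spectrum B. contraction Q \<in> V}"
  by (simp add: preim_def B.points_Spec pt_Spec_map)

lemma fraction_map_prime:
  assumes Q: "primeideal Q B" and a: "a \<in> carrier A" "g \<in> carrier A" "h g \<notin> Q"
  shows "fraction_map B (carrier B - Q) h (prime_fraction A (contraction Q) a g) =
    prime_fraction B Q (h a) (h g)"
  using mult_set_primeideal[OF Q] mult_set_primeideal[OF primeideal_contraction[OF Q]] a h_closed h
  by (intro fraction_map_fraction) auto

lemma fraction_map_hom:
  assumes Q: "primeideal Q B"
  shows "fraction_map B (carrier B - Q) h \<in>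
    ring_hom (localisation_at A (contraction Q)) (localisation_at B Q)"
proof -
  interpret MA: mult_set A "carrier A - contraction Q"
    using mult_set_primeideal[OF primeideal_contraction[OF Q]] .
  interpret MB: mult_set B "carrier B - Q" using mult_set_primeideal[OF Q] .
  note hom = ring_hom_memE[OF h]
  note fm = fraction_map_prime[OF Q]
  show ?thesis
  proof (rule ring_hom_memI)
    fix x assume "x \<in> carrier (localisation_at A (contraction Q))"
    then obtain a g where "a \<in> carrier A" "g \<in> carrier A - contraction Q"
      "x = prime_fraction A (contraction Q) a g" by (rule MA.localisation_carrierE)
    then show "fraction_map B (carrier B - Q) h x \<in> carrier (localisation_at B Q)"
      using fm[of a g] h_closed by (auto intro!: MB.fraction_in_carrier)
  next
    fix x y assume x: "x \<in> carrier (localisation_at A (contraction Q))"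
      and y: "y \<in> carrier (localisation_at A (contraction Q))"
    obtain a g where a: "a \<in> carrier A" "g \<in> carrier A - contraction Q"
      "x = prime_fraction A (contraction Q) a g" using x by (rule MA.localisation_carrierE)
    obtain b k where b: "b \<in> carrier A" "k \<in> carrier A - contraction Q"
      "y = prime_fraction A (contraction Q) b k" using y by (rule MA.localisation_carrierE)
    have m: "g \<otimes>\<^bsub>A\<^esub> k \<in> carrier A - contraction Q" using MA.mult_mem a b by blast
    have hg: "h g \<in> carrier B - Q" "h k \<in> carrier B - Q" "h (g \<otimes>\<^bsub>A\<^esub> k) \<notin> Q"
      using a b m h_closed by auto
    have fx: "fraction_map B (carrier B - Q) h x = prime_fraction B Q (h a) (h g)"
      "fraction_map B (carrier B - Q) h y = prime_fraction B Q (h b) (h k)"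
      using fm a b hg by auto
    show "fraction_map B (carrier B - Q) h (x \<otimes>\<^bsub>localisation_at A (contraction Q)\<^esub> y) =
        fraction_map B (carrier B - Q) h x \<otimes>\<^bsub>localisation_at B Q\<^esub> fraction_map B (carrier B - Q) h y"
    proof -
      have "x \<otimes>\<^bsub>localisation_at A (contraction Q)\<^esub> y =
          prime_fraction A (contraction Q) (a \<otimes>\<^bsub>A\<^esub> b) (g \<otimes>\<^bsub>A\<^esub> k)"
        unfolding a(3) b(3) using a b by (intro MA.fraction_mult) auto
      then show ?thesis
        using fm[of "a \<otimes>\<^bsub>A\<^esub> b" "g \<otimes>\<^bsub>A\<^esub> k"] a b hg h_closed unfolding fx
        by (simp add: hom(2) MB.fraction_mult)
    qed
    show "fraction_map B (carrier B - Q) h (x \<oplus>\<^bsub>localisation_at A (contraction Q)\<^esub> y) =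
        fraction_map B (carrier B - Q) h x \<oplus>\<^bsub>localisation_at B Q\<^esub> fraction_map B (carrier B - Q) h y"
    proof -
      have "x \<oplus>\<^bsub>localisation_at A (contraction Q)\<^esub> y =
          prime_fraction A (contraction Q) (a \<otimes>\<^bsub>A\<^esub> k \<oplus>\<^bsub>A\<^esub> b \<otimes>\<^bsub>A\<^esub> g) (g \<otimes>\<^bsub>A\<^esub> k)"
        unfolding a(3) b(3) using a b by (intro MA.fraction_add) auto
      then show ?thesis
        using fm[of "a \<otimes>\<^bsub>A\<^esub> k \<oplus>\<^bsub>A\<^esub> b \<otimes>\<^bsub>A\<^esub> g" "g \<otimes>\<^bsub>A\<^esub> k"] a b hg h_closed unfolding fx
        by (simp add: hom(2,3) MB.fraction_add)
    qed
  next
    show "fraction_map B (carrier B - Q) h \<one>\<^bsub>localisation_at A (contraction Q)\<^esub> = \<one>\<^bsub>localisation_at B Q\<^esub>"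
      using fm[of "\<one>\<^bsub>A\<^esub>" "\<one>\<^bsub>A\<^esub>"] hom(4) MB.one_mem by (simp add: MA.localisation_one MB.localisation_one)
  qed
qed

lemma pull_Spec_map:
  assumes "Q \<in> preim (Spec B) (Spec_map A B h) V"
  shows "pull (Spec_map A B h) V \<alpha> Q = fraction_map B (carrier B - Q) h (\<alpha> (contraction Q))"
  using assms unfolding preim_Spec_map by (simp add: Spec_map_def)

lemma pull_Spec_map_eq:
  "pull (Spec_map A B h) V \<alpha> = (\<lambda>Q\<in>preim (Spec B) (Spec_map A B h) V.
     fraction_map B (carrier B - Q) h (\<alpha> (contraction Q)))"
  unfolding preim_Spec_map by (simp add: Spec_map_def)

lemma contraction_basic: "primeideal Q B \<Longrightarrow> g \<in> carrier A \<Longrightarrow> contraction Q \<in> A.basic g \<longleftrightarrow> Q \<in> B.basic (h g)"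
  using primeideal_contraction by (auto simp: A.mem_basic B.mem_basic)

lemma Spec_map_continuous: "continuous_map (topo (Spec B)) (topo (Spec A)) (pt (Spec_map A B h))"
  unfolding A.topo_Spec
proof (rule continuous_on_generated_topo)
  fix U assume "U \<in> {A.basic f |f. f \<in> carrier A}"
  then obtain f where f: "f \<in> carrier A" "U = A.basic f" by blast
  have "pt (Spec_map A B h) -` U \<inter> points (Spec B) = B.basic (h f)"
    using contraction_basic[OF _ f(1)]
    by (auto simp: pt_Spec_map f(2) B.points_Spec prime_spectrum_def B.mem_basic)
  then show "B.opn (pt (Spec_map A B h) -` U \<inter> points (Spec B))"
    using B.opn_basic h_closed f by simp
next
  show "pt (Spec_map A B h) ` points (Spec B) \<subseteq> \<Union>{A.basic f |f. f \<in> carrier A}"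
  proof
    fix P assume "P \<in> pt (Spec_map A B h) ` points (Spec B)"
    then obtain Q where "primeideal Q B" "P = contraction Q"
      by (auto simp: pt_Spec_map B.points_Spec prime_spectrum_def)
    then have "P \<in> A.basic \<one>\<^bsub>A\<^esub>"
      using primeideal_contraction by (simp add: A.basic_one prime_spectrum_def)
    then show "P \<in> \<Union>{A.basic f |f. f \<in> carrier A}" by blast
  qed
qed

lemma Spec_map_hom: "ringed_map_hom (Spec B) (Spec A) (Spec_map A B h)"
proof (intro ringed_map_hom.intro ringed_map_hom_axioms.intro Spec_map_continuous
    A.Sp.presheaf_space_axioms B.Sp.presheaf_space_axioms)
  fix V assume V: "A.opn V"
  let ?f = "Spec_map A B h"
  have oV: "B.opn (preim (Spec B) ?f V)"
    using openin_continuous_map_preimage[OF Spec_map_continuous V] by (simp add: preim_def)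
  have cl: "pull ?f V \<alpha> \<in> carrier (sec (Spec B) (preim (Spec B) ?f V))"
    if \<alpha>: "\<alpha> \<in> carrier (sec (Spec A) V)" for \<alpha>
  proof (rule B.sectionI)
    show "pull ?f V \<alpha> \<in> extensional (preim (Spec B) ?f V)" by (simp add: pull_Spec_map_eq)
    fix Q assume Q: "Q \<in> preim (Spec B) ?f V"
    then have pQ: "primeideal Q B" and c: "contraction Q \<in> V"
      by (auto simp: preim_Spec_map prime_spectrum_def)
    obtain a g where a: "a \<in> carrier A" "g \<in> carrier A" "contraction Q \<in> A.basic g" "A.basic g \<subseteq> V"
      "\<And>P'. P' \<in> A.basic g \<Longrightarrow> \<alpha> P' = prime_fraction A P' a g"
      using A.section_local[OF V \<alpha> c] by blast
    show "\<exists>a\<in>carrier B. \<exists>g\<in>carrier B. Q \<in> B.basic g \<and> B.basic g \<subseteq> preim (Spec B) ?f V \<and>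
        (\<forall>P'\<in>B.basic g. pull ?f V \<alpha> P' = prime_fraction B P' a g)"
    proof (rule bexI[of _ "h a"], rule bexI[of _ "h g"], intro conjI ballI)
      show "Q \<in> B.basic (h g)" using contraction_basic[OF pQ a(2)] a(3) by blast
      show sub: "B.basic (h g) \<subseteq> preim (Spec B) ?f V"
        using contraction_basic[OF _ a(2)] a(4) by (auto simp: preim_Spec_map B.mem_basic prime_spectrum_def)
      fix Q' assume Q': "Q' \<in> B.basic (h g)"
      then have p: "primeideal Q' B" "h g \<notin> Q'" by (auto simp: B.mem_basic)
      show "pull ?f V \<alpha> Q' = prime_fraction B Q' (h a) (h g)"
        using pull_Spec_map[of Q' V \<alpha>] sub Q' a(5)[of "contraction Q'"] contraction_basic[OF p(1) a(2)]
          fraction_map_prime[OF p(1) a(1,2) p(2)] by auto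
    qed (use a h_closed in auto)
  qed
  show "pull ?f V \<in> ring_hom (sec (Spec A) V) (sec (Spec B) (preim (Spec B) ?f V))"
  proof (rule ring_hom_memI)
    fix x y assume xy: "x \<in> carrier (sec (Spec A) V)" "y \<in> carrier (sec (Spec A) V)"
    note m = A.section_value[OF V xy(1)] A.section_value[OF V xy(2)]
    show "pull ?f V (x \<otimes>\<^bsub>sec (Spec A) V\<^esub> y) =
        pull ?f V x \<otimes>\<^bsub>sec (Spec B) (preim (Spec B) ?f V)\<^esub> pull ?f V y"
      unfolding B.sec_mult pull_Spec_map_eq
    proof (rule restrict_ext)
      fix Q assume Q: "Q \<in> preim (Spec B) ?f V"
      then have p: "primeideal Q B" "contraction Q \<in> V" by (auto simp: preim_Spec_map prime_spectrum_def)
      show "fraction_map B (carrier B - Q) h ((x \<otimes>\<^bsub>sec (Spec A) V\<^esub> y) (contraction Q)) =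
        (\<lambda>Q\<in>preim (Spec B) ?f V. fraction_map B (carrier B - Q) h (x (contraction Q))) Q \<otimes>\<^bsub>localisation_at B Q\<^esub>
        (\<lambda>Q\<in>preim (Spec B) ?f V. fraction_map B (carrier B - Q) h (y (contraction Q))) Q"
        using Q p m[OF p(2)] ring_hom_memE(2)[OF fraction_map_hom[OF p(1)]] by (simp add: A.sec_mult)
    qed
    show "pull ?f V (x \<oplus>\<^bsub>sec (Spec A) V\<^esub> y) =
        pull ?f V x \<oplus>\<^bsub>sec (Spec B) (preim (Spec B) ?f V)\<^esub> pull ?f V y"
      unfolding B.sec_add pull_Spec_map_eq
    proof (rule restrict_ext)
      fix Q assume Q: "Q \<in> preim (Spec B) ?f V"
      then have p: "primeideal Q B" "contraction Q \<in> V" by (auto simp: preim_Spec_map prime_spectrum_def)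
      show "fraction_map B (carrier B - Q) h ((x \<oplus>\<^bsub>sec (Spec A) V\<^esub> y) (contraction Q)) =
        (\<lambda>Q\<in>preim (Spec B) ?f V. fraction_map B (carrier B - Q) h (x (contraction Q))) Q \<oplus>\<^bsub>localisation_at B Q\<^esub>
        (\<lambda>Q\<in>preim (Spec B) ?f V. fraction_map B (carrier B - Q) h (y (contraction Q))) Q"
        using Q p m[OF p(2)] ring_hom_memE(3)[OF fraction_map_hom[OF p(1)]] by (simp add: A.sec_add)
    qed
  next
    show "pull ?f V \<one>\<^bsub>sec (Spec A) V\<^esub> = \<one>\<^bsub>sec (Spec B) (preim (Spec B) ?f V)\<^esub>"
      unfolding B.sec_one pull_Spec_map_eq
    proof (rule restrict_ext)
      fix Q assume Q: "Q \<in> preim (Spec B) ?f V"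
      then have p: "primeideal Q B" "contraction Q \<in> V" by (auto simp: preim_Spec_map prime_spectrum_def)
      show "fraction_map B (carrier B - Q) h (\<one>\<^bsub>sec (Spec A) V\<^esub> (contraction Q)) = \<one>\<^bsub>localisation_at B Q\<^esub>"
        using p ring_hom_memE(4)[OF fraction_map_hom[OF p(1)]] by (simp add: A.sec_one)
    qed
  qed (rule cl)
  fix W s assume W: "A.opn W" "W \<subseteq> V" "s \<in> carrier (sec (Spec A) V)"
  show "pull ?f W (res (Spec A) V W s) =
      res (Spec B) (preim (Spec B) ?f V) (preim (Spec B) ?f W) (pull ?f V s)"
    unfolding B.res_Spec A.res_Spec pull_Spec_map_eq
    by (rule restrict_ext) (use W(2) in \<open>auto simp: preim_Spec_map\<close>)
qed

text \<open>If the image of \<open>a / g\<close> is invertible at \<open>Q\<close>, then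
  \<open>h a\<close> is outside \<open>Q\<close>, so \<open>a\<close> is outside the contraction of
  \<open>Q\<close> and \<open>a / g\<close> was invertible there.\<close>

lemma Spec_map_morphism: "morphism (Spec B) (Spec A) (Spec_map A B h)"
  unfolding morphism_iff[OF B.local_space_Spec A.local_space_Spec]
proof (intro conjI Spec_map_hom allI impI)
  interpret m: ringed_map_hom "Spec B" "Spec A" "Spec_map A B h" by (rule Spec_map_hom)
  fix Q V s assume Q: "Q \<in> points (Spec B)" and V: "A.opn V" "pt (Spec_map A B h) Q \<in> V"
    "s \<in> carrier (sec (Spec A) V)"
    and u: "B.Sp.unit_at Q (preim (Spec B) (Spec_map A B h) V) (pull (Spec_map A B h) V s)"
  have p: "primeideal Q B" using Q B.points_Spec by (auto simp: prime_spectrum_def)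
  have c: "contraction Q \<in> V" using V(2) by (simp add: pt_Spec_map)
  have Q': "Q \<in> preim (Spec B) (Spec_map A B h) V" using c Q by (simp add: m.mem_preim pt_Spec_map)
  obtain a g where a: "a \<in> carrier A" "g \<in> carrier A" "contraction Q \<in> A.basic g" "A.basic g \<subseteq> V"
    "\<And>P'. P' \<in> A.basic g \<Longrightarrow> s P' = prime_fraction A P' a g"
    using A.section_local[OF V(1,3) c] by blast
  have g: "h g \<notin> Q" "g \<notin> contraction Q" using a(2,3) by (auto simp: A.mem_basic)
  have "pull (Spec_map A B h) V s Q = prime_fraction B Q (h a) (h g)"
    using pull_Spec_map[OF Q'] a(5)[OF a(3)] fraction_map_prime[OF p a(1,2) g(1)] by simp
  then have "h a \<notin> Q"
    using u B.unit_at_iff[OF m.opn_preim[OF V(1)] Q' m.pull_closed[OF V(1,3)] h_closed[OF a(1)]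
      h_closed[OF a(2)] g(1)] by blast
  then have "a \<notin> contraction Q" by blast
  then have "A.Sp.unit_at (contraction Q) V s"
    using A.unit_at_iff[OF V(1) c V(3) a(1,2) g(2) a(5)[OF a(3)]] by blast
  then show "A.Sp.unit_at (pt (Spec_map A B h) Q) V s" by (simp add: pt_Spec_map)
qed

lemma Spec_map_global_section:
  assumes "a \<in> carrier A"
  shows "pull (Spec_map A B h) (points (Spec A)) (Spec_global_section A a) = Spec_global_section B (h a)"
  unfolding pull_Spec_map_eq Spec_global_section_def
proof (rule restrict_ext[THEN HOL.trans])
  interpret m: ringed_map_hom "Spec B" "Spec A" "Spec_map A B h" by (rule Spec_map_hom)
  show "(\<lambda>Q\<in>preim (Spec B) (Spec_map A B h) (points (Spec A)). prime_fraction B Q (h a) \<one>\<^bsub>B\<^esub>) =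
      (\<lambda>P\<in>prime_spectrum B. prime_fraction B P (h a) \<one>\<^bsub>B\<^esub>)"
    by (simp add: m.preim_points B.points_Spec)
  fix Q assume "Q \<in> preim (Spec B) (Spec_map A B h) (points (Spec A))"
  then have p: "primeideal Q B" "contraction Q \<in> prime_spectrum A"
    by (auto simp: preim_Spec_map prime_spectrum_def A.points_Spec)
  have "h \<one>\<^bsub>A\<^esub> = \<one>\<^bsub>B\<^esub>" "\<one>\<^bsub>B\<^esub> \<notin> Q" using ring_hom_memE(4)[OF h] primeideal_one_notin[OF p(1)] by auto
  then show "fraction_map B (carrier B - Q) h ((\<lambda>P\<in>prime_spectrum A. prime_fraction A P a \<one>\<^bsub>A\<^esub>) (contraction Q)) =
      prime_fraction B Q (h a) \<one>\<^bsub>B\<^esub>"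
    using fraction_map_prime[OF p(1) assms A.one_closed] p by simp
qed

end

section \<open>Global sections of a spectrum\<close>

context affine begin

lemma global_section_closed:
  assumes "a \<in> carrier A"
  shows "Spec_global_section A a \<in> carrier (sec (Spec A) (points (Spec A)))"
  using section_constI[OF openin_topspace, of a \<one>] assms
  unfolding points_Spec basic_one Spec_global_section_def by simp

lemma global_section_hom:
  "Spec_global_section A \<in> ring_hom A (sec (Spec A) (points (Spec A)))"
proof (rule ring_hom_memI)
  fix a b assume a: "a \<in> carrier A" and b: "b \<in> carrier A"
  have "prime_fraction A P (a \<otimes> b) \<one> = prime_fraction A P a \<one> \<otimes>\<^bsub>localisation_at A P\<^esub> prime_fraction A P b \<one>"
    "prime_fraction A P (a \<oplus> b) \<one> = prime_fraction A P a \<one> \<oplus>\<^bsub>localisation_at A P\<^esub> prime_fraction A P b \<one>"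
    if "P \<in> prime_spectrum A" for P
  proof -
    interpret mult_set A "carrier A - P"
      using that mult_set_primeideal by (auto simp: prime_spectrum_def)
    show "prime_fraction A P (a \<otimes> b) \<one> = prime_fraction A P a \<one> \<otimes>\<^bsub>localisation_at A P\<^esub> prime_fraction A P b \<one>"
      "prime_fraction A P (a \<oplus> b) \<one> = prime_fraction A P a \<one> \<oplus>\<^bsub>localisation_at A P\<^esub> prime_fraction A P b \<one>"
      using a b one_mem by (simp_all add: fraction_mult fraction_add_same)
  qed
  then show "Spec_global_section A (a \<otimes> b) = Spec_global_section A a
      \<otimes>\<^bsub>sec (Spec A) (points (Spec A))\<^esub> Spec_global_section A b"
    "Spec_global_section A (a \<oplus> b) = Spec_global_section A a
      \<oplus>\<^bsub>sec (Spec A) (points (Spec A))\<^esub> Spec_global_section A b"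
    by (auto simp: Spec_global_section_def sec_mult sec_add points_Spec fun_eq_iff)
qed (auto simp: global_section_closed, simp add: Spec_global_section_def sec_one points_Spec localisation_def)

text \<open>The \<open>u\<close> with \<open>u \<otimes> a = u \<otimes> b\<close> form an ideal,
  and equality in the localisation at a prime puts one of them outside that prime. This is what
  makes \<open>value_at\<close> well defined.\<close>

lemma global_section_inj:
  assumes a: "a \<in> carrier A" and b: "b \<in> carrier A"
    and eq: "Spec_global_section A a = Spec_global_section A b"
  shows "a = b"
proof -
  let ?I = "{u \<in> carrier A. u \<otimes> a = u \<otimes> b}"
  have "ideal ?I A"
  proof (rule idealI)
    show "ring A" by (rule ring_axioms)
    show "subgroup ?I (add_monoid A)"
    proof (rule add.subgroupI)
      show "?I \<noteq> {}" using a b zero_closed l_null by fastforce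
    qed (use a b in \<open>auto simp: l_distr l_minus\<close>)
    fix u x assume u: "u \<in> ?I" and x: "x \<in> carrier A"
    show *: "x \<otimes> u \<in> ?I" using u x a b by (auto simp: m_assoc)
    show "u \<otimes> x \<in> ?I" using * u x m_comm[of u x] by simp
  qed
  then have "\<one> \<in> ?I"
  proof (rule one_mem_ideal)
    fix P assume P: "primeideal P A"
    interpret mult_set A "carrier A - P" using mult_set_primeideal[OF P] .
    have "prime_fraction A P a \<one> = prime_fraction A P b \<one>"
      using fun_cong[OF eq, of P] P by (simp add: Spec_global_section_def prime_spectrum_def)
    then show "\<exists>u\<in>?I. u \<notin> P" using fraction_eqD[of a \<one> b \<one>] a b one_mem by auto
  qed
  then show ?thesis using a b by simp
qed

lemma unit_at_global_section:
  assumes "P \<in> points (Spec A)" "a \<in> carrier A"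
  shows "Sp.unit_at P (points (Spec A)) (Spec_global_section A a) \<longleftrightarrow> a \<notin> P"
proof (rule unit_at_iff[OF openin_topspace assms(1) global_section_closed[OF assms(2)] assms(2) one_closed])
  have "primeideal P A" using assms(1) by (simp add: points_Spec prime_spectrum_def)
  then show "\<one> \<notin> P" by (rule primeideal_one_notin)
  show "Spec_global_section A a P = prime_fraction A P a \<one>"
    using assms(1) by (simp add: points_Spec Spec_global_section_def)
qed

end

subsection \<open>Subrings of a field with that field of fractions\<close>

text \<open>The chosen representative does not matter for fractions at a prime of a subring of a
  field, by \<open>fraction_value_fraction\<close>.\<close>

definition fraction_value :: "('k \<times> 'k) set \<Rightarrow> 'k::field" where
  "fraction_value x = (case SOME p. p \<in> x of (a, s) \<Rightarrow> a / s)"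

text \<open>Both the ring of integers and \<open>K\<close> itself, with \<open>D = UNIV\<close>, are
  instances; so values at integral points and at \<open>K\<close>-points are one notion.\<close>

locale fraction_subring =
  fixes D :: "'k::field_char_0 set" and R :: "'k ring"
  assumes R_def: "R = field_ring\<lparr>carrier := D\<rparr>"
    and one_in: "1 \<in> D" and add_in: "\<And>x y. x \<in> D \<Longrightarrow> y \<in> D \<Longrightarrow> x + y \<in> D"
    and mult_in: "\<And>x y. x \<in> D \<Longrightarrow> y \<in> D \<Longrightarrow> x * y \<in> D"
    and uminus_in: "\<And>x. x \<in> D \<Longrightarrow> - x \<in> D"
    and frac: "\<And>x. \<exists>a\<in>D. \<exists>s\<in>D. s \<noteq> 0 \<and> x = a / s"
begin

lemma zero_in: "0 \<in> D"
  using add_in[OF one_in uminus_in[OF one_in]] by simp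

lemma R_simps: "carrier R = D" "x \<otimes>\<^bsub>R\<^esub> y = x * y" "x \<oplus>\<^bsub>R\<^esub> y = x + y" "\<one>\<^bsub>R\<^esub> = 1" "\<zero>\<^bsub>R\<^esub> = 0"
  by (simp_all add: R_def ring_of_type_algebra_def)

lemma domain_R: "domain R"
proof (rule domainI)
  show "cring R"
  proof (rule cringI)
    show "abelian_group R"
    proof (rule abelian_groupI)
      fix x assume "x \<in> carrier R"
      then show "\<exists>y\<in>carrier R. y \<oplus>\<^bsub>R\<^esub> x = \<zero>\<^bsub>R\<^esub>"
        by (intro bexI[of _ "- x"]) (auto simp: R_simps uminus_in)
    qed (auto simp: R_simps zero_in add_in)
    show "comm_monoid R"
      by (rule comm_monoidI) (auto simp: R_simps one_in mult_in)
  qed (auto simp: R_simps algebra_simps)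
qed (auto simp: R_simps)

sublocale Rd: domain R by (rule domain_R)
sublocale Ra: affine R by (rule affineI[OF Rd.is_cring])

lemma zero_prime: "primeideal {0} R"
  using Rd.zeroprimeideal by (simp add: R_simps)

lemma zero_in_prime: "primeideal P R \<Longrightarrow> 0 \<in> P"
  using additive_subgroup.zero_closed[OF ideal.axioms(1)[OF primeideal.axioms(1)]] R_simps by metis

lemma fraction_value_fraction:
  assumes P: "primeideal P R" and a: "a \<in> D" "s \<in> D" "s \<notin> P"
  shows "fraction_value (prime_fraction R P a s) = a / s"
proof -
  interpret mult_set R "carrier R - P" using mult_set_primeideal[OF P] .
  have "(a, s) \<in> prime_fraction R P a s" using fraction_self a by (simp add: R_simps)
  moreover have "fst p / snd p = a / s" if "p \<in> prime_fraction R P a s" for p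
  proof -
    obtain b t where p: "p = (b, t)" by (cases p)
    have bt: "b \<in> D" "t \<in> D" "t \<notin> P" and "\<exists>u\<in>D - P. u * (a * t) = u * (b * s)"
      using that[unfolded p fraction_mem] by (auto simp: R_simps)
    then obtain u where u: "u \<in> D" "u \<notin> P" "u * (a * t) = u * (b * s)" by blast
    have "u \<noteq> 0" "t \<noteq> 0" "s \<noteq> 0" using u bt a zero_in_prime[OF P] by auto
    then show ?thesis using u(3) by (simp add: p field_simps)
  qed
  ultimately show ?thesis
    unfolding fraction_value_def by (metis (mono_tags, lifting) case_prod_beta someI_ex)
qed

lemmas fraction_value_fraction_D = fraction_value_fraction[unfolded R_simps(1)]

lemma fraction_value_hom:
  assumes P: "primeideal P R"
  shows "fraction_value \<in> ring_hom (localisation_at R P) field_ring"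
proof -
  interpret mult_set R "carrier R - P" using mult_set_primeideal[OF P] .
  note fv = fraction_value_fraction[OF P] fraction_value_fraction_D[OF P]
  have 1: "1 \<notin> P" using primeideal_one_notin[OF P] by (simp add: R_simps)
  show ?thesis
  proof (rule ring_hom_memI)
    fix x y assume x: "x \<in> carrier (localisation_at R P)" and y: "y \<in> carrier (localisation_at R P)"
    obtain a s where a: "a \<in> carrier R" "s \<in> carrier R - P" "x = prime_fraction R P a s"
      using x by (rule localisation_carrierE)
    obtain b t where b: "b \<in> carrier R" "t \<in> carrier R - P" "y = prime_fraction R P b t"
      using y by (rule localisation_carrierE)
    have m: "s * t \<in> D" "s * t \<notin> P" using mult_mem[OF a(2) b(2)] by (auto simp: R_simps)
    have nz: "s \<noteq> 0" "t \<noteq> 0" using a b zero_in_prime[OF P] by auto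
    have c: "a \<in> D" "b \<in> D" "s \<in> D" "t \<in> D" "s \<notin> P" "t \<notin> P" using a b by (auto simp: R_simps)
    show "fraction_value (x \<otimes>\<^bsub>localisation_at R P\<^esub> y) = fraction_value x \<otimes>\<^bsub>field_ring\<^esub> fraction_value y"
      unfolding a(3) b(3) fraction_mult[OF a(1,2) b(1,2)]
      using c m by (simp add: R_simps fv mult_in) (simp add: ring_of_type_algebra_def)
    show "fraction_value (x \<oplus>\<^bsub>localisation_at R P\<^esub> y) = fraction_value x \<oplus>\<^bsub>field_ring\<^esub> fraction_value y"
      unfolding a(3) b(3) fraction_add[OF a(1,2) b(1,2)]
      using c m nz by (simp add: R_simps fv mult_in add_in) (simp add: ring_of_type_algebra_def field_simps)
  next
    show "fraction_value \<one>\<^bsub>localisation_at R P\<^esub> = \<one>\<^bsub>field_ring\<^esub>"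
      using localisation_one[unfolded R_simps(4)] fv(1)[OF one_in one_in 1]
      by (simp add: ring_of_type_algebra_def)
  qed (simp add: ring_of_type_algebra_def)
qed

lemma fraction_value_inj:
  assumes P: "primeideal P R" and x: "x \<in> carrier (localisation_at R P)"
    and y: "y \<in> carrier (localisation_at R P)" and eq: "fraction_value x = fraction_value y"
  shows "x = y"
proof -
  interpret mult_set R "carrier R - P" using mult_set_primeideal[OF P] .
  note fv = fraction_value_fraction[OF P] fraction_value_fraction_D[OF P]
  obtain a s where a: "a \<in> carrier R" "s \<in> carrier R - P" "x = prime_fraction R P a s"
    using x by (rule localisation_carrierE)
  obtain b t where b: "b \<in> carrier R" "t \<in> carrier R - P" "y = prime_fraction R P b t"
    using y by (rule localisation_carrierE)
  have nz: "s \<noteq> 0" "t \<noteq> 0" using a b zero_in_prime[OF P] by auto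
  have "a / s = b / t" using eq a b by (simp add: fv R_simps)
  then have "a \<otimes>\<^bsub>R\<^esub> t = b \<otimes>\<^bsub>R\<^esub> s" using nz by (simp add: R_simps field_simps)
  then show ?thesis unfolding a(3) b(3) by (rule fraction_eqI[OF a(1,2) b(1,2)])
qed

text \<open>A set \<open>basic f\<close> that contains a prime has \<open>f \<noteq> 0\<close>,
  hence contains the zero ideal.\<close>

lemma generic_mem: "Ra.opn V \<Longrightarrow> P \<in> V \<Longrightarrow> {0} \<in> V"
proof -
  assume V: "Ra.opn V" "P \<in> V"
  obtain f where f: "f \<in> carrier R" "P \<in> Ra.basic f" "Ra.basic f \<subseteq> V" using Ra.basic_nbhd[OF V] by metis
  then have "f \<noteq> 0" using zero_in_prime by (auto simp: Ra.mem_basic)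
  then have "{0} \<in> Ra.basic f" using zero_prime by (simp add: Ra.mem_basic)
  then show ?thesis using f by blast
qed

lemma generic_point: "{0} \<in> points (Spec R)"
  using zero_prime by (simp add: Ra.points_Spec prime_spectrum_def)

text \<open>The value at the generic point. Sections over a nonempty open set are determined by it,
  which embeds their ring into \<open>K\<close>.\<close>

definition generic_value :: "('k set \<Rightarrow> ('k \<times> 'k) set) \<Rightarrow> 'k" where
  "generic_value \<alpha> = fraction_value (\<alpha> {0})"

text \<open>Near \<open>P\<close> the section is one fraction \<open>a / g\<close> on a basic open
  set, which also contains the zero ideal. The second part is how integrality at the prime
  \<open>P\<close> is detected later.\<close>

lemma generic_value_at:
  assumes "Ra.opn V" "\<alpha> \<in> carrier (sec (Spec R) V)" "P \<in> V"
  shows "fraction_value (\<alpha> P) = generic_value \<alpha>"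
    and "\<exists>a\<in>D. \<exists>g\<in>D. g \<notin> P \<and> generic_value \<alpha> = a / g"
proof -
  obtain a g where a: "a \<in> carrier R" "g \<in> carrier R" "P \<in> Ra.basic g" "Ra.basic g \<subseteq> V"
    "\<And>P'. P' \<in> Ra.basic g \<Longrightarrow> \<alpha> P' = prime_fraction R P' a g"
    using Ra.section_local[OF assms] by blast
  have P: "primeideal P R" "g \<notin> P" using a by (auto simp: Ra.mem_basic)
  then have "g \<noteq> 0" using zero_in_prime by auto
  then have 0: "{0} \<in> Ra.basic g" using zero_prime by (simp add: Ra.mem_basic)
  have "fraction_value (\<alpha> P) = a / g"
    using a P by (simp add: fraction_value_fraction_D R_simps)
  moreover have v: "generic_value \<alpha> = a / g"
    using a 0 zero_prime \<open>g \<noteq> 0\<close> by (simp add: generic_value_def fraction_value_fraction fraction_value_fraction_D R_simps)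
  ultimately show "fraction_value (\<alpha> P) = generic_value \<alpha>" by simp
  show "\<exists>a\<in>D. \<exists>g\<in>D. g \<notin> P \<and> generic_value \<alpha> = a / g" using v a P by (auto simp: R_simps)
qed

lemma generic_value_hom:
  assumes V: "Ra.opn V" "{0} \<in> V"
  shows "generic_value \<in> ring_hom (sec (Spec R) V) field_ring"
proof -
  note hom = ring_hom_memE[OF fraction_value_hom[OF zero_prime]]
  show ?thesis
  proof (rule ring_hom_memI)
    fix x y assume "x \<in> carrier (sec (Spec R) V)" "y \<in> carrier (sec (Spec R) V)"
    then have m: "x {0} \<in> carrier (localisation_at R {0})" "y {0} \<in> carrier (localisation_at R {0})"
      using Ra.section_value V by auto
    show "generic_value (x \<otimes>\<^bsub>sec (Spec R) V\<^esub> y) = generic_value x \<otimes>\<^bsub>field_ring\<^esub> generic_value y"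
      "generic_value (x \<oplus>\<^bsub>sec (Spec R) V\<^esub> y) = generic_value x \<oplus>\<^bsub>field_ring\<^esub> generic_value y"
      using hom(2,3)[OF m] V by (simp_all add: generic_value_def Ra.sec_mult Ra.sec_add)
  next
    show "generic_value \<one>\<^bsub>sec (Spec R) V\<^esub> = \<one>\<^bsub>field_ring\<^esub>"
      using hom(4) V by (simp add: generic_value_def Ra.sec_one)
  qed (simp add: ring_of_type_algebra_def)
qed

lemma generic_value_restrict: "{0} \<in> W \<Longrightarrow> generic_value (restrict \<alpha> W) = generic_value \<alpha>"
  by (simp add: generic_value_def)

lemma generic_value_inj:
  assumes V: "Ra.opn V" and \<alpha>: "\<alpha> \<in> carrier (sec (Spec R) V)" and \<beta>: "\<beta> \<in> carrier (sec (Spec R) V)"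
    and eq: "generic_value \<alpha> = generic_value \<beta>"
  shows "\<alpha> = \<beta>"
proof (rule extensionalityI[OF Ra.section_ext[OF \<alpha>] Ra.section_ext[OF \<beta>]])
  fix P assume P: "P \<in> V"
  show "\<alpha> P = \<beta> P"
    using fraction_value_inj[OF Ra.opn_prime[OF V P] Ra.section_value[OF V \<alpha> P] Ra.section_value[OF V \<beta> P]]
      generic_value_at(1)[OF V \<alpha> P] generic_value_at(1)[OF V \<beta> P] eq by simp
qed

lemma generic_germ_eq_iff:
  assumes V: "Ra.opn V" "{0} \<in> V" "\<alpha> \<in> carrier (sec (Spec R) V)"
    and W: "Ra.opn W" "{0} \<in> W" "\<beta> \<in> carrier (sec (Spec R) W)"
  shows "germ (Spec R) {0} V \<alpha> = germ (Spec R) {0} W \<beta> \<longleftrightarrow> generic_value \<alpha> = generic_value \<beta>"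
proof
  assume "germ (Spec R) {0} V \<alpha> = germ (Spec R) {0} W \<beta>"
  then obtain N where N: "Ra.opn N" "{0} \<in> N" "res (Spec R) V N \<alpha> = res (Spec R) W N \<beta>"
    by (rule Ra.Sp.germ_eqD[OF _ W])
  have "restrict \<alpha> N {0} = restrict \<beta> N {0}" using N(3) by (simp add: Ra.res_Spec)
  then show "generic_value \<alpha> = generic_value \<beta>" using N(2) by (simp add: generic_value_def)
next
  assume eq: "generic_value \<alpha> = generic_value \<beta>"
  have o: "Ra.opn (V \<inter> W)" using V W by blast
  have "restrict \<alpha> (V \<inter> W) = restrict \<beta> (V \<inter> W)"
    using V W eq by (intro generic_value_inj[OF o] Ra.section_restrict[OF _ o])
      (auto simp: generic_value_restrict)
  then show "germ (Spec R) {0} V \<alpha> = germ (Spec R) {0} W \<beta>"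
    using V W o by (intro Ra.Sp.germ_eqI[OF V W o]) (simp_all add: Ra.res_Spec)
qed

lemma generic_value_surj:
  obtains V \<alpha> where "Ra.opn V" "{0} \<in> V" "\<alpha> \<in> carrier (sec (Spec R) V)" "generic_value \<alpha> = k"
proof -
  obtain a s where a: "a \<in> D" "s \<in> D" "s \<noteq> 0" "k = a / s" using frac by blast
  have z: "{0} \<in> Ra.basic s" using a zero_prime by (simp add: Ra.mem_basic)
  show thesis
  proof (rule that[of "Ra.basic s" "\<lambda>P\<in>Ra.basic s. prime_fraction R P a s"])
    show "Ra.opn (Ra.basic s)" using Ra.opn_basic a by (simp add: R_simps)
    then show "(\<lambda>P\<in>Ra.basic s. prime_fraction R P a s) \<in> carrier (sec (Spec R) (Ra.basic s))"
      using a by (intro Ra.section_constI) (auto simp: R_simps)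
    show "generic_value (\<lambda>P\<in>Ra.basic s. prime_fraction R P a s) = k"
      using z a zero_prime by (simp add: generic_value_def fraction_value_fraction fraction_value_fraction_D)
  qed (rule z)
qed

lemma generic_value_global:
  assumes "a \<in> D"
  shows "generic_value (Spec_global_section R a) = a"
  using assms zero_prime one_in
  by (simp add: generic_value_def Spec_global_section_def prime_spectrum_def fraction_value_fraction fraction_value_fraction_D R_simps)

lemma unit_at_generic_iff:
  assumes V: "Ra.opn V" "{0} \<in> V" "\<alpha> \<in> carrier (sec (Spec R) V)"
  shows "Ra.Sp.unit_at {0} V \<alpha> \<longleftrightarrow> generic_value \<alpha> \<noteq> 0"
proof -
  obtain a g where a: "a \<in> carrier R" "g \<in> carrier R" "{0} \<in> Ra.basic g"
    "\<And>P'. P' \<in> Ra.basic g \<Longrightarrow> \<alpha> P' = prime_fraction R P' a g"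
    using Ra.section_local[OF V(1,3,2)] by blast
  have g: "g \<notin> {0}" using a by (simp add: Ra.mem_basic)
  have "generic_value \<alpha> = a / g"
    using a g zero_prime by (simp add: generic_value_def fraction_value_fraction fraction_value_fraction_D R_simps)
  then show ?thesis
    using Ra.unit_at_iff[OF V a(1,2) g a(4)[OF a(3)]] g by auto
qed

end

lemma field_ring_UNIV: "(field_ring :: 'k::field_char_0 ring)\<lparr>carrier := UNIV\<rparr> = field_ring"
  by (simp add: ring_of_type_algebra_def)

lemma field_fraction_subring: "fraction_subring (UNIV :: 'k::field_char_0 set) field_ring"
proof
  fix x :: 'k
  show "\<exists>a\<in>UNIV. \<exists>s\<in>UNIV. s \<noteq> 0 \<and> x = a / s" by (rule bexI[of _ x], rule bexI[of _ 1]) auto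
qed (auto simp: field_ring_UNIV)

interpretation Kf: fraction_subring "UNIV :: 'k::field_char_0 set" field_ring
  by (rule field_fraction_subring)

subsection \<open>Tensor product with an isomorphic algebra\<close>

text \<open>If \<open>R \<rightarrow> B\<close> is bijective, then \<open>A \<otimes>\<^sub>R B\<close> is \<open>A\<close>. The isomorphism \<open>tens\<close> and the
  evaluation \<open>collapse\<close> of lists that inverts it turn the relation \<^const>\<open>tensor_eq\<close> into
  equality in \<open>A\<close>.\<close>

locale tensor_iso = R: cring R + A: cring A + B: cring B
  for R :: "'r ring" and A :: "'a ring" and B :: "'b ring" +
  fixes hA :: "'r \<Rightarrow> 'a" and hB :: "'r \<Rightarrow> 'b"
  assumes hA: "hA \<in> ring_hom R A" and hB: "hB \<in> ring_hom R B"
    and bij: "bij_betw hB (carrier R) (carrier B)"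
begin

abbreviation "M \<equiv> algebra_via hA A"
abbreviation "N \<equiv> algebra_via hB B"
abbreviation "teq \<equiv> tensor_eq R M N"
abbreviation "T \<equiv> tensor_ring R M N"
abbreviation "wfl xs \<equiv> set xs \<subseteq> carrier A \<times> carrier B"

definition transfer :: "'b \<Rightarrow> 'a" where
  "transfer b = hA (inv_into (carrier R) hB b)"

lemma transfer_hB: "r \<in> carrier R \<Longrightarrow> transfer (hB r) = hA r"
  using bij by (simp add: transfer_def bij_betw_def)

lemma B_cases: assumes "b \<in> carrier B" obtains r where "r \<in> carrier R" "b = hB r"
  using assms bij by (auto simp: bij_betw_def)

lemma transfer_hom: "transfer \<in> ring_hom B A"
proof (rule ring_hom_memI)
  note a = ring_hom_memE[OF hA] and b = ring_hom_memE[OF hB]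
  fix x assume "x \<in> carrier B"
  then obtain r where r: "r \<in> carrier R" "x = hB r" by (rule B_cases)
  show "transfer x \<in> carrier A" using r a by (simp add: transfer_hB)
  fix y assume "y \<in> carrier B"
  then obtain s where s: "s \<in> carrier R" "y = hB s" by (rule B_cases)
  show "transfer (x \<otimes>\<^bsub>B\<^esub> y) = transfer x \<otimes>\<^bsub>A\<^esub> transfer y"
    using r s a(2)[OF r(1) s(1)] b(2)[OF r(1) s(1), symmetric] by (simp add: transfer_hB)
  show "transfer (x \<oplus>\<^bsub>B\<^esub> y) = transfer x \<oplus>\<^bsub>A\<^esub> transfer y"
    using r s a(3)[OF r(1) s(1)] b(3)[OF r(1) s(1), symmetric] by (simp add: transfer_hB)
next
  show "transfer \<one>\<^bsub>B\<^esub> = \<one>\<^bsub>A\<^esub>"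
    using transfer_hB[OF R.one_closed] ring_hom_memE(4)[OF hA] ring_hom_memE(4)[OF hB] by simp
qed

lemma transfer_closed: "b \<in> carrier B \<Longrightarrow> transfer b \<in> carrier A"
  using ring_hom_memE(1)[OF transfer_hom] .

lemmas transfer_simps = ring_hom_memE(2-4)[OF transfer_hom]

fun collapse :: "('a \<times> 'b) list \<Rightarrow> 'a" where
  "collapse [] = \<zero>\<^bsub>A\<^esub>"
| "collapse ((a, b) # xs) = a \<otimes>\<^bsub>A\<^esub> transfer b \<oplus>\<^bsub>A\<^esub> collapse xs"

lemma collapse_closed: "wfl xs \<Longrightarrow> collapse xs \<in> carrier A"
  by (induction xs rule: collapse.induct) (auto simp: transfer_closed)

lemma collapse_append: "wfl xs \<Longrightarrow> wfl ys \<Longrightarrow> collapse (xs @ ys) = collapse xs \<oplus>\<^bsub>A\<^esub> collapse ys"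
  by (induction xs rule: collapse.induct) (auto simp: collapse_closed transfer_closed A.a_assoc)

lemma algebra_via_simps:
  "carrier (algebra_via h C) = carrier C" "x \<oplus>\<^bsub>algebra_via h C\<^esub> y = x \<oplus>\<^bsub>C\<^esub> y"
  "\<zero>\<^bsub>algebra_via h C\<^esub> = \<zero>\<^bsub>C\<^esub>" "r \<odot>\<^bsub>algebra_via h C\<^esub> x = h r \<otimes>\<^bsub>C\<^esub> x"
  "\<one>\<^bsub>algebra_via h C\<^esub> = \<one>\<^bsub>C\<^esub>" "x \<otimes>\<^bsub>algebra_via h C\<^esub> y = x \<otimes>\<^bsub>C\<^esub> y"
  by (simp_all add: algebra_via_def)

text \<open>Induction on the relation: \<open>collapse\<close> sends the tensor of \<open>a\<close>
  and \<open>b\<close> to \<open>a\<close> times \<open>transfer b\<close> and respects each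
  generating rule; the rule for scalars holds because \<open>transfer (hB r) = hA r\<close>.\<close>

lemma tensor_eq_collapse: "teq xs ys \<Longrightarrow> wfl xs \<and> wfl ys \<and> collapse xs = collapse ys"
proof (induction rule: tensor_eq.induct)
  case (commute xs ys)
  then show ?case
    using A.a_comm[OF collapse_closed[of xs] collapse_closed[of ys]]
    by (simp add: algebra_via_simps collapse_append)
next
  case (smult r m n)
  note a = ring_hom_memE[OF hA] and b = ring_hom_memE[OF hB]
  have c: "m \<in> carrier A" "n \<in> carrier B" "hA r \<in> carrier A" "hB r \<in> carrier B"
    using smult a(1) b(1) by (auto simp: algebra_via_simps)
  then show ?case
    using smult by (simp add: algebra_via_simps transfer_simps transfer_hB transfer_closed A.m_ac)
qed (auto simp: algebra_via_simps collapse_append transfer_closed transfer_simps A.l_distr A.r_distr)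

text \<open>Writing \<open>b = hB r\<close> moves the scalar \<open>r\<close> to the left factor,
  and tensors whose right factor is one add up to a single one. So \<open>collapse\<close> is a
  normal form.\<close>

lemma teq_canonical: "wfl xs \<Longrightarrow> teq xs [(collapse xs, \<one>\<^bsub>B\<^esub>)]"
proof (induction xs rule: collapse.induct)
  case 1
  show ?case
    using tensor_eq.sym[OF tensor_eq.zero[of "\<one>\<^bsub>B\<^esub>" N R M]] by (simp add: algebra_via_simps)
next
  case (2 a b xs)
  then have ab: "a \<in> carrier A" "b \<in> carrier B" and xs: "wfl xs" by auto
  obtain r where r: "r \<in> carrier R" "b = hB r" using ab(2) by (rule B_cases)
  have hr: "hA r \<in> carrier A" "hB r \<in> carrier B"
    using r ring_hom_memE(1)[OF hA] ring_hom_memE(1)[OF hB] by auto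
  have "teq [(hA r \<otimes>\<^bsub>A\<^esub> a, \<one>\<^bsub>B\<^esub>)] [(a, hB r \<otimes>\<^bsub>B\<^esub> \<one>\<^bsub>B\<^esub>)]"
    using tensor_eq.smult[of r R a M "\<one>\<^bsub>B\<^esub>" N] r ab by (simp add: algebra_via_simps)
  then have "teq [(a, b)] [(a \<otimes>\<^bsub>A\<^esub> transfer b, \<one>\<^bsub>B\<^esub>)]"
    using r hr ab by (simp add: transfer_hB A.m_comm tensor_eq.sym)
  then have "teq ([(a, b)] @ xs) ([(a \<otimes>\<^bsub>A\<^esub> transfer b, \<one>\<^bsub>B\<^esub>)] @ [(collapse xs, \<one>\<^bsub>B\<^esub>)])"
    using 2(1)[OF xs] by (rule tensor_eq.append)
  moreover have "teq [(a \<otimes>\<^bsub>A\<^esub> transfer b, \<one>\<^bsub>B\<^esub>), (collapse xs, \<one>\<^bsub>B\<^esub>)]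
      [(a \<otimes>\<^bsub>A\<^esub> transfer b \<oplus>\<^bsub>A\<^esub> collapse xs, \<one>\<^bsub>B\<^esub>)]"
    using tensor_eq.add_left[of "a \<otimes>\<^bsub>A\<^esub> transfer b" M "collapse xs" "\<one>\<^bsub>B\<^esub>" N R]
      ab xs by (rule_tac tensor_eq.sym) (simp add: algebra_via_simps collapse_closed transfer_closed)
  ultimately show ?case using tensor_eq.trans[of R M N] by (simp only: append.simps collapse.simps)
qed

lemma teq_iff:
  assumes "wfl xs"
  shows "teq xs ys \<longleftrightarrow> wfl ys \<and> collapse xs = collapse ys"
proof
  assume "wfl ys \<and> collapse xs = collapse ys"
  then have "teq [(collapse xs, \<one>\<^bsub>B\<^esub>)] ys" using teq_canonical[of ys] tensor_eq.sym by auto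
  then show "teq xs ys" using teq_canonical[OF assms] by (rule tensor_eq.trans[rotated])
qed (use tensor_eq_collapse in blast)

abbreviation "cls \<equiv> tensor_class R M N"

lemma cls_eq: "wfl xs \<Longrightarrow> cls xs = {ys. wfl ys \<and> collapse ys = collapse xs}"
  by (auto simp: tensor_class_def teq_iff)

definition tens :: "'a \<Rightarrow> ('a \<times> 'b) list set" where "tens a = cls [(a, \<one>\<^bsub>B\<^esub>)]"

lemma collapse_single: "a \<in> carrier A \<Longrightarrow> collapse [(a, \<one>\<^bsub>B\<^esub>)] = a"
  by (simp add: transfer_simps)

lemma cls_tens: "wfl xs \<Longrightarrow> cls xs = tens (collapse xs)"
  using collapse_single[OF collapse_closed, of xs]
  by (simp add: tens_def cls_eq collapse_closed del: collapse.simps)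

lemma tens_mem: "c \<in> carrier A \<Longrightarrow> xs \<in> tens c \<longleftrightarrow> wfl xs \<and> collapse xs = c"
  by (simp add: tens_def cls_eq transfer_simps)

lemma tens_self: "a \<in> carrier A \<Longrightarrow> [(a, \<one>\<^bsub>B\<^esub>)] \<in> tens a"
  by (simp add: tens_mem transfer_simps)

lemma tens_inj: "a \<in> carrier A \<Longrightarrow> b \<in> carrier A \<Longrightarrow> tens a = tens b \<Longrightarrow> a = b"
  by (metis tens_self tens_mem)

lemma carrier_T: "carrier T = tens ` carrier A"
proof -
  have "carrier T = cls ` {xs. wfl xs}"
    by (auto simp: tensor_ring_def algebra_via_simps lists_eq_set)
  also have "\<dots> = tens ` carrier A"
  proof
    show "cls ` {xs. wfl xs} \<subseteq> tens ` carrier A" using cls_tens collapse_closed by auto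
    show "tens ` carrier A \<subseteq> cls ` {xs. wfl xs}" by (auto simp: tens_def)
  qed
  finally show ?thesis .
qed

definition prod_list_of :: "('a \<times> 'b) list \<Rightarrow> ('a \<times> 'b) list \<Rightarrow> ('a \<times> 'b) list" where
  "prod_list_of xs ys = [(a \<otimes>\<^bsub>A\<^esub> a', b \<otimes>\<^bsub>B\<^esub> b'). (a, b) \<leftarrow> xs, (a', b') \<leftarrow> ys]"

lemma prod_list_of_wfl: "wfl xs \<Longrightarrow> wfl ys \<Longrightarrow> wfl (prod_list_of xs ys)"
  by (fastforce simp: prod_list_of_def)

lemma collapse_prod: "wfl xs \<Longrightarrow> wfl ys \<Longrightarrow> collapse (prod_list_of xs ys) = collapse xs \<otimes>\<^bsub>A\<^esub> collapse ys"
proof (induction xs rule: collapse.induct)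
  case 1
  then show ?case by (simp add: prod_list_of_def collapse_closed)
next
  case (2 a b xs)
  then have ab: "a \<in> carrier A" "b \<in> carrier B" and xs: "wfl xs" by auto
  have "collapse (map (\<lambda>(a', b'). (a \<otimes>\<^bsub>A\<^esub> a', b \<otimes>\<^bsub>B\<^esub> b')) ys) = (a \<otimes>\<^bsub>A\<^esub> transfer b) \<otimes>\<^bsub>A\<^esub> collapse ys"
    using \<open>wfl ys\<close>
  proof (induction ys rule: collapse.induct)
    case (2 a' b' ys)
    then have "a' \<in> carrier A" "b' \<in> carrier B" "wfl ys" by auto
    then show ?case
      using 2 ab by (simp add: transfer_simps transfer_closed collapse_closed A.r_distr A.m_ac)
  qed (use ab in \<open>simp add: transfer_closed\<close>)
  moreover have "wfl (map (\<lambda>(a', b'). (a \<otimes>\<^bsub>A\<^esub> a', b \<otimes>\<^bsub>B\<^esub> b')) ys)" using 2(3) ab by fastforce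
  moreover have "prod_list_of ((a, b) # xs) ys =
      map (\<lambda>(a', b'). (a \<otimes>\<^bsub>A\<^esub> a', b \<otimes>\<^bsub>B\<^esub> b')) ys @ prod_list_of xs ys"
    by (simp add: prod_list_of_def)
  ultimately show ?case
    using 2(1)[OF xs 2(3)] prod_list_of_wfl[OF xs 2(3)] ab xs 2(3)
    by (simp add: collapse_append collapse_closed transfer_closed A.l_distr)
qed

lemma tens_mult:
  assumes "a \<in> carrier A" "b \<in> carrier A"
  shows "tens a \<otimes>\<^bsub>T\<^esub> tens b = tens (a \<otimes>\<^bsub>A\<^esub> b)"
proof -
  have "cls (prod_list_of xs ys) = tens (a \<otimes>\<^bsub>A\<^esub> b)" if "xs \<in> tens a" "ys \<in> tens b" for xs ys
    using that tens_mem assms by (simp add: cls_tens prod_list_of_wfl collapse_prod)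
  moreover have "tens a \<otimes>\<^bsub>T\<^esub> tens b = (\<Union>xs\<in>tens a. \<Union>ys\<in>tens b. cls (prod_list_of xs ys))"
    by (simp add: tensor_ring_def algebra_via_simps prod_list_of_def)
  moreover note tens_self[OF assms(1)] tens_self[OF assms(2)]
  ultimately show ?thesis by auto
qed

lemma tens_add:
  assumes "a \<in> carrier A" "b \<in> carrier A"
  shows "tens a \<oplus>\<^bsub>T\<^esub> tens b = tens (a \<oplus>\<^bsub>A\<^esub> b)"
proof -
  have "cls (xs @ ys) = tens (a \<oplus>\<^bsub>A\<^esub> b)" if "xs \<in> tens a" "ys \<in> tens b" for xs ys
    using that tens_mem assms by (simp add: cls_tens collapse_append)
  moreover have "tens a \<oplus>\<^bsub>T\<^esub> tens b = (\<Union>xs\<in>tens a. \<Union>ys\<in>tens b. cls (xs @ ys))"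
    by (simp add: tensor_ring_def)
  moreover note tens_self[OF assms(1)] tens_self[OF assms(2)]
  ultimately show ?thesis by auto
qed

lemma tens_one: "\<one>\<^bsub>T\<^esub> = tens \<one>\<^bsub>A\<^esub>"
  by (simp add: tensor_ring_def tens_def algebra_via_simps)

lemma tens_zero: "\<zero>\<^bsub>T\<^esub> = tens \<zero>\<^bsub>A\<^esub>"
  using cls_tens[of "[]"] by (simp add: tensor_ring_def)

lemma tens_iso: "tens \<in> ring_iso A T"
proof (rule ring_iso_memI)
  show "bij_betw tens (carrier A) (carrier T)"
    using tens_inj by (auto simp: bij_betw_def carrier_T intro: inj_onI)
qed (auto simp: tens_mult tens_add tens_one carrier_T)

lemma T_cring: "cring T"
proof -
  \<comment> \<open>The transported ring structure has its zero replaced by the image of zero; that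
    image already is the zero of \<open>T\<close>.\<close>
  have "cring (T\<lparr>zero := tens \<zero>\<^bsub>A\<^esub>\<rparr>)"
    by (rule A.ring_iso_imp_img_cring[OF tens_iso])
  then show ?thesis by (simp add: tens_zero[symmetric])
qed

lemma tens_prime:
  assumes "primeideal m A"
  shows "primeideal (tens ` m) T"
proof -
  interpret m: primeideal m A by fact
  interpret T: cring T by (rule T_cring)
  let ?i = "inv_into (carrier A) tens"
  have inj: "inj_on tens (carrier A)" using tens_inj by (auto intro: inj_onI)
  have "?i \<in> ring_iso T A" by (rule ring_iso_set_sym[OF A.ring_axioms tens_iso])
  then interpret ring_hom_ring T A ?i
    by (intro ring_hom_ringI2 T.ring_axioms A.ring_axioms) (simp add: ring_iso_def)
  have "{r \<in> carrier T. ?i r \<in> m} = tens ` m"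
    using inj m.Icarr by (auto simp: carrier_T)
  then show ?thesis using primeideal_vimage[OF T.is_cring assms] by simp
qed

end

section \<open>Integers in rings and the generic point of a number ring\<close>

primrec nat_elt :: "('a, 'b) ring_scheme \<Rightarrow> nat \<Rightarrow> 'a" where
  "nat_elt R 0 = \<zero>\<^bsub>R\<^esub>"
| "nat_elt R (Suc n) = \<one>\<^bsub>R\<^esub> \<oplus>\<^bsub>R\<^esub> nat_elt R n"

lemma (in ring) nat_elt_closed: "nat_elt R n \<in> carrier R"
  by (induction n) auto

lemma (in ring) nat_elt_add: "nat_elt R (m + n) = nat_elt R m \<oplus> nat_elt R n"
  by (induction m) (auto simp: nat_elt_closed a_assoc)

lemma (in ring) nat_elt_mult: "nat_elt R (m * n) = nat_elt R m \<otimes> nat_elt R n"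
  by (induction m) (auto simp: nat_elt_closed nat_elt_add l_distr)

text \<open>By this, positive integers are recognised after passing between number rings, charts,
  rings of sections, stalks and \<open>K\<close>.\<close>

lemma nat_elt_hom:
  assumes "ring R" "ring S" "h \<in> ring_hom R S"
  shows "h (nat_elt R n) = nat_elt S n"
proof (induction n)
  case 0
  show ?case using ring_hom_zero[OF assms(3,1,2)] by simp
next
  case (Suc n)
  have "h (nat_elt R (Suc n)) = h \<one>\<^bsub>R\<^esub> \<oplus>\<^bsub>S\<^esub> h (nat_elt R n)"
    using ring_hom_memE(3)[OF assms(3) ring.ring_simprules(6)[OF assms(1)] ring.nat_elt_closed[OF assms(1)]]
    by simp
  then show ?case using ring_hom_memE(4)[OF assms(3)] Suc by simp
qed

lemma nat_elt_field: "nat_elt (field_ring :: 'k::field_char_0 ring) n = of_nat n"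
  by (induction n) (auto simp: ring_of_type_algebra_def)

lemma Kf_prime: "primeideal P (field_ring :: 'k::field_char_0 ring) \<longleftrightarrow> P = {0}"
proof
  assume P: "primeideal P (field_ring :: 'k ring)"
  have "x = 0" if "x \<in> P" for x
  proof (rule ccontr)
    assume "x \<noteq> 0"
    then have "inverse x \<otimes>\<^bsub>field_ring\<^esub> x = \<one>\<^bsub>field_ring\<^esub>" by (simp add: Kf.R_simps)
    moreover have "inverse x \<otimes>\<^bsub>field_ring\<^esub> x \<in> P"
      using ideal.I_l_closed[OF primeideal.axioms(1)[OF P] that] by (simp add: Kf.R_simps)
    ultimately show False using primeideal_one_notin[OF P] by simp
  qed
  then show "P = {0}" using Kf.zero_in_prime[OF P] by auto
qed (auto intro: Kf.zero_prime)

lemma points_Spec_field: "points (Spec (field_ring :: 'k::field_char_0 ring)) = {{0}}"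
  by (auto simp: Kf.Ra.points_Spec prime_spectrum_def Kf_prime)

text \<open>By \<open>denominator\<close>, inverting the positive integers of \<open>D\<close>
  already yields \<open>K\<close>; hence a prime that contains no positive integer is zero.\<close>

locale number_subring = fraction_subring +
  assumes denominator: "\<And>x. \<exists>n::nat. n > 0 \<and> of_nat n * x \<in> D"
begin

lemma nat_elt_R: "nat_elt R n = of_nat n"
  by (induction n) (auto simp: R_simps)

lemma inclusion_hom: "(\<lambda>x. x) \<in> ring_hom R field_ring"
  by (rule ring_hom_memI) (auto simp: R_simps Kf.R_simps)

sublocale incl: affine_hom R field_ring "\<lambda>x. x"
  by (intro affine_hom.intro affine_hom_axioms.intro inclusion_hom Ra.affine_axioms Kf.Ra.affine_axioms)

abbreviation "incl \<equiv> Spec_map R field_ring (\<lambda>x. x)"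

lemma contraction_zero: "incl.contraction {0} = {0}"
  using zero_in by (auto simp: R_simps)

sublocale im: ringed_map_hom "Spec field_ring" "Spec R" incl
  by (rule incl.Spec_map_hom)

lemma pt_incl: "pt incl {0} = {0}"
  using contraction_zero by (simp add: incl.pt_Spec_map)

lemma preim_incl:
  assumes "{0} \<in> V"
  shows "preim (Spec field_ring) incl V = {{0}}"
proof -
  have "{0} \<in> preim (Spec field_ring) incl V"
    using assms by (simp only: im.mem_preim pt_incl points_Spec_field singleton_iff simp_thms)
  moreover have "preim (Spec field_ring) incl V \<subseteq> {{0}}"
    using im.mem_preim points_Spec_field by blast
  ultimately show ?thesis by blast
qed

lemma generic_value_pull_incl:
  assumes V: "Ra.opn V" "{0} \<in> V" and \<alpha>: "\<alpha> \<in> carrier (sec (Spec R) V)"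
  shows "Kf.generic_value (pull incl V \<alpha>) = generic_value \<alpha>"
proof -
  obtain a g where a: "a \<in> carrier R" "g \<in> carrier R" "{0} \<in> Ra.basic g"
    "\<And>P'. P' \<in> Ra.basic g \<Longrightarrow> \<alpha> P' = prime_fraction R P' a g"
    using Ra.section_local[OF V(1) \<alpha> V(2)] by blast
  have g: "g \<notin> {0}" using a(3) by (simp add: Ra.mem_basic)
  have "{0} \<in> preim (Spec field_ring) incl V" using preim_incl V by simp
  from incl.pull_Spec_map[OF this, of \<alpha>] have "pull incl V \<alpha> {0} = fraction_map field_ring
      (carrier field_ring - {0}) (\<lambda>x. x) (\<alpha> (incl.contraction {0}))" .
  also have "\<alpha> (incl.contraction {0}) = prime_fraction R (incl.contraction {0}) a g"
    unfolding contraction_zero by (rule a(4)[OF a(3)])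
  also have "fraction_map field_ring (carrier field_ring - {0}) (\<lambda>x. x) \<dots> = prime_fraction field_ring {0} a g"
    by (rule incl.fraction_map_prime[OF Kf.zero_prime a(1,2) g])
  finally have "Kf.generic_value (pull incl V \<alpha>) = a / g"
    using Kf.fraction_value_fraction[OF Kf.zero_prime, of a g] g by (simp add: Kf.generic_value_def)
  moreover have "generic_value \<alpha> = a / g"
    using a(4)[OF a(3)] fraction_value_fraction_D[OF zero_prime, of a g] g a
    by (simp add: generic_value_def R_simps)
  ultimately show ?thesis by simp
qed

text \<open>The generic value identifies both stalks with \<open>K\<close>, and pulling back along
  the inclusion preserves it. This provides the bijectivity assumed in
  \<open>tensor_iso\<close>.\<close>

lemma generic_stalk_bij:
  "bij_betw (stalk_map (Spec field_ring) incl {0}) (carrier (stalk (Spec R) {0}))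
     (carrier (stalk (Spec field_ring) {0}))"
proof -
  have z: "{0} \<in> points (Spec field_ring)" by (simp add: points_Spec_field)
  have sm: "stalk_map (Spec field_ring) incl {0} (germ (Spec R) {0} V \<alpha>) =
      germ (Spec field_ring) {0} (preim (Spec field_ring) incl V) (pull incl V \<alpha>)"
    if "Ra.opn V" "{0} \<in> V" "\<alpha> \<in> carrier (sec (Spec R) V)" for V \<alpha>
    using im.stalk_map_germ[OF z, of V \<alpha>] that by (simp add: pt_incl)
  have z': "{0} \<in> preim (Spec field_ring) incl V" if "{0} \<in> V" for V using preim_incl[OF that] by simp
  have geq: "germ (Spec field_ring) {0} (preim (Spec field_ring) incl V) (pull incl V \<alpha>) =
      germ (Spec field_ring) {0} W \<beta> \<longleftrightarrow> generic_value \<alpha> = Kf.generic_value \<beta>"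
    if V: "Ra.opn V" "{0} \<in> V" "\<alpha> \<in> carrier (sec (Spec R) V)"
      and W: "Kf.Ra.opn W" "{0} \<in> W" "\<beta> \<in> carrier (sec (Spec field_ring) W)" for V W \<alpha> \<beta>
    using Kf.generic_germ_eq_iff[OF im.opn_preim[OF V(1)] z'[OF V(2)] im.pull_closed[OF V(1,3)] W]
      generic_value_pull_incl[OF V] by simp
  show ?thesis
    unfolding bij_betw_def
  proof
    show "inj_on (stalk_map (Spec field_ring) incl {0}) (carrier (stalk (Spec R) {0}))"
    proof (rule inj_onI)
      fix x y assume xy: "x \<in> carrier (stalk (Spec R) {0})" "y \<in> carrier (stalk (Spec R) {0})"
        and eq: "stalk_map (Spec field_ring) incl {0} x = stalk_map (Spec field_ring) incl {0} y"
      obtain V \<alpha> where V: "Ra.opn V" "{0} \<in> V" "\<alpha> \<in> carrier (sec (Spec R) V)" "x = germ (Spec R) {0} V \<alpha>"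
        using xy(1) by (rule Ra.Sp.stalkE)
      obtain W \<beta> where W: "Ra.opn W" "{0} \<in> W" "\<beta> \<in> carrier (sec (Spec R) W)" "y = germ (Spec R) {0} W \<beta>"
        using xy(2) by (rule Ra.Sp.stalkE)
      have "germ (Spec field_ring) {0} (preim (Spec field_ring) incl V) (pull incl V \<alpha>) =
          germ (Spec field_ring) {0} (preim (Spec field_ring) incl W) (pull incl W \<beta>)"
        using eq unfolding V(4) W(4) sm[OF V(1-3)] sm[OF W(1-3)] .
      then have "generic_value \<alpha> = generic_value \<beta>"
        using geq[OF V(1-3) im.opn_preim[OF W(1)] z'[OF W(2)] im.pull_closed[OF W(1,3)]]
          generic_value_pull_incl[OF W(1-3)] by simp
      then show "x = y" unfolding V(4) W(4) using generic_germ_eq_iff[OF V(1-3) W(1-3)] by simp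
    qed
    show "stalk_map (Spec field_ring) incl {0} ` carrier (stalk (Spec R) {0}) =
        carrier (stalk (Spec field_ring) {0})"
    proof
      show "stalk_map (Spec field_ring) incl {0} ` carrier (stalk (Spec R) {0}) \<subseteq>
          carrier (stalk (Spec field_ring) {0})"
        using ring_hom_memE(1)[OF im.stalk_map_hom[OF z]] unfolding pt_incl by blast
      show "carrier (stalk (Spec field_ring) {0}) \<subseteq>
          stalk_map (Spec field_ring) incl {0} ` carrier (stalk (Spec R) {0})"
      proof
        fix y assume "y \<in> carrier (stalk (Spec (field_ring :: 'a ring)) {0})"
        then obtain W \<beta> where W: "Kf.Ra.opn W" "{0} \<in> W" "\<beta> \<in> carrier (sec (Spec field_ring) W)"
          "y = germ (Spec field_ring) {0} W \<beta>" by (rule Kf.Ra.Sp.stalkE)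
        obtain V \<alpha> where V: "Ra.opn V" "{0} \<in> V" "\<alpha> \<in> carrier (sec (Spec R) V)"
          "generic_value \<alpha> = Kf.generic_value \<beta>" by (rule generic_value_surj)
        have "y = stalk_map (Spec field_ring) incl {0} (germ (Spec R) {0} V \<alpha>)"
          using geq[OF V(1-3) W(1-3)] V(4) unfolding sm[OF V(1-3)] W(4) by simp
        then show "y \<in> stalk_map (Spec field_ring) incl {0} ` carrier (stalk (Spec R) {0})"
          using Ra.Sp.germ_in_stalk[OF V(1-3)] by blast
      qed
    qed
  qed
qed

lemma nat_elt_unit:
  assumes "n > 0"
  shows "nat_elt (stalk (Spec R) {0}) n \<in> Units (stalk (Spec R) {0})"
proof -
  let ?P = "points (Spec R)"
  have o: "Ra.opn ?P" by simp
  have c: "nat_elt R n \<in> carrier R" using Rd.nat_elt_closed .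
  have "germ (Spec R) {0} ?P (nat_elt (sec (Spec R) ?P) n) = nat_elt (stalk (Spec R) {0}) n"
    using cring.axioms(1)[OF Ra.Sp.cring_sec[OF o]] cring.axioms(1)[OF Ra.Sp.stalk_cring[OF generic_point]]
      Ra.Sp.germ_hom[OF o generic_point] by (rule nat_elt_hom)
  moreover have "Spec_global_section R (nat_elt R n) = nat_elt (sec (Spec R) ?P) n"
    using Rd.ring_axioms cring.axioms(1)[OF Ra.Sp.cring_sec[OF o]] Ra.global_section_hom
    by (rule nat_elt_hom)
  moreover have "Ra.Sp.unit_at {0} ?P (Spec_global_section R (nat_elt R n))"
    using Ra.unit_at_global_section[OF generic_point c] assms by (simp add: nat_elt_R)
  ultimately show ?thesis
    using Ra.Sp.germ_Units_iff[OF o generic_point Ra.global_section_closed[OF c]] by simp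
qed

end

section \<open>The generic fibre of a model\<close>

text \<open>Instantiated twice: for the integral model over the ring of integers and, in
  \<open>variety_over\<close>, for \<open>U\<close> over \<open>K\<close> itself.\<close>

locale model = number_subring D R for D :: "'k::field_char_0 set" and R :: "'k ring" +
  fixes \<UU> :: "('q, 'b) ringed_space"
    and f :: "('q, 'k set, 'b, 'k set \<Rightarrow> ('k \<times> 'k) set) ringed_map"
  assumes local_model: "local_space \<UU>" and f_morphism: "morphism \<UU> (Spec R) f"
begin

sublocale fm: ringed_map_hom \<UU> "Spec R" f
  using f_morphism morphism_iff[OF local_model Ra.local_space_Spec] by blast

abbreviation "cls x \<equiv> stalk_tensor_class \<UU> (Spec field_ring) (Spec R) f incl x {0}"
abbreviation "ten x \<equiv> stalk_tensor \<UU> (Spec field_ring) (Spec R) f incl x {0}"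
abbreviation "K_points \<equiv> fibre_points \<UU> (Spec field_ring) (Spec R) f incl"
abbreviation "K_basic \<equiv> fibre_basic_open \<UU> (Spec field_ring) (Spec R) f incl"
abbreviation "K_fibre \<equiv> fibre_product \<UU> (Spec field_ring) (Spec R) f incl"
abbreviation "K_fst \<equiv> fibre_fst \<UU> (Spec field_ring) (Spec R) f incl"
abbreviation "K_lists V W \<equiv> lists (carrier (sec \<UU> V) \<times> carrier (sec (Spec (field_ring :: 'k ring)) W))"

definition generic :: "'q \<Rightarrow> bool" where
  "generic x \<longleftrightarrow> x \<in> points \<UU> \<and> pt f x = {0}"

text \<open>The maximal ideal of the stalk carried into the tensor product; by
  \<open>K_points_iff\<close> it is the one prime that gives a point of the fibre over
  \<open>x\<close>.\<close>

definition gen_ideal where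
  "gen_ideal x = (\<lambda>a. cls x [(a, \<one>\<^bsub>stalk (Spec (field_ring :: 'k ring)) {0}\<^esub>)]) ` the_maximal_ideal (stalk \<UU> x)"

abbreviation "gen_point x \<equiv> (x, {0} :: 'k set, gen_ideal x)"

text \<open>The element of the stalk of the model for which a list of tensors stands.\<close>

definition coll where
  "coll x = tensor_iso.collapse (stalk (Spec R) {0}) (stalk \<UU> x) (stalk_map \<UU> f x)
     (stalk_map (Spec field_ring) incl {0})"

abbreviation "germs V W x t \<equiv> map (\<lambda>(a, b). (germ \<UU> x V a, germ (Spec (field_ring :: 'k ring)) {0} W b)) t"

lemma Kf_generic: "{0} \<in> points (Spec (field_ring :: 'k ring))"
  by (simp add: points_Spec_field)

lemma tensor_iso_at:
  assumes "generic x"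
  shows "tensor_iso (stalk (Spec R) {0}) (stalk \<UU> x) (stalk (Spec field_ring) {0}) (stalk_map \<UU> f x)
    (stalk_map (Spec field_ring) incl {0})"
proof (intro tensor_iso.intro tensor_iso_axioms.intro)
  have x: "x \<in> points \<UU>" "pt f x = {0}" using assms by (auto simp: generic_def)
  show "cring (stalk (Spec R) {0})" by (rule Ra.Sp.stalk_cring[OF generic_point])
  show "cring (stalk \<UU> x)" by (rule fm.X.stalk_cring[OF x(1)])
  show "cring (stalk (Spec (field_ring :: 'k ring)) {0})" by (rule Kf.Ra.Sp.stalk_cring[OF Kf_generic])
  show "stalk_map \<UU> f x \<in> ring_hom (stalk (Spec R) {0}) (stalk \<UU> x)"
    using fm.stalk_map_hom[OF x(1)] unfolding x(2) .
  show "stalk_map (Spec field_ring) incl {0} \<in> ring_hom (stalk (Spec R) {0}) (stalk (Spec field_ring) {0})"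
    using im.stalk_map_hom[OF Kf_generic] unfolding pt_incl .
  show "bij_betw (stalk_map (Spec field_ring) incl {0}) (carrier (stalk (Spec R) {0}))
      (carrier (stalk (Spec field_ring) {0}))" by (rule generic_stalk_bij)
qed

lemma max_ideal_iff:
  assumes "x \<in> points \<UU>" "a \<in> carrier (stalk \<UU> x)"
  shows "a \<in> the_maximal_ideal (stalk \<UU> x) \<longleftrightarrow> a \<notin> Units (stalk \<UU> x)"
  using local_model assms by (intro mem_the_maximal_ideal_iff) (auto simp: local_space_def)

lemma max_ideal_prime:
  assumes "x \<in> points \<UU>"
  shows "primeideal (the_maximal_ideal (stalk \<UU> x)) (stalk \<UU> x)"
proof -
  interpret cring "stalk \<UU> x" by (rule fm.X.stalk_cring[OF assms])
  have l: "local_ring (stalk \<UU> x)" using local_model assms by (auto simp: local_space_def)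
  have "maximalideal (the_maximal_ideal (stalk \<UU> x)) (stalk \<UU> x)"
    unfolding the_maximal_ideal_def using l unfolding local_ring_def by (elim conjE) (rule theI')
  then show ?thesis by (rule maximalideal_prime)
qed

text \<open>The locale \<open>tensor_iso\<close> is interpreted anew at every point, so its facts
  are collected here in the notation of the fibre product.\<close>

lemma generic_data:
  assumes "generic x"
  defines "T \<equiv> ten x"
  defines "tens \<equiv> tensor_iso.tens (stalk (Spec R) {0}) (stalk \<UU> x) (stalk (Spec field_ring) {0})
     (stalk_map \<UU> f x) (stalk_map (Spec field_ring) incl {0})"
  shows "cring (ten x)" and "tens \<in> ring_iso (stalk \<UU> x) (ten x)"
    and "\<And>xs. set xs \<subseteq> carrier (stalk \<UU> x) \<times> carrier (stalk (Spec field_ring) {0}) \<Longrightarrow> cls x xs = tens (coll x xs)"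
    and "\<And>a. cls x [(a, \<one>\<^bsub>stalk (Spec field_ring) {0}\<^esub>)] = tens a"
    and "\<one>\<^bsub>ten x\<^esub> = tens \<one>\<^bsub>stalk \<UU> x\<^esub>"
    and "\<And>xs. set xs \<subseteq> carrier (stalk \<UU> x) \<times> carrier (stalk (Spec field_ring) {0}) \<Longrightarrow> coll x xs \<in> carrier (stalk \<UU> x)"
    and "gen_ideal x = tens ` the_maximal_ideal (stalk \<UU> x)"
    and "carrier (ten x) = tens ` carrier (stalk \<UU> x)"
    and "primeideal (gen_ideal x) (ten x)"
proof -
  interpret ti: tensor_iso "stalk (Spec R) {0}" "stalk \<UU> x" "stalk (Spec field_ring) {0}" "stalk_map \<UU> f x"
    "stalk_map (Spec field_ring) incl {0}" by (rule tensor_iso_at[OF assms(1)])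
  have x: "x \<in> points \<UU>" "pt f x = {0}" using assms by (auto simp: generic_def)
  have T: "ten x = ti.T" by (simp add: stalk_tensor_def stalk_algebra_def x(2))
  have c: "cls x = ti.cls" by (simp add: stalk_tensor_class_def stalk_algebra_def x(2))
  show "cring (ten x)" unfolding T by (rule ti.T_cring)
  show "tens \<in> ring_iso (stalk \<UU> x) (ten x)" unfolding T tens_def by (rule ti.tens_iso)
  show "cls x xs = tens (coll x xs)"
    if "set xs \<subseteq> carrier (stalk \<UU> x) \<times> carrier (stalk (Spec field_ring) {0})" for xs
    unfolding c tens_def coll_def using that by (rule ti.cls_tens)
  show ct: "cls x [(a, \<one>\<^bsub>stalk (Spec field_ring) {0}\<^esub>)] = tens a" for a
    unfolding c tens_def ti.tens_def ..
  show "\<one>\<^bsub>ten x\<^esub> = tens \<one>\<^bsub>stalk \<UU> x\<^esub>" unfolding T tens_def by (rule ti.tens_one)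
  show "coll x xs \<in> carrier (stalk \<UU> x)"
    if "set xs \<subseteq> carrier (stalk \<UU> x) \<times> carrier (stalk (Spec field_ring) {0})" for xs
    unfolding coll_def using that by (rule ti.collapse_closed)
  show g: "gen_ideal x = tens ` the_maximal_ideal (stalk \<UU> x)" unfolding gen_ideal_def ct ..
  show "carrier (ten x) = tens ` carrier (stalk \<UU> x)" unfolding T tens_def by (rule ti.carrier_T)
  show "primeideal (gen_ideal x) (ten x)"
    unfolding g T tens_def using max_ideal_prime[OF x(1)] by (rule ti.tens_prime)
qed

lemma gen_ideal_contraction:
  assumes x: "generic x"
  shows "{a \<in> carrier (stalk \<UU> x). cls x [(a, \<one>\<^bsub>stalk (Spec field_ring) {0}\<^esub>)] \<in> gen_ideal x} =
    the_maximal_ideal (stalk \<UU> x)"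
proof -
  note g = generic_data[OF x]
  let ?m = "the_maximal_ideal (stalk \<UU> x)"
  have x': "x \<in> points \<UU>" using x by (simp add: generic_def)
  have sub: "?m \<subseteq> carrier (stalk \<UU> x)"
    using max_ideal_prime[OF x'] by (meson additive_subgroup.a_subset ideal.axioms(1) primeideal.axioms(1))
  show ?thesis
    unfolding g(4,7) using sub ring_iso_memE(5)[OF g(2)] by (auto simp: bij_betw_def inj_on_def)
qed

lemma gen_ideal_mem:
  assumes "generic x" "a \<in> carrier (stalk \<UU> x)"
  shows "cls x [(a, \<one>\<^bsub>stalk (Spec field_ring) {0}\<^esub>)] \<in> gen_ideal x \<longleftrightarrow> a \<in> the_maximal_ideal (stalk \<UU> x)"
  unfolding gen_ideal_contraction[OF assms(1), symmetric] using assms(2) by simp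

text \<open>As \<open>tens\<close> is an isomorphism, the contraction to the stalk of the model
  determines the prime. Conversely the contraction to the stalk of \<open>Spec K\<close> is the
  maximal ideal, since that stalk is a field and its nonzero elements go to units.\<close>

lemma K_points_iff: "p \<in> K_points \<longleftrightarrow> (\<exists>x. generic x \<and> p = gen_point x)"
proof
  assume "p \<in> K_points"
  then obtain x y P where p: "p = (x, y, P)" and x: "x \<in> points \<UU>" and y: "y \<in> points (Spec (field_ring :: 'k ring))"
    and xy: "pt f x = pt incl y"
    and P: "primeideal P (stalk_tensor \<UU> (Spec field_ring) (Spec R) f incl x y)"
    "{a \<in> carrier (stalk \<UU> x). stalk_tensor_class \<UU> (Spec field_ring) (Spec R) f incl x y
       [(a, \<one>\<^bsub>stalk (Spec field_ring) y\<^esub>)] \<in> P} = the_maximal_ideal (stalk \<UU> x)"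
    unfolding fibre_points_def by blast
  have y0: "y = {0}" using y by (simp add: points_Spec_field)
  have x0: "generic x" using x xy unfolding y0 pt_incl by (simp add: generic_def)
  note g = generic_data[OF x0]
  have "P \<subseteq> carrier (ten x)"
    using P(1) unfolding y0 by (meson additive_subgroup.a_subset ideal.axioms(1) primeideal.axioms(1))
  moreover note P(2)[unfolded y0 g(4)]
  ultimately have "P = gen_ideal x" unfolding g(7,8) by blast
  then show "\<exists>x. generic x \<and> p = gen_point x" using x0 p y0 by blast
next
  assume "\<exists>x. generic x \<and> p = gen_point x"
  then obtain x where x: "generic x" and p: "p = gen_point x" by blast
  note g = generic_data[OF x]
  have x': "x \<in> points \<UU>" "pt f x = {0}" using x by (auto simp: generic_def)
  interpret ti: tensor_iso "stalk (Spec R) {0}" "stalk \<UU> x" "stalk (Spec field_ring) {0}" "stalk_map \<UU> f x"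
    "stalk_map (Spec field_ring) incl {0}" by (rule tensor_iso_at[OF x])
  let ?K = "stalk (Spec (field_ring :: 'k ring)) {0}"
  have lK: "local_ring ?K" by (rule Kf.Ra.stalk_local_ring[OF Kf_generic])
  interpret tr: ring_hom_ring ?K "stalk \<UU> x" ti.transfer
    by (intro ring_hom_ringI2 ti.B.ring_axioms ti.A.ring_axioms ti.transfer_hom)
  have "cls x [(\<one>\<^bsub>stalk \<UU> x\<^esub>, b)] \<in> gen_ideal x \<longleftrightarrow> b \<in> the_maximal_ideal ?K"
    if b: "b \<in> carrier ?K" for b
  proof -
    have 1: "coll x [(\<one>\<^bsub>stalk \<UU> x\<^esub>, b)] = ti.transfer b"
      using b by (simp add: coll_def ti.transfer_closed)
    have "cls x [(\<one>\<^bsub>stalk \<UU> x\<^esub>, b)] = cls x [(ti.transfer b, \<one>\<^bsub>?K\<^esub>)]"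
      using g(3)[of "[(\<one>\<^bsub>stalk \<UU> x\<^esub>, b)]"] b unfolding 1 g(4) by simp
    then have "cls x [(\<one>\<^bsub>stalk \<UU> x\<^esub>, b)] \<in> gen_ideal x \<longleftrightarrow> ti.transfer b \<in> the_maximal_ideal (stalk \<UU> x)"
      using gen_ideal_mem[OF x ti.transfer_closed[OF b]] by (simp only:)
    also have "\<dots> \<longleftrightarrow> ti.transfer b \<notin> Units (stalk \<UU> x)"
      using max_ideal_iff[OF x'(1) ti.transfer_closed[OF b]] .
    also have "\<dots> \<longleftrightarrow> b \<notin> Units ?K"
    proof
      assume u: "ti.transfer b \<notin> Units (stalk \<UU> x)"
      show "b \<notin> Units ?K"
      proof
        assume "b \<in> Units ?K"
        then obtain c where c: "c \<in> carrier ?K" "b \<otimes>\<^bsub>?K\<^esub> c = \<one>\<^bsub>?K\<^esub>" by (auto simp: Units_def)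
        then have e: "ti.transfer b \<otimes>\<^bsub>stalk \<UU> x\<^esub> ti.transfer c = \<one>\<^bsub>stalk \<UU> x\<^esub>"
          using ti.transfer_simps(1)[OF b c(1)] ti.transfer_simps(3) by simp
        have "ti.transfer b \<in> Units (stalk \<UU> x)"
          unfolding Units_def using e ti.transfer_closed[OF b] ti.transfer_closed[OF c(1)]
            ti.A.m_comm[of "ti.transfer b" "ti.transfer c"] by auto
        then show False using u by blast
      qed
    next
      \<comment> \<open>The stalk of \<open>Spec K\<close> is a field: a nonunit has generic value
        zero, so it is the zero germ.\<close>
      assume nb: "b \<notin> Units ?K"
      obtain W \<beta> where W: "Kf.Ra.opn W" "{0} \<in> W" "\<beta> \<in> carrier (sec (Spec field_ring) W)"
        "b = germ (Spec field_ring) {0} W \<beta>" using b by (rule Kf.Ra.Sp.stalkE)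
      have "Kf.generic_value \<beta> = 0"
        using nb Kf.unit_at_generic_iff[OF W(1-3)] Kf.Ra.Sp.germ_Units_iff[OF W(1-3)] W(4) by simp
      moreover have "Kf.generic_value \<zero>\<^bsub>sec (Spec (field_ring :: 'k ring)) W\<^esub> = 0"
        using ring_hom_zero[OF Kf.generic_value_hom[OF W(1,2)] cring.axioms(1)[OF Kf.Ra.Sp.cring_sec[OF W(1)]]
          Kf.Rd.ring_axioms] by (simp add: Kf.R_simps)
      ultimately have "b = \<zero>\<^bsub>?K\<^esub>"
        using Kf.generic_germ_eq_iff[OF W(1-3) W(1,2) Kf.Ra.Sp.sec_zero_closed[OF W(1)]] W(4)
          Kf.Ra.Sp.germ_zero[OF W(1,2)] by simp
      then have "ti.transfer b = \<zero>\<^bsub>stalk \<UU> x\<^esub>" by simp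
      moreover have "\<zero>\<^bsub>stalk \<UU> x\<^esub> \<in> the_maximal_ideal (stalk \<UU> x)"
        using max_ideal_prime[OF x'(1)]
        by (meson additive_subgroup.zero_closed ideal.axioms(1) primeideal.axioms(1))
      ultimately show "ti.transfer b \<notin> Units (stalk \<UU> x)"
        using max_ideal_iff[OF x'(1), of "\<zero>\<^bsub>stalk \<UU> x\<^esub>"] by simp
    qed
    also have "\<dots> \<longleftrightarrow> b \<in> the_maximal_ideal ?K" using mem_the_maximal_ideal_iff[OF lK b] by simp
    finally show ?thesis .
  qed
  moreover have "the_maximal_ideal ?K \<subseteq> carrier ?K"
  proof -
    have "maximalideal (the_maximal_ideal ?K) ?K"
      unfolding the_maximal_ideal_def using lK unfolding local_ring_def by (elim conjE) (rule theI')
    then show ?thesis by (meson additive_subgroup.a_subset ideal.axioms(1) maximalideal.axioms(1))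
  qed
  ultimately have "{b \<in> carrier ?K. cls x [(\<one>\<^bsub>stalk \<UU> x\<^esub>, b)] \<in> gen_ideal x} = the_maximal_ideal ?K"
    by (intro subset_antisym subsetI) (auto simp only: mem_Collect_eq subset_iff)
  then show "p \<in> K_points"
    unfolding p fibre_points_def
    using x' Kf_generic pt_incl g(9) gen_ideal_contraction[OF x] by simp
qed

text \<open>Over the generic point the stalk receives a homomorphism from the stalk of
  \<open>Spec R\<close> at zero, where positive integers are units.\<close>

lemma nat_elt_stalk_unit:
  assumes "generic x" "n > 0"
  shows "nat_elt (stalk \<UU> x) n \<in> Units (stalk \<UU> x)"
proof -
  interpret ti: tensor_iso "stalk (Spec R) {0}" "stalk \<UU> x" "stalk (Spec field_ring) {0}" "stalk_map \<UU> f x"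
    "stalk_map (Spec field_ring) incl {0}" by (rule tensor_iso_at[OF assms(1)])
  let ?h = "stalk_map \<UU> f x" and ?S = "stalk (Spec R) {0}"
  obtain c where c: "c \<in> carrier ?S" "nat_elt ?S n \<otimes>\<^bsub>?S\<^esub> c = \<one>\<^bsub>?S\<^esub>"
    using nat_elt_unit[OF assms(2)] by (auto simp: Units_def)
  note h = ring_hom_memE[OF ti.hA]
  have "?h (nat_elt ?S n) = nat_elt (stalk \<UU> x) n"
    by (rule nat_elt_hom[OF ti.R.ring_axioms ti.A.ring_axioms ti.hA])
  then have "nat_elt (stalk \<UU> x) n \<otimes>\<^bsub>stalk \<UU> x\<^esub> ?h c = \<one>\<^bsub>stalk \<UU> x\<^esub>"
    using h(2)[OF ti.R.nat_elt_closed c(1), of n] c(2) h(4) by simp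
  then show ?thesis
    unfolding Units_def using ti.A.nat_elt_closed[of n] h(1)[OF c(1)]
      ti.A.m_comm[of "nat_elt (stalk \<UU> x) n" "?h c"] by auto
qed

end

section \<open>Tensors with \<open>K\<close> as sections of the model up to integers\<close>

context model begin

lemma germs_closed:
  assumes "fm.X.opn V" "x \<in> V" "Kf.Ra.opn W" "{0} \<in> W" "t \<in> K_lists V W"
  shows "set (germs V W x t) \<subseteq> carrier (stalk \<UU> x) \<times> carrier (stalk (Spec field_ring) {0})"
proof
  fix z assume "z \<in> set (germs V W x t)"
  then obtain a b where ab: "(a, b) \<in> set t" "z = (germ \<UU> x V a, germ (Spec field_ring) {0} W b)" by auto
  then have "a \<in> carrier (sec \<UU> V)" "b \<in> carrier (sec (Spec field_ring) W)" using assms(5) by auto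
  then show "z \<in> carrier (stalk \<UU> x) \<times> carrier (stalk (Spec field_ring) {0})"
    unfolding ab(2) using fm.X.germ_in_stalk[OF assms(1,2)] Kf.Ra.Sp.germ_in_stalk[OF assms(3,4)] by simp
qed

text \<open>Induction on the list. For a pair \<open>(a, b)\<close> some positive multiple of the
  generic value of \<open>b\<close> is an element \<open>c\<close> of \<open>D\<close>, and the
  pullback of \<open>c\<close> by \<open>f\<close> is a section of the model. One \<open>n\<close>
  and one \<open>\<beta>\<close> serve all generic points of \<open>V\<close>, which is what makes
  them usable on neighbourhoods.\<close>

lemma clear_denominators:
  assumes V: "fm.X.opn V" and W: "Kf.Ra.opn W" "{0} \<in> W" and t: "t \<in> K_lists V W"
  shows "\<exists>n>0. \<exists>\<beta>\<in>carrier (sec \<UU> V). \<forall>x\<in>V. generic x \<longrightarrow>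
    nat_elt (stalk \<UU> x) n \<otimes>\<^bsub>stalk \<UU> x\<^esub> coll x (germs V W x t) = germ \<UU> x V \<beta>"
  using t
proof (induction t rule: list.induct)
  case Nil
  have "nat_elt (stalk \<UU> x) 1 \<otimes>\<^bsub>stalk \<UU> x\<^esub> coll x (germs V W x []) = germ \<UU> x V \<zero>\<^bsub>sec \<UU> V\<^esub>"
    if x: "x \<in> V" "generic x" for x
  proof -
    interpret ti: tensor_iso "stalk (Spec R) {0}" "stalk \<UU> x" "stalk (Spec field_ring) {0}" "stalk_map \<UU> f x"
      "stalk_map (Spec field_ring) incl {0}" by (rule tensor_iso_at[OF x(2)])
    show ?thesis
      using ti.A.nat_elt_closed[of 1] fm.X.germ_zero[OF V x(1)] by (simp add: coll_def)
  qed
  then show ?case using fm.X.sec_zero_closed[OF V] by (intro exI[of _ 1]) blast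
next
  case (Cons p t)
  obtain a b where p: "p = (a, b)" by (cases p)
  have ab: "a \<in> carrier (sec \<UU> V)" "b \<in> carrier (sec (Spec field_ring) W)" and t: "t \<in> K_lists V W"
    using Cons.prems unfolding p by auto
  obtain n \<beta> where n: "n > 0" "\<beta> \<in> carrier (sec \<UU> V)" and IH: "\<And>x. x \<in> V \<Longrightarrow> generic x \<Longrightarrow>
      nat_elt (stalk \<UU> x) n \<otimes>\<^bsub>stalk \<UU> x\<^esub> coll x (germs V W x t) = germ \<UU> x V \<beta>"
    using Cons.IH[OF t] by blast
  obtain m :: nat where m: "m > 0" "of_nat m * Kf.generic_value b \<in> D" using denominator by blast
  define c where "c = of_nat m * Kf.generic_value b"
  let ?SR = "points (Spec R)"
  have SR: "Ra.opn ?SR" "{0} \<in> ?SR" using generic_point by auto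
  have gc: "Spec_global_section R c \<in> carrier (sec (Spec R) ?SR)"
    using m(2) by (intro Ra.global_section_closed) (simp add: c_def R_simps)
  define fc where "fc = pull f ?SR (Spec_global_section R c)"
  have fc: "fc \<in> carrier (sec \<UU> (points \<UU>))"
    using fm.pull_closed[OF SR(1) gc] unfolding fc_def fm.preim_points .
  have Vsub: "V \<subseteq> points \<UU>" using V by (rule openin_subset)
  have top: "fm.X.opn (points \<UU>)" by simp
  have r: "res \<UU> (points \<UU>) V fc \<in> carrier (sec \<UU> V)" using fm.X.res_closed[OF top V Vsub fc] .
  interpret V: cring "sec \<UU> V" by (rule fm.X.cring_sec[OF V])
  \<comment> \<open>With \<open>m b\<close> equal to \<open>c\<close>, this is
    \<open>m n (a b + r) = n a c + m (n r)\<close>, where \<open>r\<close> is the rest of the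
    list.\<close>
  let ?\<gamma> = "nat_elt (sec \<UU> V) n \<otimes>\<^bsub>sec \<UU> V\<^esub> (a \<otimes>\<^bsub>sec \<UU> V\<^esub> res \<UU> (points \<UU>) V fc) \<oplus>\<^bsub>sec \<UU> V\<^esub>
      nat_elt (sec \<UU> V) m \<otimes>\<^bsub>sec \<UU> V\<^esub> \<beta>"
  have "?\<gamma> \<in> carrier (sec \<UU> V)" using r ab n V.nat_elt_closed by simp
  moreover have "nat_elt (stalk \<UU> x) (m * n) \<otimes>\<^bsub>stalk \<UU> x\<^esub> coll x (germs V W x (p # t)) = germ \<UU> x V ?\<gamma>"
    if x: "x \<in> V" "generic x" for x
  proof -
    interpret ti: tensor_iso "stalk (Spec R) {0}" "stalk \<UU> x" "stalk (Spec field_ring) {0}" "stalk_map \<UU> f x"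
      "stalk_map (Spec field_ring) incl {0}" by (rule tensor_iso_at[OF x(2)])
    have x': "x \<in> points \<UU>" "pt f x = {0}" using x by (auto simp: generic_def)
    let ?A = "stalk \<UU> x" and ?B = "stalk (Spec (field_ring :: 'k ring)) {0}"
    let ?gb = "germ (Spec field_ring) {0} W b"
    have gb: "?gb \<in> carrier ?B" using Kf.Ra.Sp.germ_in_stalk[OF W ab(2)] .
    have ga: "germ \<UU> x V a \<in> carrier ?A" using fm.X.germ_in_stalk[OF V x(1) ab(1)] .
    have cl: "coll x (germs V W x t) \<in> carrier ?A"
      using generic_data(6)[OF x(2) germs_closed[OF V x(1) W t]] .
    note gh = fm.X.germ_hom[OF V x(1)]
    have tg: "ti.transfer ?gb \<in> carrier ?A" using ti.transfer_closed[OF gb] .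
    \<comment> \<open>Both sides come from the germ of \<open>c\<close> at the zero ideal of
      \<open>Spec R\<close>. In the stalk of \<open>Spec K\<close> this germ becomes
      \<open>m\<close> times that of \<open>b\<close>, by comparing generic values, and
      \<open>transfer\<close> sends it on to its image in the stalk of the model.\<close>
    have key: "nat_elt ?A m \<otimes>\<^bsub>?A\<^esub> ti.transfer ?gb = germ \<UU> x V (res \<UU> (points \<UU>) V fc)"
    proof -
      interpret W: cring "sec (Spec (field_ring :: 'k ring)) W" by (rule Kf.Ra.Sp.cring_sec[OF W(1)])
      let ?mb = "nat_elt (sec (Spec (field_ring :: 'k ring)) W) m \<otimes>\<^bsub>sec (Spec field_ring) W\<^esub> b"
      have mb: "?mb \<in> carrier (sec (Spec field_ring) W)" using ab W.nat_elt_closed by simp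
      note gvh = Kf.generic_value_hom[OF W]
      have "Kf.generic_value (nat_elt (sec (Spec (field_ring :: 'k ring)) W) m) = of_nat m"
        using nat_elt_hom[OF W.ring_axioms Kf.Rd.ring_axioms gvh, of m] by (simp add: nat_elt_field)
      then have vmb: "Kf.generic_value ?mb = c"
        using ring_hom_memE(2)[OF gvh W.nat_elt_closed ab(2), of m] by (simp add: c_def Kf.R_simps)
      have z: "{0} \<in> preim (Spec field_ring) incl ?SR" using preim_incl[OF SR(2)] by simp
      have "nat_elt ?A m = ti.transfer (nat_elt ?B m)"
        by (rule nat_elt_hom[OF ti.B.ring_axioms ti.A.ring_axioms ti.transfer_hom, symmetric])
      then have "nat_elt ?A m \<otimes>\<^bsub>?A\<^esub> ti.transfer ?gb = ti.transfer (nat_elt ?B m \<otimes>\<^bsub>?B\<^esub> ?gb)"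
        using ti.transfer_simps(1)[OF ti.B.nat_elt_closed gb, of m] by simp
      also have "nat_elt ?B m \<otimes>\<^bsub>?B\<^esub> ?gb = germ (Spec field_ring) {0} W ?mb"
        using nat_elt_hom[OF W.ring_axioms ti.B.ring_axioms Kf.Ra.Sp.germ_hom[OF W], of m]
          Kf.Ra.Sp.germ_mult[OF W W.nat_elt_closed ab(2), of m] by simp
      also have "\<dots> = germ (Spec field_ring) {0} (preim (Spec field_ring) incl ?SR)
          (pull incl ?SR (Spec_global_section R c))"
        using Kf.generic_germ_eq_iff[OF W mb im.opn_preim[OF SR(1)] z im.pull_closed[OF SR(1) gc]]
          generic_value_pull_incl[OF SR gc] generic_value_global[OF m(2)[folded c_def]] vmb by simp
      also have "\<dots> = stalk_map (Spec field_ring) incl {0} (germ (Spec R) {0} ?SR (Spec_global_section R c))"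
        using im.stalk_map_germ[OF Kf_generic SR(1) _ gc] SR(2) unfolding pt_incl by simp
      also have "ti.transfer \<dots> = stalk_map \<UU> f x (germ (Spec R) {0} ?SR (Spec_global_section R c))"
        by (rule ti.transfer_hB[OF Ra.Sp.germ_in_stalk[OF SR gc]])
      also have "\<dots> = germ \<UU> x (points \<UU>) fc"
        using fm.stalk_map_germ[OF x'(1) SR(1) _ gc] SR(2) unfolding x'(2) fc_def fm.preim_points by simp
      also have "\<dots> = germ \<UU> x V (res \<UU> (points \<UU>) V fc)"
        by (rule fm.X.germ_res[OF top V Vsub x(1) fc, symmetric])
      finally show ?thesis .
    qed
    have ne: "germ \<UU> x V (nat_elt (sec \<UU> V) k) = nat_elt ?A k" for k
      by (rule nat_elt_hom[OF V.ring_axioms ti.A.ring_axioms gh])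
    have "coll x (germs V W x (p # t)) = germ \<UU> x V a \<otimes>\<^bsub>?A\<^esub> ti.transfer ?gb \<oplus>\<^bsub>?A\<^esub> coll x (germs V W x t)"
      by (simp add: p coll_def)
    then have "nat_elt ?A (m * n) \<otimes>\<^bsub>?A\<^esub> coll x (germs V W x (p # t)) =
        nat_elt ?A n \<otimes>\<^bsub>?A\<^esub> (germ \<UU> x V a \<otimes>\<^bsub>?A\<^esub> (nat_elt ?A m \<otimes>\<^bsub>?A\<^esub> ti.transfer ?gb)) \<oplus>\<^bsub>?A\<^esub>
        nat_elt ?A m \<otimes>\<^bsub>?A\<^esub> (nat_elt ?A n \<otimes>\<^bsub>?A\<^esub> coll x (germs V W x t))"
      using ga tg cl ti.A.nat_elt_closed by (simp add: ti.A.nat_elt_mult ti.A.r_distr ti.A.m_ac)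
    also have "\<dots> = nat_elt ?A n \<otimes>\<^bsub>?A\<^esub> (germ \<UU> x V a \<otimes>\<^bsub>?A\<^esub> germ \<UU> x V (res \<UU> (points \<UU>) V fc)) \<oplus>\<^bsub>?A\<^esub>
        nat_elt ?A m \<otimes>\<^bsub>?A\<^esub> germ \<UU> x V \<beta>"
      unfolding key IH[OF x] ..
    also have "\<dots> = germ \<UU> x V ?\<gamma>"
      using ring_hom_memE(2,3)[OF gh] r ab n V.nat_elt_closed by (simp add: ne[symmetric])
    finally show ?thesis .
  qed
  ultimately show ?case using m(1) n(1) by (intro exI[of _ "m * n"]) auto
qed

lemma unit_factor_iff:
  assumes "cring S" "u \<in> Units S" "a \<in> carrier S"
  shows "u \<otimes>\<^bsub>S\<^esub> a \<in> Units S \<longleftrightarrow> a \<in> Units S"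
proof -
  interpret S: cring S by fact
  have "a = inv\<^bsub>S\<^esub> u \<otimes>\<^bsub>S\<^esub> (u \<otimes>\<^bsub>S\<^esub> a)"
    using assms S.m_assoc[of "inv\<^bsub>S\<^esub> u" u a] by auto
  then show ?thesis using assms by (metis S.Units_inv_Units S.Units_m_closed)
qed

text \<open>The germ of \<open>\<beta>\<close> differs from the collapsed tensor by the factor
  \<open>n\<close>, which is a unit over the generic point.\<close>

lemma K_basic_iff:
  assumes V: "fm.X.opn V" and W: "Kf.Ra.opn W" "{0} \<in> W" and t: "t \<in> K_lists V W"
    and n: "n > 0" and \<beta>: "\<beta> \<in> carrier (sec \<UU> V)"
    and eq: "nat_elt (stalk \<UU> x) n \<otimes>\<^bsub>stalk \<UU> x\<^esub> coll x (germs V W x t) = germ \<UU> x V \<beta>"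
    and x: "generic x" "x \<in> V"
  shows "gen_point x \<in> K_basic V W t \<longleftrightarrow> fm.X.unit_at x V \<beta>"
proof -
  have x': "x \<in> points \<UU>" using x by (simp add: generic_def)
  note gc = germs_closed[OF V x(2) W t]
  note cl = generic_data(6)[OF x(1) gc]
  have tg: "tensor_germ \<UU> (Spec field_ring) (Spec R) f incl V W t x {0} =
      cls x [(coll x (germs V W x t), \<one>\<^bsub>stalk (Spec field_ring) {0}\<^esub>)]"
    unfolding tensor_germ_def generic_data(3)[OF x(1) gc] generic_data(4)[OF x(1)] ..
  have "gen_point x \<in> K_basic V W t \<longleftrightarrow>
      cls x [(coll x (germs V W x t), \<one>\<^bsub>stalk (Spec field_ring) {0}\<^esub>)] \<notin> gen_ideal x"
    unfolding fibre_basic_open_def using K_points_iff x W(2) tg by auto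
  also have "\<dots> \<longleftrightarrow> coll x (germs V W x t) \<in> Units (stalk \<UU> x)"
    unfolding gen_ideal_mem[OF x(1) cl] max_ideal_iff[OF x' cl] by simp
  also have "\<dots> \<longleftrightarrow> germ \<UU> x V \<beta> \<in> Units (stalk \<UU> x)"
    unfolding eq[symmetric]
    by (rule unit_factor_iff[OF fm.X.stalk_cring[OF x'] nat_elt_stalk_unit[OF x(1) n] cl, symmetric])
  also have "\<dots> \<longleftrightarrow> fm.X.unit_at x V \<beta>" by (rule fm.X.germ_Units_iff[OF V x(2) \<beta>])
  finally show ?thesis .
qed

lemma topo_K_fibre:
  "topo K_fibre = topology_generated_by {K_basic V W t |V W t. fm.X.opn V \<and> Kf.Ra.opn W \<and> t \<in> K_lists V W}"
  by (simp add: fibre_product_def space_of_local_families_def)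

text \<open>A basic open set of the fibre is the locus where a cleared tensor \<open>\<beta>\<close>
  is invertible, and invertibility at \<open>x\<close> persists on an open set of the model. Thus
  the fibre has no more open sets than those induced from the model.\<close>

lemma K_nbhd:
  assumes "openin (topo K_fibre) N" "generic x" "gen_point x \<in> N"
  shows "\<exists>V. fm.X.opn V \<and> x \<in> V \<and> (\<forall>x'\<in>V. generic x' \<longrightarrow> gen_point x' \<in> N)"
proof -
  have "generate_topology_on {K_basic V W t |V W t. fm.X.opn V \<and> Kf.Ra.opn W \<and> t \<in> K_lists V W} N"
    using assms(1) unfolding topo_K_fibre by (rule openin_topology_generated_by)
  then show ?thesis
    using assms(3)
  proof (induction rule: generate_topology_on.induct)
    case (Int a b)
    then obtain V W where "fm.X.opn V" "x \<in> V" "\<forall>x'\<in>V. generic x' \<longrightarrow> gen_point x' \<in> a"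
      "fm.X.opn W" "x \<in> W" "\<forall>x'\<in>W. generic x' \<longrightarrow> gen_point x' \<in> b" by auto
    then show ?case by (intro exI[of _ "V \<inter> W"]) auto
  next
    case (UN K)
    then show ?case by (meson UnionE UnionI)
  next
    case (Basis s)
    then obtain V W t where s: "s = K_basic V W t" and V: "fm.X.opn V" and W: "Kf.Ra.opn W" and t: "t \<in> K_lists V W"
      by blast
    have W0: "{0} \<in> W" and xV: "x \<in> V" using Basis(2) unfolding s fibre_basic_open_def by auto
    obtain n \<beta> where n: "n > 0" and \<beta>: "\<beta> \<in> carrier (sec \<UU> V)" and eq: "\<And>x. x \<in> V \<Longrightarrow> generic x \<Longrightarrow>
      nat_elt (stalk \<UU> x) n \<otimes>\<^bsub>stalk \<UU> x\<^esub> coll x (germs V W x t) = germ \<UU> x V \<beta>"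
      using clear_denominators[OF V W W0 t] by blast
    note iff = K_basic_iff[OF V W W0 t n \<beta> eq]
    have "fm.X.unit_at x V \<beta>" using iff[OF xV assms(2) assms(2) xV] Basis(2) s by simp
    then obtain M where M: "fm.X.opn M" "x \<in> M" "M \<subseteq> V"
      "\<exists>t\<in>carrier (sec \<UU> M). res \<UU> V M \<beta> \<otimes>\<^bsub>sec \<UU> M\<^esub> t = \<one>\<^bsub>sec \<UU> M\<^esub>"
      unfolding fm.X.unit_at_def by blast
    have "gen_point x' \<in> s" if x': "x' \<in> M" "generic x'" for x'
    proof -
      have v: "x' \<in> V" using x' M by blast
      have "fm.X.unit_at x' V \<beta>" unfolding fm.X.unit_at_def using M x' by blast
      then show ?thesis using iff[OF v x'(2) x'(2) v] s by simp
    qed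
    then show ?case using M by blast
  qed auto
qed

end

section \<open>Sections of the generic fibre near a point\<close>

context model begin

abbreviation "one_list V \<equiv> [(\<one>\<^bsub>sec \<UU> V\<^esub>, \<one>\<^bsub>sec (Spec (field_ring :: 'k ring)) {{0}}\<^esub>)]"

lemma K_open: "Kf.Ra.opn {{0} :: 'k set}"
  using openin_topspace[of "topo (Spec (field_ring :: 'k ring))"] by (simp only: points_Spec_field)

text \<open>The tensor of ones is a unit at every point, so the preimage of \<open>V\<close> under
  the projection is itself a basic open set.\<close>

lemma K_basic_one:
  assumes V: "fm.X.opn V"
  shows "K_basic V {{0}} (one_list V) = {p \<in> K_points. fst p \<in> V}"
proof -
  have 0: "{0} \<in> {{0} :: 'k set}" by simp
  have t: "one_list V \<in> K_lists V {{0}}"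
    using fm.X.sec_one_closed[OF V] Kf.Ra.Sp.sec_one_closed[OF K_open] by simp
  have "gen_point x \<in> K_basic V {{0}} (one_list V)" if x: "generic x" "x \<in> V" for x
  proof -
    interpret ti: tensor_iso "stalk (Spec R) {0}" "stalk \<UU> x" "stalk (Spec field_ring) {0}" "stalk_map \<UU> f x"
      "stalk_map (Spec field_ring) incl {0}" by (rule tensor_iso_at[OF x(1)])
    have "coll x (germs V {{0}} x (one_list V)) = \<one>\<^bsub>stalk \<UU> x\<^esub>"
      by (simp add: coll_def fm.X.germ_one[OF V x(2)] Kf.Ra.Sp.germ_one[OF K_open 0] ti.transfer_simps)
    then have eq: "nat_elt (stalk \<UU> x) 1 \<otimes>\<^bsub>stalk \<UU> x\<^esub> coll x (germs V {{0}} x (one_list V)) =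
        germ \<UU> x V \<one>\<^bsub>sec \<UU> V\<^esub>"
      by (simp add: fm.X.germ_one[OF V x(2)])
    interpret V: cring "sec \<UU> V" by (rule fm.X.cring_sec[OF V])
    have "res \<UU> V V \<one>\<^bsub>sec \<UU> V\<^esub> \<otimes>\<^bsub>sec \<UU> V\<^esub> \<one>\<^bsub>sec \<UU> V\<^esub> = \<one>\<^bsub>sec \<UU> V\<^esub>"
      by (simp add: fm.X.res_id[OF V V.one_closed])
    then have "fm.X.unit_at x V \<one>\<^bsub>sec \<UU> V\<^esub>"
      unfolding fm.X.unit_at_def using V x(2) V.one_closed by blast
    then show ?thesis
      using K_basic_iff[OF V K_open 0 t _ V.one_closed eq x] by simp
  qed
  then show ?thesis
    unfolding fibre_basic_open_def using K_points_iff by auto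
qed

lemma K_basic_one_mem:
  assumes "fm.X.opn V"
  shows "K_basic V {{0}} (one_list V) \<in> {K_basic V W t |V W t. fm.X.opn V \<and> Kf.Ra.opn W \<and> t \<in> K_lists V W}"
proof -
  have "one_list V \<in> K_lists V {{0}}"
    using fm.X.sec_one_closed[OF assms] Kf.Ra.Sp.sec_one_closed[OF K_open] by simp
  then show ?thesis using assms K_open by blast
qed

lemma points_K_fibre: "points K_fibre = K_points"
proof
  show "points K_fibre \<subseteq> K_points"
    unfolding topo_K_fibre topology_generated_by_topspace fibre_basic_open_def by blast
  have "fm.X.opn (points \<UU>)" by simp
  then have "K_basic (points \<UU>) {{0}} (one_list (points \<UU>)) \<subseteq> points K_fibre"
    unfolding topo_K_fibre topology_generated_by_topspace by (intro Union_upper K_basic_one_mem)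
  moreover have "K_points \<subseteq> {p \<in> K_points. fst p \<in> points \<UU>}"
    using K_points_iff by (auto simp: generic_def)
  ultimately show "K_points \<subseteq> points K_fibre" using K_basic_one[of "points \<UU>"] by auto
qed

lemma preim_K_fst: "preim K_fibre K_fst V = {p \<in> K_points. fst p \<in> V}"
  by (simp add: preim_def points_K_fibre fibre_fst_def)

lemma K_fst_open:
  assumes V: "fm.X.opn V"
  shows "openin (topo K_fibre) (preim K_fibre K_fst V)"
  unfolding preim_K_fst K_basic_one[OF V, symmetric] topo_K_fibre
  by (rule topology_generated_by_Basis[OF K_basic_one_mem[OF V]])

text \<open>Near the point \<open>s\<close> is a quotient of two tensors. Both become sections of
  the model after multiplication by a common \<open>n\<close>, which cancels in the quotient; the
  denominator is invertible at \<open>x\<close>, hence nearby, so the quotient is a section of the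
  model.\<close>

lemma local_section:
  assumes s: "s \<in> carrier (sec K_fibre (points K_fibre))" and x: "generic x"
  obtains V \<rho> where "fm.X.opn V" "x \<in> V" "\<rho> \<in> carrier (sec \<UU> V)"
    "res K_fibre (points K_fibre) (preim K_fibre K_fst V) s = pull K_fst V \<rho>"
proof -
  have p: "gen_point x \<in> points K_fibre" using x K_points_iff points_K_fibre by blast
  obtain N V W l t where N: "openin (topo K_fibre) N" "gen_point x \<in> N"
    and V: "fm.X.opn V" and W: "Kf.Ra.opn W" and l: "l \<in> K_lists V W" and t: "t \<in> K_lists V W"
    and sub: "N \<subseteq> K_basic V W t"
    and val: "\<forall>(x, y, P)\<in>N. s (x, y, P) = prime_fraction (stalk_tensor \<UU> (Spec field_ring) (Spec R) f incl x y) P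
      (tensor_germ \<UU> (Spec field_ring) (Spec R) f incl V W l x y) (tensor_germ \<UU> (Spec field_ring) (Spec R) f incl V W t x y)"
  proof -
    have "\<forall>p\<in>points K_fibre. \<exists>N. openin (topo K_fibre) N \<and> p \<in> N \<and> N \<subseteq> points K_fibre \<and>
      (\<exists>V W. fm.X.opn V \<and> Kf.Ra.opn W \<and> (\<exists>l\<in>K_lists V W. \<exists>t\<in>K_lists V W. N \<subseteq> K_basic V W t \<and>
        (\<forall>(x, y, P)\<in>N. s (x, y, P) = prime_fraction (stalk_tensor \<UU> (Spec field_ring) (Spec R) f incl x y) P
          (tensor_germ \<UU> (Spec field_ring) (Spec R) f incl V W l x y)
          (tensor_germ \<UU> (Spec field_ring) (Spec R) f incl V W t x y))))"
      using s unfolding topo_K_fibre by (simp add: fibre_product_def space_of_local_families_def)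
    then show thesis using that p by meson
  qed
  obtain V1 where V1: "fm.X.opn V1" "x \<in> V1" "\<And>x'. x' \<in> V1 \<Longrightarrow> generic x' \<Longrightarrow> gen_point x' \<in> N"
    using K_nbhd[OF N(1) x N(2)] by blast
  have pb: "gen_point x \<in> K_basic V W t" using N sub by blast
  then have W0: "{0} \<in> W" and xV: "x \<in> V" unfolding fibre_basic_open_def by auto
  obtain n1 \<nu> where n1: "n1 > 0" and \<nu>: "\<nu> \<in> carrier (sec \<UU> V)" and eq1: "\<And>x. x \<in> V \<Longrightarrow> generic x \<Longrightarrow>
      nat_elt (stalk \<UU> x) n1 \<otimes>\<^bsub>stalk \<UU> x\<^esub> coll x (germs V W x l) = germ \<UU> x V \<nu>"
    using clear_denominators[OF V W W0 l] by blast
  obtain n2 \<beta> where n2: "n2 > 0" and \<beta>: "\<beta> \<in> carrier (sec \<UU> V)" and eq2: "\<And>x. x \<in> V \<Longrightarrow> generic x \<Longrightarrow>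
      nat_elt (stalk \<UU> x) n2 \<otimes>\<^bsub>stalk \<UU> x\<^esub> coll x (germs V W x t) = germ \<UU> x V \<beta>"
    using clear_denominators[OF V W W0 t] by blast
  interpret V: cring "sec \<UU> V" by (rule fm.X.cring_sec[OF V])
  \<comment> \<open>Cross multiplication gives both tensors the same factor
    \<open>n = n1 * n2\<close>.\<close>
  define \<nu>' where "\<nu>' = nat_elt (sec \<UU> V) n2 \<otimes>\<^bsub>sec \<UU> V\<^esub> \<nu>"
  define \<beta>' where "\<beta>' = nat_elt (sec \<UU> V) n1 \<otimes>\<^bsub>sec \<UU> V\<^esub> \<beta>"
  define n where "n = n1 * n2"
  have n: "n > 0" using n1 n2 by (simp add: n_def)
  have c: "\<nu>' \<in> carrier (sec \<UU> V)" "\<beta>' \<in> carrier (sec \<UU> V)"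
    using \<nu> \<beta> V.nat_elt_closed by (auto simp: \<nu>'_def \<beta>'_def)
  have e: "nat_elt (stalk \<UU> x) n \<otimes>\<^bsub>stalk \<UU> x\<^esub> coll x (germs V W x l) = germ \<UU> x V \<nu>'"
    "nat_elt (stalk \<UU> x) n \<otimes>\<^bsub>stalk \<UU> x\<^esub> coll x (germs V W x t) = germ \<UU> x V \<beta>'"
    if x: "x \<in> V" "generic x" for x
  proof -
    have x': "x \<in> points \<UU>" using x by (simp add: generic_def)
    interpret A: cring "stalk \<UU> x" by (rule fm.X.stalk_cring[OF x'])
    note gh = fm.X.germ_hom[OF V x(1)]
    have ne: "germ \<UU> x V (nat_elt (sec \<UU> V) k) = nat_elt (stalk \<UU> x) k" for k
      by (rule nat_elt_hom[OF V.ring_axioms A.ring_axioms gh])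
    note cl = generic_data(6)[OF x(2) germs_closed[OF V x(1) W W0 l]] generic_data(6)[OF x(2) germs_closed[OF V x(1) W W0 t]]
    have "germ \<UU> x V \<nu>' = nat_elt (stalk \<UU> x) n2 \<otimes>\<^bsub>stalk \<UU> x\<^esub>
        (nat_elt (stalk \<UU> x) n1 \<otimes>\<^bsub>stalk \<UU> x\<^esub> coll x (germs V W x l))"
      unfolding eq1[OF x] \<nu>'_def ring_hom_memE(2)[OF gh V.nat_elt_closed \<nu>] ne ..
    then show "nat_elt (stalk \<UU> x) n \<otimes>\<^bsub>stalk \<UU> x\<^esub> coll x (germs V W x l) = germ \<UU> x V \<nu>'"
      using cl A.nat_elt_closed by (simp add: n_def A.nat_elt_mult A.m_ac)
    have "germ \<UU> x V \<beta>' = nat_elt (stalk \<UU> x) n1 \<otimes>\<^bsub>stalk \<UU> x\<^esub>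
        (nat_elt (stalk \<UU> x) n2 \<otimes>\<^bsub>stalk \<UU> x\<^esub> coll x (germs V W x t))"
      unfolding eq2[OF x] \<beta>'_def ring_hom_memE(2)[OF gh V.nat_elt_closed \<beta>] ne ..
    then show "nat_elt (stalk \<UU> x) n \<otimes>\<^bsub>stalk \<UU> x\<^esub> coll x (germs V W x t) = germ \<UU> x V \<beta>'"
      using cl A.nat_elt_closed by (simp add: n_def A.nat_elt_mult A.m_ac)
  qed
  have "fm.X.unit_at x V \<beta>'" using K_basic_iff[OF V W W0 t n c(2) e(2)[OF xV x] x xV] pb by simp
  then obtain V2 \<gamma> where V2: "fm.X.opn V2" "x \<in> V2" "V2 \<subseteq> V" and \<gamma>: "\<gamma> \<in> carrier (sec \<UU> V2)"
    "res \<UU> V V2 \<beta>' \<otimes>\<^bsub>sec \<UU> V2\<^esub> \<gamma> = \<one>\<^bsub>sec \<UU> V2\<^esub>"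
    unfolding fm.X.unit_at_def by blast
  interpret V2: cring "sec \<UU> V2" by (rule fm.X.cring_sec[OF V2(1)])
  \<comment> \<open>Over \<open>V1\<close> the quotient describes \<open>s\<close>; on
    \<open>V2\<close> its denominator \<open>\<beta>'\<close> has the inverse
    \<open>\<gamma>\<close>.\<close>
  let ?V = "V1 \<inter> V2"
  have oV: "fm.X.opn ?V" using V1(1) V2(1) by blast
  define \<rho>2 where "\<rho>2 = res \<UU> V V2 \<nu>' \<otimes>\<^bsub>sec \<UU> V2\<^esub> \<gamma>"
  have rc: "res \<UU> V V2 \<nu>' \<in> carrier (sec \<UU> V2)" "res \<UU> V V2 \<beta>' \<in> carrier (sec \<UU> V2)"
    using fm.X.res_closed[OF V V2(1,3)] c by auto
  have \<rho>2: "\<rho>2 \<in> carrier (sec \<UU> V2)" using rc \<gamma> by (simp add: \<rho>2_def)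
  define \<rho> where "\<rho> = res \<UU> V2 ?V \<rho>2"
  have \<rho>: "\<rho> \<in> carrier (sec \<UU> ?V)" unfolding \<rho>_def using fm.X.res_closed[OF V2(1) oV _ \<rho>2] by blast
  have key: "s (gen_point z) = prime_fraction (ten z) (gen_ideal z)
      (cls z [(germ \<UU> z ?V \<rho>, \<one>\<^bsub>stalk (Spec field_ring) {0}\<^esub>)]) \<one>\<^bsub>ten z\<^esub>"
    if z: "generic z" "z \<in> ?V" for z
  proof -
    have z': "z \<in> points \<UU>" "z \<in> V" "z \<in> V2" "z \<in> V1" using z V2(3) by (auto simp: generic_def)
    interpret A: cring "stalk \<UU> z" by (rule fm.X.stalk_cring[OF z'(1)])
    note g = generic_data[OF z(1)]
    interpret ms: mult_set "ten z" "carrier (ten z) - gen_ideal z" by (rule mult_set_primeideal[OF g(9)])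
    note gl = germs_closed[OF V z'(2) W W0 l] and gt = germs_closed[OF V z'(2) W W0 t]
    let ?l = "coll z (germs V W z l)" and ?t = "coll z (germs V W z t)" and ?r = "germ \<UU> z ?V \<rho>"
    let ?ten = "\<lambda>a. cls z [(a, \<one>\<^bsub>stalk (Spec (field_ring :: 'k ring)) {0}\<^esub>)]"
    have cl: "?l \<in> carrier (stalk \<UU> z)" "?t \<in> carrier (stalk \<UU> z)" "?r \<in> carrier (stalk \<UU> z)"
      using g(6)[OF gl] g(6)[OF gt] fm.X.germ_in_stalk[OF oV z(2) \<rho>] by auto
    have r2: "?r = germ \<UU> z V2 \<rho>2"
      unfolding \<rho>_def using fm.X.germ_res[OF V2(1) oV _ z(2) \<rho>2] by simp
    have gr: "germ \<UU> z V2 (res \<UU> V V2 \<nu>') = germ \<UU> z V \<nu>'" "germ \<UU> z V2 (res \<UU> V V2 \<beta>') = germ \<UU> z V \<beta>'"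
      using fm.X.germ_res[OF V V2(1,3) z'(3)] c by auto
    have "?r \<otimes>\<^bsub>stalk \<UU> z\<^esub> germ \<UU> z V \<beta>' = germ \<UU> z V2 (\<rho>2 \<otimes>\<^bsub>sec \<UU> V2\<^esub> res \<UU> V V2 \<beta>')"
      unfolding r2 gr(2)[symmetric] by (rule fm.X.germ_mult[OF V2(1) z'(3) \<rho>2 rc(2)])
    also have "\<rho>2 \<otimes>\<^bsub>sec \<UU> V2\<^esub> res \<UU> V V2 \<beta>' = res \<UU> V V2 \<nu>' \<otimes>\<^bsub>sec \<UU> V2\<^esub> (res \<UU> V V2 \<beta>' \<otimes>\<^bsub>sec \<UU> V2\<^esub> \<gamma>)"
      unfolding \<rho>2_def using rc \<gamma>(1) by (simp add: V2.m_ac)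
    also have "\<dots> = res \<UU> V V2 \<nu>'" unfolding \<gamma>(2) using rc by simp
    finally have "?r \<otimes>\<^bsub>stalk \<UU> z\<^esub> germ \<UU> z V \<beta>' = germ \<UU> z V \<nu>'" unfolding gr .
    then have "nat_elt (stalk \<UU> z) n \<otimes>\<^bsub>stalk \<UU> z\<^esub> ?l = nat_elt (stalk \<UU> z) n \<otimes>\<^bsub>stalk \<UU> z\<^esub> (?r \<otimes>\<^bsub>stalk \<UU> z\<^esub> ?t)"
      unfolding e(1)[OF z'(2) z(1), symmetric] e(2)[OF z'(2) z(1), symmetric]
      using cl A.nat_elt_closed[of n] by (simp add: A.m_lcomm)
    then have lt: "?l = ?r \<otimes>\<^bsub>stalk \<UU> z\<^esub> ?t"
      using nat_elt_stalk_unit[OF z(1) n] cl by (subst (asm) A.Units_l_cancel) auto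
    have tg: "tensor_germ \<UU> (Spec field_ring) (Spec R) f incl V W l z {0} = ?ten ?l"
      "tensor_germ \<UU> (Spec field_ring) (Spec R) f incl V W t z {0} = ?ten ?t"
      unfolding tensor_germ_def g(3)[OF gl] g(3)[OF gt] g(4) by auto
    have "s (gen_point z) = prime_fraction (ten z) (gen_ideal z) (?ten ?l) (?ten ?t)"
      using val V1(3)[OF z'(4) z(1)] tg by fastforce
    also have "\<dots> = prime_fraction (ten z) (gen_ideal z) (?ten ?r) \<one>\<^bsub>ten z\<^esub>"
    proof (rule ms.fraction_eqI)
      note iso = ring_iso_memE[OF g(2)]
      show "?ten ?l \<in> carrier (ten z)" "?ten ?r \<in> carrier (ten z)" unfolding g(4) using iso(1) cl by auto
      have "gen_point z \<in> K_basic V W t" using V1(3)[OF z'(4) z(1)] sub by blast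
      then have "?ten ?t \<notin> gen_ideal z" unfolding fibre_basic_open_def using tg(2) by simp
      then show "?ten ?t \<in> carrier (ten z) - gen_ideal z" unfolding g(4) using iso(1) cl by auto
      show "\<one>\<^bsub>ten z\<^esub> \<in> carrier (ten z) - gen_ideal z" by (rule ms.one_mem)
      show "?ten ?l \<otimes>\<^bsub>ten z\<^esub> \<one>\<^bsub>ten z\<^esub> = ?ten ?r \<otimes>\<^bsub>ten z\<^esub> ?ten ?t"
        unfolding g(4) lt using iso(1,2) cl by simp
    qed
    finally show ?thesis .
  qed
  have "res K_fibre (points K_fibre) (preim K_fibre K_fst ?V) s = pull K_fst ?V \<rho>"
  proof
    fix p
    have L: "res K_fibre (points K_fibre) (preim K_fibre K_fst ?V) s = restrict s {p \<in> K_points. fst p \<in> ?V}"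
      unfolding preim_K_fst by (simp add: fibre_product_def space_of_local_families_def)
    show "res K_fibre (points K_fibre) (preim K_fibre K_fst ?V) s p = pull K_fst ?V \<rho> p"
    proof (cases "p \<in> K_points \<and> fst p \<in> ?V")
      case True
      then obtain z where z: "generic z" "p = gen_point z" "z \<in> ?V" using K_points_iff by auto
      then have "p \<in> {(x, y, P) \<in> K_points. x \<in> ?V}" using True by auto
      then have "pull K_fst ?V \<rho> p = prime_fraction (ten z) (gen_ideal z)
          (cls z [(germ \<UU> z ?V \<rho>, \<one>\<^bsub>stalk (Spec field_ring) {0}\<^esub>)]) \<one>\<^bsub>ten z\<^esub>"
        using z(2) by (simp add: fibre_fst_def)
      then show ?thesis unfolding L using True key[OF z(1,3)] z(2) by simp
    next
      \<comment> \<open>Both sides are restricted functions, so off the preimage they are undefined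
        alike.\<close>
      case False
      then have "p \<notin> {(x, y, P) \<in> K_points. x \<in> ?V}" by auto
      then show ?thesis unfolding L using False by (auto simp: fibre_fst_def)
    qed
  qed
  then show thesis using that[of ?V \<rho>] oV V1(2) V2(2) \<rho> by blast
qed

end

subsection \<open>Open subspaces\<close>

lemma open_subspace_simps:
  "topo (open_subspace \<XX> W) = subtopology (topo \<XX>) W"
  "sec (open_subspace \<XX> W) = sec \<XX>" "res (open_subspace \<XX> W) = res \<XX>"
  by (simp_all add: open_subspace_def)

context presheaf_space begin

lemma open_subspace_opn:
  "opn W \<Longrightarrow> openin (topo (open_subspace \<XX> W)) V \<longleftrightarrow> opn V \<and> V \<subseteq> W"
  by (simp add: open_subspace_simps openin_open_subtopology)

lemma open_subspace_points: "opn W \<Longrightarrow> points (open_subspace \<XX> W) = W"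
  using openin_subset by (fastforce simp: open_subspace_simps topspace_subtopology)

lemma presheaf_open_subspace: "opn W \<Longrightarrow> presheaf_space (open_subspace \<XX> W)"
  by (intro presheaf_space.intro)
    (auto simp: open_subspace_opn open_subspace_simps(2,3) cring_sec res_id res_res intro: res_hom)

lemma unit_at_open_subspace:
  assumes "opn W" "V \<subseteq> W"
  shows "presheaf_space.unit_at (open_subspace \<XX> W) x V s \<longleftrightarrow> unit_at x V s"
  unfolding unit_at_def presheaf_space.unit_at_def[OF presheaf_open_subspace[OF assms(1)]]
    open_subspace_opn[OF assms(1)] open_subspace_simps(2,3)
  using assms(2) by blast

lemma unit_at_res:
  assumes "opn V" "opn W" "W \<subseteq> V" "s \<in> carrier (sec \<XX> V)" "unit_at x W (res \<XX> V W s)"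
  shows "unit_at x V s"
proof -
  obtain N t where N: "opn N" "x \<in> N" "N \<subseteq> W" "t \<in> carrier (sec \<XX> N)"
    "res \<XX> W N (res \<XX> V W s) \<otimes>\<^bsub>sec \<XX> N\<^esub> t = \<one>\<^bsub>sec \<XX> N\<^esub>"
    using assms(5) unfolding unit_at_def by blast
  have "N \<subseteq> V" using N assms by blast
  moreover have "res \<XX> V N s \<otimes>\<^bsub>sec \<XX> N\<^esub> t = \<one>\<^bsub>sec \<XX> N\<^esub>"
    using N(5) unfolding res_res[OF assms(1,2) N(1,3) assms(3,4)] .
  ultimately show ?thesis unfolding unit_at_def using N by blast
qed

end

section \<open>Affine charts\<close>

locale affine_chart = presheaf_space \<XX> for \<XX> :: "('p, 'a) ringed_space" +
  fixes W :: "'p set" and A :: "'c ring" and h g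
  assumes W: "opn W" and A: "cring A"
    and h_morph: "morphism (open_subspace \<XX> W) (Spec A) h" and g_morph: "morphism (Spec A) (open_subspace \<XX> W) g"
    and gh: "same_map (open_subspace \<XX> W) (open_subspace \<XX> W) (comp_map (Spec A) g h) id_map"
    and hg: "same_map (Spec A) (Spec A) (comp_map (open_subspace \<XX> W) h g) id_map"
begin

sublocale aA: affine A by (rule affineI[OF A])

sublocale os: presheaf_space "open_subspace \<XX> W" by (rule presheaf_open_subspace[OF W])

sublocale hm: ringed_map_hom "open_subspace \<XX> W" "Spec A" h
  by (rule ringed_map_hom_of_morphism[OF os.presheaf_space_axioms aA.Sp.presheaf_space_axioms h_morph])

sublocale gm: ringed_map_hom "Spec A" "open_subspace \<XX> W" g
  by (rule ringed_map_hom_of_morphism[OF aA.Sp.presheaf_space_axioms os.presheaf_space_axioms g_morph])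

text \<open>Sections are compared with elements of \<open>A\<close> through this homomorphism; a
  general section is near each point a quotient of its values, by
  \<open>section_quotient\<close>.\<close>

definition chart :: "'c \<Rightarrow> 'a" where
  "chart a = pull h (points (Spec A)) (Spec_global_section A a)"

lemma pt_gh: "x \<in> W \<Longrightarrow> pt g (pt h x) = x"
  using gh open_subspace_points[OF W] by (auto simp: same_map_def comp_map_def id_map_def)

lemma pt_hg: "q \<in> points (Spec A) \<Longrightarrow> pt h (pt g q) = q"
  using hg by (auto simp: same_map_def comp_map_def id_map_def)

lemma pt_h: "x \<in> W \<Longrightarrow> pt h x \<in> points (Spec A)"
  using hm.pt_closed open_subspace_points[OF W] by blast

lemma pt_g: "q \<in> points (Spec A) \<Longrightarrow> pt g q \<in> W"
  using gm.pt_closed open_subspace_points[OF W] by blast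

lemma preim_h_points: "preim (open_subspace \<XX> W) h (points (Spec A)) = W"
  using hm.preim_points open_subspace_points[OF W] by simp

lemma preim_g_W: "preim (Spec A) g W = points (Spec A)"
  using gm.preim_points open_subspace_points[OF W] by simp

lemma chart_hom: "chart \<in> ring_hom A (sec \<XX> W)"
proof -
  have "pull h (points (Spec A)) \<in> ring_hom (sec (Spec A) (points (Spec A))) (sec \<XX> W)"
    using hm.pull_hom[OF openin_topspace] unfolding preim_h_points open_subspace_simps .
  from ring_hom_trans[OF aA.global_section_hom this] show ?thesis
    by (simp add: chart_def[abs_def] comp_def)
qed

lemma chart_closed: "a \<in> carrier A \<Longrightarrow> chart a \<in> carrier (sec \<XX> W)"
  using ring_hom_memE(1)[OF chart_hom] .

text \<open>\<open>h\<close> carries an inverse from \<open>Spec A\<close> to \<open>W\<close>, and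
  \<open>g\<close> carries one back, since pulling \<open>chart a\<close> back by \<open>g\<close>
  returns the global section of \<open>a\<close>.\<close>

lemma unit_at_chart:
  assumes x: "x \<in> W" and a: "a \<in> carrier A"
  shows "unit_at x W (chart a) \<longleftrightarrow> a \<notin> pt h x"
proof -
  have os: "openin (topo (open_subspace \<XX> W)) W" using open_subspace_opn[OF W] W by simp
  have "a \<notin> pt h x \<longleftrightarrow> aA.Sp.unit_at (pt h x) (points (Spec A)) (Spec_global_section A a)"
    using aA.unit_at_global_section[OF pt_h[OF x] a] by simp
  also have "\<dots> \<longleftrightarrow> os.unit_at x W (chart a)"
  proof
    assume "aA.Sp.unit_at (pt h x) (points (Spec A)) (Spec_global_section A a)"
    from hm.unit_at_pull[OF _ openin_topspace pt_h[OF x] aA.global_section_closed[OF a] this]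
    show "os.unit_at x W (chart a)"
      using x open_subspace_points[OF W] preim_h_points by (simp add: chart_def)
  next
    assume u: "os.unit_at x W (chart a)"
    have "pull g W (chart a) = Spec_global_section A a"
      using hg[unfolded same_map_def comp_map_def id_map_def, THEN conjunct2, rule_format,
          OF openin_topspace aA.global_section_closed[OF a]]
      unfolding chart_def by (simp add: preim_h_points)
    moreover have "aA.Sp.unit_at (pt h x) (preim (Spec A) g W) (pull g W (chart a))"
      by (rule gm.unit_at_pull[OF pt_h[OF x] os])
        (use pt_gh[OF x] x u chart_closed[OF a] in \<open>simp_all add: open_subspace_simps\<close>)
    ultimately show "aA.Sp.unit_at (pt h x) (points (Spec A)) (Spec_global_section A a)"
      by (simp add: preim_g_W)
  qed
  also have "\<dots> \<longleftrightarrow> unit_at x W (chart a)" using unit_at_open_subspace[OF W] by simp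
  finally show ?thesis by simp
qed

text \<open>Transported to \<open>Spec A\<close> by \<open>g\<close>, the section is a fraction
  \<open>c / d\<close> on some \<open>basic d\<close>; the identity \<open>(c / d) d = c\<close> is
  then transported back by \<open>h\<close>. \<open>N\<close> is the part of \<open>W\<close> where
  \<open>d\<close> is invertible.\<close>

lemma section_quotient:
  assumes V: "opn V" and x: "x \<in> V" "x \<in> W" and \<rho>: "\<rho> \<in> carrier (sec \<XX> V)"
  obtains c d N where "c \<in> carrier A" "d \<in> carrier A" "d \<notin> pt h x" "opn N" "N \<subseteq> V" "N \<subseteq> W"
    "\<And>y. y \<in> W \<Longrightarrow> y \<in> N \<longleftrightarrow> d \<notin> pt h y"
    "res \<XX> V N \<rho> \<otimes>\<^bsub>sec \<XX> N\<^esub> res \<XX> W N (chart d) = res \<XX> W N (chart c)"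
proof -
  let ?O = "open_subspace \<XX> W" and ?M = "V \<inter> W"
  have M: "opn ?M" using V W by blast
  have oM: "openin (topo ?O) ?M" using open_subspace_opn[OF W] M by simp
  let ?\<rho> = "res \<XX> V ?M \<rho>"
  have r: "?\<rho> \<in> carrier (sec \<XX> ?M)" using res_closed[OF V M _ \<rho>] by simp
  let ?G = "preim (Spec A) g ?M"
  have oG: "aA.opn ?G" by (rule gm.opn_preim[OF oM])
  have gr: "pull g ?M ?\<rho> \<in> carrier (sec (Spec A) ?G)"
    using gm.pull_closed[OF oM] r by (simp add: open_subspace_simps)
  have q: "pt h x \<in> ?G" using pt_h[OF x(2)] pt_gh[OF x(2)] x by (simp add: gm.mem_preim)
  obtain c d where c: "c \<in> carrier A" and d: "d \<in> carrier A" and qd: "pt h x \<in> aA.basic d" and bs: "aA.basic d \<subseteq> ?G"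
    and val: "\<And>q. q \<in> aA.basic d \<Longrightarrow> pull g ?M ?\<rho> q = prime_fraction A q c d"
    using aA.section_local[OF oG gr q] by blast
  let ?B = "aA.basic d" and ?N = "preim ?O h (aA.basic d)"
  have oB: "aA.opn ?B" by (rule aA.opn_basic[OF d])
  have Bp: "?B \<subseteq> points (Spec A)" using openin_subset[OF oB] .
  have "openin (topo ?O) ?N" by (rule hm.opn_preim[OF oB])
  then have N: "opn ?N" "?N \<subseteq> W" using open_subspace_opn[OF W] by auto
  have NV: "?N \<subseteq> ?M"
  proof
    fix y assume y: "y \<in> ?N"
    then have "y \<in> W" "pt h y \<in> ?G" using N bs hm.mem_preim by auto
    then show "y \<in> ?M" using pt_gh[of y] by (simp add: gm.mem_preim)
  qed
  have iff: "y \<in> ?N \<longleftrightarrow> d \<notin> pt h y" if y: "y \<in> W" for y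
    using y pt_h[OF y] open_subspace_points[OF W] aA.points_Spec
    by (auto simp: hm.mem_preim aA.mem_basic prime_spectrum_def)
  let ?SA = "points (Spec A)"
  have rB: "restrict (pull g ?M ?\<rho>) ?B \<in> carrier (sec (Spec A) ?B)"
    by (rule aA.section_restrict[OF oG oB bs gr])
  have gB: "restrict (Spec_global_section A a) ?B \<in> carrier (sec (Spec A) ?B)" if "a \<in> carrier A" for a
    by (rule aA.section_restrict[OF openin_topspace oB Bp aA.global_section_closed[OF that]])
  have prod: "restrict (pull g ?M ?\<rho>) ?B \<otimes>\<^bsub>sec (Spec A) ?B\<^esub> restrict (Spec_global_section A d) ?B =
      restrict (Spec_global_section A c) ?B"
    unfolding aA.sec_mult
  proof (rule restrict_ext)
    fix q assume q: "q \<in> ?B"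
    interpret ms: mult_set A "carrier A - q" by (rule aA.ms[OF q])
    have dq: "d \<in> carrier A - q" using q d by (simp add: aA.mem_basic)
    have "Spec_global_section A a q = prime_fraction A q a \<one>\<^bsub>A\<^esub>" for a
      using q by (simp add: Spec_global_section_def aA.mem_basic prime_spectrum_def)
    moreover have "prime_fraction A q c d \<otimes>\<^bsub>localisation_at A q\<^esub> prime_fraction A q d \<one>\<^bsub>A\<^esub> =
        prime_fraction A q c \<one>\<^bsub>A\<^esub>"
      unfolding ms.fraction_mult[OF c dq d ms.one_mem]
      using c d ms.mult_mem[OF dq ms.one_mem] ms.one_mem by (intro ms.fraction_eqI) auto
    ultimately show "restrict (pull g ?M ?\<rho>) ?B q \<otimes>\<^bsub>localisation_at A q\<^esub> restrict (Spec_global_section A d) ?B q =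
        Spec_global_section A c q"
      using q val by simp
  qed
  have hr: "pull h ?B (restrict (Spec_global_section A a) ?B) = res \<XX> W ?N (chart a)" if a: "a \<in> carrier A" for a
    using hm.pull_res[OF openin_topspace oB Bp aA.global_section_closed[OF a]]
    unfolding aA.res_Spec preim_h_points open_subspace_simps chart_def .
  have "pull h ?B (restrict (pull g ?M ?\<rho>) ?B) = res \<XX> (preim ?O h ?G) ?N (pull h ?G (pull g ?M ?\<rho>))"
    using hm.pull_res[OF oG oB bs gr] unfolding aA.res_Spec open_subspace_simps .
  moreover have "pull h ?G (pull g ?M ?\<rho>) = ?\<rho>"
    using gh oM r unfolding same_map_def comp_map_def id_map_def by (simp add: open_subspace_simps)
  moreover have "preim ?O h ?G = ?M"
    using pt_gh pt_h open_subspace_points[OF W] by (auto simp: hm.mem_preim gm.mem_preim)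
  ultimately have hrho: "pull h ?B (restrict (pull g ?M ?\<rho>) ?B) = res \<XX> V ?N \<rho>"
    using res_res[OF V M N(1) NV _ \<rho>] by simp
  have "res \<XX> V ?N \<rho> \<otimes>\<^bsub>sec \<XX> ?N\<^esub> res \<XX> W ?N (chart d) = res \<XX> W ?N (chart c)"
    using ring_hom_memE(2)[OF hm.pull_hom[OF oB] rB gB[OF d]]
    unfolding prod hr[OF c] hr[OF d] hrho open_subspace_simps by simp
  moreover have "d \<notin> pt h x" using qd by (simp add: aA.mem_basic)
  ultimately show thesis using that[of c d ?N] c d N NV iff by blast
qed

end

lemma affine_openE:
  assumes "presheaf_space \<XX>" "affine_open \<XX> W"
  obtains A :: "'a ring" and h g where "affine_chart (\<XX> :: ('p, 'a) ringed_space) W A h g"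
proof -
  obtain A :: "'a ring" and h where A: "cring A" "isomorphism (open_subspace \<XX> W) (Spec A) h"
    and W: "openin (topo \<XX>) W" using assms(2) unfolding affine_open_def by blast
  obtain g where "morphism (open_subspace \<XX> W) (Spec A) h" "morphism (Spec A) (open_subspace \<XX> W) g"
    "same_map (open_subspace \<XX> W) (open_subspace \<XX> W) (comp_map (Spec A) g h) id_map"
    "same_map (Spec A) (Spec A) (comp_map (open_subspace \<XX> W) h g) id_map"
    using A(2) unfolding isomorphism_def by blast
  then show thesis
    using that[of A h g] assms(1) A(1) W
    by (simp add: affine_chart_def affine_chart_axioms_def)
qed

subsection \<open>Bounded denominators at integral points\<close>

context model begin

text \<open>\<open>takes_value s P v\<close>: the section \<open>s\<close> of the generic fibre has the value \<open>v\<close> at the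
  \<open>K\<close>-point below the integral point \<open>P\<close>, as far as this can be read off from local sections
  of the model.\<close>

definition takes_value where
  "takes_value s P v \<longleftrightarrow> morphism (Spec R) \<UU> P \<and> (\<forall>p\<in>points (Spec R). pt f (pt P p) = p) \<and>
     (\<forall>V \<rho>. fm.X.opn V \<longrightarrow> \<rho> \<in> carrier (sec \<UU> V) \<longrightarrow> pt P {0} \<in> V \<longrightarrow>
        res K_fibre (points K_fibre) (preim K_fibre K_fst V) s = pull K_fst V \<rho> \<longrightarrow>
        generic_value (pull P V \<rho>) = v)"

section \<open>Values of sections at points of the model\<close>

lemma point_hom:
  assumes "morphism (Spec R) \<UU> P"
  shows "ringed_map_hom (Spec R) \<UU> P"
  using assms morphism_iff[OF Ra.local_space_Spec local_model] by blast

lemma point_value_hom: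
  assumes P: "morphism (Spec R) \<UU> P" and V: "fm.X.opn V" "pt P {0} \<in> V"
  shows "(\<lambda>\<rho>. generic_value (pull P V \<rho>)) \<in> ring_hom (sec \<UU> V) field_ring"
proof -
  interpret pm: ringed_map_hom "Spec R" \<UU> P by (rule point_hom[OF P])
  have "{0} \<in> preim (Spec R) P V" using V generic_point by (simp add: pm.mem_preim)
  from ring_hom_trans[OF pm.pull_hom[OF V(1)] generic_value_hom[OF pm.opn_preim[OF V(1)] this]]
  show ?thesis by (simp add: comp_def)
qed

lemma point_value_res:
  assumes P: "morphism (Spec R) \<UU> P" and V: "fm.X.opn V" "fm.X.opn W" "W \<subseteq> V" "pt P {0} \<in> W"
    and \<rho>: "\<rho> \<in> carrier (sec \<UU> V)"
  shows "generic_value (pull P W (res \<UU> V W \<rho>)) = generic_value (pull P V \<rho>)"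
proof -
  interpret pm: ringed_map_hom "Spec R" \<UU> P by (rule point_hom[OF P])
  have "{0} \<in> preim (Spec R) P W" using V generic_point by (simp add: pm.mem_preim)
  then show ?thesis
    unfolding pm.pull_res[OF V(1-3) \<rho>] Ra.res_Spec by (rule generic_value_restrict)
qed

text \<open>A nonzero generic value means invertibility at the generic point, and a morphism
  reflects invertible sections.\<close>

lemma point_value_unit:
  assumes P: "morphism (Spec R) \<UU> P" and V: "fm.X.opn V" "pt P {0} \<in> V"
    and \<rho>: "\<rho> \<in> carrier (sec \<UU> V)" and nz: "generic_value (pull P V \<rho>) \<noteq> 0"
  shows "fm.X.unit_at (pt P {0}) V \<rho>"
proof -
  interpret pm: ringed_map_hom "Spec R" \<UU> P by (rule point_hom[OF P])
  have 0: "{0} \<in> preim (Spec R) P V" using V generic_point by (simp add: pm.mem_preim)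
  have "Ra.Sp.unit_at {0} (preim (Spec R) P V) (pull P V \<rho>)"
    using unit_at_generic_iff[OF pm.opn_preim[OF V(1)] 0 pm.pull_closed[OF V(1) \<rho>]] nz by simp
  then show ?thesis
    using P[unfolded morphism_iff[OF Ra.local_space_Spec local_model], THEN conjunct2, rule_format,
      OF generic_point V \<rho>] by blast
qed

lemma field_ring_hom_simps:
  assumes "e \<in> ring_hom S (field_ring :: 'k ring)" "a \<in> carrier S" "b \<in> carrier S"
  shows "e (a \<otimes>\<^bsub>S\<^esub> b) = e a * e b" "e (a \<oplus>\<^bsub>S\<^esub> b) = e a + e b"
  using ring_hom_memE(2,3)[OF assms(1-3)] by (simp_all add: Kf.R_simps)

text \<open>The denominator \<open>g\<close> may vary with the point and has to avoid
  \<open>p\<close> only, whereas \<open>m\<close> must serve all points. That \<open>m v\<close> is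
  the value of one element of \<open>A\<close> is more than is claimed; such an element has a
  denominator outside \<open>p\<close> because \<open>P\<close> is defined at
  \<open>p\<close>.\<close>

lemma affine_denominator:
  assumes s: "s \<in> carrier (sec K_fibre (points K_fibre))" and aff: "affine_open \<UU> W"
  shows "\<exists>m::nat>0. \<forall>P v p. takes_value s P v \<longrightarrow> p \<in> points (Spec R) \<longrightarrow> pt P p \<in> W \<longrightarrow>
    (\<exists>a\<in>D. \<exists>g\<in>D. g \<notin> p \<and> of_nat m * v = a / g)"
proof -
  obtain A :: "'b ring" and h g where "affine_chart \<UU> W A h g"
    using affine_openE[OF fm.X.presheaf_space_axioms aff] by metis
  then interpret ch: affine_chart \<UU> W A h g .
  note W = ch.W
  define ev where "ev P a = generic_value (pull P W (ch.chart a))"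
    for P :: "('k set, 'q, 'k set \<Rightarrow> ('k \<times> 'k) set, 'b) ringed_map" and a
  have ev_hom: "ev P \<in> ring_hom A field_ring" if "morphism (Spec R) \<UU> P" "pt P {0} \<in> W" for P
    using ring_hom_trans[OF ch.chart_hom point_value_hom[OF that(1) W that(2)]]
    by (simp add: ev_def[abs_def] comp_def)
  have ev_mult: "ev P (a \<otimes>\<^bsub>A\<^esub> b) = ev P a * ev P b" and ev_add: "ev P (a \<oplus>\<^bsub>A\<^esub> b) = ev P a + ev P b"
    if "morphism (Spec R) \<UU> P" "pt P {0} \<in> W" "a \<in> carrier A" "b \<in> carrier A" for P a b
    using field_ring_hom_simps[OF ev_hom[OF that(1,2)] that(3,4)] by auto
  have ev_zero: "ev P \<zero>\<^bsub>A\<^esub> = 0" if "morphism (Spec R) \<UU> P" "pt P {0} \<in> W" for P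
    using ring_hom_zero[OF ev_hom[OF that] ch.aA.ring_axioms Kf.Rd.ring_axioms] by (simp add: Kf.R_simps)
  have ev_nat: "ev P (nat_elt A n) = of_nat n" if "morphism (Spec R) \<UU> P" "pt P {0} \<in> W" for P n
    using nat_elt_hom[OF ch.aA.ring_axioms Kf.Rd.ring_axioms ev_hom[OF that], of n] by (simp add: nat_elt_field)
  \<comment> \<open>A single \<open>a\<close> must serve all pairs \<open>P\<close>,
    \<open>v\<close>; an integer found in \<open>J\<close> is then uniform by construction.\<close>
  define J where "J = {b \<in> carrier A. \<exists>a\<in>carrier A. \<forall>P v. takes_value s P v \<longrightarrow> pt P {0} \<in> W \<longrightarrow>
    ev P b * v = ev P a}"
  have tvm: "morphism (Spec R) \<UU> P" if "takes_value s P v" for P v using that by (simp add: takes_value_def)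
  have Ji: "ideal J A"
  proof (rule idealI[OF ch.aA.ring_axioms])
    show "subgroup J (add_monoid A)"
    proof (rule ch.aA.add.subgroupI)
      show "J \<subseteq> carrier A" by (auto simp: J_def)
      have "\<zero>\<^bsub>A\<^esub> \<in> J" unfolding J_def using ev_zero tvm by (auto intro!: bexI[of _ "\<zero>\<^bsub>A\<^esub>"])
      then show "J \<noteq> {}" by blast
    next
      fix b assume "b \<in> J"
      then obtain a where b: "b \<in> carrier A" "a \<in> carrier A" and *: "\<And>P v. takes_value s P v \<Longrightarrow> pt P {0} \<in> W \<Longrightarrow>
        ev P b * v = ev P a" unfolding J_def by blast
      have mn: "ev P (\<ominus>\<^bsub>A\<^esub> c) = - ev P c" if "morphism (Spec R) \<UU> P" "pt P {0} \<in> W" "c \<in> carrier A" for P c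
      proof -
        have "ev P (\<ominus>\<^bsub>A\<^esub> c) + ev P c = 0"
          using ev_add[OF that(1,2), of "\<ominus>\<^bsub>A\<^esub> c" c] that ev_zero[OF that(1,2)] by (simp add: ch.aA.l_neg)
        then show ?thesis by (simp add: eq_neg_iff_add_eq_0)
      qed
      have "ev P (\<ominus>\<^bsub>A\<^esub> b) * v = ev P (\<ominus>\<^bsub>A\<^esub> a)" if "takes_value s P v" "pt P {0} \<in> W" for P v
        using *[OF that] mn[OF tvm[OF that(1)] that(2)] b by simp
      then show "\<ominus>\<^bsub>A\<^esub> b \<in> J" unfolding J_def using b by blast
      fix b' assume "b' \<in> J"
      then obtain a' where b': "b' \<in> carrier A" "a' \<in> carrier A" and **: "\<And>P v. takes_value s P v \<Longrightarrow> pt P {0} \<in> W \<Longrightarrow>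
        ev P b' * v = ev P a'" unfolding J_def by blast
      have "ev P (b \<oplus>\<^bsub>A\<^esub> b') * v = ev P (a \<oplus>\<^bsub>A\<^esub> a')" if "takes_value s P v" "pt P {0} \<in> W" for P v
        using *[OF that] **[OF that] b b' ev_add[OF tvm[OF that(1)] that(2)] by (simp add: algebra_simps)
      then show "b \<oplus>\<^bsub>A\<^esub> b' \<in> J" unfolding J_def using b b' by blast
    qed
  next
    fix b x assume "b \<in> J" and x: "x \<in> carrier A"
    then obtain a where b: "b \<in> carrier A" "a \<in> carrier A" and *: "\<And>P v. takes_value s P v \<Longrightarrow> pt P {0} \<in> W \<Longrightarrow>
      ev P b * v = ev P a" unfolding J_def by blast
    have "ev P (x \<otimes>\<^bsub>A\<^esub> b) * v = ev P (x \<otimes>\<^bsub>A\<^esub> a)" if "takes_value s P v" "pt P {0} \<in> W" for P v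
      using *[OF that] b x ev_mult[OF tvm[OF that(1)] that(2)] by (simp add: mult.assoc)
    then show *: "x \<otimes>\<^bsub>A\<^esub> b \<in> J" unfolding J_def using b x by blast
    then show "b \<otimes>\<^bsub>A\<^esub> x \<in> J" using b x ch.aA.m_comm[of b x] by simp
  qed
  define S where "S = {nat_elt A n |n. n > 0}"
  have "J \<inter> S \<noteq> {}"
  proof
    assume dis: "J \<inter> S = {}"
    have "\<exists>q. primeideal q A \<and> J \<subseteq> q \<and> q \<inter> S = {}"
    proof (rule ch.aA.primeideal_avoiding[OF Ji _ _ _ dis])
      show "S \<subseteq> carrier A" using ch.aA.nat_elt_closed by (auto simp: S_def)
      have "nat_elt A 1 = \<one>\<^bsub>A\<^esub>" by simp
      moreover have "nat_elt A 1 \<in> S" unfolding S_def by blast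
      ultimately show "\<one>\<^bsub>A\<^esub> \<in> S" by simp
      fix a b assume "a \<in> S" "b \<in> S"
      then obtain k l where "a = nat_elt A k" "b = nat_elt A l" "k > 0" "l > 0" by (auto simp: S_def)
      then show "a \<otimes>\<^bsub>A\<^esub> b \<in> S"
        unfolding S_def using ch.aA.nat_elt_mult[of k l] by (auto intro!: exI[of _ "k * l"])
    qed
    then obtain q where q: "primeideal q A" "J \<subseteq> q" "q \<inter> S = {}" by blast
    define x where "x = pt g q"
    have qp: "q \<in> points (Spec A)" using q(1) ch.aA.points_Spec by (simp add: prime_spectrum_def)
    have x: "x \<in> W" "pt h x = q" using ch.pt_g[OF qp] ch.pt_hg[OF qp] by (auto simp: x_def)
    have xp: "x \<in> points \<UU>" using x W openin_subset by blast
    have Wsub: "W \<subseteq> points \<UU>" using W by (rule openin_subset)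
    have fx: "pt f x \<in> points (Spec R)" using fm.pt_closed[OF xp] .
    then have fpr: "primeideal (pt f x) R" by (simp add: Ra.points_Spec prime_spectrum_def)
    \<comment> \<open>An integer outside \<open>q\<close> is invertible at \<open>x\<close>, and
      \<open>f\<close> reflects this down to \<open>Spec R\<close>.\<close>
    have nat_notin: "of_nat n \<notin> pt f x" if n: "n > 0" for n :: nat
    proof -
      let ?SR = "points (Spec R)"
      let ?c = "Spec_global_section R (nat_elt R n)"
      have nR: "nat_elt R n \<in> carrier R" by (rule Rd.nat_elt_closed)
      have gc: "?c \<in> carrier (sec (Spec R) ?SR)" by (rule Ra.global_section_closed[OF nR])
      have top: "fm.X.opn (points \<UU>)" by simp
      have fc: "pull f ?SR ?c \<in> carrier (sec \<UU> (points \<UU>))"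
        using fm.pull_closed[OF openin_topspace gc] unfolding fm.preim_points .
      have fh: "(\<lambda>a. res \<UU> (points \<UU>) W (pull f ?SR (Spec_global_section R a))) \<in> ring_hom R (sec \<UU> W)"
      proof -
        have 1: "pull f ?SR \<in> ring_hom (sec (Spec R) ?SR) (sec \<UU> (points \<UU>))"
          using fm.pull_hom[OF openin_topspace] unfolding fm.preim_points .
        from ring_hom_trans[OF ring_hom_trans[OF Ra.global_section_hom 1] fm.X.res_hom[OF top W Wsub]]
        show ?thesis by (simp add: comp_def)
      qed
      have "ch.chart (nat_elt A n) = res \<UU> (points \<UU>) W (pull f ?SR ?c)"
        using nat_elt_hom[OF ch.aA.ring_axioms cring.axioms(1)[OF fm.X.cring_sec[OF W]] ch.chart_hom, of n]
          nat_elt_hom[OF Rd.ring_axioms cring.axioms(1)[OF fm.X.cring_sec[OF W]] fh, of n] by simp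
      moreover have "nat_elt A n \<notin> q" using q(3) n by (auto simp: S_def)
      then have "fm.X.unit_at x W (ch.chart (nat_elt A n))"
        using ch.unit_at_chart[OF x(1) ch.aA.nat_elt_closed] x(2) by simp
      ultimately have "fm.X.unit_at x (points \<UU>) (pull f ?SR ?c)"
        using fm.X.unit_at_res[OF top W Wsub fc] by simp
      then have "fm.X.unit_at x (preim \<UU> f ?SR) (pull f ?SR ?c)" by (simp only: fm.preim_points)
      then have "Ra.Sp.unit_at (pt f x) ?SR ?c"
        by (rule f_morphism[unfolded morphism_iff[OF local_model Ra.local_space_Spec], THEN conjunct2,
            rule_format, OF xp openin_topspace fx gc])
      then show ?thesis using Ra.unit_at_global_section[OF fx nR] by (simp add: nat_elt_R)
    qed
    \<comment> \<open>If \<open>c\<close> is a nonzero element of this prime,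
      \<open>denominator\<close> applied to its inverse makes a positive integer a multiple of
      \<open>c\<close>, and that integer would lie in the prime too.\<close>
    have "pt f x = {0}"
    proof
      show "{0} \<subseteq> pt f x" using zero_in_prime[OF fpr] by blast
      show "pt f x \<subseteq> {0}"
      proof
        fix c assume c: "c \<in> pt f x"
        show "c \<in> {0}"
        proof (rule ccontr)
          assume "c \<notin> {0}"
          then have nz: "c \<noteq> 0" by simp
          obtain n :: nat where n: "n > 0" "of_nat n * inverse c \<in> D" using denominator by blast
          have "(of_nat n * inverse c) \<otimes>\<^bsub>R\<^esub> c \<in> pt f x"
            using ideal.I_l_closed[OF primeideal.axioms(1)[OF fpr] c] n(2) by (simp add: R_simps)
          moreover have "of_nat n * inverse c * c = of_nat n" using nz by simp
          ultimately have "of_nat n \<in> pt f x" unfolding R_simps by metis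
          then show False using nat_notin[OF n(1)] by blast
        qed
      qed
    qed
    then have gx: "generic x" using xp by (simp add: generic_def)
    obtain V \<rho> where V: "fm.X.opn V" "x \<in> V" and \<rho>: "\<rho> \<in> carrier (sec \<UU> V)"
      and sr: "res K_fibre (points K_fibre) (preim K_fibre K_fst V) s = pull K_fst V \<rho>"
      using local_section[OF s gx] by metis
    obtain c d N where c: "c \<in> carrier A" and d: "d \<in> carrier A" "d \<notin> pt h x"
      and N: "fm.X.opn N" "N \<subseteq> V" "N \<subseteq> W" and iff: "\<And>y. y \<in> W \<Longrightarrow> y \<in> N \<longleftrightarrow> d \<notin> pt h y"
      and eq: "res \<UU> V N \<rho> \<otimes>\<^bsub>sec \<UU> N\<^esub> res \<UU> W N (ch.chart d) = res \<UU> W N (ch.chart c)"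
      using ch.section_quotient[OF V(1,2) x(1) \<rho>] by metis
    \<comment> \<open>The multiplier is the square of \<open>d\<close>: at points where
      \<open>d\<close> has value zero both sides vanish whatever \<open>v\<close> is, and elsewhere
      the point lies in \<open>N\<close>, where \<open>\<rho>\<close> is the quotient
      \<open>c / d\<close>.\<close>
    have "ev P (d \<otimes>\<^bsub>A\<^esub> d) * v = ev P (c \<otimes>\<^bsub>A\<^esub> d)" if tv: "takes_value s P v" and PW: "pt P {0} \<in> W" for P v
    proof (cases "ev P d = 0")
      case True
      then show ?thesis using ev_mult[OF tvm[OF tv] PW] c d by simp
    next
      case False
      note mP = tvm[OF tv]
      have "fm.X.unit_at (pt P {0}) W (ch.chart d)"
        using point_value_unit[OF mP W PW ch.chart_closed[OF d(1)]] False by (simp add: ev_def)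
      then have "d \<notin> pt h (pt P {0})" using ch.unit_at_chart[OF PW d(1)] by simp
      then have PN: "pt P {0} \<in> N" using iff[OF PW] by simp
      then have PV: "pt P {0} \<in> V" using N by blast
      have v: "generic_value (pull P V \<rho>) = v" using tv V(1) \<rho> PV sr unfolding takes_value_def by blast
      have rc: "res \<UU> V N \<rho> \<in> carrier (sec \<UU> N)" "res \<UU> W N (ch.chart d) \<in> carrier (sec \<UU> N)"
        using fm.X.res_closed[OF V(1) N(1,2) \<rho>] fm.X.res_closed[OF W N(1,3) ch.chart_closed[OF d(1)]] by auto
      have "generic_value (pull P N (res \<UU> V N \<rho>)) * generic_value (pull P N (res \<UU> W N (ch.chart d))) =
          generic_value (pull P N (res \<UU> W N (ch.chart c)))"
        using field_ring_hom_simps(1)[OF point_value_hom[OF mP N(1) PN] rc] eq by simp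
      then have "v * ev P d = ev P c"
        using point_value_res[OF mP V(1) N(1,2) PN \<rho>] point_value_res[OF mP W N(1,3) PN ch.chart_closed[OF d(1)]]
          point_value_res[OF mP W N(1,3) PN ch.chart_closed[OF c]] v by (simp add: ev_def)
      then show ?thesis using ev_mult[OF mP PW] c d by (simp add: algebra_simps)
    qed
    then have "d \<otimes>\<^bsub>A\<^esub> d \<in> J" unfolding J_def using c d by blast
    then have "d \<in> q" using q(2) ch.aA.prime_mem_mult_iff[OF q(1) d(1) d(1)] by blast
    then show False using d(2) x(2) by simp
  qed
  then obtain m :: nat where m: "m > 0" "nat_elt A m \<in> J" by (auto simp: S_def)
  then obtain a where a: "a \<in> carrier A" and *: "\<And>P v. takes_value s P v \<Longrightarrow> pt P {0} \<in> W \<Longrightarrow>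
    ev P (nat_elt A m) * v = ev P a" unfolding J_def by blast
  have "\<exists>a\<in>D. \<exists>g\<in>D. g \<notin> p \<and> of_nat m * v = a / g"
    if tv: "takes_value s P v" and p: "p \<in> points (Spec R)" "pt P p \<in> W" for P v p
  proof -
    interpret pm: ringed_map_hom "Spec R" \<UU> P by (rule point_hom[OF tvm[OF tv]])
    have pp: "p \<in> preim (Spec R) P W" using p by (simp add: pm.mem_preim)
    \<comment> \<open>The preimage of \<open>W\<close> is open and contains \<open>p\<close>, hence
      the zero ideal; so the equation defining \<open>J\<close> applies to \<open>P\<close>.\<close>
    have "{0} \<in> preim (Spec R) P W" by (rule generic_mem[OF pm.opn_preim[OF W] pp])
    then have 0: "pt P {0} \<in> W" by (simp add: pm.mem_preim)
    have "of_nat m * v = ev P a" using *[OF tv 0] ev_nat[OF tvm[OF tv] 0] by simp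
    then show ?thesis
      using generic_value_at(2)[OF pm.opn_preim[OF W] pm.pull_closed[OF W ch.chart_closed[OF a]] pp]
      by (simp add: ev_def)
  qed
  then show ?thesis using m(1) by blast
qed

text \<open>Two patching arguments over \<open>Spec R\<close>. The \<open>h\<close> that admit one
  \<open>m\<close> for all primes not containing \<open>h\<close> form an ideal, and by finite type
  each prime is missed by such an \<open>h\<close>; so one \<open>m\<close> serves all primes. For a
  fixed \<open>v\<close> the denominators of \<open>m v\<close> then form an ideal contained in no
  prime.\<close>

lemma bounded_denominator:
  assumes s: "s \<in> carrier (sec K_fibre (points K_fibre))" and ft: "finite_type \<UU> (Spec R) f"
  shows "\<exists>m::nat>0. \<forall>P v. takes_value s P v \<longrightarrow> of_nat m * v \<in> D"
proof -
  have nat_in: "of_nat n \<in> D" for n :: nat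
    using Rd.nat_elt_closed[of n] by (simp add: nat_elt_R R_simps)
  define ok where "ok m h \<longleftrightarrow> (\<forall>P v p. takes_value s P v \<longrightarrow> p \<in> points (Spec R) \<longrightarrow> h \<notin> p \<longrightarrow>
    (\<exists>a\<in>D. \<exists>g\<in>D. g \<notin> p \<and> of_nat m * v = a / g))" for m :: nat and h
  have scale: "\<exists>a\<in>D. \<exists>g\<in>D. g \<notin> p \<and> of_nat (k * m) * v = a / g"
    if ex: "\<exists>a\<in>D. \<exists>g\<in>D. g \<notin> p \<and> of_nat m * v = a / g" for k m v p
  proof -
    obtain a g where "a \<in> D" "g \<in> D" "g \<notin> p" "of_nat m * v = a / g" using ex by blast
    then show ?thesis using mult_in[OF nat_in[of k]]
      by (intro bexI[of _ "of_nat k * a"] bexI[of _ g]) (auto simp: mult.assoc)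
  qed
  define J where "J = {h \<in> D. \<exists>m>0. ok m h}"
  have prime: "primeideal p R" if "p \<in> points (Spec R)" for p
    using that by (simp add: Ra.points_Spec prime_spectrum_def)
  have "ideal J R"
  proof (rule idealI[OF Rd.ring_axioms])
    show "subgroup J (add_monoid R)"
    proof (rule Rd.add.subgroupI)
      show "J \<subseteq> carrier R" by (auto simp: J_def R_simps)
      \<comment> \<open>Vacuous, as zero lies in every prime.\<close>
      have "ok 1 0" unfolding ok_def using zero_in_prime[OF prime] by blast
      then have "0 \<in> J" unfolding J_def using zero_in by blast
      then show "J \<noteq> {}" by blast
    next
      fix b assume "b \<in> J"
      then obtain m where b: "b \<in> D" "m > 0" "ok m b" by (auto simp: J_def)
      have "\<ominus>\<^bsub>R\<^esub> b \<notin> p \<Longrightarrow> b \<notin> p" if "p \<in> points (Spec R)" for p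
        using additive_subgroup.a_inv_closed[OF ideal.axioms(1)[OF primeideal.axioms(1)[OF prime[OF that]]]] by blast
      then have "ok m (\<ominus>\<^bsub>R\<^esub> b)" using b(3) unfolding ok_def by blast
      moreover have "\<ominus>\<^bsub>R\<^esub> b \<in> D" using Rd.a_inv_closed[of b] b by (simp add: R_simps)
      ultimately show "\<ominus>\<^bsub>R\<^esub> b \<in> J" unfolding J_def using b by blast
      fix b' assume "b' \<in> J"
      then obtain m' where b': "b' \<in> D" "m' > 0" "ok m' b'" by (auto simp: J_def)
      \<comment> \<open>A prime that misses the sum misses \<open>b\<close> or \<open>b'\<close>,
        and by \<open>scale\<close> a larger multiple still works.\<close>
      have "ok (m * m') (b \<oplus>\<^bsub>R\<^esub> b')"
        unfolding ok_def
      proof (intro allI impI)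
        fix P v p assume tv: "takes_value s P v" and p: "p \<in> points (Spec R)" and n: "b \<oplus>\<^bsub>R\<^esub> b' \<notin> p"
        have "b \<notin> p \<or> b' \<notin> p"
          using n additive_subgroup.a_closed[OF ideal.axioms(1)[OF primeideal.axioms(1)[OF prime[OF p]]]] by blast
        then show "\<exists>a\<in>D. \<exists>g\<in>D. g \<notin> p \<and> of_nat (m * m') * v = a / g"
        proof
          assume "b \<notin> p"
          then have "\<exists>a\<in>D. \<exists>g\<in>D. g \<notin> p \<and> of_nat m * v = a / g" using b(3) tv p unfolding ok_def by blast
          from scale[OF this, of m'] show ?thesis by (simp add: mult.commute)
        next
          assume "b' \<notin> p"
          then have "\<exists>a\<in>D. \<exists>g\<in>D. g \<notin> p \<and> of_nat m' * v = a / g" using b'(3) tv p unfolding ok_def by blast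
          from scale[OF this, of m] show ?thesis .
        qed
      qed
      moreover have "b \<oplus>\<^bsub>R\<^esub> b' \<in> D" using b b' add_in by (simp add: R_simps)
      ultimately show "b \<oplus>\<^bsub>R\<^esub> b' \<in> J" unfolding J_def using b b' by (auto intro!: exI[of _ "m * m'"])
    qed
  next
    fix b x assume "b \<in> J" and x: "x \<in> carrier R"
    then obtain m where b: "b \<in> D" "m > 0" "ok m b" by (auto simp: J_def)
    have "x \<otimes>\<^bsub>R\<^esub> b \<notin> p \<Longrightarrow> b \<notin> p" if "p \<in> points (Spec R)" for p
      using ideal.I_l_closed[OF primeideal.axioms(1)[OF prime[OF that]], of b x] x by blast
    then have "ok m (x \<otimes>\<^bsub>R\<^esub> b)" using b(3) unfolding ok_def by blast
    moreover have "x \<otimes>\<^bsub>R\<^esub> b \<in> D" using b x mult_in by (simp add: R_simps)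
    ultimately show *: "x \<otimes>\<^bsub>R\<^esub> b \<in> J" unfolding J_def using b by blast
    then show "b \<otimes>\<^bsub>R\<^esub> x \<in> J" by (simp add: R_simps mult.commute)
  qed
  then have "\<one>\<^bsub>R\<^esub> \<in> J"
  proof (rule Rd.one_mem_ideal)
    fix p0 assume p0: "primeideal p0 R"
    then have "p0 \<in> points (Spec R)" by (simp add: Ra.points_Spec prime_spectrum_def)
    then obtain V \<W> where V: "affine_open (Spec R) V" "p0 \<in> V" and \<W>: "finite \<W>" "\<Union>\<W> = preim \<UU> f V"
      "\<And>W. W \<in> \<W> \<Longrightarrow> affine_open \<UU> W"
      using ft unfolding finite_type_def by meson
    have "Ra.opn V" using V(1) by (simp add: affine_open_def)
    then obtain h where h: "h \<in> carrier R" "p0 \<in> Ra.basic h" "Ra.basic h \<subseteq> V" using Ra.basic_nbhd V(2) by metis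
    have "\<forall>W\<in>\<W>. \<exists>m::nat>0. \<forall>P v p. takes_value s P v \<longrightarrow> p \<in> points (Spec R) \<longrightarrow> pt P p \<in> W \<longrightarrow>
        (\<exists>a\<in>D. \<exists>g\<in>D. g \<notin> p \<and> of_nat m * v = a / g)"
      using affine_denominator[OF s \<W>(3)] by blast
    then obtain M :: "'q set \<Rightarrow> nat" where M: "\<And>W. W \<in> \<W> \<Longrightarrow> M W > 0"
      "\<And>W P v p. W \<in> \<W> \<Longrightarrow> takes_value s P v \<Longrightarrow> p \<in> points (Spec R) \<Longrightarrow> pt P p \<in> W \<Longrightarrow>
        \<exists>a\<in>D. \<exists>g\<in>D. g \<notin> p \<and> of_nat (M W) * v = a / g"
      by metis
    \<comment> \<open>The piece that \<open>P\<close> meets at \<open>p\<close> depends on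
      \<open>P\<close> and \<open>p\<close>, so the factors of all finitely many pieces are
      multiplied.\<close>
    have "ok (\<Prod>W\<in>\<W>. M W) h"
      unfolding ok_def
    proof (intro allI impI)
      fix P v p assume tv: "takes_value s P v" and p: "p \<in> points (Spec R)" and hp: "h \<notin> p"
      interpret pm: ringed_map_hom "Spec R" \<UU> P
        using tv by (intro point_hom) (simp add: takes_value_def)
      have "p \<in> V" using h(3) hp prime[OF p] by (auto simp: Ra.mem_basic)
      moreover have "pt f (pt P p) = p" using tv p by (simp add: takes_value_def)
      ultimately have "pt P p \<in> \<Union>\<W>" using pm.pt_closed[OF p] by (simp add: \<W>(2) fm.mem_preim)
      then obtain W where W: "W \<in> \<W>" "pt P p \<in> W" by blast
      have "(\<Prod>W\<in>\<W>. M W) = (\<Prod>W\<in>\<W> - {W}. M W) * M W"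
        using prod.remove[OF \<W>(1) W(1), of M] by (simp add: mult.commute)
      then show "\<exists>a\<in>D. \<exists>g\<in>D. g \<notin> p \<and> of_nat (\<Prod>W\<in>\<W>. M W) * v = a / g"
        using scale[OF M(2)[OF W(1) tv p W(2)], of "\<Prod>W\<in>\<W> - {W}. M W"] by simp
    qed
    moreover have "(\<Prod>W\<in>\<W>. M W) > 0" using M(1) by (simp add: prod_pos)
    ultimately have "h \<in> J" using h(1) unfolding J_def R_simps by blast
    then show "\<exists>a\<in>J. a \<notin> p0" using h(2) by (auto simp: Ra.mem_basic)
  qed
  then obtain m where m: "m > 0" "ok m 1" by (auto simp: J_def R_simps)
  have "of_nat m * v \<in> D" if tv: "takes_value s P v" for P v
  proof -
    \<comment> \<open>The ideal of denominators of \<open>m v\<close>; the local fraction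
      \<open>a / g\<close> puts \<open>g\<close> into it.\<close>
    let ?I = "{h \<in> D. h * (of_nat m * v) \<in> D}"
    have "ideal ?I R"
    proof (rule idealI[OF Rd.ring_axioms])
      show "subgroup ?I (add_monoid R)"
      proof (rule Rd.add.subgroupI)
        show "?I \<subseteq> carrier R" by (auto simp: R_simps)
        show "?I \<noteq> {}" using zero_in by auto
        fix b assume b: "b \<in> ?I"
        have "\<ominus>\<^bsub>R\<^esub> b = - b"
          using b uminus_in by (intro Rd.minus_equality) (auto simp: R_simps)
        then show "\<ominus>\<^bsub>R\<^esub> b \<in> ?I" using b uminus_in by auto
        fix b' assume "b' \<in> ?I"
        then show "b \<oplus>\<^bsub>R\<^esub> b' \<in> ?I" using b add_in by (auto simp: R_simps distrib_right)
      qed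
      fix b x assume b: "b \<in> ?I" and x: "x \<in> carrier R"
      have "x * (b * (of_nat m * v)) \<in> D" using b x mult_in by (simp add: R_simps)
      then show *: "x \<otimes>\<^bsub>R\<^esub> b \<in> ?I" using b x mult_in by (simp add: R_simps mult.assoc)
      then show "b \<otimes>\<^bsub>R\<^esub> x \<in> ?I" by (simp add: R_simps mult.commute)
    qed
    then have "\<one>\<^bsub>R\<^esub> \<in> ?I"
    proof (rule Rd.one_mem_ideal)
      fix p assume p: "primeideal p R"
      then have pp: "p \<in> points (Spec R)" by (simp add: Ra.points_Spec prime_spectrum_def)
      have "1 \<notin> p" using primeideal_one_notin[OF p] by (simp add: R_simps)
      then obtain a g where a: "a \<in> D" "g \<in> D" "g \<notin> p" "of_nat m * v = a / g"
        using m(2) tv pp unfolding ok_def by blast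
      have "g \<noteq> 0" using a zero_in_prime[OF p] by auto
      then have "g * (of_nat m * v) = a" using a(4) by simp
      then show "\<exists>a\<in>?I. a \<notin> p" using a by blast
    qed
    then show ?thesis by (simp add: R_simps)
  qed
  then show ?thesis using m(1) by blast
qed

end

section \<open>Algebraic integers and archimedean places\<close>

subsection \<open>Sums and products of algebraic integers\<close>

text \<open>\<open>x\<close> is an eigenvalue of an integer matrix, and the characteristic
  polynomial of such a matrix is monic with integer coefficients.\<close>

lemma algebraic_int_eigen:
  fixes x :: "'a::field_char_0" and v :: "nat \<Rightarrow> 'a" and c :: "nat \<Rightarrow> nat \<Rightarrow> int"
  assumes eig: "\<And>i. i < N \<Longrightarrow> x * v i = (\<Sum>j<N. of_int (c i j) * v j)" and nz: "k < N" "v k \<noteq> 0"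
  shows "algebraic_int x"
proof -
  define M where "M = Matrix.mat N N (\<lambda>(i, j). c i j)"
  define M' where "M' = map_mat (of_int :: int \<Rightarrow> 'a) M"
  define w where "w = Matrix.vec N v"
  have M: "M \<in> carrier_mat N N" and M': "M' \<in> carrier_mat N N" by (auto simp: M_def M'_def)
  have "eigenvector M' w x"
    unfolding eigenvector_def
  proof (intro conjI)
    show "w \<in> carrier_vec (dim_row M')" using M' by (simp add: w_def)
    show "w \<noteq> 0\<^sub>v (dim_row M')"
    proof
      assume "w = 0\<^sub>v (dim_row M')"
      then have "vec_index w k = vec_index (0\<^sub>v (dim_row M')) k" by simp
      then show False using nz M' by (simp add: w_def)
    qed
    show "M' *\<^sub>v w = x \<cdot>\<^sub>v w"
    proof (rule eq_vecI)
      fix i assume "i < dim_vec (x \<cdot>\<^sub>v w)"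
      then have i: "i < N" by (simp add: w_def)
      have "vec_index (M' *\<^sub>v w) i = (\<Sum>j<N. of_int (c i j) * v j)"
        using i by (simp add: M'_def M_def w_def scalar_prod_def atLeast0LessThan)
      then show "vec_index (M' *\<^sub>v w) i = vec_index (x \<cdot>\<^sub>v w) i" using eig[OF i] i by (simp add: w_def)
    qed (use M' in \<open>simp add: w_def\<close>)
  qed
  then have "poly (char_poly M') x = 0"
    using eigenvalue_root_char_poly[OF M'] unfolding eigenvalue_def by blast
  moreover have "char_poly M' = map_poly of_int (char_poly M)"
    unfolding M'_def by (rule of_int_hom.char_poly_hom[OF M])
  moreover have "Polynomial.lead_coeff (char_poly M) = 1" using degree_monic_char_poly[OF M] by simp
  ultimately show ?thesis unfolding algebraic_int_altdef_ipoly by metis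
qed

definition int_span :: "nat \<Rightarrow> (nat \<Rightarrow> 'a::field_char_0) \<Rightarrow> 'a set" where
  "int_span N v = range (\<lambda>c::nat \<Rightarrow> int. \<Sum>j<N. of_int (c j) * v j)"

lemma int_span_add: "x \<in> int_span N v \<Longrightarrow> y \<in> int_span N v \<Longrightarrow> x + y \<in> int_span N v"
proof -
  assume "x \<in> int_span N v" "y \<in> int_span N v"
  then obtain c d :: "nat \<Rightarrow> int" where "x = (\<Sum>j<N. of_int (c j) * v j)" "y = (\<Sum>j<N. of_int (d j) * v j)"
    by (auto simp: int_span_def)
  then have "x + y = (\<Sum>j<N. of_int (c j + d j) * v j)" by (simp add: sum.distrib algebra_simps)
  then show ?thesis unfolding int_span_def by (intro range_eqI[where x = "\<lambda>j. c j + d j"])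
qed

lemma int_span_scale: "x \<in> int_span N v \<Longrightarrow> of_int k * x \<in> int_span N v"
proof -
  assume "x \<in> int_span N v"
  then obtain c :: "nat \<Rightarrow> int" where "x = (\<Sum>j<N. of_int (c j) * v j)" by (auto simp: int_span_def)
  then have "of_int k * x = (\<Sum>j<N. of_int (k * c j) * v j)" by (simp add: sum_distrib_left mult.assoc)
  then show ?thesis unfolding int_span_def by (intro range_eqI[where x = "\<lambda>j. k * c j"])
qed

lemma int_span_sum: "(\<And>i. i \<in> I \<Longrightarrow> h i \<in> int_span N v) \<Longrightarrow> sum h I \<in> int_span N v"
proof (induction I rule: infinite_finite_induct)
  case (insert x F)
  then show ?case by (simp add: int_span_add)
qed (auto simp: int_span_def intro: range_eqI[of _ _ "\<lambda>_. 0"])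

lemma int_span_base: "i < N \<Longrightarrow> v i \<in> int_span N v"
proof -
  assume i: "i < N"
  have "v i = (\<Sum>j<N. of_int (if j = i then 1 else 0) * v j)"
    using i by (simp add: if_distrib[of "\<lambda>x. x * _"] if_distrib[of of_int] cong: if_cong)
  then show ?thesis unfolding int_span_def by (intro range_eqI[where x = "\<lambda>j. if j = i then 1 else 0"])
qed

lemma int_span_stable:
  assumes "\<And>i. i < N \<Longrightarrow> x * v i \<in> int_span N v" "u \<in> int_span N v"
  shows "x * u \<in> int_span N v"
proof -
  obtain c :: "nat \<Rightarrow> int" where "u = (\<Sum>j<N. of_int (c j) * v j)" using assms(2) by (auto simp: int_span_def)
  then have "x * u = (\<Sum>j<N. of_int (c j) * (x * v j))" by (simp add: sum_distrib_left algebra_simps)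
  then show ?thesis using assms(1) by (auto intro!: int_span_sum int_span_scale)
qed

text \<open>The coefficients that express each \<open>x * v i\<close> in the spanning family form
  the integer matrix of which \<open>x\<close> is an eigenvalue.\<close>

lemma algebraic_int_of_stable:
  assumes "\<And>i. i < N \<Longrightarrow> x * v i \<in> int_span N v" "k < N" "v k \<noteq> 0"
  shows "algebraic_int x"
proof -
  have "\<forall>i. \<exists>c::nat \<Rightarrow> int. i < N \<longrightarrow> x * v i = (\<Sum>j<N. of_int (c j) * v j)"
    using assms(1) unfolding int_span_def by blast
  then obtain c :: "nat \<Rightarrow> nat \<Rightarrow> int" where "\<And>i. i < N \<Longrightarrow> x * v i = (\<Sum>j<N. of_int (c i j) * v j)"
    by metis
  then show ?thesis using algebraic_int_eigen[of N x v c] assms by blast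
qed

lemma algebraic_int_power_relation:
  fixes x :: "'a::field_char_0"
  assumes "algebraic_int x"
  obtains a :: nat and c :: "nat \<Rightarrow> int" where "a > 0" "x ^ a = (\<Sum>i<a. of_int (c i) * x ^ i)"
proof -
  obtain p :: "int poly" where p: "poly (map_poly of_int p) x = 0" "Polynomial.lead_coeff p = 1"
    using assms unfolding algebraic_int_altdef_ipoly by blast
  define a where "a = Polynomial.degree p"
  have "0 = (\<Sum>i\<le>a. of_int (Polynomial.coeff p i) * x ^ i)"
    using p(1) by (simp add: poly_altdef degree_map_poly coeff_map_poly a_def)
  also have "\<dots> = (\<Sum>i<a. of_int (Polynomial.coeff p i) * x ^ i) + x ^ a"
    using p(2) by (simp add: a_def lessThan_Suc_atMost[symmetric])
  finally have "x ^ a = - (\<Sum>i<a. of_int (Polynomial.coeff p i) * x ^ i)" by (simp add: eq_neg_iff_add_eq_0 add.commute)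
  then have e: "x ^ a = (\<Sum>i<a. of_int (- Polynomial.coeff p i) * x ^ i)" by (simp add: sum_negf)
  \<comment> \<open>With exponent zero the relation would read \<open>1 = 0\<close>.\<close>
  have "a > 0"
  proof (rule ccontr)
    assume "\<not> ?thesis"
    then show False using e by simp
  qed
  then show thesis by (rule that[OF _ e])
qed

text \<open>The products \<open>x ^ i * y ^ j\<close> with \<open>i < a\<close> and
  \<open>j < b\<close> span a group stable under multiplication by \<open>x\<close> and by
  \<open>y\<close>, hence by their sum and product.\<close>

lemma algebraic_int_add_mult:
  fixes x y :: "'a::field_char_0"
  assumes x: "algebraic_int x" and y: "algebraic_int y"
  shows "algebraic_int (x + y)" "algebraic_int (x * y)"
proof -
  obtain a c where a: "a > 0" "x ^ a = (\<Sum>i<a. of_int (c i) * x ^ i)" using algebraic_int_power_relation[OF x] by metis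
  obtain b d where b: "b > 0" "y ^ b = (\<Sum>i<b. of_int (d i) * y ^ i)" using algebraic_int_power_relation[OF y] by metis
  \<comment> \<open>The pairs of exponents are numbered by one index, with \<open>i\<close> as
    quotient and \<open>j\<close> as remainder modulo \<open>b\<close>.\<close>
  define v where "v k = x ^ (k div b) * y ^ (k mod b)" for k
  let ?L = "int_span (a * b) v"
  have base: "x ^ i * y ^ j \<in> ?L" if "i < a" "j < b" for i j
  proof -
    have "i * b + j < a * b"
    proof -
      have "i * b + j < i * b + b" using that by simp
      also have "\<dots> = (i + 1) * b" by simp
      also have "\<dots> \<le> a * b" using that by (intro mult_le_mono1) simp
      finally show ?thesis .
    qed
    moreover have "v (i * b + j) = x ^ i * y ^ j" using that by (simp add: v_def)
    ultimately show ?thesis using int_span_base[of "i * b + j" "a * b" v] by simp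
  qed
  have vk: "k div b < a" "k mod b < b" if "k < a * b" for k
    using that b(1) by (auto simp: less_mult_imp_div_less)
  \<comment> \<open>Either the exponent of \<open>x\<close> just grows by one, or it was
    \<open>a - 1\<close> and the relation for \<open>x ^ a\<close> lowers it again.\<close>
  have X: "x * v k \<in> ?L" if k: "k < a * b" for k
  proof (cases "k div b + 1 < a")
    case True
    then show ?thesis using base[of "k div b + 1" "k mod b"] vk[OF k] by (simp add: v_def mult.assoc)
  next
    case False
    then have "k div b + 1 = a" using vk(1)[OF k] by simp
    then have "x * v k = x ^ a * y ^ (k mod b)" by (simp add: v_def mult.assoc flip: power_Suc)
    also have "\<dots> = (\<Sum>i<a. of_int (c i) * (x ^ i * y ^ (k mod b)))" by (simp add: a(2) sum_distrib_right mult.assoc)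
    finally show ?thesis using base vk[OF k] by (auto intro!: int_span_sum int_span_scale)
  qed
  have Y: "y * v k \<in> ?L" if k: "k < a * b" for k
  proof (cases "k mod b + 1 < b")
    case True
    then show ?thesis using base[of "k div b" "k mod b + 1"] vk[OF k] by (simp add: v_def algebra_simps)
  next
    case False
    then have "k mod b + 1 = b" using vk(2)[OF k] by simp
    then have "y * y ^ (k mod b) = y ^ b" by (simp flip: power_Suc)
    then have "y * v k = x ^ (k div b) * y ^ b" by (simp add: v_def mult.left_commute)
    also have "\<dots> = (\<Sum>i<b. of_int (d i) * (x ^ (k div b) * y ^ i))" by (simp add: b(2) sum_distrib_left algebra_simps)
    finally show ?thesis using base vk[OF k] by (auto intro!: int_span_sum int_span_scale)
  qed
  have 0: "0 < a * b" "v 0 \<noteq> 0" using a b by (auto simp: v_def)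
  show "algebraic_int (x + y)"
    using X Y by (intro algebraic_int_of_stable[where v = v and k = 0 and N = "a * b", OF _ 0]) (simp add: distrib_right int_span_add)
  show "algebraic_int (x * y)"
    using int_span_stable[OF X] Y by (intro algebraic_int_of_stable[where v = v and k = 0 and N = "a * b", OF _ 0]) (simp add: mult.assoc)
qed

subsection \<open>Algebraicity\<close>

text \<open>The powers of \<open>x\<close> with exponents up to \<open>d\<close> are one more than
  the size of a spanning set, so they are linearly dependent over the rationals.\<close>

lemma number_field_degree:
  assumes "number_field TYPE('k::field_char_0)"
  obtains d where "\<And>x::'k. \<exists>c::nat \<Rightarrow> rat. (\<exists>i\<le>d. c i \<noteq> 0) \<and> (\<Sum>i\<le>d. of_rat (c i) * x ^ i) = 0"
proof -
  obtain B :: "'k set" where B: "finite B" "\<And>x. \<exists>c::'k \<Rightarrow> rat. x = (\<Sum>b\<in>B. of_rat (c b) * b)"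
    using assms unfolding number_field_def by blast
  interpret V: vector_space "\<lambda>(q::rat) (x::'k). of_rat q * x"
    by unfold_locales (auto simp: algebra_simps of_rat_add of_rat_mult)
  have span: "x \<in> V.span B" for x
  proof -
    obtain c where "x = (\<Sum>b\<in>B. of_rat (c b) * b)" using B(2) by blast
    then show ?thesis by (auto intro: V.span_sum V.span_scale V.span_base)
  qed
  show thesis
  proof (rule that[of "card B"])
    fix x :: 'k
    let ?d = "card B"
    show "\<exists>c::nat \<Rightarrow> rat. (\<exists>i\<le>?d. c i \<noteq> 0) \<and> (\<Sum>i\<le>?d. of_rat (c i) * x ^ i) = 0"
    proof (cases "inj_on (\<lambda>i. x ^ i) {..?d}")
      case True
      let ?S = "(\<lambda>i. x ^ i) ` {..?d}"
      have "card ?S = Suc ?d" using True by (simp add: card_image)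
      then have "V.dependent ?S" using V.independent_span_bound[OF B(1), of ?S] span by auto
      then obtain u where u: "\<exists>v\<in>?S. u v \<noteq> 0" "(\<Sum>v\<in>?S. of_rat (u v) * v) = 0"
        using V.dependent_finite[of ?S] by auto
      have "(\<Sum>i\<le>?d. of_rat (u (x ^ i)) * x ^ i) = 0" using u(2) by (simp add: sum.reindex[OF True])
      then show ?thesis using u(1) by (intro exI[of _ "\<lambda>i. u (x ^ i)"]) auto
    next
      \<comment> \<open>Coinciding powers leave too few elements for the dimension count; the
        relation is then \<open>x ^ j - x ^ i = 0\<close>.\<close>
      case False
      then obtain i j where ij: "i < j" "j \<le> ?d" "x ^ i = x ^ j"
        unfolding inj_on_def by (metis atMost_iff linorder_neqE_nat)
      let ?c = "\<lambda>k. (if k = j then 1 else 0) - (if k = i then 1 else 0) :: rat"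
      have "(\<Sum>k\<le>?d. of_rat (?c k) * x ^ k) =
          (\<Sum>k\<le>?d. (if k = j then x ^ k else 0)) - (\<Sum>k\<le>?d. (if k = i then x ^ k else 0))"
        by (subst sum_subtractf[symmetric]) (auto intro!: sum.cong simp: of_rat_diff)
      also have "\<dots> = 0" using ij by simp
      finally show ?thesis using ij by (intro exI[of _ ?c]) auto
    qed
  qed
qed

text \<open>If \<open>x\<close> is a root of an integer polynomial with leading coefficient
  \<open>l\<close>, then \<open>l * x\<close> is an algebraic integer; up to sign, \<open>l\<close>
  is the required positive integer.\<close>

lemma number_field_denominator:
  fixes x :: "'k::field_char_0"
  assumes "number_field TYPE('k)"
  shows "\<exists>n::nat. n > 0 \<and> algebraic_int (of_nat n * x)"
proof -
  obtain d where "\<And>x::'k. \<exists>c::nat \<Rightarrow> rat. (\<exists>i\<le>d. c i \<noteq> 0) \<and> (\<Sum>i\<le>d. of_rat (c i) * x ^ i) = 0"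
    by (rule number_field_degree[OF assms]) blast
  then obtain c :: "nat \<Rightarrow> rat" where c: "\<exists>i\<le>d. c i \<noteq> 0" "(\<Sum>i\<le>d. of_rat (c i) * x ^ i) = 0" by meson
  define p where "p = (\<Sum>i\<le>d. Polynomial.monom (of_rat (c i) :: 'k) i)"
  have cp: "Polynomial.coeff p i = (if i \<le> d then of_rat (c i) else 0)" for i
    by (auto simp: p_def coeff_sum)
  have "algebraic x"
    unfolding algebraic_altdef
  proof (intro exI[of _ p] conjI allI)
    show "Polynomial.coeff p i \<in> \<rat>" for i by (simp add: cp)
    show "p \<noteq> 0" using c(1) cp by (metis coeff_0 of_rat_eq_0_iff)
    show "poly p x = 0" using c(2) by (simp add: p_def poly_sum poly_monom)
  qed
  then obtain q where q: "\<And>i. Polynomial.coeff q i \<in> \<int>" "q \<noteq> 0" "poly q x = 0"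
    unfolding algebraic_def by blast
  define n where "n = Polynomial.degree q"
  have n0: "n > 0"
  proof (rule ccontr)
    assume "\<not> n > 0"
    then obtain a where "q = [:a:]" unfolding n_def using degree_eq_zeroE by blast
    then show False using q by auto
  qed
  define l where "l = Polynomial.lead_coeff q"
  obtain L :: int where L: "l = of_int L" using q(1)[of n] unfolding l_def n_def by (auto elim: Ints_cases)
  have "l \<noteq> 0" using q(2) by (simp add: l_def)
  \<comment> \<open>The monic polynomial for which
    \<open>r (l x) = l ^ (n - 1) q (x)\<close>.\<close>
  define r where "r = Polynomial.monom 1 n + (\<Sum>i<n. Polynomial.monom (Polynomial.coeff q i * l ^ (n - 1 - i)) i)"
  have cr: "Polynomial.coeff r i = (if i = n then 1 else if i < n then Polynomial.coeff q i * l ^ (n - 1 - i) else 0)" for i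
    by (auto simp: r_def coeff_sum)
  have dr: "Polynomial.degree r = n"
  proof (rule antisym)
    show "Polynomial.degree r \<le> n" by (rule degree_le) (simp add: cr)
    show "n \<le> Polynomial.degree r" by (rule le_degree) (simp add: cr)
  qed
  have "algebraic_int (l * x)"
  proof (rule algebraic_int.intros[of r])
    show "Polynomial.lead_coeff r = 1" by (simp add: dr cr)
    show "\<forall>i. Polynomial.coeff r i \<in> \<int>" using q(1) by (auto simp: cr L)
    have "poly r (l * x) = (l * x) ^ n + (\<Sum>i<n. Polynomial.coeff q i * l ^ (n - 1 - i) * (l * x) ^ i)"
      by (simp add: r_def poly_sum poly_monom)
    also have "(\<Sum>i<n. Polynomial.coeff q i * l ^ (n - 1 - i) * (l * x) ^ i) = l ^ (n - 1) * (\<Sum>i<n. Polynomial.coeff q i * x ^ i)"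
    proof -
      have step: "Polynomial.coeff q i * l ^ (n - 1 - i) * (l * x) ^ i = l ^ (n - 1) * (Polynomial.coeff q i * x ^ i)" if "i < n" for i
      proof -
        have "l ^ (n - 1 - i) * l ^ i = l ^ (n - 1)" using that by (simp flip: power_add)
        then show ?thesis by (simp add: power_mult_distrib algebra_simps)
      qed
      show ?thesis unfolding sum_distrib_left by (intro sum.cong refl step) auto
    qed
    also have "(l * x) ^ n = l ^ (n - 1) * (l * x ^ n)"
      using n0 by (simp add: power_mult_distrib power_eq_if[of l n])
    also have "l ^ (n - 1) * (l * x ^ n) + l ^ (n - 1) * (\<Sum>i<n. Polynomial.coeff q i * x ^ i) =
        l ^ (n - 1) * poly q x"
      by (simp add: poly_altdef n_def[symmetric] l_def lessThan_Suc_atMost[symmetric] algebra_simps)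
    finally show "poly r (l * x) = 0" using q(3) by simp
  qed
  \<comment> \<open>Negation preserves algebraic integers, so the sign of \<open>L\<close> can be
    absorbed.\<close>
  moreover have "of_nat (nat \<bar>L\<bar>) * x = l * x \<or> of_nat (nat \<bar>L\<bar>) * x = - (l * x)"
    unfolding L by (cases "L \<ge> 0") (simp_all add: abs_if)
  ultimately have "algebraic_int (of_nat (nat \<bar>L\<bar>) * x)" by auto
  moreover have "nat \<bar>L\<bar> > 0" using \<open>l \<noteq> 0\<close> L by simp
  ultimately show ?thesis by blast
qed

subsection \<open>Complex embeddings\<close>

text \<open>A homomorphism to the complex numbers on a subring \<open>F\<close> of \<open>K\<close>,
  which is a field by \<open>inverse_in\<close>. The bound \<open>d\<close> of
  \<open>relation\<close> on degrees over the rationals is carried along, so that minimal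
  polynomials exist over every \<open>F\<close>.\<close>

locale partial_embedding =
  fixes d :: nat and F :: "'k::field_char_0 set" and e :: "'k \<Rightarrow> complex"
  assumes relation: "\<And>x::'k. \<exists>c::nat \<Rightarrow> rat. (\<exists>i\<le>d. c i \<noteq> 0) \<and> (\<Sum>i\<le>d. of_rat (c i) * x ^ i) = 0"
    and rat: "\<And>q. of_rat q \<in> F" "\<And>q. e (of_rat q) = of_rat q"
    and add: "\<And>x y. x \<in> F \<Longrightarrow> y \<in> F \<Longrightarrow> x + y \<in> F" "\<And>x y. x \<in> F \<Longrightarrow> y \<in> F \<Longrightarrow> e (x + y) = e x + e y"
    and mult: "\<And>x y. x \<in> F \<Longrightarrow> y \<in> F \<Longrightarrow> x * y \<in> F" "\<And>x y. x \<in> F \<Longrightarrow> y \<in> F \<Longrightarrow> e (x * y) = e x * e y"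
begin

lemma zero: "0 \<in> F" "e 0 = 0" and one: "1 \<in> F" "e 1 = 1"
  using rat[of 0] rat[of 1] by simp_all

lemma uminus: "x \<in> F \<Longrightarrow> - x \<in> F" "x \<in> F \<Longrightarrow> e (- x) = - e x"
  using mult[of "of_rat (-1)" x] rat[of "-1"] by simp_all

lemma sum_in: "(\<And>i. i \<in> I \<Longrightarrow> h i \<in> F) \<Longrightarrow> sum h I \<in> F"
  and e_sum: "(\<And>i. i \<in> I \<Longrightarrow> h i \<in> F) \<Longrightarrow> e (sum h I) = (\<Sum>i\<in>I. e (h i))"
proof -
  have "sum h I \<in> F \<and> e (sum h I) = (\<Sum>i\<in>I. e (h i))" if "\<And>i. i \<in> I \<Longrightarrow> h i \<in> F"
    using that by (induction I rule: infinite_finite_induct) (auto simp: zero add)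
  then show "(\<And>i. i \<in> I \<Longrightarrow> h i \<in> F) \<Longrightarrow> sum h I \<in> F"
    "(\<And>i. i \<in> I \<Longrightarrow> h i \<in> F) \<Longrightarrow> e (sum h I) = (\<Sum>i\<in>I. e (h i))" by auto
qed

lemma power: "x \<in> F \<Longrightarrow> x ^ n \<in> F" "x \<in> F \<Longrightarrow> e (x ^ n) = e x ^ n"
proof -
  have "x ^ n \<in> F \<and> e (x ^ n) = e x ^ n" if "x \<in> F"
    using that by (induction n) (auto simp: one mult)
  then show "x \<in> F \<Longrightarrow> x ^ n \<in> F" "x \<in> F \<Longrightarrow> e (x ^ n) = e x ^ n" by auto
qed

text \<open>Divide a rational relation of \<open>x\<close> by its lowest power of \<open>x\<close>:
  the constant term that remains is nonzero, and solving for it shows the inverse to be a polynomial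
  in \<open>x\<close>.\<close>

lemma inverse_in:
  assumes x: "x \<in> F" "x \<noteq> 0"
  shows "inverse x \<in> F"
proof -
  obtain c :: "nat \<Rightarrow> rat" where c: "\<exists>i\<le>d. c i \<noteq> 0" "(\<Sum>i\<le>d. of_rat (c i) * x ^ i) = 0"
    using relation by blast
  define k where "k = (LEAST i. i \<le> d \<and> c i \<noteq> 0)"
  have k: "k \<le> d" "c k \<noteq> 0" using LeastI_ex[OF c(1)] by (auto simp: k_def)
  have lt: "c i = 0" if "i < k" for i
    using not_less_Least[of i "\<lambda>i. i \<le> d \<and> c i \<noteq> 0"] that k(1) by (auto simp: k_def)
  have "0 = (\<Sum>i\<in>{k..d}. of_rat (c i) * x ^ i)"
    unfolding c(2)[symmetric] using lt by (intro sum.mono_neutral_right) (auto simp: not_le)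
  also have "\<dots> = (\<Sum>j\<in>{0..d - k}. of_rat (c (k + j)) * x ^ (k + j))"
    using sum.atLeastAtMost_shift_0[OF k(1), of "\<lambda>i. of_rat (c i) * x ^ i"] by (simp add: comp_def)
  also have "\<dots> = x ^ k * (\<Sum>j\<in>{0..d - k}. of_rat (c (k + j)) * x ^ j)"
    by (simp add: sum_distrib_left power_add algebra_simps)
  finally have "(\<Sum>j\<in>{0..d - k}. of_rat (c (k + j)) * x ^ j) = 0" using x(2) by simp
  moreover have "(\<Sum>j\<in>{0..d - k}. of_rat (c (k + j)) * x ^ j) =
      of_rat (c k) + x * (\<Sum>j<d - k. of_rat (c (k + Suc j)) * x ^ j)"
    unfolding atLeast0AtMost sum.atMost_shift
    by (simp add: sum_distrib_left algebra_simps)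
  ultimately have "x * (\<Sum>j<d - k. of_rat (c (k + Suc j)) * x ^ j) = - of_rat (c k)"
    by (simp add: eq_neg_iff_add_eq_0 add.commute)
  then have "x * (of_rat (- 1 / c k) * (\<Sum>j<d - k. of_rat (c (k + Suc j)) * x ^ j)) = 1"
    using k(2) by (simp add: of_rat_divide of_rat_minus mult.left_commute[of x])
  then have "inverse x = of_rat (- 1 / c k) * (\<Sum>j<d - k. of_rat (c (k + Suc j)) * x ^ j)"
    by (rule inverse_unique)
  moreover have "\<dots> \<in> F" using x(1) by (intro mult rat sum_in power)
  ultimately show ?thesis by simp
qed

definition over_F :: "'k poly \<Rightarrow> bool" where "over_F p \<longleftrightarrow> (\<forall>i. Polynomial.coeff p i \<in> F)"

abbreviation "me \<equiv> map_poly e"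

lemma coeff_me: "Polynomial.coeff (me p) i = e (Polynomial.coeff p i)"
  by (rule coeff_map_poly) (rule zero(2))

lemma over_add: "over_F p \<Longrightarrow> over_F q \<Longrightarrow> over_F (p + q)" "over_F p \<Longrightarrow> over_F q \<Longrightarrow> me (p + q) = me p + me q"
  by (auto simp: over_F_def add coeff_me intro!: poly_eqI)

lemma over_uminus: "over_F p \<Longrightarrow> over_F (- p)" "over_F p \<Longrightarrow> me (- p) = - me p"
  by (auto simp: over_F_def uminus coeff_me intro!: poly_eqI)

lemma over_mult: "over_F p \<Longrightarrow> over_F q \<Longrightarrow> over_F (p * q)" "over_F p \<Longrightarrow> over_F q \<Longrightarrow> me (p * q) = me p * me q"
  by (auto simp: over_F_def coeff_me coeff_mult mult e_sum intro!: poly_eqI sum_in)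

lemma over_monom: "c \<in> F \<Longrightarrow> over_F (Polynomial.monom c n)" "me (Polynomial.monom c n) = Polynomial.monom (e c) n"
  by (auto simp: over_F_def zero coeff_me intro!: poly_eqI)

text \<open>A polynomial of least degree, made monic by an inverse in \<open>F\<close>. Its degree
  is at most \<open>d\<close> because a rational relation is a polynomial over
  \<open>F\<close>.\<close>

lemma minimal_polynomial:
  fixes \<beta> :: 'k
  obtains m where "over_F m" "Polynomial.lead_coeff m = 1" "poly m \<beta> = 0" "Polynomial.degree m \<le> d"
    "\<And>p. over_F p \<Longrightarrow> p \<noteq> 0 \<Longrightarrow> poly p \<beta> = 0 \<Longrightarrow> Polynomial.degree m \<le> Polynomial.degree p"
proof -
  obtain c :: "nat \<Rightarrow> rat" where c: "\<exists>i\<le>d. c i \<noteq> 0" "(\<Sum>i\<le>d. of_rat (c i) * \<beta> ^ i) = 0"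
    using relation by blast
  define p0 where "p0 = (\<Sum>i\<le>d. Polynomial.monom (of_rat (c i) :: 'k) i)"
  have cp: "Polynomial.coeff p0 i = (if i \<le> d then of_rat (c i) else 0)" for i
    by (auto simp: p0_def coeff_sum)
  have p0: "over_F p0" "p0 \<noteq> 0" "poly p0 \<beta> = 0" "Polynomial.degree p0 \<le> d"
  proof -
    show "over_F p0" by (auto simp: over_F_def cp rat zero)
    show "p0 \<noteq> 0" using c(1) cp by (metis coeff_0 of_rat_eq_0_iff)
    show "poly p0 \<beta> = 0" using c(2) by (simp add: p0_def poly_sum poly_monom)
    show "Polynomial.degree p0 \<le> d" by (rule degree_le) (simp add: cp)
  qed
  let ?Q = "\<lambda>n. \<exists>p. over_F p \<and> p \<noteq> 0 \<and> poly p \<beta> = 0 \<and> Polynomial.degree p = n"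
  have ex: "?Q (Polynomial.degree p0)" using p0 by blast
  define n where "n = (LEAST n. ?Q n)"
  have "?Q n" unfolding n_def by (rule LeastI[of ?Q, OF ex])
  then obtain p where p: "over_F p" "p \<noteq> 0" "poly p \<beta> = 0" "Polynomial.degree p = n" by blast
  have min: "n \<le> Polynomial.degree q" if "over_F q" "q \<noteq> 0" "poly q \<beta> = 0" for q
    unfolding n_def using that by (intro Least_le) blast
  let ?c = "inverse (Polynomial.lead_coeff p)"
  have c: "Polynomial.lead_coeff p \<noteq> 0" using p(2) by simp
  have cF: "?c \<in> F" using inverse_in[OF _ c] p(1) by (simp add: over_F_def)
  show thesis
  proof (rule that[of "Polynomial.smult ?c p"])
    show "over_F (Polynomial.smult ?c p)" using p(1) cF mult by (auto simp: over_F_def)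
    show "Polynomial.lead_coeff (Polynomial.smult ?c p) = 1" using c by simp
    show "poly (Polynomial.smult ?c p) \<beta> = 0" using p(3) by simp
    show "Polynomial.degree (Polynomial.smult ?c p) \<le> d" using p(4) min[OF p0(1-3)] p0(4) c by simp
    fix q assume "over_F q" "q \<noteq> 0" "poly q \<beta> = 0"
    then show "Polynomial.degree (Polynomial.smult ?c p) \<le> Polynomial.degree q" using min[of q] p(4) c by simp
  qed
qed

lemma degree_me: "Polynomial.lead_coeff m = 1 \<Longrightarrow> Polynomial.degree (me m) = Polynomial.degree m"
  and lead_coeff_me: "Polynomial.lead_coeff m = 1 \<Longrightarrow> Polynomial.lead_coeff (me m) = 1"
proof -
  assume m: "Polynomial.lead_coeff m = 1"
  show d: "Polynomial.degree (me m) = Polynomial.degree m"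
  proof (rule antisym)
    show "Polynomial.degree (me m) \<le> Polynomial.degree m"
      by (rule degree_le) (auto simp: coeff_me coeff_eq_0 zero)
    show "Polynomial.degree m \<le> Polynomial.degree (me m)"
      by (rule le_degree) (simp add: coeff_me m one)
  qed
  show "Polynomial.lead_coeff (me m) = 1" unfolding d by (simp add: coeff_me m one)
qed

text \<open>Division by the monic \<open>m\<close>, one leading term at a time: adding the multiple
  \<open>q\<close> of \<open>m\<close> lowers the degree and affects neither value, since
  \<open>m\<close> vanishes at \<open>\<beta>\<close> and \<open>me m\<close> at \<open>z\<close>.
  By minimality the process ends at the zero polynomial.\<close>

lemma vanish_at_conjugate:
  assumes m: "over_F m" "Polynomial.lead_coeff m = 1" "poly m \<beta> = 0"
    and min: "\<And>p. over_F p \<Longrightarrow> p \<noteq> 0 \<Longrightarrow> poly p \<beta> = 0 \<Longrightarrow> Polynomial.degree m \<le> Polynomial.degree p"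
    and z: "poly (me m) z = 0"
    and p: "over_F p" "poly p \<beta> = 0"
  shows "poly (me p) z = 0"
  using p
proof (induction "Polynomial.degree p" arbitrary: p rule: less_induct)
  case less
  show ?case
  proof (cases "p = 0")
    case True
    then show ?thesis by simp
  next
    case False
    define k where "k = Polynomial.degree p - Polynomial.degree m"
    define q where "q = Polynomial.monom (- Polynomial.lead_coeff p) k * m"
    have le: "Polynomial.degree m \<le> Polynomial.degree p" using min less False by blast
    have q: "over_F q" "me q = Polynomial.monom (e (- Polynomial.lead_coeff p)) k * me m"
      using over_mult[OF over_monom(1) m(1), of "- Polynomial.lead_coeff p" k] less(2) uminus
      by (auto simp: q_def over_F_def over_monom)
    have dq: "Polynomial.degree q \<le> Polynomial.degree p"
      unfolding q_def using le degree_mult_le[of "Polynomial.monom (- Polynomial.lead_coeff p) k" m]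
        degree_monom_le[of "- Polynomial.lead_coeff p" k] by (simp add: k_def)
    have "Polynomial.coeff q (Polynomial.degree p) = - Polynomial.lead_coeff p"
      using le m(2) by (simp add: q_def k_def coeff_monom_mult)
    then have c0: "Polynomial.coeff (p + q) (Polynomial.degree p) = 0" by simp
    have dle: "Polynomial.degree (p + q) \<le> Polynomial.degree p" using dq by (simp add: degree_add_le)
    have pq: "over_F (p + q)" "poly (p + q) \<beta> = 0"
      using over_add(1)[OF less(2) q(1)] less(3) m(3) by (auto simp: q_def)
    have "poly (me (p + q)) z = 0"
    proof (cases "p + q = 0")
      case True
      then show ?thesis by simp
    next
      case False
      then have "Polynomial.degree (p + q) \<noteq> Polynomial.degree p" using c0 by (metis leading_coeff_0_iff)
      then show ?thesis using less(1)[of "p + q"] pq dle by simp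
    qed
    then show ?thesis using over_add(2)[OF less(2) q(1)] q(2) z by simp
  qed
qed

text \<open>\<open>F'\<close> is generated by \<open>\<beta>\<close> over \<open>F\<close>. An
  element is written as a polynomial in \<open>\<beta>\<close>, and the transported polynomial is
  evaluated at \<open>z\<close>; two expressions differ by a polynomial vanishing at
  \<open>\<beta>\<close>, to which \<open>vanish_at_conjugate\<close> applies.\<close>

lemma extend:
  assumes m: "over_F m" "Polynomial.lead_coeff m = 1" "poly m \<beta> = 0"
    and min: "\<And>p. over_F p \<Longrightarrow> p \<noteq> 0 \<Longrightarrow> poly p \<beta> = 0 \<Longrightarrow> Polynomial.degree m \<le> Polynomial.degree p"
    and z: "poly (me m) z = 0"
  obtains F' e' where "partial_embedding d F' e'" "F \<subseteq> F'" "\<And>x. x \<in> F \<Longrightarrow> e' x = e x" "\<beta> \<in> F'" "e' \<beta> = z"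
proof -
  define F' where "F' = {poly p \<beta> |p. over_F p}"
  define e' where "e' u = poly (me (SOME p. over_F p \<and> poly p \<beta> = u)) z" for u
  have val: "e' (poly p \<beta>) = poly (me p) z" if p: "over_F p" for p
  proof -
    define q where "q = (SOME q. over_F q \<and> poly q \<beta> = poly p \<beta>)"
    have q: "over_F q \<and> poly q \<beta> = poly p \<beta>" unfolding q_def by (rule someI[of _ p]) (use p in simp)
    have "poly (me (q + - p)) z = 0"
      using q p by (intro vanish_at_conjugate[OF m min z] over_add over_uminus) auto
    then have "poly (me q) z = poly (me p) z"
      using over_add(2)[OF _ over_uminus(1)[OF p], of q] over_uminus(2)[OF p] q by simp
    then show ?thesis by (simp add: e'_def q_def)
  qed
  have const: "over_F [:c:]" "me [:c:] = [:e c:]" if "c \<in> F" for c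
    using over_monom[of c 0] that by (simp_all add: monom_0)
  have X: "over_F [:0, 1:]" "me [:0, 1:] = [:0, 1:]"
    using over_monom[of 1 1] one by (simp_all add: monom_altdef)
  have in_F': "x \<in> F'" "e' x = e x" if "x \<in> F" for x
    using const[OF that] val[of "[:x:]"] by (auto simp: F'_def intro!: exI[of _ "[:x:]"])
  show thesis
  proof (rule that[of F' e'])
    show "partial_embedding d F' e'"
    proof
      show "of_rat q \<in> F'" "e' (of_rat q) = of_rat q" for q using in_F' rat by auto
      fix x y assume "x \<in> F'" "y \<in> F'"
      then obtain p q where p: "over_F p" "x = poly p \<beta>" and q: "over_F q" "y = poly q \<beta>" by (auto simp: F'_def)
      have "x + y = poly (p + q) \<beta>" "x * y = poly (p * q) \<beta>" using p q by auto
      then show "x + y \<in> F'" "x * y \<in> F'"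
        using over_add(1)[OF p(1) q(1)] over_mult(1)[OF p(1) q(1)] unfolding F'_def by blast+
      show "e' (x + y) = e' x + e' y"
        using val[OF over_add(1)[OF p(1) q(1)]] val[OF p(1)] val[OF q(1)] over_add(2)[OF p(1) q(1)] p q by simp
      show "e' (x * y) = e' x * e' y"
        using val[OF over_mult(1)[OF p(1) q(1)]] val[OF p(1)] val[OF q(1)] over_mult(2)[OF p(1) q(1)] p q by simp
    qed (rule relation)
    show "F \<subseteq> F'" using in_F' by blast
    show "e' x = e x" if "x \<in> F" for x using in_F' that by blast
    show "\<beta> \<in> F'" using X(1) by (auto simp: F'_def intro!: exI[of _ "[:0, 1:]"])
    show "e' \<beta> = z" using val[OF X(1)] X(2) by simp
  qed
qed

text \<open>One element at a time: its minimal polynomial has positive degree, so the transported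
  polynomial has a complex root to which the element can be sent.\<close>

lemma extend_finite:
  assumes "finite B"
  shows "\<exists>F' e'. partial_embedding d F' e' \<and> F \<subseteq> F' \<and> (\<forall>x\<in>F. e' x = e x) \<and> B \<subseteq> F'"
  using assms
proof (induction B rule: finite_induct)
  case empty
  show ?case using partial_embedding_axioms by blast
next
  case (insert b B)
  then obtain F1 e1 where 1: "partial_embedding d F1 e1" "F \<subseteq> F1" "\<forall>x\<in>F. e1 x = e x" "B \<subseteq> F1" by blast
  interpret E: partial_embedding d F1 e1 by (rule 1(1))
  obtain m where m: "E.over_F m" "Polynomial.lead_coeff m = 1" "poly m b = 0" "Polynomial.degree m \<le> d"
    "\<And>p. E.over_F p \<Longrightarrow> p \<noteq> 0 \<Longrightarrow> poly p b = 0 \<Longrightarrow> Polynomial.degree m \<le> Polynomial.degree p"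
    by (rule E.minimal_polynomial[of b]) blast
  have "Polynomial.degree m > 0"
  proof (rule ccontr)
    assume "\<not> ?thesis"
    then obtain a where "m = [:a:]" using degree_eq_zeroE by blast
    then show False using m(2,3) by simp
  qed
  then obtain z where z: "poly (E.me m) z = 0"
    using alg_closed_imp_poly_has_root[of "E.me m"] E.degree_me[OF m(2)] by auto
  obtain F2 e2 where 2: "partial_embedding d F2 e2" "F1 \<subseteq> F2" "\<And>x. x \<in> F1 \<Longrightarrow> e2 x = e1 x" "b \<in> F2" "e2 b = z"
    by (rule E.extend[OF m(1-3,5) z]) blast+
  show ?case using 1 2 by (intro exI[of _ F2] exI[of _ e2]) auto
qed

lemma algebraic_int_image:
  assumes "x \<in> F" "algebraic_int x"
  shows "algebraic_int (e x)"
proof -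
  obtain p :: "int poly" where p: "poly (map_poly of_int p) x = 0" "Polynomial.lead_coeff p = 1"
    using assms(2) unfolding algebraic_int_altdef_ipoly by blast
  have int: "of_int k \<in> F" "e (of_int k) = of_int k" for k using rat[of "of_int k"] by simp_all
  have tm: "e (of_int k * x ^ i) = of_int k * e x ^ i" for k i
    using mult(2)[OF int(1) power(1)[OF assms(1)], of k i] power(2)[OF assms(1)] int(2) by metis
  have "poly (map_poly of_int p) (e x) = (\<Sum>i\<le>Polynomial.degree p. of_int (Polynomial.coeff p i) * e x ^ i)"
    by (simp add: poly_altdef degree_map_poly coeff_map_poly)
  also have "\<dots> = (\<Sum>i\<le>Polynomial.degree p. e (of_int (Polynomial.coeff p i) * x ^ i))"
    by (simp only: tm)
  also have "\<dots> = e (\<Sum>i\<le>Polynomial.degree p. of_int (Polynomial.coeff p i) * x ^ i)"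
    by (intro e_sum[symmetric] mult(1)[OF int(1) power(1)[OF assms(1)]])
  also have "\<dots> = e (poly (map_poly of_int p) x)"
    by (simp add: poly_altdef degree_map_poly coeff_map_poly)
  finally show ?thesis using p unfolding algebraic_int_altdef_ipoly by (metis zero(2))
qed

end

section \<open>From complex embeddings to the finiteness of bounded algebraic integers\<close>

lemma partial_embedding_rat:
  fixes d :: nat
  assumes "\<And>x::'k::field_char_0. \<exists>c::nat \<Rightarrow> rat. (\<exists>i\<le>d. c i \<noteq> 0) \<and> (\<Sum>i\<le>d. of_rat (c i) * x ^ i) = 0"
  shows "partial_embedding d (range (of_rat :: rat \<Rightarrow> 'k)) (\<lambda>x. of_rat (inv_into UNIV of_rat x))"
proof
  have inj: "inv_into UNIV of_rat (of_rat q :: 'k) = q" for q by (simp add: inv_f_f inj_def)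
  show "of_rat q \<in> range (of_rat :: rat \<Rightarrow> 'k)" "of_rat (inv_into UNIV of_rat (of_rat q :: 'k)) = of_rat q" for q
    by (simp_all add: inj)
  fix x y :: 'k assume "x \<in> range of_rat" "y \<in> range of_rat"
  then obtain p q where x: "x = of_rat p" "y = of_rat q" by blast
  have s: "x + y = of_rat (p + q)" "x * y = of_rat (p * q)" by (simp_all add: x of_rat_add of_rat_mult)
  show "x + y \<in> range of_rat" "x * y \<in> range of_rat" unfolding s by auto
  show "of_rat (inv_into UNIV of_rat (x + y)) = of_rat (inv_into UNIV of_rat x) + of_rat (inv_into UNIV of_rat y)"
    "of_rat (inv_into UNIV of_rat (x * y)) = of_rat (inv_into UNIV of_rat x) * of_rat (inv_into UNIV of_rat y)"
    unfolding s inj by (simp_all add: x inj of_rat_add of_rat_mult)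
qed (rule assms)

lemma archimedean_place_embedding:
  assumes "partial_embedding d (UNIV :: 'k::field_char_0 set) e"
  shows "archimedean_place (\<lambda>x. cmod (e x))"
proof -
  interpret partial_embedding d UNIV e by fact
  \<comment> \<open>An embedding of a field is injective: the values at \<open>x\<close> and at
    \<open>inverse x\<close> multiply to one.\<close>
  have "e x \<noteq> 0" if "x \<noteq> 0" for x
  proof
    assume "e x = 0"
    then have "e (x * inverse x) = 0" by (simp add: mult)
    then show False using that one by simp
  qed
  moreover have "cmod (of_rat q) = real_of_rat \<bar>q\<bar>" for q
  proof -
    obtain a b where "q = of_int a / of_int b" by (metis quotient_of_div surj_pair)
    then show ?thesis by (simp add: of_rat_divide norm_divide flip: abs_of_rat)
  qed
  ultimately show ?thesis
    unfolding archimedean_place_def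
    by (auto simp: mult add zero rat norm_mult norm_triangle_ineq)
qed

text \<open>A coefficient of the new product is an old coefficient plus \<open>- z\<close> times
  another, so each linear factor enlarges the bound by at most \<open>1 + r\<close> and keeps
  algebraic integers.\<close>

lemma coeff_linear_factors:
  fixes A :: "complex multiset"
  assumes "\<And>z. z \<in># A \<Longrightarrow> cmod z \<le> r \<and> algebraic_int z" "r \<ge> 0"
  shows "algebraic_int (Polynomial.coeff (\<Prod>z\<in>#A. [:- z, 1:]) i) \<and>
    cmod (Polynomial.coeff (\<Prod>z\<in>#A. [:- z, 1:]) i) \<le> (1 + r) ^ size A"
  using assms(1)
proof (induction A arbitrary: i)
  case empty
  show ?case by (auto simp: coeff_1)
next
  case (add z A)
  define p where "p = (\<Prod>z\<in>#A. [:- z, 1:])"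
  have IH: "algebraic_int (Polynomial.coeff p j)" "cmod (Polynomial.coeff p j) \<le> (1 + r) ^ size A" for j
    using add by (auto simp: p_def)
  have z: "cmod z \<le> r" "algebraic_int z" using add.prems[of z] by auto
  have c: "Polynomial.coeff ([:- z, 1:] * p) i =
      - (z * Polynomial.coeff p i) + (if i = 0 then 0 else Polynomial.coeff p (i - 1))"
    by (cases i) (auto simp: mult_pCons_left)
  have a: "algebraic_int (if i = 0 then 0 else Polynomial.coeff p (i - 1))"
    "cmod (if i = 0 then 0 else Polynomial.coeff p (i - 1)) \<le> (1 + r) ^ size A"
    using IH assms(2) by auto
  have b: "cmod (z * Polynomial.coeff p i) \<le> r * (1 + r) ^ size A"
    unfolding norm_mult using z IH assms(2) by (intro mult_mono) auto
  have "algebraic_int (- (z * Polynomial.coeff p i) + (if i = 0 then 0 else Polynomial.coeff p (i - 1)))"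
    using IH(1) z(2) a(1) by (intro algebraic_int_add_mult(1) algebraic_int_minus algebraic_int_add_mult(2))
  moreover have "cmod (- (z * Polynomial.coeff p i) + (if i = 0 then 0 else Polynomial.coeff p (i - 1)))
      \<le> (1 + r) ^ size (add_mset z A)"
    using norm_triangle_ineq[of "- (z * Polynomial.coeff p i)" "if i = 0 then 0 else Polynomial.coeff p (i - 1)"]
      a(2) b by (simp add: algebra_simps)
  moreover have "(\<Prod>z\<in>#add_mset z A. [:- z, 1:]) = [:- z, 1:] * p" by (simp add: p_def)
  ultimately show ?case unfolding c[symmetric] by simp
qed

text \<open>Northcott's theorem for \<open>K\<close>. Each complex root of the minimal polynomial of
  \<open>x\<close> over the rationals is the image of \<open>x\<close> under an embedding of
  \<open>K\<close>, whose absolute value is an archimedean place. So the roots are bounded, and with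
  them the coefficients, which are rational algebraic integers and thus integers.\<close>

lemma finite_bounded_algebraic_ints:
  assumes nf: "number_field TYPE('k::field_char_0)"
  shows "finite {x::'k. algebraic_int x \<and> (\<forall>v. archimedean_place v \<longrightarrow> v x < C)}"
proof -
  obtain d where d: "\<And>x::'k. \<exists>c::nat \<Rightarrow> rat. (\<exists>i\<le>d. c i \<noteq> 0) \<and> (\<Sum>i\<le>d. of_rat (c i) * x ^ i) = 0"
    by (rule number_field_degree[OF nf]) blast
  obtain B :: "'k set" where B: "finite B" "\<And>x. \<exists>c::'k \<Rightarrow> rat. x = (\<Sum>b\<in>B. of_rat (c b) * b)"
    using nf unfolding number_field_def by blast
  define Q where "Q = range (of_rat :: rat \<Rightarrow> 'k)"
  define e where "e x = (of_rat (inv_into UNIV of_rat x) :: complex)" for x :: 'k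
  interpret E: partial_embedding d Q e
    unfolding Q_def e_def using partial_embedding_rat[OF d] by simp
  \<comment> \<open>Nonnegative whatever the sign of \<open>C\<close>, as the bound on coefficients
    requires.\<close>
  define r where "r = \<bar>C\<bar>"
  define M where "M = \<lceil>(1 + r) ^ d\<rceil>"
  \<comment> \<open>Coefficient lists in place of polynomials: lists of bounded length over a finite
    set are finite in number. A polynomial of degree \<open>d\<close> has \<open>Suc d\<close>
    coefficients.\<close>
  define L where "L = {xs::'k list. set xs \<subseteq> of_int ` {- M..M} \<and> length xs \<le> Suc d}"
  have "finite (\<Union>xs\<in>{xs \<in> L. Poly xs \<noteq> 0}. {t. poly (Poly xs) t = 0})"
    unfolding L_def by (intro finite_UN_I finite_subset[OF _ finite_lists_length_le[of "of_int ` {- M..M}" "Suc d"]])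
      (auto intro: poly_roots_finite)
  moreover have "x \<in> (\<Union>xs\<in>{xs \<in> L. Poly xs \<noteq> 0}. {t. poly (Poly xs) t = 0})"
    if x: "algebraic_int x" "\<And>v. archimedean_place v \<Longrightarrow> v x < C" for x :: 'k
  proof -
    obtain m where m: "E.over_F m" "Polynomial.lead_coeff m = 1" "poly m x = 0" "Polynomial.degree m \<le> d"
      "\<And>p. E.over_F p \<Longrightarrow> p \<noteq> 0 \<Longrightarrow> poly p x = 0 \<Longrightarrow> Polynomial.degree m \<le> Polynomial.degree p"
      by (rule E.minimal_polynomial[of x]) blast
    have m0: "m \<noteq> 0" using m(2) by auto
    have lc: "Polynomial.lead_coeff (E.me m) = 1" "Polynomial.degree (E.me m) = Polynomial.degree m"
      using E.lead_coeff_me[OF m(2)] E.degree_me[OF m(2)] by auto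
    have me0: "E.me m \<noteq> 0" using lc(1) by auto
    obtain A where sA: "size A = Polynomial.degree (E.me m)"
      "E.me m = Polynomial.smult (Polynomial.lead_coeff (E.me m)) (\<Prod>z\<in>#A. [:- z, 1:])"
      using alg_closed_imp_factorization[OF me0] by (elim exE conjE)
    have A: "size A = Polynomial.degree m" by (rule HOL.trans[OF sA(1) lc(2)])
    have fac: "E.me m = (\<Prod>z\<in>#A. [:- z, 1:])"
      by (rule HOL.trans[OF sA(2)]) (simp only: lc(1) smult_1_left)
    have root: "cmod z \<le> r \<and> algebraic_int z" if z: "z \<in># A" for z
    proof -
      obtain A' where "A = add_mset z A'" using multi_member_split[OF z] by blast
      then have z0: "poly (E.me m) z = 0" unfolding fac by simp
      obtain F1 e1 where 1: "partial_embedding d F1 e1" "Q \<subseteq> F1" "x \<in> F1" "e1 x = z"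
        by (rule E.extend[OF m(1-3,5) z0]) blast+
      interpret E1: partial_embedding d F1 e1 by (rule 1(1))
      \<comment> \<open>Adjoining the finite spanning set \<open>B\<close> extends the embedding to
        all of \<open>K\<close>, while \<open>x\<close> still goes to \<open>z\<close>.\<close>
      obtain F2 e2 where 2: "partial_embedding d F2 e2" "F1 \<subseteq> F2" "\<forall>x\<in>F1. e2 x = e1 x" "B \<subseteq> F2"
        using E1.extend_finite[OF B(1)] by blast
      interpret E2: partial_embedding d F2 e2 by (rule 2(1))
      have "y \<in> F2" for y
      proof -
        obtain c where "y = (\<Sum>b\<in>B. of_rat (c b) * b)" using B(2) by blast
        then show ?thesis using 2(4) by (auto intro!: E2.sum_in E2.mult E2.rat)
      qed
      then have "F2 = UNIV" by blast
      then have "archimedean_place (\<lambda>x. cmod (e2 x))" using archimedean_place_embedding[of d e2] 2(1) by simp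
      from x(2)[OF this] have "cmod z < C" using 1 2 by auto
      moreover have "algebraic_int z" using E1.algebraic_int_image[OF 1(3) x(1)] 1(4) by simp
      ultimately show ?thesis by (simp add: r_def)
    qed
    have co: "Polynomial.coeff m i \<in> of_int ` {- M..M}" for i
    proof -
      obtain q where q: "Polynomial.coeff m i = of_rat q" using m(1) unfolding E.over_F_def unfolding Q_def by blast
      have eq: "Polynomial.coeff (E.me m) i = of_rat q" by (simp add: E.coeff_me q E.rat)
      have b: "algebraic_int (of_rat q :: complex)" "cmod (of_rat q) \<le> (1 + r) ^ size A"
        using coeff_linear_factors[of A r i] root unfolding fac[symmetric] eq by (auto simp: r_def)
      have "(of_rat q :: complex) \<in> \<int>" using b(1) by (rule rational_algebraic_int_is_int) simp
      then obtain k where k: "(of_rat q :: complex) = of_int k" by (elim Ints_cases)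
      then have "(of_rat q :: complex) = of_rat (of_int k)" by simp
      then have qk: "q = of_int k" by (simp only: of_rat_eq_iff)
      have "real_of_int \<bar>k\<bar> \<le> (1 + r) ^ size A" using b(2) unfolding k by simp
      also have "\<dots> \<le> (1 + r) ^ d" using A m(4) by (intro power_increasing) (auto simp: r_def)
      finally have "\<bar>k\<bar> \<le> M" unfolding M_def by linarith
      then show ?thesis unfolding q qk by (intro image_eqI[of _ _ k]) auto
    qed
    have "coeffs m \<in> L"
      unfolding L_def using co m(4) m0 by (auto simp: coeffs_def length_coeffs_degree)
    then show ?thesis using m(3) m0 by (intro UN_I[of "coeffs m"]) auto
  qed
  ultimately show ?thesis by (elim finite_subset[rotated]) blast
qed

lemma integer_ring_number_subring:
  assumes nf: "number_field TYPE('k::field_char_0)"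
  shows "number_subring {x::'k. algebraic_int x} integer_ring"
proof
  show "integer_ring = field_ring\<lparr>carrier := {x::'k. algebraic_int x}\<rparr>" by (rule integer_ring_def)
  show den: "\<exists>n::nat. n > 0 \<and> of_nat n * x \<in> {x. algebraic_int x}" for x :: 'k
    using number_field_denominator[OF nf, of x] by simp
  show "\<exists>a\<in>{x. algebraic_int x}. \<exists>s\<in>{x. algebraic_int x}. s \<noteq> 0 \<and> x = a / s" for x :: 'k
  proof -
    obtain n :: nat where "n > 0" "of_nat n * x \<in> {x. algebraic_int x}" using den by blast
    then show ?thesis by (intro bexI[of _ "of_nat n * x"] bexI[of _ "of_nat n"]) auto
  qed
qed (auto intro: algebraic_int_add_mult algebraic_int_minus)

subsection \<open>Completions\<close>

locale archimedean_absolute_value =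
  fixes v :: "'k::field_char_0 \<Rightarrow> real"
  assumes place: "archimedean_place v"
begin

lemma v_nonneg: "0 \<le> v x" and v_zero: "v x = 0 \<longleftrightarrow> x = 0" and v_mult: "v (x * y) = v x * v y"
  and v_add: "v (x + y) \<le> v x + v y"
  using place by (auto simp: archimedean_place_def)

lemma v_rat: "v (of_rat q) = real_of_rat \<bar>q\<bar>"
  using place by (auto simp: archimedean_place_def)

lemma v_uminus: "v (- x) = v x"
  using v_mult[of "of_rat (-1)" x] v_rat[of "-1"] by simp

lemma v_diff: "v (x - y) \<le> v x + v y"
  using v_add[of x "- y"] by (simp add: v_uminus)

lemma cauchy_simps:
  "u \<in> carrier (cauchy_sequences v) \<longleftrightarrow> (\<forall>e>0. \<exists>N. \<forall>m\<ge>N. \<forall>n\<ge>N. v (u m - u n) < e)"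
  "u \<otimes>\<^bsub>cauchy_sequences v\<^esub> w = (\<lambda>n. u n * w n)" "u \<oplus>\<^bsub>cauchy_sequences v\<^esub> w = (\<lambda>n. u n + w n)"
  "\<one>\<^bsub>cauchy_sequences v\<^esub> = (\<lambda>_. 1)" "\<zero>\<^bsub>cauchy_sequences v\<^esub> = (\<lambda>_. 0)"
  by (simp_all add: cauchy_sequences_def)

lemma cauchyE:
  assumes "u \<in> carrier (cauchy_sequences v)" "e > 0"
  obtains N where "\<And>m n. m \<ge> N \<Longrightarrow> n \<ge> N \<Longrightarrow> v (u m - u n) < e"
proof -
  have "\<exists>N. \<forall>m\<ge>N. \<forall>n\<ge>N. v (u m - u n) < e" using assms unfolding cauchy_simps by blast
  then show thesis using that by blast
qed

lemma cauchy_bounded: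
  assumes "u \<in> carrier (cauchy_sequences v)"
  obtains B where "B > 0" "\<And>n. v (u n) \<le> B"
proof -
  obtain N where N: "\<And>m n. m \<ge> N \<Longrightarrow> n \<ge> N \<Longrightarrow> v (u m - u n) < 1"
    by (rule cauchyE[OF assms, of 1]) auto
  show thesis
  proof (rule that[of "(\<Sum>i<N. v (u i)) + v (u N) + 1"])
    have s: "0 \<le> (\<Sum>i<N. v (u i))" by (intro sum_nonneg v_nonneg)
    then show "(\<Sum>i<N. v (u i)) + v (u N) + 1 > 0" using v_nonneg[of "u N"] by linarith
    show "v (u n) \<le> (\<Sum>i<N. v (u i)) + v (u N) + 1" for n
    proof (cases "n < N")
      case True
      then have "v (u n) \<le> (\<Sum>i<N. v (u i))" by (intro member_le_sum v_nonneg) auto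
      then show ?thesis using v_nonneg[of "u N"] by linarith
    next
      case False
      then show ?thesis using v_add[of "u n - u N" "u N"] N[of n N] s by simp
    qed
  qed
qed

lemma cauchy_add:
  assumes u: "u \<in> carrier (cauchy_sequences v)" and w: "w \<in> carrier (cauchy_sequences v)"
  shows "(\<lambda>n. u n + w n) \<in> carrier (cauchy_sequences v)"
  unfolding cauchy_simps
proof (intro allI impI)
  fix e :: real assume "e > 0"
  then have e: "e / 2 > 0" by simp
  obtain M where M: "\<And>m n. m \<ge> M \<Longrightarrow> n \<ge> M \<Longrightarrow> v (u m - u n) < e / 2"
    by (rule cauchyE[OF u e]) blast
  obtain N where N: "\<And>m n. m \<ge> N \<Longrightarrow> n \<ge> N \<Longrightarrow> v (w m - w n) < e / 2"
    by (rule cauchyE[OF w e]) blast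
  have "v (u m + w m - (u n + w n)) < e" if mn: "m \<ge> max M N" "n \<ge> max M N" for m n
  proof -
    have eq: "u m + w m - (u n + w n) = (u m - u n) + (w m - w n)" by simp
    show ?thesis unfolding eq using v_add[of "u m - u n" "w m - w n"] M[of m n] N[of m n] mn by simp
  qed
  then show "\<exists>N. \<forall>m\<ge>N. \<forall>n\<ge>N. v (u m + w m - (u n + w n)) < e" by blast
qed

lemma cauchy_mult:
  assumes u: "u \<in> carrier (cauchy_sequences v)" and w: "w \<in> carrier (cauchy_sequences v)"
  shows "(\<lambda>n. u n * w n) \<in> carrier (cauchy_sequences v)"
  unfolding cauchy_simps
proof (intro allI impI)
  fix e :: real assume e: "e > 0"
  obtain A where A: "A > 0" "\<And>n. v (u n) \<le> A" using cauchy_bounded[OF u] by blast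
  obtain B where B: "B > 0" "\<And>n. v (w n) \<le> B" using cauchy_bounded[OF w] by blast
  have eA: "e / (2 * A) > 0" and eB: "e / (2 * B) > 0" using e A B by auto
  obtain M where M: "\<And>m n. m \<ge> M \<Longrightarrow> n \<ge> M \<Longrightarrow> v (u m - u n) < e / (2 * B)"
    by (rule cauchyE[OF u eB]) blast
  obtain N where N: "\<And>m n. m \<ge> N \<Longrightarrow> n \<ge> N \<Longrightarrow> v (w m - w n) < e / (2 * A)"
    by (rule cauchyE[OF w eA]) blast
  have "v (u m * w m - u n * w n) < e" if mn: "m \<ge> max M N" "n \<ge> max M N" for m n
  proof -
    have "u m * w m - u n * w n = u m * (w m - w n) + (u m - u n) * w n" by (simp add: algebra_simps)
    then have "v (u m * w m - u n * w n) \<le> v (u m) * v (w m - w n) + v (u m - u n) * v (w n)"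
      using v_add[of "u m * (w m - w n)" "(u m - u n) * w n"] by (simp add: v_mult)
    also have "\<dots> \<le> A * v (w m - w n) + v (u m - u n) * B"
      using A B v_nonneg by (intro add_mono mult_right_mono mult_left_mono) auto
    also have "\<dots> < A * (e / (2 * A)) + e / (2 * B) * B"
      using M[of m n] N[of m n] mn A(1) B(1)
      by (intro add_strict_mono mult_strict_left_mono mult_strict_right_mono) auto
    also have "\<dots> = e" using A(1) B(1) by simp
    finally show ?thesis .
  qed
  then show "\<exists>N. \<forall>m\<ge>N. \<forall>n\<ge>N. v (u m * w m - u n * w n) < e" by blast
qed

lemma cauchy_const: "(\<lambda>_. a) \<in> carrier (cauchy_sequences v)"
  by (simp add: cauchy_simps v_zero[THEN iffD2])

lemma cauchy_uminus:
  assumes "u \<in> carrier (cauchy_sequences v)"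
  shows "(\<lambda>n. - u n) \<in> carrier (cauchy_sequences v)"
  using cauchy_mult[OF cauchy_const[of "- 1"] assms] by simp

lemma cauchy_cring: "cring (cauchy_sequences v)"
proof (rule cringI)
  show "abelian_group (cauchy_sequences v)"
  proof (rule abelian_groupI)
    fix u assume u: "u \<in> carrier (cauchy_sequences v)"
    show "\<exists>w\<in>carrier (cauchy_sequences v). w \<oplus>\<^bsub>cauchy_sequences v\<^esub> u = \<zero>\<^bsub>cauchy_sequences v\<^esub>"
      by (rule bexI[OF _ cauchy_uminus[OF u]]) (simp add: cauchy_simps(2-))
  qed (auto simp: cauchy_simps(2-) cauchy_add cauchy_const algebra_simps)
  show "comm_monoid (cauchy_sequences v)"
    by (rule comm_monoidI) (auto simp: cauchy_simps(2-) cauchy_mult cauchy_const algebra_simps)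
qed (auto simp: cauchy_simps(2-) algebra_simps)

sublocale S: cring "cauchy_sequences v" by (rule cauchy_cring)

lemma null_subset: "null_sequences v \<subseteq> carrier (cauchy_sequences v)"
proof
  fix u assume "u \<in> null_sequences v"
  then have u: "(\<lambda>n. v (u n)) \<longlonglongrightarrow> 0" by (simp add: null_sequences_def)
  show "u \<in> carrier (cauchy_sequences v)"
    unfolding cauchy_simps
  proof (intro allI impI)
    fix e :: real assume "e > 0"
    then obtain N where N: "\<And>n. n \<ge> N \<Longrightarrow> \<bar>v (u n)\<bar> < e / 2"
      using LIMSEQ_D[OF u, of "e / 2"] by auto
    have "v (u m - u n) < e" if "m \<ge> N" "n \<ge> N" for m n
      using v_diff[of "u m" "u n"] N[OF that(1)] N[OF that(2)] by linarith
    then show "\<exists>N. \<forall>m\<ge>N. \<forall>n\<ge>N. v (u m - u n) < e" by blast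
  qed
qed

text \<open>Cauchy sequences are bounded, so their products with null sequences tend to
  zero.\<close>

lemma null_ideal: "ideal (null_sequences v) (cauchy_sequences v)"
proof (rule idealI[OF S.ring_axioms])
  show "subgroup (null_sequences v) (add_monoid (cauchy_sequences v))"
  proof (rule S.add.subgroupI[OF null_subset])
    show "null_sequences v \<noteq> {}"
      using v_zero[of 0] by (auto simp: null_sequences_def intro!: exI[of _ "\<lambda>_. 0"])
    fix u assume u: "u \<in> null_sequences v"
    have "\<ominus>\<^bsub>cauchy_sequences v\<^esub> u = (\<lambda>n. - u n)"
      using u null_subset by (intro S.minus_equality cauchy_uminus) (auto simp: cauchy_simps(2-))
    then show "\<ominus>\<^bsub>cauchy_sequences v\<^esub> u \<in> null_sequences v"
      using u by (simp add: null_sequences_def v_uminus)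
    fix w assume w: "w \<in> null_sequences v"
    have "(\<lambda>n. v (u n) + v (w n)) \<longlonglongrightarrow> 0"
      using tendsto_add[of "\<lambda>n. v (u n)" 0 sequentially "\<lambda>n. v (w n)" 0] u w by (simp add: null_sequences_def)
    then have "(\<lambda>n. v (u n + w n)) \<longlonglongrightarrow> 0"
      by (rule Lim_null_comparison[rotated]) (simp add: v_nonneg v_add)
    then show "u \<oplus>\<^bsub>cauchy_sequences v\<^esub> w \<in> null_sequences v" by (simp add: cauchy_simps null_sequences_def)
  qed
  fix u w assume u: "u \<in> null_sequences v" and w: "w \<in> carrier (cauchy_sequences v)"
  obtain B where B: "B > 0" "\<And>n. v (w n) \<le> B" using cauchy_bounded[OF w] by blast
  have lim: "(\<lambda>n. B * v (u n)) \<longlonglongrightarrow> 0"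
    using tendsto_mult_right_zero[of "\<lambda>n. v (u n)" sequentially B] u by (simp add: null_sequences_def)
  have "\<forall>n. norm (v (w n * u n)) \<le> B * v (u n)"
    using B v_nonneg by (auto simp: v_mult intro!: mult_right_mono)
  then have "(\<lambda>n. v (w n * u n)) \<longlonglongrightarrow> 0"
    by (rule Lim_null_comparison[OF always_eventually lim])
  then show "w \<otimes>\<^bsub>cauchy_sequences v\<^esub> u \<in> null_sequences v" "u \<otimes>\<^bsub>cauchy_sequences v\<^esub> w \<in> null_sequences v"
    by (auto simp: cauchy_simps null_sequences_def mult.commute)
qed

lemma completion_cring: "cring (place_completion v)"
  unfolding place_completion_def by (rule ideal.quotient_is_cring[OF null_ideal cauchy_cring])

lemma to_completion_hom: "to_completion v \<in> ring_hom field_ring (place_completion v)"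
proof -
  have "(\<lambda>a _. a) \<in> ring_hom field_ring (cauchy_sequences v)"
    by (rule ring_hom_memI) (auto simp: cauchy_const cauchy_simps(2-) Kf.R_simps)
  from ring_hom_trans[OF this ideal.rcos_ring_hom[OF null_ideal]] show ?thesis
    by (simp add: place_completion_def comp_def to_completion_def[abs_def])
qed

text \<open>Every representative of the class is the constant sequence plus a null sequence, so all
  of them give the same limit \<open>v a\<close>.\<close>

lemma completion_abs: "completion_abs v (to_completion v a) = v a"
proof -
  have lim: "(\<lambda>n. v (u n)) \<longlonglongrightarrow> v a" if u: "u \<in> to_completion v a" for u
  proof -
    obtain h where h: "h \<in> null_sequences v" and eq: "u = (\<lambda>n. h n + a)"
      using u by (auto simp: to_completion_def a_r_coset_def' cauchy_simps(3))
    have "\<forall>n. norm (v (u n) - v a) \<le> v (h n)"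
    proof
      show "norm (v (u n) - v a) \<le> v (h n)" for n using v_add[of "h n" a] v_diff[of "h n + a" "h n"] by (simp add: eq)
    qed
    moreover have "(\<lambda>n. v (h n)) \<longlonglongrightarrow> 0" using h by (simp add: null_sequences_def)
    ultimately have "(\<lambda>n. v (u n) - v a) \<longlonglongrightarrow> 0"
      by (rule Lim_null_comparison[OF always_eventually])
    then show ?thesis by (rule LIM_zero_cancel)
  qed
  have "(\<lambda>_. 0) \<in> null_sequences v" using v_zero[of 0] by (simp add: null_sequences_def)
  then have "(\<lambda>n. 0 + a) \<in> to_completion v a"
    unfolding to_completion_def a_r_coset_def' cauchy_simps(3) by (intro UN_I[of "\<lambda>_. 0"]) auto
  then obtain u where u: "u \<in> to_completion v a" by blast
  show ?thesis unfolding completion_abs_def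
    by (rule the_equality) (use u lim LIMSEQ_unique in blast)+
qed

sublocale B: affine "place_completion v" by (rule affineI[OF completion_cring])

sublocale ec: affine_hom field_ring "place_completion v" "to_completion v"
  by (intro affine_hom.intro affine_hom_axioms.intro Kf.Ra.affine_axioms B.affine_axioms to_completion_hom)

text \<open>The local point is \<open>Q\<close> after the map of spectra induced by \<open>K\<close>
  into its completion. A global section of \<open>Spec K\<close> is given by its generic value
  \<open>a\<close>, so the value at the local point is the class of the constant sequence
  \<open>a\<close>.\<close>

lemma rational_point_local_point:
  fixes U :: "('p, 'a) ringed_space"
  assumes U: "local_space U" and \<pi>: "morphism U (Spec field_ring) \<pi>"
    and Q: "Q \<in> rational_points U \<pi>"
  defines "x \<equiv> comp_map (Spec field_ring) Q (Spec_map field_ring (place_completion v) (to_completion v))"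
  shows "x \<in> local_points v U \<pi>"
    and "s \<in> carrier (sec U (points U)) \<Longrightarrow>
      completion_abs v (value_at (place_completion v) U s x) = v (Kf.generic_value (pull Q (points U) s))"
proof -
  let ?K = "Spec (field_ring :: 'k ring)" and ?B = "Spec (place_completion v)"
  let ?h = "Spec_map field_ring (place_completion v) (to_completion v)"
  have Qm: "morphism ?K U Q" and id: "same_map ?K ?K (comp_map U \<pi> Q) id_map"
    using Q by (auto simp: rational_points_def points_over_def)
  have Qh: "ringed_map_hom ?K U Q" using Qm morphism_iff[OF Kf.Ra.local_space_Spec U] by blast
  interpret Q: ringed_map_hom ?K U Q by (rule Qh)
  have ph: "ringed_map_hom U ?K \<pi>" using \<pi> morphism_iff[OF U Kf.Ra.local_space_Spec] by blast
  interpret p: ringed_map_hom U ?K \<pi> by (rule ph)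
  interpret e: ringed_map_hom ?B ?K ?h by (rule ec.Spec_map_hom)
  have pt_id: "pt \<pi> (pt Q p) = p" if "p \<in> points ?K" for p
    using id that by (simp add: same_map_def comp_map_def id_map_def)
  have pull_id: "pull Q (preim U \<pi> V) (pull \<pi> V \<alpha>) = \<alpha>" if "Kf.Ra.opn V" "\<alpha> \<in> carrier (sec ?K V)" for V \<alpha>
    using id that by (simp add: same_map_def comp_map_def id_map_def)
  have pre: "preim ?K Q (preim U \<pi> V) = V" if V: "Kf.Ra.opn V" for V
    using openin_subset[OF V] by (auto simp: Q.mem_preim p.mem_preim pt_id Q.pt_closed)
  have "morphism ?B U x" unfolding x_def
    by (rule morphism_comp[OF B.local_space_Spec Kf.Ra.local_space_Spec U ec.Spec_map_morphism Qm])
  moreover have "same_map ?B ?K (comp_map U \<pi> x) ?h"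
    unfolding same_map_def
    by (auto simp: comp_map_def x_def pt_id e.pt_closed pre pull_id)
  ultimately show "x \<in> local_points v U \<pi>" by (simp add: local_points_def points_over_def)
  assume s: "s \<in> carrier (sec U (points U))"
  define a where "a = Kf.generic_value (pull Q (points U) s)"
  have ac: "a \<in> carrier field_ring" by (simp add: Kf.R_simps)
  have Qs: "pull Q (points U) s \<in> carrier (sec ?K (points ?K))"
    using Q.pull_closed[OF openin_topspace s] by (simp only: Q.preim_points)
  have "pull Q (points U) s = Spec_global_section field_ring a"
    by (rule Kf.generic_value_inj[OF openin_topspace Qs Kf.Ra.global_section_closed[OF ac]])
      (simp add: Kf.generic_value_global a_def)
  then have px: "pull x (points U) s = Spec_global_section (place_completion v) (to_completion v a)"
    using ec.Spec_map_global_section[OF ac] by (simp add: x_def comp_map_def Q.preim_points)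
  \<comment> \<open>The definite description is resolved by injectivity of global sections over the
    completion.\<close>
  have "value_at (place_completion v) U s x = to_completion v a"
    unfolding value_at_def px
  proof (rule the_equality)
    show "to_completion v a \<in> carrier (place_completion v) \<and>
      Spec_global_section (place_completion v) (to_completion v a) =
      Spec_global_section (place_completion v) (to_completion v a)"
      using ec.h_closed[OF ac] by blast
    show "\<And>b. b \<in> carrier (place_completion v) \<and> Spec_global_section (place_completion v) (to_completion v a) =
      Spec_global_section (place_completion v) b \<Longrightarrow> b = to_completion v a"
      using B.global_section_inj[OF _ ec.h_closed[OF ac]] by metis
  qed
  then show "completion_abs v (value_at (place_completion v) U s x) = v (Kf.generic_value (pull Q (points U) s))"
    using completion_abs by (simp add: a_def)
qed

end

section \<open>Values at rational points\<close>

lemma field_number_subring: "number_subring (UNIV :: 'k::field_char_0 set) field_ring"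
proof (intro number_subring.intro number_subring_axioms.intro field_fraction_subring)
  show "\<exists>n::nat. n > 0 \<and> of_nat n * x \<in> UNIV" for x :: 'k by auto
qed

text \<open>\<open>U\<close> is regarded as a model over the base ring \<open>K\<close>, so that the
  facts about values at points of a model apply to its rational points.\<close>

locale variety_over = base: model "UNIV :: 'k::field_char_0 set" field_ring U \<pi>
  for U :: "('p, 'a) ringed_space"
    and \<pi> :: "('p, 'k::field_char_0 set, 'a, 'k set \<Rightarrow> ('k \<times> 'k) set) ringed_map" +
  assumes integral: "integral_scheme U"
begin

abbreviation opn where "opn \<equiv> openin (topo U)"

abbreviation value_in where "value_in Q V s \<equiv> Kf.generic_value (pull Q V s)"

lemma domain_sec: "opn V \<Longrightarrow> V \<noteq> {} \<Longrightarrow> domain (sec U V)"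
  using integral by (simp add: integral_scheme_def)

lemma domain_global: "domain (sec U (points U))"
  using integral by (simp add: integral_scheme_def)

sublocale G: domain "sec U (points U)" by (rule domain_global)

lemma rational_point_morphism: "Q \<in> rational_points U \<pi> \<Longrightarrow> morphism (Spec field_ring) U Q"
  by (simp add: rational_points_def points_over_def)

lemma pt_rational_point:
  assumes "Q \<in> rational_points U \<pi>"
  shows "pt Q {0} \<in> points U"
proof -
  interpret q: ringed_map_hom "Spec field_ring" U Q
    by (rule base.point_hom[OF rational_point_morphism[OF assms]])
  show ?thesis by (rule q.pt_closed[OF Kf.generic_point])
qed

lemma value_hom:
  assumes "Q \<in> rational_points U \<pi>"
  shows "value_in Q (points U) \<in> ring_hom (sec U (points U)) field_ring"
  using base.point_value_hom[OF rational_point_morphism[OF assms] openin_topspace pt_rational_point[OF assms]]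
  by simp

lemma value_unit:
  assumes Q: "Q \<in> rational_points U \<pi>" and V: "opn V" "pt Q {0} \<in> V" "t \<in> carrier (sec U V)"
    and u: "base.fm.X.unit_at (pt Q {0}) V t"
  shows "value_in Q V t \<noteq> 0"
proof -
  interpret q: ringed_map_hom "Spec field_ring" U Q
    by (rule base.point_hom[OF rational_point_morphism[OF Q]])
  have "{0} \<in> preim (Spec field_ring) Q V" using V Kf.generic_point by (simp add: q.mem_preim)
  then show ?thesis
    using Kf.unit_at_generic_iff[OF q.opn_preim[OF V(1)] _ q.pull_closed[OF V(1,3)]]
      q.unit_at_pull[OF Kf.generic_point V u] by blast
qed

definition const :: "'k \<Rightarrow> 'a" where
  "const c = pull \<pi> (prime_spectrum field_ring) (Spec_global_section field_ring c)"

lemma const_closed: "const c \<in> carrier (sec U (points U))"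
  using base.fm.pull_closed[OF openin_topspace Kf.Ra.global_section_closed[of c]]
  by (simp add: const_def Kf.R_simps base.fm.preim_points Kf.Ra.points_Spec[symmetric])

lemma value_const:
  assumes Q: "Q \<in> rational_points U \<pi>"
  shows "value_in Q (points U) (const c) = c"
proof -
  let ?P = "points (Spec (field_ring :: 'k ring))"
  have c: "c \<in> carrier field_ring" by (simp add: Kf.R_simps)
  have "same_map (Spec field_ring) (Spec field_ring) (comp_map U \<pi> Q) id_map"
    using Q by (simp add: rational_points_def points_over_def)
  then have "pull (comp_map U \<pi> Q) ?P (Spec_global_section field_ring c) =
      pull id_map ?P (Spec_global_section field_ring c)"
    using openin_topspace[of "topo (Spec (field_ring :: 'k ring))"] Kf.Ra.global_section_closed[OF c]
    unfolding same_map_def by blast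
  then have "pull Q (points U) (const c) = Spec_global_section field_ring c"
    by (simp add: comp_map_def id_map_def base.fm.preim_points const_def Kf.Ra.points_Spec[symmetric])
  then show ?thesis by (simp add: Kf.generic_value_global)
qed

text \<open>On an affine chart a section is a fraction \<open>c / d\<close>. If it vanishes at a dense set of points, then
  \<open>cd\<close> lies in every prime, hence is nilpotent.\<close>

lemma vanishes_locally:
  assumes Z: "Z \<subseteq> rational_points U \<pi>" and dense: "zariski_dense U Z"
    and F: "F \<in> carrier (sec U (points U))" and van: "\<And>Q. Q \<in> Z \<Longrightarrow> value_in Q (points U) F = 0"
    and u: "u \<in> points U"
  shows "\<exists>N. opn N \<and> u \<in> N \<and> res U (points U) N F = \<zero>\<^bsub>sec U N\<^esub>"
proof -
  have top: "opn (points U)" by simp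
  obtain W where W: "affine_open U W" "u \<in> W"
    using integral u unfolding integral_scheme_def scheme_def by blast
  obtain A :: "'a ring" and h g where "affine_chart U W A h g"
    by (rule affine_openE[OF base.fm.X.presheaf_space_axioms W(1)])
  then interpret ch: affine_chart U W A h g .
  obtain c d N where c: "c \<in> carrier A" and d: "d \<in> carrier A" "d \<notin> pt h u"
    and N: "opn N" "N \<subseteq> points U" "N \<subseteq> W" and iff: "\<And>y. y \<in> W \<Longrightarrow> y \<in> N \<longleftrightarrow> d \<notin> pt h y"
    and eq: "res U (points U) N F \<otimes>\<^bsub>sec U N\<^esub> res U W N (ch.chart d) = res U W N (ch.chart c)"
    using ch.section_quotient[OF top u W(2) F] by metis
  have uN: "u \<in> N" using iff[OF W(2)] d by simp
  define r a b where "r = res U (points U) N F" and "a = res U W N (ch.chart c)" and "b = res U W N (ch.chart d)"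
  have rab: "r \<in> carrier (sec U N)" "a \<in> carrier (sec U N)" "b \<in> carrier (sec U N)"
    unfolding r_def a_def b_def using base.fm.X.res_closed[OF top N(1,2) F]
      base.fm.X.res_closed[OF ch.W N(1,3) ch.chart_closed[OF c]] base.fm.X.res_closed[OF ch.W N(1,3) ch.chart_closed[OF d(1)]]
    by auto
  have cd: "c \<otimes>\<^bsub>A\<^esub> d \<in> carrier A" using c d by simp
  have "c \<otimes>\<^bsub>A\<^esub> d \<in> q" if q: "primeideal q A" for q
  proof (rule ccontr)
    assume nq: "c \<otimes>\<^bsub>A\<^esub> d \<notin> q"
    \<comment> \<open>The open set where \<open>c\<close> and \<open>d\<close> are both invertible.
      The point of the chart that belongs to \<open>q\<close> lies in it, so by density some point
      of \<open>Z\<close> does.\<close>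
    define G where "G = preim (open_subspace U W) h (ch.aA.basic (c \<otimes>\<^bsub>A\<^esub> d))"
    have memG: "y \<in> G \<longleftrightarrow> y \<in> W \<and> c \<otimes>\<^bsub>A\<^esub> d \<notin> pt h y" for y
      using ch.pt_h[of y] by (auto simp: G_def ch.hm.mem_preim base.fm.X.open_subspace_points[OF ch.W] ch.aA.mem_basic
          ch.aA.points_Spec prime_spectrum_def)
    have qp: "q \<in> points (Spec A)" using q by (simp add: ch.aA.points_Spec prime_spectrum_def)
    have "opn G"
      using ch.hm.opn_preim[OF ch.aA.opn_basic[OF cd]] base.fm.X.open_subspace_opn[OF ch.W] by (simp add: G_def)
    moreover have gG: "pt g q \<in> G" using ch.pt_g[OF qp] ch.pt_hg[OF qp] nq by (simp add: memG)
    moreover have "pt g q \<in> topo U closure_of (\<Union>Q\<in>Z. pt Q ` points (Spec (field_ring :: 'k ring)))"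
      using dense openin_subset[OF \<open>opn G\<close>] gG unfolding zariski_dense_def by blast
    ultimately have "\<exists>y\<in>(\<Union>Q\<in>Z. pt Q ` points (Spec (field_ring :: 'k ring))). y \<in> G"
      unfolding in_closure_of by blast
    then obtain Q where Q: "Q \<in> Z" "pt Q {0} \<in> G" by (auto simp: points_Spec_field)
    have QR: "Q \<in> rational_points U \<pi>" using Q(1) Z by blast
    have pW: "pt Q {0} \<in> W" "c \<otimes>\<^bsub>A\<^esub> d \<notin> pt h (pt Q {0})" using Q(2) by (auto simp: memG)
    have pr: "primeideal (pt h (pt Q {0})) A"
      using ch.pt_h[OF pW(1)] by (simp add: ch.aA.points_Spec prime_spectrum_def)
    have cn: "c \<notin> pt h (pt Q {0})" and dn: "d \<notin> pt h (pt Q {0})"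
      using pW(2) ch.aA.prime_mem_mult_iff[OF pr c d(1)] by auto
    have pN: "pt Q {0} \<in> N" using iff[OF pW(1)] dn by simp
    note mQ = rational_point_morphism[OF QR]
    \<comment> \<open>As \<open>F\<close> vanishes at \<open>Q\<close>, so does \<open>c\<close>;
      but \<open>c\<close> is invertible there.\<close>
    have "value_in Q N r * value_in Q N b = value_in Q N a"
      using base.field_ring_hom_simps(1)[OF base.point_value_hom[OF mQ N(1) pN] rab(1,3)] eq
      by (simp add: r_def a_def b_def)
    moreover have "value_in Q N r = 0"
      unfolding r_def using base.point_value_res[OF mQ top N(1,2) pN F] van[OF Q(1)] by simp
    moreover have "value_in Q N a = value_in Q W (ch.chart c)"
      unfolding a_def by (rule base.point_value_res[OF mQ ch.W N(1,3) pN ch.chart_closed[OF c]])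
    moreover have "value_in Q W (ch.chart c) \<noteq> 0"
      using value_unit[OF QR ch.W pW(1) ch.chart_closed[OF c]] ch.unit_at_chart[OF pW(1) c] cn by simp
    ultimately show False by simp
  qed
  then obtain k :: nat where k: "(c \<otimes>\<^bsub>A\<^esub> d) [^]\<^bsub>A\<^esub> k = \<zero>\<^bsub>A\<^esub>"
    using ch.aA.nilpotent_if_in_all_primes[OF cd] by blast
  interpret D: domain "sec U N" using domain_sec[OF N(1)] uN by blast
  have hom: "(\<lambda>x. res U W N (ch.chart x)) \<in> ring_hom A (sec U N)"
    using ring_hom_trans[OF ch.chart_hom base.fm.X.res_hom[OF ch.W N(1,3)]] by (simp add: comp_def)
  have ab: "a \<otimes>\<^bsub>sec U N\<^esub> b = res U W N (ch.chart (c \<otimes>\<^bsub>A\<^esub> d))"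
    using ring_hom_mult[OF hom c d(1)] by (simp add: a_def b_def)
  have "(a \<otimes>\<^bsub>sec U N\<^esub> b) [^]\<^bsub>sec U N\<^esub> k = \<zero>\<^bsub>sec U N\<^esub>"
  proof -
    interpret rh: ring_hom_ring A "sec U N" "\<lambda>x. res U W N (ch.chart x)"
      by (rule ring_hom_ringI2[OF ch.aA.ring_axioms D.ring_axioms hom])
    show ?thesis unfolding ab using rh.hom_nat_pow[OF cd, of k] k by simp
  qed
  moreover have "x = \<zero>\<^bsub>sec U N\<^esub>" if "x \<in> carrier (sec U N)" "x [^]\<^bsub>sec U N\<^esub> (k::nat) = \<zero>\<^bsub>sec U N\<^esub>" for x
    using that by (induction k) (auto simp: D.integral_iff)
  ultimately have ab0: "a = \<zero>\<^bsub>sec U N\<^esub> \<or> b = \<zero>\<^bsub>sec U N\<^esub>" using rab D.integral by simp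
  \<comment> \<open>\<open>d\<close> is invertible at \<open>u\<close>. Were its restriction to
    \<open>N\<close> zero, one would equal zero in the ring of sections over a nonempty open set,
    which is a domain.\<close>
  have "b \<noteq> \<zero>\<^bsub>sec U N\<^esub>"
  proof
    assume b0: "b = \<zero>\<^bsub>sec U N\<^esub>"
    have "base.fm.X.unit_at u W (ch.chart d)" using ch.unit_at_chart[OF W(2) d(1)] d(2) by simp
    then obtain M t where M: "opn M" "u \<in> M" "M \<subseteq> W" "t \<in> carrier (sec U M)"
      "res U W M (ch.chart d) \<otimes>\<^bsub>sec U M\<^esub> t = \<one>\<^bsub>sec U M\<^esub>" unfolding base.fm.X.unit_at_def by blast
    have L: "opn (M \<inter> N)" "M \<inter> N \<subseteq> M" "M \<inter> N \<subseteq> N" using M N by auto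
    interpret E: domain "sec U (M \<inter> N)" by (rule domain_sec[OF L(1)]) (use M uN in blast)
    have dM: "res U W M (ch.chart d) \<in> carrier (sec U M)"
      by (rule base.fm.X.res_closed[OF ch.W M(1,3) ch.chart_closed[OF d(1)]])
    have "\<one>\<^bsub>sec U (M \<inter> N)\<^esub> = res U M (M \<inter> N) (res U W M (ch.chart d) \<otimes>\<^bsub>sec U M\<^esub> t)"
      using base.fm.X.res_one[OF M(1) L(1,2)] M(5) by simp
    also have "\<dots> = res U M (M \<inter> N) (res U W M (ch.chart d)) \<otimes>\<^bsub>sec U (M \<inter> N)\<^esub> res U M (M \<inter> N) t"
      using ring_hom_mult[OF base.fm.X.res_hom[OF M(1) L(1,2)] dM M(4)] .
    also have "res U M (M \<inter> N) (res U W M (ch.chart d)) = res U N (M \<inter> N) b"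
      unfolding b_def using base.fm.X.res_res M N L ch.W ch.chart_closed[OF d(1)] by simp
    also have "\<dots> = \<zero>\<^bsub>sec U (M \<inter> N)\<^esub>" unfolding b0 by (rule base.fm.X.res_zero[OF N(1) L(1,3)])
    finally show False using base.fm.X.res_closed[OF M(1) L(1,2) M(4)] by simp
  qed
  then have "r = \<zero>\<^bsub>sec U N\<^esub>" using ab0 eq rab D.integral[of r b] by (auto simp: r_def a_def b_def)
  then show ?thesis using N(1) uN by (auto simp: r_def)
qed

text \<open>The neighbourhoods on which \<open>F\<close> vanishes cover \<open>U\<close>, and a
  section of a sheaf is determined by its restrictions to a cover.\<close>

lemma vanishes_if_dense:
  assumes Z: "Z \<subseteq> rational_points U \<pi>" and dense: "zariski_dense U Z"
    and F: "F \<in> carrier (sec U (points U))" and van: "\<And>Q. Q \<in> Z \<Longrightarrow> value_in Q (points U) F = 0"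
  shows "F = \<zero>\<^bsub>sec U (points U)\<^esub>"
proof -
  define \<C> where "\<C> = {N. opn N \<and> res U (points U) N F = \<zero>\<^bsub>sec U N\<^esub>}"
  have un: "\<Union>\<C> = points U"
  proof
    show "\<Union>\<C> \<subseteq> points U" using openin_subset by (auto simp: \<C>_def)
    show "points U \<subseteq> \<Union>\<C>" using vanishes_locally[OF assms] by (auto simp: \<C>_def)
  qed
  have sheaf: "sheaf_of_rings U"
    using integral by (simp add: integral_scheme_def scheme_def locally_ringed_space_def)
  have "\<forall>W\<in>\<C>. opn W" by (simp add: \<C>_def)
  then have loc: "\<forall>s\<in>carrier (sec U (\<Union>\<C>)). \<forall>t\<in>carrier (sec U (\<Union>\<C>)).
      (\<forall>W\<in>\<C>. res U (\<Union>\<C>) W s = res U (\<Union>\<C>) W t) \<longrightarrow> s = t"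
    by (rule sheaf[unfolded sheaf_of_rings_def, THEN conjunct2, THEN conjunct2, THEN conjunct2, THEN conjunct2,
        THEN spec, THEN mp, THEN conjunct1])
  show ?thesis
  proof (rule loc[unfolded un, THEN bspec, OF F, THEN bspec, OF G.zero_closed, THEN mp], rule ballI)
    fix W assume "W \<in> \<C>"
    then have W: "opn W" "res U (points U) W F = \<zero>\<^bsub>sec U W\<^esub>" by (auto simp: \<C>_def)
    show "res U (points U) W F = res U (points U) W \<zero>\<^bsub>sec U (points U)\<^esub>"
      using base.fm.X.res_zero[OF openin_topspace W(1) openin_subset[OF W(1)]] W(2) by simp
  qed
qed

text \<open>The product of the members of \<open>T\<close>, which is nonzero because the global
  sections form a domain.\<close>

lemma common_multiple:
  assumes "finite T" "T \<subseteq> carrier (sec U (points U)) - {\<zero>\<^bsub>sec U (points U)\<^esub>}"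
  shows "\<exists>F\<in>carrier (sec U (points U)). F \<noteq> \<zero>\<^bsub>sec U (points U)\<^esub> \<and>
    (\<forall>Q\<in>rational_points U \<pi>. (\<exists>t\<in>T. value_in Q (points U) t = 0) \<longrightarrow> value_in Q (points U) F = 0)"
  using assms
proof (induction T rule: finite_induct)
  case empty
  then show ?case by (intro bexI[of _ "\<one>\<^bsub>sec U (points U)\<^esub>"]) auto
next
  case (insert t T)
  then obtain F where F: "F \<in> carrier (sec U (points U))" "F \<noteq> \<zero>\<^bsub>sec U (points U)\<^esub>"
    "\<And>Q t. Q \<in> rational_points U \<pi> \<Longrightarrow> t \<in> T \<Longrightarrow> value_in Q (points U) t = 0 \<Longrightarrow> value_in Q (points U) F = 0"
    by blast
  have t: "t \<in> carrier (sec U (points U))" "t \<noteq> \<zero>\<^bsub>sec U (points U)\<^esub>" using insert.prems by auto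
  have "value_in Q (points U) (t \<otimes>\<^bsub>sec U (points U)\<^esub> F) = value_in Q (points U) t * value_in Q (points U) F"
    if "Q \<in> rational_points U \<pi>" for Q
    using base.field_ring_hom_simps(1)[OF value_hom[OF that] t(1) F(1)] .
  moreover have "t \<otimes>\<^bsub>sec U (points U)\<^esub> F \<noteq> \<zero>\<^bsub>sec U (points U)\<^esub>"
    using t F(1,2) by (simp add: G.integral_iff)
  ultimately show ?case
    using t(1) F(1,3) by (intro bexI[of _ "t \<otimes>\<^bsub>sec U (points U)\<^esub> F"]) auto
qed

lemma not_dense_if_finitely_many_values:
  fixes s :: "nat \<Rightarrow> 'a"
  assumes Z: "Z \<subseteq> rational_points U \<pi>" and I: "finite I"
    and s: "\<And>i. i \<in> I \<Longrightarrow> s i \<in> carrier (sec U (points U)) - constant_functions \<pi>"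
    and T: "\<And>i. i \<in> I \<Longrightarrow> finite (T i)"
    and val: "\<And>Q. Q \<in> Z \<Longrightarrow> \<exists>i\<in>I. value_in Q (points U) (s i) \<in> T i"
  shows "\<not> zariski_dense U Z"
proof
  assume dense: "zariski_dense U Z"
  define E where "E = (\<Union>i\<in>I. (\<lambda>c. s i \<ominus>\<^bsub>sec U (points U)\<^esub> const c) ` T i)"
  have "s i \<ominus>\<^bsub>sec U (points U)\<^esub> const c \<noteq> \<zero>\<^bsub>sec U (points U)\<^esub>" if "i \<in> I" for i c
  proof
    assume "s i \<ominus>\<^bsub>sec U (points U)\<^esub> const c = \<zero>\<^bsub>sec U (points U)\<^esub>"
    then have "s i = const c" using s[OF that] const_closed by simp
    then show False using s[OF that] by (auto simp: constant_functions_def const_def)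
  qed
  then have "E \<subseteq> carrier (sec U (points U)) - {\<zero>\<^bsub>sec U (points U)\<^esub>}"
    using s const_closed by (auto simp: E_def)
  moreover have "finite E" unfolding E_def using I T by blast
  ultimately obtain F where F: "F \<in> carrier (sec U (points U))" "F \<noteq> \<zero>\<^bsub>sec U (points U)\<^esub>"
    "\<And>Q t. Q \<in> rational_points U \<pi> \<Longrightarrow> t \<in> E \<Longrightarrow> value_in Q (points U) t = 0 \<Longrightarrow> value_in Q (points U) F = 0"
    using common_multiple[of E] by blast
  have "value_in Q (points U) F = 0" if Q: "Q \<in> Z" for Q
  proof -
    obtain i where i: "i \<in> I" "value_in Q (points U) (s i) \<in> T i" using val[OF Q] by blast
    define c where "c = value_in Q (points U) (s i)"
    have QR: "Q \<in> rational_points U \<pi>" using Q Z by blast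
    interpret rh: ring_hom_ring "sec U (points U)" "field_ring :: 'k ring" "value_in Q (points U)"
      by (rule ring_hom_ringI2[OF G.ring_axioms Kf.Rd.ring_axioms value_hom[OF QR]])
    have "s i \<in> carrier (sec U (points U))" using s[OF i(1)] by simp
    then have "value_in Q (points U) (s i \<ominus>\<^bsub>sec U (points U)\<^esub> const c) =
        value_in Q (points U) (s i) \<ominus>\<^bsub>field_ring\<^esub> value_in Q (points U) (const c)"
      using const_closed by (simp add: a_minus_def)
    also have "\<dots> = c \<ominus>\<^bsub>field_ring\<^esub> c" using value_const[OF QR] by (simp add: c_def)
    also have "\<dots> = 0" using Kf.Rd.r_neg[of c] by (simp add: a_minus_def Kf.R_simps)
    finally show ?thesis using F(3)[OF QR, of "s i \<ominus>\<^bsub>sec U (points U)\<^esub> const c"] i by (auto simp: E_def c_def)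
  qed
  then show False using vanishes_if_dense[OF Z dense F(1)] F(2) by blast
qed

end

section \<open>Integral points\<close>

context model begin

text \<open>\<open>Q\<close> and \<open>P\<close> lie on different spaces and are compared over
  \<open>Spec K\<close>. Transport \<open>\<rho>\<close> along both composites in \<open>QP\<close>:
  one side is a restriction of the pullback of \<open>s\<close> by \<open>Q\<close>, as
  \<open>g\<close> undoes \<open>\<theta>\<close>; the other is the pullback of
  \<open>\<rho>\<close> by \<open>P\<close>, restricted to the generic point. So the generic values
  agree.\<close>

lemma integral_point_takes_value:
  fixes U :: "('p, 'a) ringed_space"
  assumes \<theta>: "morphism U K_fibre \<theta>" and g: "morphism K_fibre U g"
    and g\<theta>: "same_map U U (comp_map K_fibre g \<theta>) id_map"
    and U: "local_space U" and Q: "morphism (Spec field_ring) U Q"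
    and P: "P \<in> points_over (Spec R) \<UU> (Spec R) f id_map"
    and QP: "same_map (Spec field_ring) \<UU> (comp_map K_fibre K_fst (comp_map U \<theta> Q)) (comp_map (Spec R) P incl)"
    and s: "s \<in> carrier (sec U (points U))"
  shows "pull g (points U) s \<in> carrier (sec K_fibre (points K_fibre))"
    and "takes_value (pull g (points U) s) P (Kf.generic_value (pull Q (points U) s))"
proof -
  let ?K = "Spec (field_ring :: 'k ring)"
  let ?s = "pull g (points U) s"
  have tU: "openin (topo U) (points U)" and tK: "openin (topo K_fibre) (points K_fibre)" by simp_all
  have pts: "preim K_fibre g (points U) = points K_fibre" "preim U \<theta> (points K_fibre) = points U"
    using g \<theta> unfolding morphism_def continuous_map_def by (auto simp: preim_def)
  have gh: "pull g (points U) \<in> ring_hom (sec U (points U)) (sec K_fibre (preim K_fibre g (points U)))"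
    using g tU unfolding morphism_def by blast
  show sK: "?s \<in> carrier (sec K_fibre (points K_fibre))"
    using ring_hom_memE(1)[OF gh s] unfolding pts(1) .
  have pull_back: "pull \<theta> (points K_fibre) ?s = s"
    using g\<theta>[unfolded same_map_def, THEN conjunct2, rule_format, OF tU s]
    by (simp add: comp_map_def id_map_def pts(1))
  have Qh: "ringed_map_hom ?K U Q" using Q morphism_iff[OF Kf.Ra.local_space_Spec U] by blast
  interpret Q: ringed_map_hom ?K U Q by (rule Qh)
  have Pm: "morphism (Spec R) \<UU> P" and Pid: "same_map (Spec R) (Spec R) (comp_map \<UU> f P) id_map"
    using P by (auto simp: points_over_def)
  interpret pm: ringed_map_hom "Spec R" \<UU> P by (rule point_hom[OF Pm])
  show "takes_value ?s P (Kf.generic_value (pull Q (points U) s))"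
    unfolding takes_value_def
  proof (intro conjI Pm ballI allI impI)
    show "pt f (pt P p) = p" if "p \<in> points (Spec R)" for p
      using Pid that by (simp add: same_map_def comp_map_def id_map_def)
    fix V \<rho> assume V: "fm.X.opn V" and \<rho>: "\<rho> \<in> carrier (sec \<UU> V)" and PV: "pt P {0} \<in> V"
      and eq: "res K_fibre (points K_fibre) (preim K_fibre K_fst V) ?s = pull K_fst V \<rho>"
    define M where "M = preim K_fibre K_fst V"
    define N where "N = preim U \<theta> M"
    have M: "openin (topo K_fibre) M" unfolding M_def by (rule K_fst_open[OF V])
    have N: "openin (topo U) N"
      using \<theta> M unfolding morphism_def N_def preim_def by (intro openin_continuous_map_preimage) auto
    have Nsub: "N \<subseteq> points U" by (auto simp: N_def preim_def)
    have "pull \<theta> M (pull K_fst V \<rho>) = res U (preim U \<theta> (points K_fibre)) N (pull \<theta> (points K_fibre) ?s)"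
      using \<theta> tK M openin_subset[OF M] sK unfolding morphism_def N_def eq[symmetric] M_def[symmetric] by blast
    then have loc: "pull \<theta> M (pull K_fst V \<rho>) = res U (points U) N s" unfolding pull_back pts(2) .
    have "pull Q N (pull \<theta> M (pull K_fst V \<rho>)) = pull incl (preim (Spec R) P V) (pull P V \<rho>)"
      using QP V \<rho> by (simp add: same_map_def comp_map_def M_def N_def)
    then have key: "res ?K (points ?K) (preim ?K Q N) (pull Q (points U) s) =
        pull incl (preim (Spec R) P V) (pull P V \<rho>)"
      using Q.pull_res[OF tU N Nsub s] unfolding loc Q.preim_points by simp
    have "pt K_fst (pt \<theta> (pt Q {0})) = pt P {0}"
      using QP Kf_generic by (simp add: same_map_def comp_map_def pt_incl)
    then have "pt Q {0} \<in> N"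
      using PV Q.pt_closed[OF Kf_generic] \<theta> unfolding N_def M_def preim_def morphism_def continuous_map_def by auto
    then have 0: "{0} \<in> preim ?K Q N" using Kf_generic by (simp add: Q.mem_preim)
    have 1: "{0} \<in> preim (Spec R) P V" using PV generic_point by (simp add: pm.mem_preim)
    have "generic_value (pull P V \<rho>) = Kf.generic_value (pull incl (preim (Spec R) P V) (pull P V \<rho>))"
      using generic_value_pull_incl[OF pm.opn_preim[OF V] 1 pm.pull_closed[OF V \<rho>]] by simp
    also have "\<dots> = Kf.generic_value (pull Q (points U) s)"
      unfolding key[symmetric] Kf.Ra.res_Spec by (rule Kf.generic_value_restrict[OF 0])
    finally show "generic_value (pull P V \<rho>) = Kf.generic_value (pull Q (points U) s)" .
  qed
qed

end

theorem theorem2p24: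
  fixes U :: "('p, 'a) ringed_space"
    and \<pi> :: "('p, 'k::field_char_0 set, 'a, 'k set \<Rightarrow> ('k \<times> 'k) set) ringed_map"
    and s :: "nat \<Rightarrow> 'a" and n :: nat and C :: real
    and \<UU> :: "('q, 'b) ringed_space"
    and f :: "('q, 'k set, 'b, 'k set \<Rightarrow> ('k \<times> 'k) set) ringed_map"
  assumes "number_field TYPE('k)"
    and "variety U \<pi>"
    and "\<forall>i\<in>{1..n}. s i \<in> carrier (sec U (points U)) - constant_functions \<pi>"
    and "C > 0"
    and "\<forall>x. (\<forall>v. archimedean_place v \<longrightarrow> x v \<in> local_points v U \<pi>) \<longrightarrow>
           (\<exists>i\<in>{1..n}. \<forall>v. archimedean_place v \<longrightarrow>
              completion_abs v (value_at (place_completion v) U (s i) (x v)) < C)"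
    and "integral_model U \<pi> \<UU> f \<theta>"
  shows "\<not> zariski_dense U (integral_points U \<pi> \<UU> f \<theta>)"
proof -
  note s = assms(3)[rule_format] and small = assms(5)[rule_format]
  let ?Z = "integral_points U \<pi> \<UU> f \<theta>" and ?D = "{x::'k. algebraic_int x}"
  have U: "local_space U" and \<pi>: "morphism U (Spec field_ring) \<pi>" and int: "integral_scheme U"
    using assms(2) local_space_of_lrs by (auto simp: variety_def integral_scheme_def scheme_def)
  interpret V: variety_over U \<pi>
    by (intro variety_over.intro variety_over_axioms.intro model.intro model_axioms.intro field_number_subring U \<pi> int)
  have model: "local_space \<UU>" "morphism \<UU> (Spec integer_ring) f" "finite_type \<UU> (Spec integer_ring) f"
    and \<theta>: "morphism U (generic_fibre \<UU> f) \<theta>"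
    using assms(6) local_space_of_lrs by (auto simp: integral_model_def scheme_def isomorphism_def)
  obtain g where g: "morphism (generic_fibre \<UU> f) U g" "same_map U U (comp_map (generic_fibre \<UU> f) g \<theta>) id_map"
    using assms(6) unfolding integral_model_def isomorphism_def by blast
  interpret M: model ?D integer_ring \<UU> f
    by (intro model.intro model_axioms.intro integer_ring_number_subring assms(1) model)
  \<comment> \<open>The function \<open>s i\<close> carried over to the generic fibre, where it can
    be compared with sections of the model.\<close>
  define s' where "s' i = pull g (points U) (s i)" for i
  define val :: "('k set, 'p, 'k set \<Rightarrow> ('k \<times> 'k) set, 'a) ringed_map \<Rightarrow> nat \<Rightarrow> 'k"
    where "val Q i = Kf.generic_value (pull Q (points U) (s i))" for Q i
  have integral_value: "s' i \<in> carrier (sec (generic_fibre \<UU> f) (points (generic_fibre \<UU> f)))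
      \<and> (\<exists>P. M.takes_value (s' i) P (val Q i))" if i: "i \<in> {1..n}" and Q: "Q \<in> ?Z" for i Q
  proof -
    obtain P where P: "P \<in> points_over (Spec integer_ring) \<UU> (Spec integer_ring) f id_map"
      "same_map (Spec field_ring) \<UU> (comp_map (generic_fibre \<UU> f) (generic_fibre_to_model \<UU> f) (comp_map U \<theta> Q))
         (comp_map (Spec integer_ring) P Spec_inclusion)"
      and QR: "Q \<in> rational_points U \<pi>"
      using Q by (auto simp: integral_points_def)
    have si: "s i \<in> carrier (sec U (points U))" using s[OF i] by simp
    show ?thesis
      using M.integral_point_takes_value[OF \<theta>[unfolded Spec_inclusion_def] g[unfolded Spec_inclusion_def] U
          V.rational_point_morphism[OF QR] P[unfolded Spec_inclusion_def] si]
      unfolding s'_def val_def Spec_inclusion_def by blast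
  qed
  have "\<exists>m::nat>0. \<forall>Q\<in>?Z. algebraic_int (of_nat m * val Q i)" if i: "i \<in> {1..n}" for i
  proof (cases "?Z = {}")
    \<comment> \<open>That \<open>s' i\<close> is a section was derived at an integral point, so the
      case without integral points is split off.\<close>
    case False
    then have "s' i \<in> carrier (sec M.K_fibre (points M.K_fibre))"
      using integral_value[OF i] unfolding Spec_inclusion_def by blast
    from M.bounded_denominator[OF this model(3)] show ?thesis using integral_value[OF i] by blast
  qed auto
  then obtain m :: "nat \<Rightarrow> nat" where m: "\<And>i. i \<in> {1..n} \<Longrightarrow> m i > 0"
    "\<And>i Q. i \<in> {1..n} \<Longrightarrow> Q \<in> ?Z \<Longrightarrow> algebraic_int (of_nat (m i) * val Q i)" by metis
  \<comment> \<open>The bound is scaled along with the value: finiteness holds for algebraic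
    integers, and it is \<open>m i\<close> times the value that is integral.\<close>
  define T where "T i = {y::'k. algebraic_int (of_nat (m i) * y) \<and>
      (\<forall>v. archimedean_place v \<longrightarrow> v (of_nat (m i) * y) < of_nat (m i) * C)}" for i
  show ?thesis
  proof (rule V.not_dense_if_finitely_many_values[where I = "{1..n}" and s = s and T = T])
    show "?Z \<subseteq> rational_points U \<pi>" by (auto simp: integral_points_def)
    show "finite {1..n}" by simp
    show "s i \<in> carrier (sec U (points U)) - constant_functions \<pi>" if "i \<in> {1..n}" for i by (rule s[OF that])
    show "finite (T i)" if i: "i \<in> {1..n}" for i
    proof -
      have eq: "T i = (\<lambda>y. of_nat (m i) * y) -` {x. algebraic_int x \<and> (\<forall>v. archimedean_place v \<longrightarrow> v x < of_nat (m i) * C)}"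
        by (auto simp: T_def)
      have "inj (\<lambda>y::'k. of_nat (m i) * y)" using m(1)[OF i] by (auto intro: injI)
      then show ?thesis unfolding eq by (rule finite_vimageI[OF finite_bounded_algebraic_ints[OF assms(1)]])
    qed
    fix Q assume Q: "Q \<in> ?Z"
    then have QR: "Q \<in> rational_points U \<pi>" by (simp add: integral_points_def)
    \<comment> \<open>The family of local points to which (O) is applied: one rational point, seen
      over each completion.\<close>
    let ?x = "\<lambda>v. comp_map (Spec field_ring) Q (Spec_map field_ring (place_completion v) (to_completion v))"
    have abs: "archimedean_absolute_value v" if "archimedean_place v" for v :: "'k \<Rightarrow> real"
      using that by (rule archimedean_absolute_value.intro)
    \<comment> \<open>One index for all archimedean places, as the definition of \<open>T i\<close>
      demands.\<close>
    obtain i where i: "i \<in> {1..n}"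
      "\<And>v. archimedean_place v \<Longrightarrow> completion_abs v (value_at (place_completion v) U (s i) (?x v)) < C"
      using small[of ?x] archimedean_absolute_value.rational_point_local_point(1)[OF abs U \<pi> QR] by blast
    have si: "s i \<in> carrier (sec U (points U))" using s[OF i(1)] by simp
    have "v (of_nat (m i) * val Q i) < of_nat (m i) * C" if v: "archimedean_place v" for v
    proof -
      interpret a: archimedean_absolute_value v by (rule abs[OF v])
      have "v (val Q i) < C" using i(2)[OF v] a.rational_point_local_point(2)[OF U \<pi> QR si] by (simp add: val_def)
      moreover have "v (of_nat (m i)) = of_nat (m i)" using a.v_rat[of "of_nat (m i)"] by simp
      ultimately show ?thesis using m(1)[OF i(1)] by (simp add: a.v_mult)
    qed
    then show "\<exists>i\<in>{1..n}. V.value_in Q (points U) (s i) \<in> T i"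
      using i(1) m(2)[OF i(1) Q] by (intro bexI[of _ i]) (auto simp: T_def val_def)
  qed
qed

end
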